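(* Let $r>3$. There exists $\delta>0$ such that for all $(c,a)\in\mathcal{P}_{\lambda}$ with $0<|a|<\delta$, the Julia set $J$ of the Hénon map $H_{c,a}$ is homeomorphic to $$\bigcap_{n\geq 0}\psi^{\circ n}(J_{P}\times\mathbb{D}_{r}),\qquad \psi(\zeta,z)=\left(P(\zeta),\ a\zeta-\frac{a^{2}z}{P'(\zeta)}\right),$$ (a quotiented solenoid), hence $J$ is connected. Moreover $J=J^{*}$, where $J^{*}$ is the closure of the set of saddle periodic points of $H_{c,a}$.
   Context: Let $p/q$ be a rational number in lowest terms ($q\ge 1$), $\lambda=e^{2\pi i p/q}$, and $c_{0}=\frac{\lambda}{2}-\frac{\lambda^{2}}{4}$; the polynomial $P(x)=x^{2}+c_{0}$ has the parabolic fixed point $\lambda/2$ of multiplier $\lambda$. $J_{P}$ denotes the Julia set of $P$. For $c,a\in\mathbb{C}$, $a\neq 0$, the complex Hénon map is $H_{c,a}(x,y)=(x^{2}+c+ay,\ ax)$, an automorphism of $\mathbb{C}^{2}$. $K^{+}$ (resp. $K^{-}$) is the set of points of $\mathbb{C}^{2}$ with bounded forward (resp. backward) orbit under $H_{c,a}$, $J^{\pm}=\partial K^{\pm}$ and $J=J^{+}\cap J^{-}$. The curve $\mathcal{P}_{\lambda}\subset\mathbb{C}^{2}$ is the set of parameters $(c,a)$ for which $H_{c,a}$ has a fixed point at which the derivative has an eigenvalue $\lambda$; explicitly $$\mathcal{P}_{\lambda}=\left\{(c,a)\in\mathbb{C}^2:\ c=(1-a^{2})\left(\tfrac{\lambda}{2}-\tfrac{a^{2}}{2\lambda}\right)-\left(\tfrac{\lambda}{2}-\tfrac{a^{2}}{2\lambda}\right)^{2}\right\}.$$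 $\mathbb{D}_{r}=\{z\in\mathbb{C}:|z|<r\}$. A periodic point is a saddle if the derivative of the corresponding iterate there has one eigenvalue of modulus $<1$ and one of modulus $>1$. *)

theory Defs
  imports "HOL-Analysis.Analysis"
begin

definition multiplier :: "int \<Rightarrow> nat \<Rightarrow> complex" where
  "multiplier p q = exp (2 * of_real pi * \<i> * (of_int p / of_nat q))"

text \<open>The constant term makes \<open>l / 2\<close> a fixed point of multiplier \<open>l\<close>.\<close>

definition parabolic_poly :: "complex \<Rightarrow> complex \<Rightarrow> complex" where
  "parabolic_poly l x = x\<^sup>2 + (l / 2 - l\<^sup>2 / 4)"

definition filled_julia :: "(complex \<Rightarrow> complex) \<Rightarrow> complex set" where
  "filled_julia P = {x. bounded (range (\<lambda>n. (P ^^ n) x))}"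

text \<open>The Julia set of a polynomial of degree at least two, as the boundary of its filled
  Julia set.\<close>

definition julia_poly :: "(complex \<Rightarrow> complex) \<Rightarrow> complex set" where
  "julia_poly P = frontier (filled_julia P)"

definition henon :: "complex \<Rightarrow> complex \<Rightarrow> complex \<times> complex \<Rightarrow> complex \<times> complex" where
  "henon c a = (\<lambda>(x, y). (x\<^sup>2 + c + a * y, a * x))"

text \<open>The backward orbit is formed with \<open>inv\<close>, which is a two-sided inverse of the Henon map
  for nonzero \<open>a\<close> by the following two lemmas.\<close>

lemma bij_henon:
  assumes "a \<noteq> 0"
  shows "bij (henon c a)"
proof (rule o_bij)
  let ?g = "\<lambda>(u, v). (v / a, (u - (v / a)\<^sup>2 - c) / a)"
  show "?g \<circ> henon c a = id" "henon c a \<circ> ?g = id"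
    using assms by (simp_all add: henon_def fun_eq_iff)
qed

lemma inv_henon:
  assumes "a \<noteq> 0"
  shows "inv (henon c a) = (\<lambda>(u, v). (v / a, (u - (v / a)\<^sup>2 - c) / a))"
  by (rule inv_unique_comp) (use assms in \<open>simp_all add: henon_def fun_eq_iff\<close>)

definition K_plus :: "complex \<Rightarrow> complex \<Rightarrow> (complex \<times> complex) set" where
  "K_plus c a = {z. bounded (range (\<lambda>n. (henon c a ^^ n) z))}"

definition K_minus :: "complex \<Rightarrow> complex \<Rightarrow> (complex \<times> complex) set" where
  "K_minus c a = {z. bounded (range (\<lambda>n. (inv (henon c a) ^^ n) z))}"

definition J_plus :: "complex \<Rightarrow> complex \<Rightarrow> (complex \<times> complex) set" where
  "J_plus c a = frontier (K_plus c a)"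

definition J_minus :: "complex \<Rightarrow> complex \<Rightarrow> (complex \<times> complex) set" where
  "J_minus c a = frontier (K_minus c a)"

definition henon_julia :: "complex \<Rightarrow> complex \<Rightarrow> (complex \<times> complex) set" where
  "henon_julia c a = J_plus c a \<inter> J_minus c a"

text \<open>The derivative is the library's (real) Frechet derivative; for the holomorphic maps below it
  is complex linear, and the eigenvalues are those of a complex linear map of \<open>\<complex>\<^sup>2\<close>: both the
  eigenvalue and the eigenvector are complex.\<close>

definition deriv_eigenvalue ::
    "(complex \<times> complex \<Rightarrow> complex \<times> complex) \<Rightarrow> complex \<times> complex \<Rightarrow> complex \<Rightarrow> bool" where
  "deriv_eigenvalue F z \<mu> \<longleftrightarrow>
     (\<exists>D. (F has_derivative D) (at z) \<and>
          (\<exists>v. v \<noteq> 0 \<and> D v = (\<mu> * fst v, \<mu> * snd v)))"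

definition saddle_periodic_point ::
    "(complex \<times> complex \<Rightarrow> complex \<times> complex) \<Rightarrow> complex \<times> complex \<Rightarrow> bool" where
  "saddle_periodic_point F z \<longleftrightarrow>
     (\<exists>n\<ge>1. (F ^^ n) z = z \<and>
        (\<exists>\<mu>. deriv_eigenvalue (F ^^ n) z \<mu> \<and> cmod \<mu> < 1) \<and>
        (\<exists>\<mu>. deriv_eigenvalue (F ^^ n) z \<mu> \<and> cmod \<mu> > 1))"

definition J_star :: "complex \<Rightarrow> complex \<Rightarrow> (complex \<times> complex) set" where
  "J_star c a = closure {z. saddle_periodic_point (henon c a) z}"

definition param_curve :: "complex \<Rightarrow> (complex \<times> complex) set" where
  "param_curve l = {(c, a). \<exists>z. henon c a z = z \<and> deriv_eigenvalue (henon c a) z l}"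

lemma has_derivative_henon:
  "(henon c a has_derivative (\<lambda>(u, v). (2 * x * u + a * v, a * u))) (at (x, y))"
proof -
  have "((\<lambda>w. ((fst w)\<^sup>2 + c + a * snd w, a * fst w)) has_derivative
         (\<lambda>w. (2 * x * fst w + a * snd w, a * fst w))) (at (x, y))"
    by (auto intro!: derivative_eq_intros simp: fun_eq_iff)
  then show ?thesis
    by (simp add: henon_def case_prod_unfold)
qed

lemma deriv_eigenvalue_henon_iff:
  "deriv_eigenvalue (henon c a) (x, y) l \<longleftrightarrow> l\<^sup>2 - 2 * x * l - a\<^sup>2 = 0"
proof -
  have "deriv_eigenvalue (henon c a) (x, y) l \<longleftrightarrow>
        (\<exists>u v. (u, v) \<noteq> (0, 0) \<and> 2 * x * u + a * v = l * u \<and> a * u = l * v)"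
  proof -
    have "deriv_eigenvalue (henon c a) (x, y) l \<longleftrightarrow>
        (\<exists>w. w \<noteq> 0 \<and> (\<lambda>(u, v). (2 * x * u + a * v, a * u)) w = (l * fst w, l * snd w))"
      unfolding deriv_eigenvalue_def
      by (rule iffI; elim exE conjE)
        (use has_derivative_henon has_derivative_unique in blast)+
    then show ?thesis
      by (simp add: split_paired_Ex zero_prod_def)
  qed
  also have "\<dots> \<longleftrightarrow> l\<^sup>2 - 2 * x * l - a\<^sup>2 = 0"
  proof
    assume "\<exists>u v. (u, v) \<noteq> (0, 0) \<and> 2 * x * u + a * v = l * u \<and> a * u = l * v"
    then obtain u v where nz: "u \<noteq> 0 \<or> v \<noteq> 0" and 1: "2 * x * u + a * v = l * u"
      and 2: "a * u = l * v" by auto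
    have "(l\<^sup>2 - 2 * x * l - a\<^sup>2) * u = 0" "(l\<^sup>2 - 2 * x * l - a\<^sup>2) * v = 0"
      using 1 2 by algebra+
    with nz show "l\<^sup>2 - 2 * x * l - a\<^sup>2 = 0" by auto
  next
    assume *: "l\<^sup>2 - 2 * x * l - a\<^sup>2 = 0"
    show "\<exists>u v. (u, v) \<noteq> (0, 0) \<and> 2 * x * u + a * v = l * u \<and> a * u = l * v"
    proof (cases "l = 0 \<and> a = 0")
      case True
      then show ?thesis by (intro exI[of _ 0] exI[of _ 1]) auto
    next
      case False
      have "2 * x * l + a * a = l * l"
        using * by algebra
      with False show ?thesis
        by (intro exI[of _ l] exI[of _ a]) (simp add: mult.commute)
    qed
  qed
  finally show ?thesis .
qed

lemma param_curve_explicit: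
  assumes "l \<noteq> 0"
  shows "param_curve l =
    {(c, a). c = (1 - a\<^sup>2) * (l / 2 - a\<^sup>2 / (2 * l)) - (l / 2 - a\<^sup>2 / (2 * l))\<^sup>2}"
proof -
  have eig: "l\<^sup>2 - 2 * x * l - a\<^sup>2 = 0 \<longleftrightarrow> x = l / 2 - a\<^sup>2 / (2 * l)" for x a
  proof -
    have "l / 2 - a\<^sup>2 / (2 * l) = (l\<^sup>2 - a\<^sup>2) / (2 * l)"
      using assms by (simp add: diff_divide_distrib power2_eq_square)
    moreover have "x = (l\<^sup>2 - a\<^sup>2) / (2 * l) \<longleftrightarrow> x * (2 * l) = l\<^sup>2 - a\<^sup>2"
      using assms by (simp add: eq_divide_eq)
    moreover have "l\<^sup>2 - 2 * x * l - a\<^sup>2 = 0 \<longleftrightarrow> x * (2 * l) = l\<^sup>2 - a\<^sup>2"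
      by algebra
    ultimately show ?thesis by simp
  qed
  have fixp: "henon c a (x, y) = (x, y) \<longleftrightarrow> y = a * x \<and> c = (1 - a\<^sup>2) * x - x\<^sup>2" for c a x y
  proof -
    have "x\<^sup>2 + c + a * (a * x) = x \<longleftrightarrow> c = (1 - a\<^sup>2) * x - x\<^sup>2"
    proof -
      have "x\<^sup>2 + c + a * (a * x) - x = c - ((1 - a\<^sup>2) * x - x\<^sup>2)"
        by algebra
      then show ?thesis
        using right_minus_eq by metis
    qed
    then show ?thesis
      unfolding henon_def prod.case prod.inject by metis
  qed
  show ?thesis
    unfolding param_curve_def split_paired_Ex deriv_eigenvalue_henon_iff eig fixp by blast
qed

text \<open>A total function; division by zero plays no role on the Julia set of a parabolic quadratic
  polynomial, which does not contain the critical point.\<close>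

definition model_map ::
    "(complex \<Rightarrow> complex) \<Rightarrow> complex \<Rightarrow> complex \<times> complex \<Rightarrow> complex \<times> complex" where
  "model_map P a = (\<lambda>(\<zeta>, z). (P \<zeta>, a * \<zeta> - a\<^sup>2 * z / deriv P \<zeta>))"

definition model_set :: "(complex \<Rightarrow> complex) \<Rightarrow> complex \<Rightarrow> real \<Rightarrow> (complex \<times> complex) set" where
  "model_set P a r = (\<Inter>n. (model_map P a ^^ n) ` (julia_poly P \<times> ball 0 r))"

end

theory Submission
  imports Defs "HOL-Complex_Analysis.Complex_Analysis"
begin

text \<open>Put \<open>b = a\<^sup>2\<close>.  A point of the plane is a pair \<open>(x 0, a * x (-1))\<close> for exactly one bi-infinite sequence with
  \<open>x (k + 1) = (x k)\<^sup>2 + c + b * x (k - 1)\<close>, so everything can be expressed through such sequences.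
  A normal form at the semi-parabolic fixed point \<open>bet b\<close>, uniform in \<open>b\<close>, yields an open set \<open>Pet b\<close> of attracting petals
  which depends continuously on \<open>b\<close>, such that orbits which stay near the fixed point without entering \<open>Pet b\<close>
  are contracted onto each other by the factor \<open>2 * cmod b\<close>.  Let \<open>SS b\<close> be the compact space of the sequences bounded by 2
  that avoid \<open>Pet b\<close>.

  For \<open>b = 0\<close> the critical orbit converges to the parabolic point (Fatou), so the inverse branches of the iterates exist and
  contract near every point of the Julia set away from the parabolic point.  They extend holomorphically to small \<open>b\<close>,
  where they determine a backward orbit from its endpoint.  A maximality argument then gives expansivity of \<open>SS b\<close>,
  and pulling back along inverse branches gives shadowing between \<open>SS b\<close> and \<open>SS 0\<close> in both directions;
  the graph of the shadowing relation is a homeomorphism.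

  Schottky's theorem makes periodic orbits dense in \<open>SS 0\<close>.  Their shadows are saddles: the inverse branch bounds the trace of
  the derivative of the return map below by more than one plus the modulus of its determinant.  Hence \<open>SS b\<close> lies in the closure
  of the saddles; Cauchy's estimate puts saddles into \<open>J\<close>; and a point of \<open>J\<close> has bounded orbit and does not enter the petals,
  because these are interior to \<open>K\<^sup>+\<close>.  On the other side, the skew product \<open>\<psi>\<close> contracts fibres, which identifies
  \<open>SS 0\<close> with the model, a nested intersection of images of \<open>J\<^sub>P\<close> times a disk.\<close>


subsection \<open>Inverse branches of quadratic polynomials\<close>

text \<open>Orbits are therefore read from the future. If an orbit is far from the fixed point at
  arbitrarily late times, it is recovered by pulling back from those times; if it finally stays
  near, the second eigenvalue \<open>- b / l\<close> governs the tail. What makes the perturbation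
  from \<open>b = 0\<close> work at unlimited depth is that all branches take values of modulus
  below 3 on domains of fixed size, so Cauchy's inequality gives Lipschitz bounds, in the endpoint
  and in \<open>b\<close>, that do not depend on the depth. The normal form is needed only up to its
  first resonant term, of order \<open>q + 1\<close>; that this term does not vanish rests on there
  being a single critical orbit, hence at most \<open>q\<close> attracting directions. Constants are
  fixed in the order \<open>s0\<close>, petals, \<open>\<sigma>\<close>, \<open>\<rho>\<close>,
  \<open>\<delta>1\<close>, each small against the earlier ones: \<open>\<sigma>\<close> separates
  the Julia set from the critical orbit, \<open>\<rho>\<close> separates orbits from the critical
  point.\<close>

definition quad :: "complex \<Rightarrow> complex \<Rightarrow> complex" where
  "quad c x = x\<^sup>2 + c"

lemma quad_iterate_Suc: "(quad c ^^ Suc n) x = ((quad c ^^ n) x)\<^sup>2 + c"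
  by (simp add: quad_def[of c "(quad c ^^ n) x"])

lemma quad_iterate_Suc': "(quad c ^^ Suc n) x = (quad c ^^ n) (x\<^sup>2 + c)"
  by (simp add: quad_def[of c x] funpow_swap1)

lemma quad_holomorphic_iterate: "(quad c ^^ n) holomorphic_on S"
proof (induction n)
  case (Suc n)
  have "(\<lambda>x. ((quad c ^^ n) x)\<^sup>2 + c) holomorphic_on S"
    by (intro holomorphic_intros Suc)
  thus ?case by (simp only: quad_iterate_Suc)
qed (simp add: id_def)

lemma quad_continuous_iterate: "continuous_on S (quad c ^^ n)"
  by (rule holomorphic_on_imp_continuous_on[OF quad_holomorphic_iterate])

text \<open>One square root is extracted per level. The target \<open>Th\<close> is general because
  the induction hypothesis is applied to the root just extracted. The radicand
  \<open>Th w - c\<close> has no zero since \<open>Th\<close> omits the critical value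
  (\<open>j = 0\<close>), and omitting the later critical images passes on to the root. The point
  \<open>y0\<close> over \<open>w0\<close> fixes the sign at each level.\<close>

lemma inverse_branch:
  assumes "open U" "convex U" "Th holomorphic_on U"
    and "\<And>w j. w \<in> U \<Longrightarrow> j < n \<Longrightarrow> (quad c ^^ Suc j) 0 \<noteq> Th w"
    and "w0 \<in> U" "(quad c ^^ n) y0 = Th w0"
  shows "\<exists>F. F holomorphic_on U \<and> (\<forall>w\<in>U. (quad c ^^ n) (F w) = Th w) \<and> F w0 = y0"
  using assms(3-)
proof (induction n arbitrary: Th)
  case 0
  thus ?case by (intro exI[of _ Th]) auto
next
  case (Suc n)
  define y1 where "y1 = (quad c ^^ n) y0"
  have y1: "y1\<^sup>2 + c = Th w0" using Suc.prems(4) by (simp only: y1_def quad_iterate_Suc)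
  have nz: "Th w - c \<noteq> 0" if "w \<in> U" for w
    using Suc.prems(2)[OF that, of 0] by (auto simp: quad_def)
  have "(\<lambda>w. Th w - c) holomorphic_on U" using Suc.prems(1) by (intro holomorphic_intros)
  then obtain g where g: "g holomorphic_on U" "\<And>w. w \<in> U \<Longrightarrow> Th w - c = (g w)\<^sup>2"
    using contractible_imp_holomorphic_sqrt[of "\<lambda>w. Th w - c" U, OF _ convex_imp_contractible[OF assms(2)]] nz by blast
  have "(g w0)\<^sup>2 = y1\<^sup>2" using g(2)[OF \<open>w0 \<in> U\<close>] y1 by (simp add: algebra_simps)
  hence "g w0 = y1 \<or> g w0 = - y1" by (simp add: power2_eq_iff)
  then obtain Th1 where Th1: "Th1 holomorphic_on U" "\<And>w. w \<in> U \<Longrightarrow> (Th1 w)\<^sup>2 + c = Th w" "Th1 w0 = y1"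
  proof
    assume "g w0 = y1"
    thus ?thesis using that[of g] g by (metis diff_add_cancel)
  next
    assume "g w0 = - y1"
    thus ?thesis using that[of "\<lambda>w. - g w"] g
      by (metis (mono_tags, lifting) diff_add_cancel holomorphic_on_minus minus_equation_iff power2_minus)
  qed
  have "\<exists>F. F holomorphic_on U \<and> (\<forall>w\<in>U. (quad c ^^ n) (F w) = Th1 w) \<and> F w0 = y0"
  proof (rule Suc.IH[OF Th1(1)])
    fix w j assume "w \<in> U" "j < n"
    show "(quad c ^^ Suc j) 0 \<noteq> Th1 w"
    proof
      assume "(quad c ^^ Suc j) 0 = Th1 w"
      hence "(quad c ^^ Suc (Suc j)) 0 = Th w" using Th1(2)[OF \<open>w \<in> U\<close>]
        by (metis quad_iterate_Suc)
      thus False using Suc.prems(2)[OF \<open>w \<in> U\<close>, of "Suc j"] \<open>j < n\<close> by simp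
    qed
  qed (use \<open>w0 \<in> U\<close> Th1 y1_def in auto)
  thus ?case using Th1(2) by (metis quad_iterate_Suc)
qed

lemma square_eq_connected:
  fixes A B :: "'a::topological_space \<Rightarrow> complex"
  assumes "connected V" "continuous_on V A" "continuous_on V B"
    and "\<And>v. v \<in> V \<Longrightarrow> (A v)\<^sup>2 = (B v)\<^sup>2" "\<And>v. v \<in> V \<Longrightarrow> A v \<noteq> 0"
    and "v0 \<in> V" "A v0 = B v0" "v \<in> V"
  shows "A v = B v"
proof -
  have cl: "closedin (top_of_set V) {v \<in> V. A v - B v = 0}" "closedin (top_of_set V) {v \<in> V. A v + B v = 0}"
    by (intro continuous_closedin_preimage_constant continuous_intros assms)+
  have cov: "V \<subseteq> {v \<in> V. A v - B v = 0} \<union> {v \<in> V. A v + B v = 0}"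
  proof
    fix v assume v: "v \<in> V"
    have "(A v - B v) * (A v + B v) = 0"
      using assms(4)[OF v] by (simp add: algebra_simps power2_eq_square)
    thus "v \<in> {v \<in> V. A v - B v = 0} \<union> {v \<in> V. A v + B v = 0}" using v by auto
  qed
  have disj: "{v \<in> V. A v - B v = 0} \<inter> {v \<in> V. A v + B v = 0} = {}"
  proof -
    have "A v = 0" if "A v - B v = 0" "A v + B v = 0" for v
      using that by (simp add: eq_neg_iff_add_eq_0 [symmetric])
    thus ?thesis using assms(5) by blast
  qed
  have "{v \<in> V. A v + B v = 0} = {}"
  proof (rule ccontr)
    assume ne: "{v \<in> V. A v + B v = 0} \<noteq> {}"
    have "{v \<in> V. A v - B v = 0} \<noteq> {}" using assms(6,7) by auto
    thus False
      using assms(1) cl cov disj ne unfolding connected_closedin by blast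
  qed
  thus ?thesis using cov \<open>v \<in> V\<close> by auto
qed

text \<open>Lifts through the iterate are unique on connected sets where no critical value is met,
  one squaring at a time. Continuity of the lifts suffices, which matters because the petal map
  below is only known to be continuous.\<close>

lemma iterate_unique_lift:
  fixes A B :: "'a::topological_space \<Rightarrow> complex"
  assumes "connected V" "continuous_on V A" "continuous_on V B"
    and "\<And>v. v \<in> V \<Longrightarrow> (quad c ^^ n) (A v) = (quad c ^^ n) (B v)"
    and "\<And>v j. v \<in> V \<Longrightarrow> j < n \<Longrightarrow> (quad c ^^ n) (A v) \<noteq> (quad c ^^ Suc j) 0"
    and "v0 \<in> V" "A v0 = B v0" "v \<in> V"
  shows "A v = B v"
  using assms(2-)
proof (induction n arbitrary: A B v)
  case 0
  thus ?case by simp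
next
  case (Suc n)
  have sw: "(quad c ^^ Suc n) x = (quad c ^^ n) (quad c x)" for x
    by (simp add: funpow_swap1)
  have eq: "quad c (A v) = quad c (B v)" if "v \<in> V" for v
  proof (rule Suc.IH[of "\<lambda>v. quad c (A v)" "\<lambda>v. quad c (B v)"])
    show "continuous_on V (\<lambda>v. quad c (A v))" "continuous_on V (\<lambda>v. quad c (B v))"
      unfolding quad_def by (intro continuous_intros Suc.prems)+
    show "(quad c ^^ n) (quad c (A v)) = (quad c ^^ n) (quad c (B v))" if "v \<in> V" for v
      using Suc.prems(3)[OF that] by (simp only: sw)
    show "(quad c ^^ n) (quad c (A v)) \<noteq> (quad c ^^ Suc j) 0" if "v \<in> V" "j < n" for v j
      using Suc.prems(4)[OF that(1), of j] that(2) by (metis sw less_SucI)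
  qed (use Suc.prems that in auto)
  show ?case
  proof (rule square_eq_connected[OF assms(1) Suc.prems(1,2) _ _ Suc.prems(5,6,7)])
    show "(A v)\<^sup>2 = (B v)\<^sup>2" if "v \<in> V" for v using eq[OF that] by (simp add: quad_def)
    show "A v \<noteq> 0" if "v \<in> V" for v
      using Suc.prems(4)[OF that, of n] by auto
  qed
qed

text \<open>Cauchy's inequality on discs of radius \<open>r / 5\<close>, which fit because
  \<open>3/4 + 1/5 < 1\<close>. The same shrinking later turns discs of radius
  \<open>2 * \<sigma>\<close> into \<open>3 * \<sigma> / 2\<close>.\<close>

lemma holomorphic_lipschitz:
  assumes "f holomorphic_on ball z r" "\<And>w. w \<in> ball z r \<Longrightarrow> cmod (f w) \<le> B"
    and "x \<in> ball z (3 * r / 4)" "y \<in> ball z (3 * r / 4)"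
  shows "cmod (f x - f y) \<le> (5 * B / r) * cmod (x - y)"
proof (rule field_differentiable_bound[of "ball z (3 * r / 4)" f "deriv f"])
  have r: "r > 0" using assms(3) by (auto simp: dist_norm) (smt (verit) norm_ge_zero)
  fix w assume w: "w \<in> ball z (3 * r / 4)"
  have sub: "cball w (r/5) \<subseteq> ball z r"
  proof
    fix v assume "v \<in> cball w (r/5)"
    hence "dist z v \<le> dist z w + r/5" using dist_triangle[of z v w] by (simp add: dist_commute)
    also have "... < r" using w r by (simp add: field_simps)
    finally show "v \<in> ball z r" by simp
  qed
  show "(f has_field_derivative deriv f w) (at w within ball z (3 * r / 4))"
  proof -
    have "w \<in> ball z r" using sub r by (meson centre_in_cball divide_nonneg_pos less_imp_le subsetD zero_less_numeral)
    thus ?thesis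
      using holomorphic_derivI[OF assms(1) open_ball] has_field_derivative_at_within by blast
  qed
  have "norm ((deriv ^^ 1) f w) \<le> fact 1 * B / (r/5) ^ 1"
  proof (rule Cauchy_inequality)
    show "f holomorphic_on ball w (r/5)" using assms(1) sub ball_subset_cball
      by (meson holomorphic_on_subset order.trans)
    show "continuous_on (cball w (r/5)) f"
      using assms(1) sub by (meson holomorphic_on_imp_continuous_on holomorphic_on_subset)
    show "norm (f v) \<le> B" if "norm (w - v) = r/5" for v
      using assms(2) sub that by (force simp: dist_norm)
  qed (use r in auto)
  thus "norm (deriv f w) \<le> 5 * B / r" by (simp add: field_simps)
qed (use assms in auto)

subsection \<open>Capture of the critical orbit by the parabolic point\<close>

lemma inv_power_taylor:
  fixes \<eta> :: real
  assumes "\<eta> > 0"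
  shows "\<exists>d>0. \<forall>z. cmod z < d \<longrightarrow> cmod (1 / (1 + z) ^ m - 1 + of_nat m * z) \<le> \<eta> * cmod z"
proof -
  have "((\<lambda>z. 1 / (1 + z) ^ m) has_field_derivative (- of_nat m)) (at (0::complex))"
    by (rule derivative_eq_intros refl | simp)+
  then obtain d where "d > 0" and d: "\<And>z. cmod (z - 0) < d \<Longrightarrow>
      cmod (1 / (1 + z) ^ m - 1 / (1 + 0) ^ m - (- of_nat m * (z - 0))) \<le> \<eta> * cmod (z - 0)"
    using has_derivative_at_alt[THEN iffD1, THEN conjunct2, rule_format, OF _ assms]
    unfolding has_field_derivative_def by metis
  show ?thesis
  proof (intro exI[of _ d] conjI allI impI)
    fix z assume "cmod z < d"
    thus "cmod (1 / (1 + z) ^ m - 1 + of_nat m * z) \<le> \<eta> * cmod z" using d[of z] by simp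
  qed (fact \<open>d > 0\<close>)
qed

text \<open>The principal logarithms add without a jump: \<open>Re W > 0\<close> keeps the argument
  of \<open>W\<close> below \<open>pi / 2\<close>, and \<open>d\<close> is chosen so that
  \<open>m\<close> times the argument of \<open>1 + z\<close> is below \<open>pi / 2\<close> as
  well.\<close>

lemma root_step:
  assumes "m \<ge> 1"
  shows "\<exists>d>0. \<forall>z W. cmod z < d \<longrightarrow> Re W > 0 \<longrightarrow>
    exp (- Ln (W / (1 + z) ^ m) / of_nat m) = exp (- Ln W / of_nat m) * (1 + z)"
proof -
  have "isCont Ln 1" by (intro continuous_intros) auto
  moreover have "pi / (2 * real m) > 0" using assms by simp
  ultimately obtain d where d: "d > 0" "\<And>x. dist x 1 < d \<Longrightarrow> dist (Ln x) (Ln 1) < pi / (2 * real m)"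
    using continuous_at_eps_delta[THEN iffD1, rule_format, of 1 Ln] by metis
  show ?thesis
  proof (intro exI[of _ "min d 1"] conjI allI impI)
    fix z W :: complex assume z: "cmod z < min d 1" and W: "Re W > 0"
    have nz: "1 + z \<noteq> 0"
    proof
      assume "1 + z = 0" hence "z = -1" by (simp add: add_eq_0_iff)
      thus False using z by simp
    qed
    have "cmod (Ln (1 + z)) < pi / (2 * real m)" using d(2)[of "1 + z"] z by (simp add: dist_norm)
    hence "real m * cmod (Ln (1 + z)) < pi / 2" using assms by (simp add: field_simps)
    moreover have "\<bar>Im (Ln (1 + z))\<bar> \<le> cmod (Ln (1 + z))" by (rule abs_Im_le_cmod)
    ultimately have "real m * \<bar>Im (Ln (1 + z))\<bar> < pi / 2"
      by (smt (verit) mult_left_mono of_nat_0_le_iff)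
    hence im: "\<bar>real m * Im (Ln (1 + z))\<bar> < pi / 2" by (simp add: abs_mult)
    have imW: "\<bar>Im (Ln W)\<bar> < pi / 2" using W by (rule Re_Ln_pos_lt_imp)
    have "Ln (W / (1 + z) ^ m) = Ln W - of_nat m * Ln (1 + z)"
    proof (rule Ln_unique)
      show "exp (Ln W - of_nat m * Ln (1 + z)) = W / (1 + z) ^ m"
      proof -
        have "W \<noteq> 0" using W by auto
        thus ?thesis using nz by (simp add: exp_diff exp_of_nat_mult)
      qed
    qed (use im imW in \<open>auto simp: abs_less_iff\<close>)
    hence "- Ln (W / (1 + z) ^ m) / of_nat m = - Ln W / of_nat m + Ln (1 + z)"
      using assms by (simp add: field_simps)
    thus "exp (- Ln (W / (1 + z) ^ m) / of_nat m) = exp (- Ln W / of_nat m) * (1 + z)"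
      using nz by (simp only: exp_add exp_Ln not_False_eq_True)
  qed (use d in auto)
qed

section \<open>The parabolic polynomial and its fixed point\<close>

locale parab =
  fixes l :: complex and q :: nat
  assumes q_pos: "q \<ge> 1" and l_q: "l ^ q = 1" and l_prim: "\<And>k. 1 \<le> k \<Longrightarrow> k < q \<Longrightarrow> l ^ k \<noteq> 1"
begin

text \<open>The first coordinate of the Henon fixed point with eigenvalue \<open>l\<close>, solved
  from the characteristic equation with \<open>b\<close> for the square of \<open>a\<close>;
  \<open>cc b\<close> below is then forced by the fixed point equation. Hence
  \<open>(cc (a\<^sup>2), a)\<close> parametrises \<open>param_curve l\<close>.\<close>

definition bet :: "complex \<Rightarrow> complex" where "bet b = l / 2 - b / (2 * l)"

definition cc :: "complex \<Rightarrow> complex" where "cc b = (1 - b) * bet b - (bet b)\<^sup>2"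

abbreviation P :: "complex \<Rightarrow> complex" where "P \<equiv> quad (cc 0)"

abbreviation beta :: complex where "beta \<equiv> bet 0"

lemma norm_l: "cmod l = 1"
proof -
  have "cmod l ^ q = 1" using l_q by (metis norm_one norm_power)
  hence "cmod l ^ q = 1 ^ q" by simp
  thus ?thesis using q_pos by (metis less_le_trans norm_ge_zero power_eq_imp_eq_base zero_le_one zero_less_one)
qed

lemma l_nz: "l \<noteq> 0" using norm_l by auto

lemma beta_eq: "beta = l / 2" by (simp add: bet_def)

lemma cc0_eq: "cc 0 = l / 2 - l\<^sup>2 / 4" by (simp add: cc_def bet_def power_divide)

lemma norm_beta: "cmod beta = 1 / 2" using norm_l by (simp add: beta_eq norm_divide)

lemma norm_cc0: "cmod (cc 0) \<le> 3 / 4"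
proof -
  have "cmod (cc 0) \<le> cmod (l / 2) + cmod (l\<^sup>2 / 4)" unfolding cc0_eq by (rule norm_triangle_ineq4)
  thus ?thesis using norm_l by (simp add: norm_divide norm_power)
qed

lemma P_eq: "P x = x\<^sup>2 + cc 0" by (simp add: quad_def)

lemma P_beta: "P beta = beta" unfolding P_eq by (simp add: cc_def)

lemma iterate_beta: "(P ^^ n) beta = beta"
  by (induction n) (simp_all add: P_beta)

lemma iterate_deriv_Suc: "deriv (P ^^ Suc n) x = 2 * (P ^^ n) x * deriv (P ^^ n) x"
proof -
  have *: "(P ^^ n) field_differentiable (at x)"
    using quad_holomorphic_iterate[of n "cc 0" UNIV] by (simp add: holomorphic_on_def)
  have "((\<lambda>x. ((P ^^ n) x)\<^sup>2 + cc 0) has_field_derivative (2 * (P ^^ n) x * deriv (P ^^ n) x)) (at x)"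
    by (auto intro!: derivative_eq_intros field_differentiable_derivI[OF *])
  thus ?thesis
    unfolding quad_iterate_Suc[symmetric] by (rule DERIV_imp_deriv)
qed

lemma iterate_deriv_beta: "deriv (P ^^ n) beta = l ^ n"
proof (induction n)
  case (Suc n)
  show ?case unfolding iterate_deriv_Suc iterate_beta Suc by (simp add: beta_eq)
qed (simp add: id_def)

lemma iterate_has_deriv: "((P ^^ n) has_field_derivative deriv (P ^^ n) x) (at x)"
  using quad_holomorphic_iterate[of n "cc 0" UNIV] by (simp add: holomorphic_derivI)

text \<open>\<open>13 / 8 = 2 - 3 / 8\<close>: the constant term has modulus at most
  \<open>3 / 4\<close>, which is \<open>3 / 8\<close> of the least modulus considered.\<close>

lemma P_grow: "cmod (P x) \<ge> (13 / 8) * cmod x" if "cmod x \<ge> 2"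
proof -
  have "cmod (P x) \<ge> cmod (x\<^sup>2) - cmod (cc 0)"
    unfolding P_eq using norm_triangle_ineq2[of "x\<^sup>2" "- cc 0"] by simp
  moreover have "cmod (x\<^sup>2) \<ge> 2 * cmod x" using mult_right_mono[OF that, of "cmod x"] by (simp add: norm_mult power2_eq_square)
  ultimately show ?thesis using norm_cc0 that by linarith
qed

lemma iterate_grow: "cmod ((P ^^ n) x) \<ge> (13 / 8) ^ n * cmod x" if "cmod x \<ge> 2"
proof (induction n)
  case (Suc n)
  have "(13 / 8) ^ n * cmod x \<ge> 1 * cmod x" by (intro mult_right_mono) auto
  hence "cmod ((P ^^ n) x) \<ge> 2" using Suc that by linarith
  from P_grow[OF this] Suc show ?case by simp
qed simp

lemma iterate_bound: "cmod y \<le> R" if "cmod ((P ^^ n) y) \<le> R" "R \<ge> 2"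
proof (rule ccontr)
  assume "\<not> cmod y \<le> R"
  hence y: "cmod y > R" by simp
  hence "(13 / 8) ^ n * cmod y \<ge> 1 * cmod y" by (intro mult_right_mono) auto
  moreover have "cmod ((P ^^ n) y) \<ge> (13 / 8) ^ n * cmod y" using y that by (intro iterate_grow) auto
  ultimately show False using that y by linarith
qed

text \<open>The zero of \<open>P ^^ q - id\<close> at \<open>beta\<close> is multiple because the
  multiplier of the iterate is \<open>l ^ q = 1\<close>; \<open>m\<close> counts the attracting
  directions. The iterate is not the identity, since it increases the modulus at 2.\<close>

lemma iterate_q_expansion:
  obtains m g r where "m \<ge> 1" "r > 0" "g holomorphic_on ball beta r"
    "\<And>x. x \<in> ball beta r \<Longrightarrow> (P ^^ q) x - x = (x - beta) ^ Suc m * g x"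
    "\<And>x. x \<in> ball beta r \<Longrightarrow> g x \<noteq> 0"
proof -
  let ?F = "\<lambda>x. (P ^^ q) x - x"
  have hol: "?F holomorphic_on UNIV" by (intro holomorphic_intros quad_holomorphic_iterate)
  have nc: "\<not> ?F constant_on UNIV"
  proof
    assume "?F constant_on UNIV"
    hence "?F 2 = ?F beta" unfolding constant_on_def by (metis UNIV_I)
    hence "(P ^^ q) 2 = 2" by (simp add: iterate_beta)
    moreover have "cmod ((P ^^ q) 2) \<ge> (13 / 8) ^ q * cmod 2" by (rule iterate_grow) simp
    moreover have "(13 / 8 :: real) ^ q > 1" using q_pos by (intro one_less_power) auto
    ultimately show False by simp
  qed
  obtain g r n where *: "0 < n" "0 < r" "g holomorphic_on ball beta r"
    "\<And>w. w \<in> ball beta r \<Longrightarrow> ?F w = (w - beta) ^ n * g w" "\<And>w. w \<in> ball beta r \<Longrightarrow> g w \<noteq> 0"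
  proof (rule holomorphic_factor_zero_nonconstant[of ?F UNIV beta, OF hol _ _ _ _ nc])
    show "connected (UNIV :: complex set)" by (rule connected_UNIV)
  qed (use iterate_beta in auto)
  have "n \<noteq> 1"
  proof
    assume n: "n = 1"
    have gd: "(g has_field_derivative deriv g beta) (at beta)"
      using *(2,3) by (simp add: holomorphic_derivI)
    have "((\<lambda>w. (w - beta) * g w) has_field_derivative g beta) (at beta)"
      by (auto intro!: derivative_eq_intros gd)
    hence "(?F has_field_derivative g beta) (at beta)"
      by (rule has_field_derivative_transform_within[where d = r]) (use *(2,4) n in \<open>auto simp: dist_commute\<close>)
    moreover have "(?F has_field_derivative (deriv (P ^^ q) beta - 1)) (at beta)"
      by (auto intro!: derivative_eq_intros iterate_has_deriv)
    ultimately have "g beta = deriv (P ^^ q) beta - 1" by (rule DERIV_unique)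
    thus False using *(5)[of beta] *(2) by (simp add: iterate_deriv_beta l_q)
  qed
  then obtain m where "n = Suc m" "m \<ge> 1" using *(1) by (cases n) auto
  thus ?thesis using that[of m r g] * by auto
qed

end

text \<open>An inverse of the approximate Fatou coordinate \<open>W = v ^ m / u ^ m\<close>. Petals
  are half-planes in \<open>W\<close>, and the \<open>m\<close> choices of \<open>v\<close> with a
  prescribed \<open>m\<close>-th power are the \<open>m\<close> attracting directions.\<close>

definition petal_param :: "nat \<Rightarrow> complex \<Rightarrow> complex \<Rightarrow> complex" where
  "petal_param m v W = v * exp (- Ln W / of_nat m)"

lemma petal_param_power:
  assumes "m \<ge> 1" "W \<noteq> 0" shows "petal_param m v W ^ m = v ^ m / W"
proof -
  have "exp (- Ln W / of_nat m) ^ m = exp (of_nat m * (- Ln W / of_nat m))"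
    by (rule exp_of_nat_mult[symmetric])
  also have "... = inverse W" using assms by (simp add: exp_minus)
  finally show ?thesis by (simp add: petal_param_def power_mult_distrib divide_inverse)
qed

lemma petal_param_holomorphic: "petal_param m v holomorphic_on {W. Re W > K}" if "K \<ge> 0"
  unfolding petal_param_def[abs_def]
  using that by (intro holomorphic_intros) (auto simp: complex_nonpos_Reals_iff)

lemma halfplane_convex_open: "open {W. Re W > K}" "convex {W. Re W > K}"
  by (rule open_halfspace_Re_gt, rule convex_halfspace_Re_gt)

context parab
begin

text \<open>With \<open>u = petal_param m v W\<close> and \<open>z = u ^ m * g (beta + u)\<close>,
  the map sends \<open>u\<close> to \<open>u * (1 + z)\<close>, hence \<open>W\<close> to
  \<open>W / (1 + z) ^ m\<close>, about \<open>W - m * z * W\<close>. The choice of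
  \<open>v ^ m\<close> makes \<open>m * z * W\<close> close to -1, so the map is nearly the
  translation by 1.\<close>

lemma petal_step:
  assumes "m \<ge> 1" "r > 0" "continuous_on (ball beta r) g" "g beta = A" "A \<noteq> 0"
    and F: "\<And>x. x \<in> ball beta r \<Longrightarrow> (P ^^ q) x - x = (x - beta) ^ Suc m * g x"
  shows "\<exists>K>0. \<forall>v. v ^ m = - 1 / (of_nat m * A) \<longrightarrow>
    (\<exists>T. continuous_on {W. Re W > K} T \<and> (\<forall>W. Re W > K \<longrightarrow>
       cmod (T W - W - 1) \<le> 1 / 4 \<and> cmod (petal_param m v W) < 1 \<and>
       (P ^^ q) (beta + petal_param m v W) = beta + petal_param m v (T W)))"
proof -
  obtain d1 where d1: "d1 > 0" "\<And>z. cmod z < d1 \<Longrightarrow> cmod (1 / (1 + z) ^ m - 1 + of_nat m * z) \<le> (1/32) * cmod z"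
    using inv_power_taylor[of "1/32" m] by auto
  obtain d2 where d2: "d2 > 0" "\<And>z W. cmod z < d2 \<Longrightarrow> Re W > 0 \<Longrightarrow>
      exp (- Ln (W / (1 + z) ^ m) / of_nat m) = exp (- Ln W / of_nat m) * (1 + z)"
    using root_step[OF assms(1)] by blast
  define d where "d = min (min d1 d2) (1/2)"
  have d: "d > 0" "d \<le> d1" "d \<le> d2" "d \<le> 1/2" using d1(1) d2(1) by (auto simp: d_def)
  have "isCont g beta" using assms(2,3) by (simp add: continuous_on_eq_continuous_at)
  moreover have "cmod A / 8 > 0" using assms(5) by simp
  ultimately obtain r1 where r1: "r1 > 0" "\<And>x. dist x beta < r1 \<Longrightarrow> dist (g x) (g beta) < cmod A / 8"
    using continuous_at_eps_delta[THEN iffD1, rule_format, of beta g "cmod A / 8"] by metis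
  define r2 where "r2 = min (min r r1) 1"
  have r2: "r2 > 0" "r2 \<le> r" "r2 \<le> r1" "r2 \<le> 1" using assms(2) r1(1) by (auto simp: r2_def)
  \<comment> \<open>The first entry of the maximum puts the petal into the disc of radius
    \<open>r2\<close>; the second makes \<open>z\<close> smaller than \<open>d\<close>, where the
    Taylor and root estimates apply.\<close>
  define K where "K = max (1 / (real m * cmod A * r2 ^ m)) (2 / d)"
  have K: "K > 0" using d by (auto simp: K_def less_max_iff_disj)
  show ?thesis
  proof (intro exI[of _ K] conjI allI impI)
    show "K > 0" by fact
    fix v :: complex assume v: "v ^ m = - 1 / (of_nat m * A)"
    have nv: "cmod v ^ m = 1 / (real m * cmod A)"
      using v by (metis norm_divide norm_minus_cancel norm_mult norm_of_nat norm_one norm_power)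
    let ?u = "petal_param m v"
    have small: "cmod (?u W) < r2" if W: "Re W > K" for W
    proof -
      have W0: "W \<noteq> 0" "cmod W > K" using W K complex_Re_le_cmod[of W] by auto
      have "cmod (?u W) ^ m = cmod v ^ m / cmod W"
        using petal_param_power[OF assms(1) W0(1), of v] by (metis norm_divide norm_power)
      also have "... < r2 ^ m"
      proof -
        have "1 / (real m * cmod A * r2 ^ m) < cmod W" using W0(2) by (simp add: K_def)
        thus ?thesis unfolding nv using assms(1,5) r2(1) W0(1)
          by (simp add: field_simps)
      qed
      finally show ?thesis using r2(1) by (meson less_le power_less_imp_less_base)
    qed
    define z where "z W = ?u W ^ m * g (beta + ?u W)" for W
    define T where "T W = W / (1 + z W) ^ m" for W
    have gz: "z W = - g (beta + ?u W) / (of_nat m * A) / W" "cmod (g (beta + ?u W) / A - 1) \<le> 1/8"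
      "cmod (z W) \<le> 2 / cmod W" "real m * cmod (z W) \<le> 2 / cmod W" "cmod (z W) < d" if W: "Re W > K" for W
    proof -
      have W0: "W \<noteq> 0" "cmod W > K" using W K complex_Re_le_cmod[of W] by auto
      show 1: "z W = - g (beta + ?u W) / (of_nat m * A) / W"
        unfolding z_def petal_param_power[OF assms(1) W0(1)] v by (simp add: field_simps)
      have "dist (beta + ?u W) beta < r1" using small[OF W] r2 by (simp add: dist_norm)
      hence c: "cmod (g (beta + ?u W) - A) < cmod A / 8" using r1(2) assms(4) by (metis dist_norm)
      have "g (beta + ?u W) / A - 1 = (g (beta + ?u W) - A) / A" using assms(5) by (simp add: field_simps)
      thus 2: "cmod (g (beta + ?u W) / A - 1) \<le> 1/8"
        using c assms(5) by (simp add: norm_divide field_simps)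
      have e: "cmod (g (beta + ?u W) / A) \<le> 2"
        using 2 norm_triangle_ineq[of "g (beta + ?u W) / A - 1" 1] by simp
      have "cmod (z W) = cmod (g (beta + ?u W) / A) / (real m * cmod W)"
        unfolding 1 by (simp add: norm_divide norm_mult field_simps)
      hence zz: "real m * cmod (z W) = cmod (g (beta + ?u W) / A) / cmod W" using assms(1) by simp
      show 3: "real m * cmod (z W) \<le> 2 / cmod W"
        unfolding zz using e by (intro divide_right_mono) auto
      have "1 * cmod (z W) \<le> real m * cmod (z W)" using assms(1) by (intro mult_right_mono) auto
      thus 4: "cmod (z W) \<le> 2 / cmod W" using 3 by simp
      have "2 / d < cmod W" using W0(2) by (simp add: K_def)
      hence "2 / cmod W < d" using d(1) W0 K by (simp add: field_simps)
      thus "cmod (z W) < d" using 4 by linarith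
    qed
    have "continuous_on {W. Re W > K} ?u"
      using petal_param_holomorphic[of K] K by (simp add: holomorphic_on_imp_continuous_on)
    moreover have "continuous_on {W. Re W > K} (\<lambda>W. g (beta + ?u W))"
      by (rule continuous_on_compose2[OF assms(3)])
        (use calculation less_le_trans[OF small r2(2)] in \<open>auto intro!: continuous_intros simp: dist_norm\<close>)
    ultimately have zc: "continuous_on {W. Re W > K} z"
      unfolding z_def[abs_def] by (intro continuous_intros)
    have nz: "1 + z W \<noteq> 0" if "Re W > K" for W
    proof
      assume "1 + z W = 0" hence "z W = -1" by (simp add: add_eq_0_iff)
      thus False using gz(5)[OF that] d by simp
    qed
    show "\<exists>T. continuous_on {W. Re W > K} T \<and> (\<forall>W. Re W > K \<longrightarrow>
       cmod (T W - W - 1) \<le> 1 / 4 \<and> cmod (?u W) < 1 \<and> (P ^^ q) (beta + ?u W) = beta + ?u (T W))"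
    proof (intro exI[of _ T] conjI allI impI)
      show "continuous_on {W. Re W > K} T"
        unfolding T_def[abs_def] by (intro continuous_intros zc) (use nz in auto)
      fix W assume W: "Re W > K"
      have W0: "W \<noteq> 0" "cmod W > K" "Re W > 0" using W K complex_Re_le_cmod[of W] by auto
      have "T W - W - 1 = W * (1 / (1 + z W) ^ m - 1 + of_nat m * z W) + (- of_nat m * z W * W - 1)"
        unfolding T_def by (simp add: algebra_simps)
      also have "- of_nat m * z W * W - 1 = g (beta + ?u W) / A - 1"
        unfolding gz(1)[OF W] using W0 assms(1,5) by simp
      finally have eq: "T W - W - 1 = W * (1 / (1 + z W) ^ m - 1 + of_nat m * z W) + (g (beta + ?u W) / A - 1)" .
      have "cmod (W * (1 / (1 + z W) ^ m - 1 + of_nat m * z W)) \<le> cmod W * ((1/32) * cmod (z W))"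
        unfolding norm_mult using gz(5)[OF W] d d1(2)[of "z W"] by (intro mult_left_mono) auto
      moreover have "cmod W * ((1/32) * cmod (z W)) \<le> cmod W * ((1/32) * (2 / cmod W))"
        using gz(3)[OF W] by (intro mult_left_mono) auto
      ultimately show "cmod (T W - W - 1) \<le> 1 / 4"
        using gz(2)[OF W] W0(1) norm_triangle_ineq[of "W * (1 / (1 + z W) ^ m - 1 + of_nat m * z W)" "g (beta + ?u W) / A - 1"]
        unfolding eq by simp
      show "cmod (?u W) < 1" using small[OF W] r2 by simp
      have "?u (T W) = ?u W * (1 + z W)"
        unfolding petal_param_def T_def using d2(2)[of "z W" W] gz(5)[OF W] d W0(3) by simp
      moreover have "(P ^^ q) (beta + ?u W) = beta + ?u W + ?u W ^ Suc m * g (beta + ?u W)"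
        using F[of "beta + ?u W"] small[OF W] r2 by (simp add: dist_norm algebra_simps)
      ultimately show "(P ^^ q) (beta + ?u W) = beta + ?u (T W)"
        by (simp add: z_def algebra_simps)
    qed
  qed
qed

end

context parab
begin

definition petal_map :: "nat \<Rightarrow> real \<Rightarrow> complex \<Rightarrow> (complex \<Rightarrow> complex) \<Rightarrow> bool" where
  "petal_map m K v T \<longleftrightarrow> m \<ge> 1 \<and> K > 0 \<and> v \<noteq> 0 \<and> continuous_on {W. Re W > K} T \<and> (\<forall>W. Re W > K \<longrightarrow>
       cmod (T W - W - 1) \<le> 1 / 4 \<and> cmod (petal_param m v W) < 1 \<and>
       (P ^^ q) (beta + petal_param m v W) = beta + petal_param m v (T W))"

lemma petal_map_iterate:
  assumes "petal_map m K v T" "Re W > K"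
  shows "Re ((T ^^ n) W) \<ge> Re W + 3 / 4 * n" "Re ((T ^^ n) W) > K"
    "(P ^^ (q * n)) (beta + petal_param m v W) = beta + petal_param m v ((T ^^ n) W)"
proof -
  have "Re ((T ^^ n) W) \<ge> Re W + 3 / 4 * n \<and> (P ^^ (q * n)) (beta + petal_param m v W) = beta + petal_param m v ((T ^^ n) W)"
  proof (induction n)
    case (Suc n)
    hence K: "Re ((T ^^ n) W) > K" using assms(2) by (smt (verit) mult_nonneg_nonneg of_nat_0_le_iff zero_le_divide_iff)
    hence "cmod (T ((T ^^ n) W) - (T ^^ n) W - 1) \<le> 1 / 4" using assms(1) by (auto simp: petal_map_def)
    hence "\<bar>Re (T ((T ^^ n) W) - (T ^^ n) W - 1)\<bar> \<le> 1 / 4" using abs_Re_le_cmod order_trans by blast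
    moreover have "(P ^^ (q * Suc n)) (beta + petal_param m v W) = (P ^^ q) ((P ^^ (q * n)) (beta + petal_param m v W))"
      by (simp add: funpow_add)
    moreover have "(P ^^ q) (beta + petal_param m v ((T ^^ n) W)) = beta + petal_param m v (T ((T ^^ n) W))"
      using assms(1) K by (auto simp: petal_map_def)
    moreover have "Re (T ((T ^^ n) W)) \<ge> Re ((T ^^ n) W) + 3 / 4"
      using calculation(1) unfolding minus_complex.sel one_complex.sel by linarith
    ultimately show ?case using Suc by (simp add: field_simps)
  qed simp
  thus "Re ((T ^^ n) W) \<ge> Re W + 3 / 4 * n" "(P ^^ (q * n)) (beta + petal_param m v W) = beta + petal_param m v ((T ^^ n) W)"
    by auto
  thus "Re ((T ^^ n) W) > K" using assms(2) by (smt (verit) mult_nonneg_nonneg of_nat_0_le_iff zero_le_divide_iff)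
qed

lemma petal_map_continuous_iterate:
  assumes "petal_map m K v T"
  shows "continuous_on {W. Re W > K} (T ^^ n)"
proof (induction n)
  case (Suc n)
  have "continuous_on {W. Re W > K} (\<lambda>W. T ((T ^^ n) W))"
    by (rule continuous_on_compose2[of "{W. Re W > K}" T])
      (use assms Suc petal_map_iterate(2)[OF assms] in \<open>auto simp: petal_map_def\<close>)
  thus ?case by (simp add: o_def)
qed (simp add: id_def)

lemma petal_param_inj:
  assumes "m \<ge> 1" "v ^ m = v' ^ m" "v \<noteq> 0" "v' \<noteq> 0" "W \<noteq> 0" "W' \<noteq> 0"
    "petal_param m v W = petal_param m v' W'"
  shows "W = W'" "v = v'"
proof -
  have "v ^ m / W = v ^ m / W'"
    using petal_param_power[OF assms(1,5), of v] petal_param_power[OF assms(1,6), of v'] assms(2,7) by metis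
  thus "W = W'" using assms by (simp add: field_simps)
  thus "v = v'" using assms(7) by (simp add: petal_param_def)
qed

text \<open>Fatou's argument. Were the petal free of critical orbit points, the inverse branch of
  \<open>P ^^ (q * n)\<close> following the petal backwards would extend to the whole half-plane,
  with values bounded by 2. The distance of \<open>(T ^^ n) W0\<close> from the boundary grows
  linearly in \<open>n\<close>, so by Cauchy the branch is nearly constant between this point and
  its image under \<open>T\<close>; yet it takes the two points to the fixed distinct points over
  \<open>W0\<close> and \<open>T W0\<close>.\<close>

lemma petal_contains_critical:
  assumes T: "petal_map m K v T"
  shows "\<exists>j W. j \<ge> 1 \<and> Re W > K \<and> (P ^^ j) 0 = beta + petal_param m v W"
proof (rule ccontr)
  assume neg: "\<not> ?thesis"
  let ?H = "{W. Re W > K}" and ?u = "petal_param m v"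
  have m: "m \<ge> 1" "K > 0" "v \<noteq> 0" using T by (auto simp: petal_map_def)
  define W0 where "W0 = complex_of_real (K + 1)"
  have W0: "Re W0 > K" by (simp add: W0_def)
  have Th: "(\<lambda>W. beta + ?u W) holomorphic_on ?H"
    using petal_param_holomorphic[of K] m(2) by (intro holomorphic_intros) auto
  have bnd: "cmod (?u W0 - ?u (T W0)) \<le> 50 / (3 * n)" if n: "n \<ge> 3" for n :: nat
  proof -
    have "\<exists>F. F holomorphic_on ?H \<and> (\<forall>W\<in>?H. (P ^^ (q * n)) (F W) = beta + ?u W) \<and> F ((T ^^ n) W0) = beta + ?u W0"
    proof (rule inverse_branch[OF halfplane_convex_open Th])
      show "(P ^^ Suc j) 0 \<noteq> beta + ?u W" if "W \<in> ?H" for W j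
        using neg that by (metis (mono_tags, lifting) le_add1 mem_Collect_eq plus_1_eq_Suc)
    qed (use petal_map_iterate[OF T W0] in auto)
    then obtain F where F: "F holomorphic_on ?H" "\<And>W. W \<in> ?H \<Longrightarrow> (P ^^ (q * n)) (F W) = beta + ?u W"
      "F ((T ^^ n) W0) = beta + ?u W0" by blast
    \<comment> \<open>The branch undoes \<open>T ^^ n\<close> on the whole half-plane, by uniqueness
      of lifts from the base point \<open>W0\<close>; besides \<open>W0\<close> it is used at
      \<open>T W0\<close>.\<close>
    have lift: "F ((T ^^ n) W) = beta + ?u W" if "W \<in> ?H" for W
    proof (rule iterate_unique_lift[of ?H "\<lambda>W. F ((T ^^ n) W)" "\<lambda>W. beta + ?u W" "q * n" "cc 0" W0])
      show "connected ?H" using halfplane_convex_open by (intro convex_connected)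
      show "continuous_on ?H (\<lambda>W. F ((T ^^ n) W))"
        by (rule continuous_on_compose2[OF holomorphic_on_imp_continuous_on[OF F(1)] petal_map_continuous_iterate[OF T]])
          (use petal_map_iterate(2)[OF T] in auto)
      show "continuous_on ?H (\<lambda>W. beta + ?u W)" using Th by (rule holomorphic_on_imp_continuous_on)
      show "(P ^^ (q * n)) (F ((T ^^ n) W)) = (P ^^ (q * n)) (beta + ?u W)" if "W \<in> ?H" for W
        using F(2) petal_map_iterate[OF T] that by simp
      show "(P ^^ (q * n)) (F ((T ^^ n) W)) \<noteq> (P ^^ Suc j) 0" if "W \<in> ?H" for W j
      proof -
        have "(T ^^ n) W \<in> ?H" using petal_map_iterate(2)[OF T] that by auto
        thus ?thesis using F(2) neg by (metis (mono_tags, lifting) le_add1 mem_Collect_eq plus_1_eq_Suc)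
      qed
    qed (use W0 F(3) that in auto)
    \<comment> \<open>Each application of \<open>T\<close> moves at least \<open>3 / 4\<close> to
      the right, so the disc of this radius about \<open>(T ^^ n) W0\<close> stays in the
      half-plane.\<close>
    define \<rho> where "\<rho> = 3 / 4 * real n"
    have \<rho>: "\<rho> > 0" using n by (simp add: \<rho>_def)
    define w where "w = (T ^^ n) W0"
    have w: "Re w \<ge> K + 1 + \<rho>" "Re w > K"
      using petal_map_iterate(1,2)[OF T W0, of n] by (auto simp: w_def \<rho>_def W0_def)
    have ball: "ball w \<rho> \<subseteq> ?H"
    proof
      fix x assume "x \<in> ball w \<rho>"
      hence "\<bar>Re (w - x)\<bar> < \<rho>" using abs_Re_le_cmod[of "w - x"] by (simp add: dist_norm)
      thus "x \<in> ?H" using w by (simp add: abs_less_iff)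
    qed
    have TW0: "Re (T W0) > K" using petal_map_iterate(2)[OF T W0, of 1] by simp
    have Tw: "T w = (T ^^ n) (T W0)" by (simp add: w_def funpow_swap1)
    have "cmod (T w - w - 1) \<le> 1 / 4" using T w(2) by (auto simp: petal_map_def)
    hence step: "cmod (T w - w) \<le> 5 / 4" using norm_triangle_ineq[of "T w - w - 1" 1] by simp
    have "cmod (F w - F (T w)) \<le> (5 * 2 / \<rho>) * cmod (w - T w)"
    proof (rule holomorphic_lipschitz[of F w \<rho> 2])
      show "F holomorphic_on ball w \<rho>" using F(1) ball holomorphic_on_subset by blast
      show "cmod (F x) \<le> 2" if "x \<in> ball w \<rho>" for x
      proof (rule iterate_bound[of "q * n"])
        have "x \<in> ?H" using that ball by blast
        hence "cmod (?u x) < 1" using T by (auto simp: petal_map_def)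
        thus "cmod ((P ^^ (q * n)) (F x)) \<le> 2"
          unfolding F(2)[OF \<open>x \<in> ?H\<close>] using norm_triangle_ineq[of beta "?u x"] norm_beta by linarith
      qed simp
      show "w \<in> ball w (3 * \<rho> / 4)" using \<rho> by simp
      show "T w \<in> ball w (3 * \<rho> / 4)" using step n by (simp add: dist_norm norm_minus_commute \<rho>_def)
    qed
    also have "... \<le> (5 * 2 / \<rho>) * (5 / 4)" using step \<rho> by (intro mult_left_mono) (auto simp: norm_minus_commute)
    also have "... = 50 / (3 * n)" by (simp add: \<rho>_def)
    finally show ?thesis
      using lift[of W0] lift[of "T W0"] W0 TW0 by (simp add: Tw) (simp add: w_def)
  qed
  have "(\<lambda>n::nat. 50 / (3 * real n)) \<longlonglongrightarrow> 0"
    using tendsto_mult[OF tendsto_const[of "50/3"] lim_inverse_n'] by (simp add: field_simps)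
  hence "cmod (?u W0 - ?u (T W0)) \<le> 0"
    by (rule tendsto_lowerbound) (use bnd in \<open>auto simp: eventually_at_top_linorder intro!: exI[of _ 3]\<close>)
  hence "?u W0 = ?u (T W0)" by simp
  moreover have "Re (T W0) \<ge> Re W0 + 3 / 4" using petal_map_iterate(1)[OF T W0, of 1] by simp
  ultimately show False using petal_param_inj(1)[of m v v W0 "T W0"] m W0 by force
qed

text \<open>Each of the \<open>m\<close> petals captures the critical orbit at some time
  \<open>j v\<close>. Equal residues of these times modulo \<open>q\<close> would put two petals on
  one orbit of \<open>P ^^ q\<close>, which keeps \<open>v\<close>; so the residues are distinct and
  \<open>m \<le> q\<close>. Convergence along one residue class comes from \<open>W\<close> tending
  to infinity, along the others from continuity of the iterates at \<open>beta\<close>.\<close>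

lemma critical_orbit:
  shows "(\<lambda>n. (P ^^ n) 0) \<longlonglongrightarrow> beta" and "(P ^^ n) 0 \<noteq> beta"
    and "\<exists>m g r. 1 \<le> m \<and> m \<le> q \<and> r > 0 \<and> continuous_on (ball beta r) g \<and>
    (\<forall>x\<in>ball beta r. (P ^^ q) x - x = (x - beta) ^ Suc m * g x \<and> g x \<noteq> 0)"
proof -
  obtain m g r where mg: "m \<ge> 1" "r > 0" "g holomorphic_on ball beta r"
    "\<And>x. x \<in> ball beta r \<Longrightarrow> (P ^^ q) x - x = (x - beta) ^ Suc m * g x"
    "\<And>x. x \<in> ball beta r \<Longrightarrow> g x \<noteq> 0" using iterate_q_expansion by metis
  have gc: "continuous_on (ball beta r) g" using mg(3) by (rule holomorphic_on_imp_continuous_on)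
  define V where "V = {v. v ^ m = - 1 / (of_nat m * g beta)}"
  have gb: "g beta \<noteq> 0" using mg(2,5) by simp
  obtain K where K: "K > 0" "\<And>v. v \<in> V \<Longrightarrow> (\<exists>T. continuous_on {W. Re W > K} T \<and> (\<forall>W. Re W > K \<longrightarrow>
       cmod (T W - W - 1) \<le> 1 / 4 \<and> cmod (petal_param m v W) < 1 \<and>
       (P ^^ q) (beta + petal_param m v W) = beta + petal_param m v (T W)))"
    using petal_step[OF mg(1,2) gc refl gb mg(4)] unfolding V_def by blast
  have V0: "v \<noteq> 0" if "v \<in> V" for v using that mg(1) gb by (auto simp: V_def power_0_left)
  have "\<forall>v\<in>V. \<exists>T. petal_map m K v T" unfolding petal_map_def using K V0 mg(1) by blast
  then obtain T where T: "\<And>v. v \<in> V \<Longrightarrow> petal_map m K v (T v)" by metis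
  have "\<forall>v\<in>V. \<exists>j W. j \<ge> 1 \<and> Re W > K \<and> (P ^^ j) 0 = beta + petal_param m v W"
    using petal_contains_critical T by blast
  then obtain j W where j: "\<And>v. v \<in> V \<Longrightarrow> j v \<ge> (1::nat)" "\<And>v. v \<in> V \<Longrightarrow> Re (W v) > K"
    "\<And>v. v \<in> V \<Longrightarrow> (P ^^ j v) 0 = beta + petal_param m v (W v)" by metis
  have orb: "(P ^^ (j v + q * k)) 0 = beta + petal_param m v ((T v ^^ k) (W v))" if "v \<in> V" for v k
    using petal_map_iterate(3)[OF T[OF that] j(2)[OF that], of k] j(3)[OF that]
    by (simp add: add.commute[of "j v"] funpow_add)
  have nz: "(T v ^^ k) (W v) \<noteq> 0" if "v \<in> V" for v k
    using petal_map_iterate(2)[OF T[OF that] j(2)[OF that], of k] K(1) by auto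
  have card: "card V = m" unfolding V_def by (rule card_nth_roots) (use mg(1) gb in auto)
  then obtain v where v: "v \<in> V" using mg(1) by fastforce
  have "inj_on (\<lambda>v. j v mod q) V"
  proof -
    have *: "v = v'" if vv: "v \<in> V" "v' \<in> V" "j v mod q = j v' mod q" "j v \<le> j v'" for v v'
    proof -
      from vv(3,4) obtain k where "j v' = j v + q * k" by (metis mod_eq_dvd_iff_nat dvd_def le_add_diff_inverse)
      hence "petal_param m v ((T v ^^ k) (W v)) = petal_param m v' (W v')"
        using orb[OF vv(1), of k] j(3)[OF vv(2)] by simp
      moreover have "W v' \<noteq> 0" using nz[OF vv(2), of 0] by simp
      ultimately show ?thesis
        using petal_param_inj(2)[OF mg(1)] vv V0 nz by (metis (mono_tags, lifting) V_def mem_Collect_eq)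
    qed
    show ?thesis
    proof (rule inj_onI)
      fix v v' assume "v \<in> V" "v' \<in> V" "j v mod q = j v' mod q"
      thus "v = v'" using *[of v v'] *[of v' v] by (cases "j v \<le> j v'") auto
    qed
  qed
  moreover have "(\<lambda>v. j v mod q) ` V \<subseteq> {..<q}" using q_pos by auto
  ultimately have "card V \<le> card {..<q}" by (rule card_inj_on_le) simp
  hence "m \<le> q" using card by simp
  thus "\<exists>m g r. 1 \<le> m \<and> m \<le> q \<and> r > 0 \<and> continuous_on (ball beta r) g \<and>
    (\<forall>x\<in>ball beta r. (P ^^ q) x - x = (x - beta) ^ Suc m * g x \<and> g x \<noteq> 0)"
    using mg gc by blast
  have ne: "petal_param m v ((T v ^^ k) (W v)) \<noteq> 0" for k
    using V0[OF v] by (simp add: petal_param_def)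
  show "(P ^^ n) 0 \<noteq> beta"
  proof
    assume n: "(P ^^ n) 0 = beta"
    have "n \<le> j v + q * n" using q_pos by (simp add: trans_le_add2)
    hence "(P ^^ (j v + q * n)) 0 = (P ^^ (j v + q * n - n)) ((P ^^ n) 0)"
      by (metis funpow_add comp_apply le_add_diff_inverse2)
    thus False using orb[OF v, of n] ne[of n] by (simp add: n iterate_beta)
  qed
  have lim0: "(\<lambda>k. petal_param m v ((T v ^^ k) (W v))) \<longlonglongrightarrow> 0"
  proof -
    have "filterlim (\<lambda>k. K + 3 / 4 * real k) at_top sequentially"
      by (intro filterlim_tendsto_add_at_top[OF tendsto_const] filterlim_tendsto_pos_mult_at_top[OF tendsto_const] filterlim_real_sequentially) auto
    hence "filterlim (\<lambda>k. (T v ^^ k) (W v)) at_infinity sequentially"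
      unfolding filterlim_at_infinity_conv_norm_at_top
    proof (rule filterlim_at_top_mono, intro always_eventually allI)
      fix k show "K + 3 / 4 * real k \<le> norm ((T v ^^ k) (W v))"
        using petal_map_iterate(1)[OF T[OF v] j(2)[OF v], of k] j(2)[OF v] complex_Re_le_cmod[of "(T v ^^ k) (W v)"] by linarith
    qed
    hence "(\<lambda>k. v ^ m / (T v ^^ k) (W v)) \<longlonglongrightarrow> 0"
      by (rule tendsto_divide_0[OF tendsto_const])
    hence "(\<lambda>k. petal_param m v ((T v ^^ k) (W v)) ^ m) \<longlonglongrightarrow> 0"
      by (simp add: petal_param_power[OF mg(1) nz[OF v]])
    hence "(\<lambda>k. root m (norm (petal_param m v ((T v ^^ k) (W v)) ^ m))) \<longlonglongrightarrow> root m 0"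
      by (intro tendsto_real_root) (simp add: tendsto_norm_zero_iff)
    hence "(\<lambda>k. norm (petal_param m v ((T v ^^ k) (W v)))) \<longlonglongrightarrow> 0"
      using mg(1) by (simp add: norm_power real_root_power_cancel)
    thus ?thesis by (simp add: tendsto_norm_zero_iff)
  qed
  show "(\<lambda>n. (P ^^ n) 0) \<longlonglongrightarrow> beta"
  proof (rule LIMSEQ_offset[where k = "j v"])
    have a: "(\<lambda>k. (P ^^ (r + (j v + q * k))) 0) \<longlonglongrightarrow> beta" for r
    proof -
      have "isCont (P ^^ r) beta" using quad_continuous_iterate[of UNIV r] by (simp add: continuous_on_eq_continuous_at)
      moreover have "(\<lambda>k. beta + petal_param m v ((T v ^^ k) (W v))) \<longlonglongrightarrow> beta + 0"
        by (intro tendsto_add tendsto_const lim0)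
      ultimately have "(\<lambda>k. (P ^^ r) (beta + petal_param m v ((T v ^^ k) (W v)))) \<longlonglongrightarrow> (P ^^ r) beta"
        using isCont_tendsto_compose by fastforce
      thus ?thesis by (simp add: funpow_add[of r] orb[OF v] iterate_beta)
    qed
    show "(\<lambda>n. (P ^^ (n + j v)) 0) \<longlonglongrightarrow> beta"
    proof (rule LIMSEQ_I)
      fix e :: real assume "e > 0"
      have "\<forall>r. \<exists>N. \<forall>k\<ge>N. norm ((P ^^ (r + (j v + q * k))) 0 - beta) < e"
        using LIMSEQ_D[OF a \<open>e > 0\<close>] by blast
      then obtain N where N: "\<And>r k. k \<ge> N r \<Longrightarrow> norm ((P ^^ (r + (j v + q * k))) 0 - beta) < e" by metis
      define N0 where "N0 = Max (N ` {..<q})"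
      have N0: "N r \<le> N0" if "r < q" for r unfolding N0_def using that by (intro Max_ge) auto
      show "\<exists>no. \<forall>n\<ge>no. norm ((P ^^ (n + j v)) 0 - beta) < e"
      proof (intro exI[of _ "q * N0"] allI impI)
        fix n assume n: "q * N0 \<le> n"
        have "n div q \<ge> N0" using n q_pos by (simp add: less_eq_div_iff_mult_less_eq mult.commute)
        moreover have "n mod q < q" using q_pos by simp
        ultimately have "norm ((P ^^ (n mod q + (j v + q * (n div q)))) 0 - beta) < e"
          using N N0 order_trans by blast
        moreover have "n mod q + (j v + q * (n div q)) = n + j v" by simp
        ultimately show "norm ((P ^^ (n + j v)) 0 - beta) < e" by simp
      qed
    qed
  qed
qed

end

subsection \<open>Normal form at the semi-parabolic fixed point\<close>

lemma norm_power_diff_le: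
  fixes x y :: complex
  assumes "cmod x \<le> r" "cmod y \<le> r" "r \<le> 1" "2 \<le> k"
  shows "cmod (x ^ k - y ^ k) \<le> real k * r * cmod (x - y)"
proof -
  have r: "r \<ge> 0" using assms(1) norm_ge_zero order_trans by blast
  have eq: "cmod (x ^ k - y ^ k) = cmod (x - y) * cmod (\<Sum>i<k. y ^ (k - Suc i) * x ^ i)"
    unfolding power_diff_sumr2[of x k y] norm_mult by (rule refl)
  have "cmod (\<Sum>i<k. y ^ (k - Suc i) * x ^ i) \<le> (\<Sum>i<k. r)"
  proof (rule sum_norm_le)
    fix i assume i: "i \<in> {..<k}"
    have "cmod (y ^ (k - Suc i) * x ^ i) \<le> r ^ (k - Suc i) * r ^ i"
      unfolding norm_mult norm_power using assms r by (intro mult_mono power_mono) auto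
    also have "... = r ^ (k - 1)" using i by (simp flip: power_add)
    also have "... \<le> r ^ 1" using assms r by (intro power_decreasing) auto
    finally show "cmod (y ^ (k - Suc i) * x ^ i) \<le> r" by simp
  qed
  hence "cmod (x - y) * cmod (\<Sum>i<k. y ^ (k - Suc i) * x ^ i) \<le> cmod (x - y) * (real k * r)"
    by (intro mult_left_mono) auto
  thus ?thesis unfolding eq by (simp add: mult_ac)
qed

context parab
begin

text \<open>With \<open>u = x - bet b\<close> and the coordinate \<open>w\<close> of
  \<open>ww\<close> below, one step of the recursion is \<open>u' = l * u + e * w + u^2\<close>,
  \<open>w' = e * w + u^2\<close>. A curve \<open>u = phi t\<close>, \<open>w = hp t\<close> on
  which \<open>t\<close> moves to \<open>GG t\<close> is sought as a power series. Comparing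
  coefficients gives \<open>hh\<close> from the coefficients \<open>pp\<close> of the square of
  \<open>phi\<close>, and \<open>ph\<close> from \<open>hh\<close> after division by
  \<open>l ^ k - l\<close>. This divisor vanishes at \<open>k = q + 1\<close>; there the recursion
  stops and the remaining term becomes the coefficient \<open>alp\<close> of
  \<open>GG\<close>.\<close>

fun ph :: "complex \<Rightarrow> nat \<Rightarrow> complex" where
  "ph e k = (if k = 0 then 0 else if k = 1 then 1 else if k \<le> q then
     (\<Sum>i\<in>{1..<k}. ph e i * ph e (k - i)) / (l ^ k - e) * l ^ k / (l ^ k - l) else 0)"

declare ph.simps [simp del]

definition pp :: "complex \<Rightarrow> nat \<Rightarrow> complex" where
  "pp e k = (\<Sum>i\<in>{1..<k}. ph e i * ph e (k - i))"

definition hh :: "complex \<Rightarrow> nat \<Rightarrow> complex" where "hh e k = pp e k / (l ^ k - e)"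

lemma ph_0: "ph e 0 = 0" and ph_1: "ph e (Suc 0) = 1"
  and ph_big: "k > q \<Longrightarrow> k \<noteq> 1 \<Longrightarrow> ph e k = 0"
  and ph_rec: "2 \<le> k \<Longrightarrow> k \<le> q \<Longrightarrow> ph e k = hh e k * l ^ k / (l ^ k - l)"
  by (subst ph.simps; simp add: hh_def pp_def)+

lemma hh_0: "hh e 0 = 0" and hh_1: "hh e (Suc 0) = 0"
  by (simp_all add: hh_def pp_def)

lemma l_pow_nz: "cmod e \<le> 1 / 2 \<Longrightarrow> l ^ k - e \<noteq> 0"
  using norm_l by (metis norm_power power_one right_minus_eq not_le zero_less_one field_sum_of_halves less_add_same_cancel1 half_gt_zero)

lemma l_pow_ne_l: "2 \<le> k \<Longrightarrow> k \<le> q \<Longrightarrow> l ^ k - l \<noteq> 0"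
proof
  assume k: "2 \<le> k" "k \<le> q" and "l ^ k - l = 0"
  hence "l * (l ^ (k - 1) - 1) = 0" by (cases k) (auto simp: algebra_simps)
  hence "l ^ (k - 1) = 1" using l_nz by simp
  thus False using l_prim[of "k - 1"] k by fastforce
qed

text \<open>No divisor comes near 0: \<open>l ^ k\<close> has modulus 1 while
  \<open>cmod e \<le> 1/2\<close>, and \<open>l ^ k - l\<close> does not involve \<open>e\<close>.
  Continuity on the closed disc then yields bounds uniform in \<open>e\<close>.\<close>

lemma ph_continuous: "continuous_on (cball 0 (1/2)) (\<lambda>e. ph e k)"
proof (induction k rule: less_induct)
  case (less k)
  show ?case
  proof (cases "2 \<le> k \<and> k \<le> q")
    case True
    have "continuous_on (cball 0 (1/2)) (\<lambda>e. (\<Sum>i\<in>{1..<k}. ph e i * ph e (k - i)) / (l ^ k - e) * l ^ k / (l ^ k - l))"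
      using less.IH l_pow_nz l_pow_ne_l True by (intro continuous_intros) auto
    thus ?thesis using True by (subst ph.simps) auto
  next
    case False
    then consider "k = 0" | "k = 1" | "k > q" "k \<noteq> 1" by linarith
    thus ?thesis by cases (simp_all add: ph_0 ph_1 ph_big)
  qed
qed

lemma pp_continuous: "continuous_on (cball 0 (1/2)) (\<lambda>e. pp e k)"
  unfolding pp_def by (intro continuous_intros ph_continuous)

lemma hh_continuous: "continuous_on (cball 0 (1/2)) (\<lambda>e. hh e k)"
  unfolding hh_def using l_pow_nz by (intro continuous_intros pp_continuous) auto

lemma coeff_bound:
  "\<exists>M\<ge>1. \<forall>e k. cmod e \<le> 1/2 \<longrightarrow> k \<le> q + 1 \<longrightarrow> cmod (ph e k) \<le> M \<and> cmod (hh e k) \<le> M"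
proof -
  have "\<exists>B. \<forall>e\<in>cball 0 (1/2). cmod (f e) \<le> B" if "continuous_on (cball 0 (1/2)) f" for f :: "complex \<Rightarrow> complex"
    using compact_imp_bounded[OF compact_continuous_image[OF that compact_cball]] by (auto simp: bounded_iff)
  hence "\<forall>k. \<exists>B. \<forall>e\<in>cball 0 (1/2). cmod (ph e k) \<le> B" "\<forall>k. \<exists>B. \<forall>e\<in>cball 0 (1/2). cmod (hh e k) \<le> B"
    using ph_continuous hh_continuous by blast+
  then obtain B1 B2 where B: "\<And>k e. cmod e \<le> 1/2 \<Longrightarrow> cmod (ph e k) \<le> B1 k" "\<And>k e. cmod e \<le> 1/2 \<Longrightarrow> cmod (hh e k) \<le> B2 k"
    by (metis mem_cball_0)
  let ?M = "max 1 (Max ((\<lambda>k. max (B1 k) (B2 k)) ` {..q + 1}))"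
  have "max (B1 k) (B2 k) \<le> ?M" if "k \<le> q + 1" for k
    using that by (intro max.coboundedI2 Max_ge) auto
  hence "\<forall>e k. cmod e \<le> 1/2 \<longrightarrow> k \<le> q + 1 \<longrightarrow> cmod (ph e k) \<le> ?M \<and> cmod (hh e k) \<le> ?M"
    using B by (meson max.bounded_iff order_trans)
  thus ?thesis by (intro exI[of _ ?M]) auto
qed

definition phi :: "complex \<Rightarrow> complex \<Rightarrow> complex" where "phi e t = (\<Sum>k\<le>q + 1. ph e k * t ^ k)"

definition hp :: "complex \<Rightarrow> complex \<Rightarrow> complex" where "hp e t = (\<Sum>k\<le>q + 1. hh e k * t ^ k)"

definition alp :: "complex \<Rightarrow> complex" where "alp e = hh e (q + 1)"

definition GG :: "complex \<Rightarrow> complex \<Rightarrow> complex" where "GG e t = l * t + l * alp e * t ^ (q + 1)"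

lemma phi_0 [simp]: "phi e 0 = 0" and hp_0 [simp]: "hp e 0 = 0"
  by (simp_all add: phi_def hp_def power_0_left ph_0 hh_0 if_distrib cong: if_cong)

lemma hp_scaled: "cmod e \<le> 1/2 \<Longrightarrow> hp e (l * t) - e * hp e t = (\<Sum>k\<le>q + 1. pp e k * t ^ k)"
  unfolding hp_def sum_distrib_left sum_subtractf[symmetric]
proof (intro sum.cong refl)
  fix k assume "cmod e \<le> 1/2"
  hence "hh e k * (l ^ k - e) = pp e k" using l_pow_nz[of e k] by (simp add: hh_def)
  thus "hh e k * (l * t) ^ k - e * (hh e k * t ^ k) = pp e k * t ^ k"
    by (metis (no_types, opaque_lifting) left_diff_distrib mult.assoc mult.commute power_mult_distrib)
qed

text \<open>Up to degree \<open>q\<close> the coefficients agree by the choice of \<open>ph\<close>.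
  At the resonant degree \<open>q + 1\<close> the left side contributes nothing, which leaves
  exactly the term with \<open>alp\<close>.\<close>

lemma phi_scaled: "phi e (l * t) - l * phi e t = hp e (l * t) - l * alp e * t ^ (q + 1)"
proof -
  have "phi e (l * t) - l * phi e t = (\<Sum>k\<le>q + 1. ph e k * (l ^ k - l) * t ^ k)"
    unfolding phi_def sum_distrib_left sum_subtractf[symmetric]
    by (intro sum.cong refl) (auto simp: field_simps power_mult_distrib)
  also have "... = (\<Sum>k\<le>q. ph e k * (l ^ k - l) * t ^ k)"
    using q_pos by (simp add: ph_big)
  also have "... = (\<Sum>k\<le>q. hh e k * l ^ k * t ^ k)"
  proof (intro sum.cong refl)
    fix k assume k: "k \<in> {..q}"
    consider "k = 0" | "k = 1" | "2 \<le> k" by linarith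
    thus "ph e k * (l ^ k - l) * t ^ k = hh e k * l ^ k * t ^ k"
    proof cases
      case 3
      thus ?thesis using k l_pow_ne_l[of k] by (simp add: ph_rec)
    qed (auto simp: ph_0 hh_0 hh_1)
  qed
  also have "... = hp e (l * t) - l * alp e * t ^ (q + 1)"
    using l_q by (simp add: hp_def alp_def power_mult_distrib mult_ac)
  finally show ?thesis .
qed

text \<open>The sums \<open>pp\<close> collect the products of total degree at most
  \<open>q + 1\<close>; the index pairs left over, \<open>A - B\<close>, have degree at least
  \<open>q + 2\<close>, and \<open>A\<close> has \<open>(q + 2)^2\<close> elements.\<close>

lemma phi_square:
  assumes M: "M \<ge> 1" "\<And>k. k \<le> q + 1 \<Longrightarrow> cmod (ph e k) \<le> M" and t: "cmod t \<le> 1"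
  shows "cmod ((phi e t)\<^sup>2 - (\<Sum>k\<le>q + 1. pp e k * t ^ k)) \<le> (real (q + 2))\<^sup>2 * M\<^sup>2 * cmod t ^ (q + 2)"
proof -
  define A where "A = {..q + 1} \<times> {..q + 1}"
  define B where "B = {(i, j) \<in> A. i + j \<le> q + 1}"
  define f where "f = (\<lambda>(i, j). ph e i * ph e j * t ^ (i + j))"
  have fin: "finite A" "B \<subseteq> A" by (auto simp: A_def B_def)
  have 1: "(phi e t)\<^sup>2 = sum f A"
    unfolding phi_def power2_eq_square sum_product A_def f_def sum.cartesian_product
    by (intro sum.cong) (auto simp: power_add mult_ac)
  have "(\<Sum>k\<le>q + 1. pp e k * t ^ k) = (\<Sum>k\<le>q + 1. \<Sum>i\<in>{..k}. ph e i * ph e (k - i) * t ^ k)"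
  proof (intro sum.cong refl)
    fix k assume "k \<in> {..q + 1}"
    have "(\<Sum>i\<in>{1..<k}. ph e i * ph e (k - i)) = (\<Sum>i\<in>{..k}. ph e i * ph e (k - i))"
    proof (rule sum.mono_neutral_left)
      show "\<forall>i\<in>{..k} - {1..<k}. ph e i * ph e (k - i) = 0"
      proof
        fix i assume "i \<in> {..k} - {1..<k}"
        hence "i = 0 \<or> k - i = 0" by auto
        thus "ph e i * ph e (k - i) = 0" by (auto simp: ph_0)
      qed
    qed auto
    thus "pp e k * t ^ k = (\<Sum>i\<in>{..k}. ph e i * ph e (k - i) * t ^ k)"
      by (simp add: pp_def sum_distrib_right)
  qed
  also have "... = (\<Sum>(k, i)\<in>Sigma {..q + 1} (\<lambda>k. {..k}). ph e i * ph e (k - i) * t ^ k)"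
    by (rule sum.Sigma) auto
  also have "... = sum f B"
    by (rule sum.reindex_bij_witness[of _ "\<lambda>(i, j). (i + j, i)" "\<lambda>(k, i). (i, k - i)"])
      (auto simp: B_def A_def f_def)
  finally have 2: "(\<Sum>k\<le>q + 1. pp e k * t ^ k) = sum f B" .
  have "(phi e t)\<^sup>2 - (\<Sum>k\<le>q + 1. pp e k * t ^ k) = sum f (A - B)"
    unfolding 1 2 using fin by (simp add: sum_diff)
  also have "cmod ... \<le> (\<Sum>x\<in>A - B. M\<^sup>2 * cmod t ^ (q + 2))"
  proof (rule sum_norm_le)
    fix x assume "x \<in> A - B"
    then obtain i j where x: "x = (i, j)" "i \<le> q + 1" "j \<le> q + 1" "i + j \<ge> q + 2" by (cases x) (auto simp: A_def B_def not_le)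
    have "cmod (f x) = cmod (ph e i) * cmod (ph e j) * cmod t ^ (i + j)"
      by (simp add: f_def x norm_mult norm_power)
    also have "... \<le> M * M * cmod t ^ (q + 2)"
      using M x t by (intro mult_mono power_decreasing) auto
    finally show "cmod (f x) \<le> M\<^sup>2 * cmod t ^ (q + 2)" by (simp add: power2_eq_square)
  qed
  also have "... = real (card (A - B)) * (M\<^sup>2 * cmod t ^ (q + 2))" by simp
  also have "... \<le> (real (q + 2))\<^sup>2 * (M\<^sup>2 * cmod t ^ (q + 2))"
  proof (intro mult_right_mono)
    have "card (A - B) \<le> card A" using fin by (intro card_mono) auto
    also have "card A = (q + 2)\<^sup>2" by (simp add: A_def card_cartesian_product power2_eq_square)
    finally show "real (card (A - B)) \<le> (real (q + 2))\<^sup>2"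
      by (metis of_nat_le_iff of_nat_power)
  qed simp
  finally show ?thesis by (simp add: mult_ac)
qed

lemma sum_power_diff:
  assumes "\<And>k. k \<le> q + 1 \<Longrightarrow> cmod (c k) \<le> M" "cmod x \<le> r" "cmod y \<le> r" "r \<le> 1"
  shows "cmod ((\<Sum>k\<le>q + 1. c k * x ^ k) - (\<Sum>k\<le>q + 1. c k * y ^ k) - c 1 * (x - y))
    \<le> (real (q + 2))\<^sup>2 * M * r * cmod (x - y)"
proof -
  have r: "r \<ge> 0" using assms(2) norm_ge_zero order_trans by blast
  have M: "M \<ge> 0" using assms(1)[of 0] norm_ge_zero order_trans by blast
  have "(\<Sum>k\<le>q + 1. c k * x ^ k) - (\<Sum>k\<le>q + 1. c k * y ^ k) - c 1 * (x - y) =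
    (\<Sum>k\<le>q + 1. c k * (x ^ k - y ^ k)) - (\<Sum>k\<in>{1}. c k * (x ^ k - y ^ k))"
    by (simp add: sum_subtractf algebra_simps)
  also have "... = (\<Sum>k\<in>{..q + 1} - {1}. c k * (x ^ k - y ^ k))"
    by (rule sum_diff[symmetric]) auto
  also have "cmod ... \<le> (\<Sum>k\<in>{..q + 1} - {1}. M * (real (q + 2) * r * cmod (x - y)))"
  proof (rule sum_norm_le)
    fix k assume k: "k \<in> {..q + 1} - {1}"
    show "cmod (c k * (x ^ k - y ^ k)) \<le> M * (real (q + 2) * r * cmod (x - y))"
    proof (cases "k = 0")
      case False
      hence "cmod (x ^ k - y ^ k) \<le> real k * r * cmod (x - y)"
        using assms k by (intro norm_power_diff_le) auto
      also have "... \<le> real (q + 2) * r * cmod (x - y)"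
        using k r by (intro mult_right_mono) auto
      finally show ?thesis unfolding norm_mult using assms(1) k M by (intro mult_mono) auto
    qed (use r M in auto)
  qed
  also have "... = real (card ({..q + 1} - {1})) * (M * (real (q + 2) * r * cmod (x - y)))" by simp
  also have "... \<le> real (q + 2) * (M * (real (q + 2) * r * cmod (x - y)))"
    using r M by (intro mult_right_mono) auto
  finally show ?thesis by (simp add: power2_eq_square mult_ac)
qed

end

context parab
begin

text \<open>For the rotation \<open>l * t\<close> in place of \<open>GG e t\<close> the invariance
  equations hold up to order \<open>q + 2\<close> by \<open>hp_scaled\<close>,
  \<open>phi_scaled\<close> and \<open>phi_square\<close>. Replacing \<open>l * t\<close> by
  \<open>GG e t\<close> costs a Lipschitz constant of order \<open>t\<close> times a displacement of
  order \<open>t ^ (q + 1)\<close>. The constant is the same for all \<open>e\<close>.\<close>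

lemma normal_form:
  "\<exists>C\<ge>1. \<forall>e. cmod e \<le> 1/2 \<longrightarrow> cmod (alp e) \<le> C \<and>
    (\<forall>r x y. cmod x \<le> r \<longrightarrow> cmod y \<le> r \<longrightarrow> r \<le> 1 \<longrightarrow>
       cmod (phi e x - phi e y - (x - y)) \<le> C * r * cmod (x - y) \<and>
       cmod (hp e x - hp e y) \<le> C * r * cmod (x - y)) \<and>
    (\<forall>t. cmod t \<le> 1 / (2 * C) \<longrightarrow> cmod (GG e t) \<le> 2 * cmod t \<and>
       cmod (hp e (GG e t) - e * hp e t - (phi e t)\<^sup>2) \<le> C * cmod t ^ (q + 2) \<and>
       cmod (phi e (GG e t) - l * phi e t - (phi e t)\<^sup>2 - e * hp e t) \<le> C * cmod t ^ (q + 2))"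
proof -
  obtain M where M: "M \<ge> 1" "\<And>e k. cmod e \<le> 1/2 \<Longrightarrow> k \<le> q + 1 \<Longrightarrow> cmod (ph e k) \<le> M"
    "\<And>e k. cmod e \<le> 1/2 \<Longrightarrow> k \<le> q + 1 \<Longrightarrow> cmod (hh e k) \<le> M"
    using coeff_bound by blast
  define Q where "Q = (real (q + 2))\<^sup>2"
  have Q: "Q \<ge> 1" by (simp add: Q_def)
  \<comment> \<open>One summand \<open>Q * M^2\<close> for the truncation of the square and two for
    the displacement, whose Lipschitz estimate is taken on the disc of radius
    \<open>2 * cmod t\<close>.\<close>
  define C where "C = 3 * Q * M\<^sup>2"
  have MM: "M \<le> M\<^sup>2" using M(1) by (simp add: power2_eq_square)
  have QM: "M\<^sup>2 \<le> Q * M\<^sup>2" using Q by (simp add: mult_le_cancel_right1)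
  have QM2: "Q * M \<le> Q * M\<^sup>2" using Q MM by (intro mult_left_mono) auto
  have C: "C \<ge> 1" "M \<le> C" "Q * M \<le> C" using MM QM QM2 M(1) unfolding C_def by linarith+
  show ?thesis
  proof (intro exI[of _ C] conjI[OF C(1)] allI impI)
    fix e assume e: "cmod e \<le> 1/2"
    have a: "cmod (alp e) \<le> C" using M(3)[OF e, of "q + 1"] C by (simp add: alp_def)
    have aM: "cmod (alp e) \<le> M" using M(3)[OF e, of "q + 1"] by (simp add: alp_def)
    have Lp: "cmod (phi e x - phi e y - (x - y)) \<le> Q * M * r * cmod (x - y)"
      and Lh: "cmod (hp e x - hp e y) \<le> Q * M * r * cmod (x - y)"
      if "cmod x \<le> r" "cmod y \<le> r" "r \<le> 1" for r x y
      using sum_power_diff[of "ph e" M x r y, OF M(2)[OF e] that]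
        sum_power_diff[of "hh e" M x r y, OF M(3)[OF e] that]
      by (auto simp: phi_def hp_def Q_def ph_1 hh_1)
    have L: "cmod (phi e x - phi e y - (x - y)) \<le> C * r * cmod (x - y) \<and>
      cmod (hp e x - hp e y) \<le> C * r * cmod (x - y)"
      if h: "cmod x \<le> r" "cmod y \<le> r" "r \<le> (1::real)" for r x y
    proof -
      have "r \<ge> 0" using h(1) norm_ge_zero order_trans by blast
      hence "Q * M * r * cmod (x - y) \<le> C * r * cmod (x - y)"
        using C by (intro mult_right_mono) auto
      thus ?thesis using Lp[OF h] Lh[OF h] by linarith
    qed
    have N: "cmod (GG e t) \<le> 2 * cmod t \<and>
       cmod (hp e (GG e t) - e * hp e t - (phi e t)\<^sup>2) \<le> C * cmod t ^ (q + 2) \<and>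
       cmod (phi e (GG e t) - l * phi e t - (phi e t)\<^sup>2 - e * hp e t) \<le> C * cmod t ^ (q + 2)"
      if t: "cmod t \<le> 1 / (2 * C)" for t
    proof (intro conjI)
    have t1: "cmod t \<le> 1/2" using t C(1) by (smt (verit) frac_le)
    have "cmod (GG e t - l * t) = cmod (alp e) * cmod t ^ (q + 1)"
      using norm_l by (simp add: GG_def norm_mult norm_power)
    hence G1: "cmod (GG e t - l * t) \<le> M * cmod t ^ (q + 1)"
      using aM by (simp add: mult_right_mono)
    have "M * cmod t ^ (q + 1) \<le> C * (cmod t ^ 1 * cmod t)"
    proof (rule mult_mono)
      have "cmod t ^ (q + 1) \<le> cmod t ^ (1 + 1)" using q_pos t1 by (intro power_decreasing) auto
      thus "cmod t ^ (q + 1) \<le> cmod t ^ 1 * cmod t" by simp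
    qed (use C in auto)
    also have "... = (C * cmod t) * cmod t" by simp
    also have "... \<le> 1 * cmod t" using t C(1) by (intro mult_right_mono) (simp_all add: field_simps)
    finally have "cmod (GG e t - l * t) \<le> cmod t" using G1 by simp
    moreover have "cmod (l * t) = cmod t" by (simp add: norm_mult norm_l)
    ultimately show G2: "cmod (GG e t) \<le> 2 * cmod t"
      using norm_triangle_ineq[of "GG e t - l * t" "l * t"] by simp
    have ps: "cmod (hp e (l * t) - e * hp e t - (phi e t)\<^sup>2) \<le> Q * M\<^sup>2 * cmod t ^ (q + 2)"
      using phi_square[of M e t, OF M(1) M(2)[OF e]] t1
      unfolding hp_scaled[OF e] Q_def by (simp add: norm_minus_commute)
    have d: "Q * M * (2 * cmod t) * cmod (GG e t - l * t) \<le> 2 * Q * M\<^sup>2 * cmod t ^ (q + 2)"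
    proof -
      have "Q * M * (2 * cmod t) * cmod (GG e t - l * t) \<le> Q * M * (2 * cmod t) * (M * cmod t ^ (q + 1))"
        using G1 Q M(1) by (intro mult_left_mono) auto
      thus ?thesis by (simp add: power2_eq_square mult_ac)
    qed
    have lt: "cmod (l * t) \<le> 2 * cmod t" "2 * cmod t \<le> 1" using t1 by (auto simp: norm_mult norm_l)
    have h1: "cmod (hp e (GG e t) - hp e (l * t)) \<le> 2 * Q * M\<^sup>2 * cmod t ^ (q + 2)"
      using Lh[OF G2 lt] d by linarith
    have "hp e (GG e t) - e * hp e t - (phi e t)\<^sup>2 =
      (hp e (GG e t) - hp e (l * t)) + (hp e (l * t) - e * hp e t - (phi e t)\<^sup>2)" by simp
    from this[THEN arg_cong[where f = cmod]] have "cmod (hp e (GG e t) - e * hp e t - (phi e t)\<^sup>2) \<le>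
       2 * Q * M\<^sup>2 * cmod t ^ (q + 2) + Q * M\<^sup>2 * cmod t ^ (q + 2)"
      using norm_triangle_mono[OF h1 ps] by (simp only:)
    thus "cmod (hp e (GG e t) - e * hp e t - (phi e t)\<^sup>2) \<le> C * cmod t ^ (q + 2)"
      unfolding C_def by (simp add: algebra_simps)
    have p1: "cmod (phi e (GG e t) - phi e (l * t) - (GG e t - l * t)) \<le> 2 * Q * M\<^sup>2 * cmod t ^ (q + 2)"
      using Lp[OF G2 lt] d by linarith
    have "GG e t - l * t = l * alp e * t ^ (q + 1)" by (simp add: GG_def)
    hence "phi e (GG e t) - l * phi e t - (phi e t)\<^sup>2 - e * hp e t =
      (phi e (GG e t) - phi e (l * t) - (GG e t - l * t)) + (hp e (l * t) - e * hp e t - (phi e t)\<^sup>2)"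
      using phi_scaled[of e t] by (simp add: algebra_simps)
    from this[THEN arg_cong[where f = cmod]] have "cmod (phi e (GG e t) - l * phi e t - (phi e t)\<^sup>2 - e * hp e t) \<le>
       2 * Q * M\<^sup>2 * cmod t ^ (q + 2) + Q * M\<^sup>2 * cmod t ^ (q + 2)"
      using norm_triangle_mono[OF p1 ps] by (simp only:)
    thus "cmod (phi e (GG e t) - l * phi e t - (phi e t)\<^sup>2 - e * hp e t) \<le> C * cmod t ^ (q + 2)"
      unfolding C_def by (simp add: algebra_simps)
    qed
    show "cmod (alp e) \<le> C \<and>
    (\<forall>r x y. cmod x \<le> r \<longrightarrow> cmod y \<le> r \<longrightarrow> r \<le> 1 \<longrightarrow>
       cmod (phi e x - phi e y - (x - y)) \<le> C * r * cmod (x - y) \<and>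
       cmod (hp e x - hp e y) \<le> C * r * cmod (x - y)) \<and>
    (\<forall>t. cmod t \<le> 1 / (2 * C) \<longrightarrow> cmod (GG e t) \<le> 2 * cmod t \<and>
       cmod (hp e (GG e t) - e * hp e t - (phi e t)\<^sup>2) \<le> C * cmod t ^ (q + 2) \<and>
       cmod (phi e (GG e t) - l * phi e t - (phi e t)\<^sup>2 - e * hp e t) \<le> C * cmod t ^ (q + 2))"
      using a L N by blast
  qed
qed

lemma P_shift: "P (beta + u) = beta + l * u + u\<^sup>2"
proof -
  have "P (beta + u) = P beta + 2 * beta * u + u\<^sup>2" unfolding P_eq by (simp add: power2_eq_square algebra_simps)
  moreover have "2 * beta = l" by (simp add: beta_eq)
  ultimately show ?thesis by (simp add: P_beta)
qed

text \<open>Otherwise \<open>GG 0\<close> is a rotation, \<open>phi 0\<close> conjugates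
  \<open>P\<close> to it up to order \<open>q + 2\<close>, and \<open>P ^^ q\<close> agrees with the
  identity to that order. The count of petals in \<open>critical_orbit\<close> bounds the order of
  contact by \<open>q + 1\<close>.\<close>

lemma alp_nonzero: "alp 0 \<noteq> 0"
proof
  assume a0: "alp 0 = 0"
  obtain C where C: "C \<ge> 1"
    and L: "\<And>r x y. cmod x \<le> r \<Longrightarrow> cmod y \<le> r \<Longrightarrow> r \<le> 1 \<Longrightarrow> cmod (phi 0 x - phi 0 y - (x - y)) \<le> C * r * cmod (x - y)"
    and N: "\<And>t. cmod t \<le> 1 / (2 * C) \<Longrightarrow> cmod (phi 0 (GG 0 t) - l * phi 0 t - (phi 0 t)\<^sup>2 - 0 * hp 0 t) \<le> C * cmod t ^ (q + 2)"
    using normal_form by (metis norm_zero zero_le_divide_1_iff zero_le_numeral)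
  have G: "GG 0 t = l * t" for t by (simp add: GG_def a0)
  have phin: "cmod (phi 0 t) \<le> 2 * cmod t" "cmod t / 2 \<le> cmod (phi 0 t)" if "cmod t \<le> 1 / (2 * C)" for t
  proof -
    have "C * cmod t \<le> 1/2" using that C by (simp add: field_simps)
    moreover have "1 * cmod t \<le> C * cmod t" using C by (intro mult_right_mono) auto
    ultimately have Ct: "C * cmod t \<le> 1/2" "cmod t \<le> 1" by linarith+
    have "cmod (phi 0 t - phi 0 0 - (t - 0)) \<le> C * cmod t * cmod (t - 0)"
      using Ct by (intro L) auto
    also have "... \<le> 1/2 * cmod t" using mult_right_mono[OF Ct(1), of "cmod t"] by simp
    finally have "cmod (phi 0 t - t) \<le> cmod t / 2" by simp
    thus "cmod (phi 0 t) \<le> 2 * cmod t" "cmod t / 2 \<le> cmod (phi 0 t)"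
      using norm_triangle_ineq[of "phi 0 t - t" t] norm_triangle_ineq2[of t "t - phi 0 t"]
      by (auto simp: norm_minus_commute)
  qed
  define \<tau> where "\<tau> = 1 / (2 * C)"
  have \<tau>: "\<tau> > 0" "\<tau> \<le> 1/2" using C by (auto simp: \<tau>_def field_simps)
  \<comment> \<open>The errors of the single steps add up without loss of order. The constant and
    the disc may depend on \<open>n\<close>; the case used is \<open>n = q\<close>.\<close>
  have iter: "\<exists>D>0. \<exists>d>0. d \<le> \<tau> \<and> (\<forall>t. cmod t \<le> d \<longrightarrow>
      cmod ((P ^^ n) (beta + phi 0 t) - beta - phi 0 (l ^ n * t)) \<le> D * cmod t ^ (q + 2))" for n
  proof (induction n)
    case 0
    show ?case by (intro exI[of _ 1] conjI exI[of _ \<tau>]) (use \<tau> in auto)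
  next
    case (Suc n)
    then obtain D d where D: "D > 0" "d > 0" "d \<le> \<tau>" and
      IH: "\<And>t. cmod t \<le> d \<Longrightarrow> cmod ((P ^^ n) (beta + phi 0 t) - beta - phi 0 (l ^ n * t)) \<le> D * cmod t ^ (q + 2)"
      by blast
    define d' where "d' = min d (1 / D)"
    have d': "d' > 0" "d' \<le> d" "d' \<le> \<tau>" "d' \<le> 1 / D" using D by (auto simp: d'_def)
    show ?case
    proof (rule exI[of _ "4 * D + C"], intro conjI exI[of _ d'] allI impI)
      fix t assume t: "cmod t \<le> d'"
      define u where "u = (P ^^ n) (beta + phi 0 t) - beta"
      define s where "s = l ^ n * t"
      have ns: "cmod s = cmod t" by (simp add: s_def norm_mult norm_power norm_l)
      have "cmod s \<le> 1 / (2 * C)" using ns t d' by (simp add: \<tau>_def)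
      note ps = phin[OF this] and Ns = N[OF this]
      have IHt: "cmod (u - phi 0 s) \<le> D * cmod t ^ (q + 2)" using IH[of t] t d' by (simp add: u_def s_def)
      have t12: "cmod t \<le> 1/2" using t d' \<tau> by linarith
      have "D * cmod t ^ (q + 2) \<le> D * cmod t ^ 1"
        using D t12 by (intro mult_left_mono power_decreasing) auto
      also have "... \<le> D * (1 / D)" using order_trans[OF t d'(4)] D(1) by (intro mult_left_mono) auto
      also have "... = 1" using D(1) by simp
      finally have "cmod (u - phi 0 s) \<le> 1" using IHt by linarith
      moreover have "cmod (phi 0 s) \<le> 1" using ps ns t12 by linarith
      ultimately have "cmod (l + u + phi 0 s) \<le> 4"
        using norm_triangle_ineq[of "l + (u - phi 0 s)" "2 * phi 0 s"] norm_triangle_ineq[of l "u - phi 0 s"] norm_l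
        by (simp add: algebra_simps)
      hence 1: "cmod ((u - phi 0 s) * (l + u + phi 0 s)) \<le> D * cmod t ^ (q + 2) * 4"
        unfolding norm_mult using IHt D by (intro mult_mono) auto
      have "(P ^^ Suc n) (beta + phi 0 t) = P (beta + u)" by (simp add: u_def)
      hence "(P ^^ Suc n) (beta + phi 0 t) - beta - phi 0 (l ^ Suc n * t) =
        (u - phi 0 s) * (l + u + phi 0 s) - (phi 0 (GG 0 s) - l * phi 0 s - (phi 0 s)\<^sup>2 - 0 * hp 0 s)"
        unfolding P_shift G s_def by (simp add: algebra_simps power2_eq_square)
      also have "cmod ... \<le> D * cmod t ^ (q + 2) * 4 + C * cmod s ^ (q + 2)"
        by (rule norm_triangle_le_diff[OF add_mono[OF 1 Ns]])
      finally show "cmod ((P ^^ Suc n) (beta + phi 0 t) - beta - phi 0 (l ^ Suc n * t)) \<le> (4 * D + C) * cmod t ^ (q + 2)"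
        by (simp add: ns algebra_simps)
    qed (use D C d' in auto)
  qed
  obtain D d where D: "D > 0" "d > 0" "d \<le> \<tau>" and
    I: "\<And>t. cmod t \<le> d \<Longrightarrow> cmod ((P ^^ q) (beta + phi 0 t) - beta - phi 0 (l ^ q * t)) \<le> D * cmod t ^ (q + 2)"
    using iter[of q] by blast
  obtain m g r where m: "1 \<le> m" "m \<le> q" "r > 0" "continuous_on (ball beta r) g"
    "\<And>x. x \<in> ball beta r \<Longrightarrow> (P ^^ q) x - x = (x - beta) ^ Suc m * g x"
    "\<And>x. x \<in> ball beta r \<Longrightarrow> g x \<noteq> 0"
    using critical_orbit(3) by blast
  define c where "c = cmod (g beta) / 2"
  have c: "c > 0" using m(3,6) by (simp add: c_def)
  have "isCont g beta" using m(3,4) by (simp add: continuous_on_eq_continuous_at)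
  then obtain r1 where r1: "r1 > 0" "\<And>x. dist x beta < r1 \<Longrightarrow> dist (g x) (g beta) < c"
    using continuous_at_eps_delta[THEN iffD1, rule_format, of beta g c] c by metis
  have "0 < min (min d (min (r / 4) (r1 / 4))) (c / (2 ^ (q + 1) * D))"
    using D m(3) r1 c by simp
  then obtain x :: real where "0 < x" "x < min (min d (min (r / 4) (r1 / 4))) (c / (2 ^ (q + 1) * D))"
    using dense by blast
  hence x: "x < min d (min (r / 4) (r1 / 4))" "x < c / (2 ^ (q + 1) * D)" "0 < x" by auto
  define t where "t = complex_of_real x"
  have nt: "cmod t = x" using x by (simp add: t_def)
  have t: "cmod t \<le> 1 / (2 * C)" "cmod t \<le> d" using x D unfolding nt \<tau>_def by linarith+
  have x1: "x \<le> 1" using x D \<tau> by linarith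
  have u: "beta + phi 0 t \<in> ball beta r" "dist (beta + phi 0 t) beta < r1"
    using phin(1)[OF t(1)] x m(3) r1 unfolding nt by (auto simp: dist_norm)
  have "dist (g (beta + phi 0 t)) (g beta) < c" using r1(2) u by blast
  hence gc: "cmod (g (beta + phi 0 t)) \<ge> c"
    using norm_triangle_ineq2[of "g beta" "g beta - g (beta + phi 0 t)"] by (simp add: c_def dist_norm norm_minus_commute)
  have "(x / 2) ^ (q + 1) \<le> (x / 2) ^ Suc m"
    using x x1 m(2) by (intro power_decreasing) auto
  also have "... \<le> cmod (phi 0 t) ^ Suc m" using phin(2)[OF t(1)] x unfolding nt by (intro power_mono) auto
  finally have "(x / 2) ^ (q + 1) * c \<le> cmod (phi 0 t) ^ Suc m * cmod (g (beta + phi 0 t))"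
    using gc c by (intro mult_mono) auto
  also have "... = cmod ((P ^^ q) (beta + phi 0 t) - (beta + phi 0 t))"
    using m(5)[OF u(1)] by (simp add: norm_mult norm_power)
  also have "... \<le> D * x ^ (q + 2)" using I[OF t(2)] by (simp add: l_q nt algebra_simps)
  finally have "c \<le> 2 ^ (q + 1) * D * x" using x by (simp add: power_divide field_simps)
  thus False using x D by (simp add: field_simps)
qed

end

subsection \<open>Local dynamics near the semi-parabolic fixed point\<close>

text \<open>\<open>C\<close> bounds the normal form, \<open>a\<close> bounds the resonant
  coefficient from below, \<open>R\<close> is the radius in \<open>t\<close> of the parabolic
  estimates. \<open>L\<close> compares the deviation from the curve with
  \<open>cmod t ^ (q + 2)\<close>: it is large enough that off the cusp of \<open>captured\<close>
  the truncation error is a small part of the deviation, and \<open>e1\<close> is small enough that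
  \<open>e1 * L \<le> C\<close>. The base 8 produces a decay by \<open>1/8\<close> per step, faster
  than the rate \<open>1/4\<close> that \<open>strong_stable\<close> has to beat.\<close>

locale local_nf = parab +
  fixes C R L e1 a :: real
  assumes C1: "C \<ge> 1" and R0: "0 < R" and RC: "R \<le> 1 / (10 * C)" and Ra: "R \<le> a / (16 * C)" and a0: "a > 0"
    and L_def: "L = 6 * C * 8 ^ (q + 2)" and e0: "0 < e1" and e1L: "e1 \<le> 1 / (6 * 8 ^ (q + 2))"
    and half: "\<And>e x y. cmod e \<le> e1 \<Longrightarrow> cmod x \<le> 1 / (2 * C) \<Longrightarrow> cmod y \<le> 1 / (2 * C) \<Longrightarrow>
       cmod (phi e x - phi e y - (x - y)) \<le> cmod (x - y) / 2 \<and> cmod (hp e x - hp e y) \<le> cmod (x - y) / 2"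
    and GGb: "\<And>e t. cmod e \<le> e1 \<Longrightarrow> cmod t \<le> 1 / (2 * C) \<Longrightarrow> cmod (GG e t) \<le> 2 * cmod t"
    and N3: "\<And>e t. cmod e \<le> e1 \<Longrightarrow> cmod t \<le> 1 / (2 * C) \<Longrightarrow>
       cmod (hp e (GG e t) - e * hp e t - (phi e t)\<^sup>2) \<le> C * cmod t ^ (q + 2)"
    and N4: "\<And>e t. cmod e \<le> e1 \<Longrightarrow> cmod t \<le> 1 / (2 * C) \<Longrightarrow>
       cmod (phi e (GG e t) - l * phi e t - (phi e t)\<^sup>2 - e * hp e t) \<le> C * cmod t ^ (q + 2)"
    and alpC: "\<And>e. cmod e \<le> e1 \<Longrightarrow> cmod (alp e) \<le> C" and alpa: "\<And>e. cmod e \<le> e1 \<Longrightarrow> a \<le> cmod (alp e)"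
    and Tay: "\<And>z. cmod z \<le> 6 * C * R \<Longrightarrow> cmod (1 / (1 + z) ^ q - 1 + of_nat q * z) \<le> (1/8) * cmod z"
begin

lemma e1_le: "e1 \<le> 1 / 48" "e1 * L \<le> C" "2 * e1 + 2 * C / L \<le> (1/8) ^ (q + 2)" "L > 0" "L \<ge> 1"
proof -
  define X :: real where "X = 8 ^ (q + 2)"
  have "(8::real) ^ 1 \<le> 8 ^ (q + 2)" by (intro power_increasing) auto
  hence X: "X \<ge> 8" by (simp add: X_def)
  have e: "e1 \<le> 1 / (6 * X)" using e1L by (simp add: X_def)
  have L: "L = 6 * C * X" by (simp add: L_def X_def)
  have "1 / (6 * X) \<le> 1 / 48" using X by (simp add: field_simps)
  thus "e1 \<le> 1 / 48" using e by linarith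
  show L0: "L > 0" using L X C1 by simp
  have "C * X \<ge> 1 * 1" using X C1 by (intro mult_mono) auto
  thus "L \<ge> 1" using L by simp
  have "e1 * L \<le> 1 / (6 * X) * L" using e L0 by (intro mult_right_mono) auto
  thus "e1 * L \<le> C" using L X by simp
  have "2 * C / L = 1 / (3 * X)" using L X C1 by (simp add: field_simps)
  moreover have "2 * (1 / (6 * X)) + 1 / (3 * X) \<le> 1 / X" using X by (simp add: field_simps)
  moreover have "(1/8) ^ (q + 2) = 1 / X" unfolding X_def power_one_over by simp
  ultimately show "2 * e1 + 2 * C / L \<le> (1/8) ^ (q + 2)" using e by linarith
qed

definition R1 :: real where "R1 = 1 / (4 * C)"

lemma R1: "R1 > 0" "2 * R1 = 1 / (2 * C)" "R \<le> R1" "R1 \<le> 1/4" "R \<le> 1/10" "10 * R * C \<le> 1"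
proof -
  show "R1 > 0" "2 * R1 = 1 / (2 * C)" using C1 by (auto simp: R1_def)
  have "1 / (10 * C) \<le> 1 / (4 * C)" using C1 by (simp add: field_simps)
  thus "R \<le> R1" using RC by (simp add: R1_def)
  show "R1 \<le> 1/4" using C1 by (simp add: R1_def field_simps)
  have "1 / (10 * C) \<le> 1 / 10" using C1 by (simp add: field_simps)
  thus "R \<le> 1/10" using RC by linarith
  show "10 * R * C \<le> 1" using RC C1 by (simp add: field_simps)
qed

lemma phi_bounds:
  assumes "cmod e \<le> e1" "cmod x \<le> 2 * R1" "cmod y \<le> 2 * R1"
  shows "cmod (x - y) \<le> 2 * cmod (phi e x - phi e y)" "cmod (phi e x - phi e y) \<le> 3 / 2 * cmod (x - y)"
    "cmod (hp e x - hp e y) \<le> cmod (x - y) / 2"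
proof -
  have *: "cmod (phi e x - phi e y - (x - y)) \<le> cmod (x - y) / 2" "cmod (hp e x - hp e y) \<le> cmod (x - y) / 2"
    using half[of e x y] assms R1 by auto
  show "cmod (x - y) \<le> 2 * cmod (phi e x - phi e y)"
    using *(1) norm_triangle_ineq4[of "phi e x - phi e y" "phi e x - phi e y - (x - y)"] by simp
  show "cmod (phi e x - phi e y) \<le> 3 / 2 * cmod (x - y)"
    using *(1) norm_triangle_ineq[of "phi e x - phi e y - (x - y)" "x - y"] by simp
  show "cmod (hp e x - hp e y) \<le> cmod (x - y) / 2" by (rule *(2))
qed

lemma phi_bounds0:
  assumes "cmod e \<le> e1" "cmod x \<le> 2 * R1"
  shows "cmod x \<le> 2 * cmod (phi e x)" "cmod (phi e x) \<le> 3 / 2 * cmod x" "cmod (hp e x) \<le> cmod x / 2"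
  using phi_bounds[of e x 0] assms R1(1) by auto

definition tau :: "complex \<Rightarrow> complex \<Rightarrow> complex" where
  "tau e u = (THE t. cmod t \<le> R1 \<and> phi e t = u)"

lemma tau_unique: "cmod e \<le> e1 \<Longrightarrow> cmod t \<le> R1 \<Longrightarrow> phi e t = u \<Longrightarrow> tau e u = t"
  unfolding tau_def
proof (rule the_equality)
  fix s assume "cmod e \<le> e1" "cmod t \<le> R1" "phi e t = u" "cmod s \<le> R1 \<and> phi e s = u"
  thus "s = t" using phi_bounds(1)[of e s t] R1(1) by auto
qed auto

text \<open>Contraction principle for \<open>t - (phi e t - u)\<close>, as \<open>phi e\<close>
  differs from the identity by a map with Lipschitz constant \<open>1/2\<close>. Parameters are kept
  below \<open>R1\<close>, half the radius where the estimates hold, so that \<open>GG e t\<close>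
  is still admissible.\<close>

lemma tau:
  assumes "cmod e \<le> e1" "cmod u \<le> R1 / 2"
  shows "cmod (tau e u) \<le> R1" "phi e (tau e u) = u" "cmod (tau e u) \<le> 2 * cmod u"
proof -
  have "\<exists>!t\<in>cball 0 R1. t - (phi e t - u) = t"
  proof (rule Banach_fix[where c = "1/2"])
    show "complete (cball 0 R1 :: complex set)" by (simp add: complete_eq_closed)
    show "cball 0 R1 \<noteq> ({} :: complex set)" using R1(1) by simp
    have *: "cmod (phi e x - phi e y - (x - y)) \<le> cmod (x - y) / 2" if "x \<in> cball 0 R1" "y \<in> cball 0 R1" for x y
      using half[of e x y] assms(1) R1 that by auto
    show "(\<lambda>t. t - (phi e t - u)) ` cball 0 R1 \<subseteq> cball 0 R1"
    proof clarsimp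
      fix t assume t: "cmod t \<le> R1"
      have "cmod (phi e t - t) \<le> cmod t / 2" using *[of t 0] t R1(1) by simp
      hence "cmod (u - (phi e t - t)) \<le> R1"
        using norm_triangle_ineq4[of u "phi e t - t"] assms(2) t by linarith
      thus "cmod (t - (phi e t - u)) \<le> R1" by (simp add: algebra_simps)
    qed
    show "dist (x - (phi e x - u)) (y - (phi e y - u)) \<le> 1/2 * dist x y" if "x \<in> cball 0 R1" "y \<in> cball 0 R1" for x y
      using *[OF that] by (simp add: dist_norm norm_minus_commute algebra_simps)
  qed (auto)
  then obtain t where t: "cmod t \<le> R1" "phi e t = u" by auto
  hence "tau e u = t" using tau_unique assms(1) by blast
  thus "cmod (tau e u) \<le> R1" "phi e (tau e u) = u" "cmod (tau e u) \<le> 2 * cmod u"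
    using t phi_bounds0(1)[of e t] assms(1) R1(1) by auto
qed

text \<open>The Fatou coordinate of \<open>GG e\<close>. Since \<open>l ^ q = 1\<close>, the power
  \<open>t ^ q\<close> does not see the rotation by \<open>l\<close>, so already a single step of
  the map is nearly the translation by 1.\<close>

definition WW :: "complex \<Rightarrow> complex \<Rightarrow> complex" where "WW e t = - 1 / (of_nat q * alp e * t ^ q)"

text \<open>\<open>d\<close> is the deviation of \<open>w\<close> from the approximately invariant
  curve over \<open>t\<close>. It is multiplied by the strong eigenvalue \<open>e\<close> up to a
  factor 2, and the invariance error of order \<open>q + 2\<close> is added.\<close>

lemma step_estimate:
  assumes e: "cmod e \<le> e1" and t: "cmod t \<le> R1" "cmod t' \<le> R1"
    and u': "phi e t' = l * phi e t + e * w + (phi e t)\<^sup>2"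
  defines "d \<equiv> w - hp e t" and "d' \<equiv> e * w + (phi e t)\<^sup>2 - hp e t'"
  shows "cmod (t' - GG e t) \<le> 2 * (C * cmod t ^ (q + 2) + cmod e * cmod d)"
    and "cmod d' \<le> 2 * cmod e * cmod d + 2 * C * cmod t ^ (q + 2)"
proof -
  have t2: "cmod t \<le> 1 / (2 * C)" using t R1(1,2) by linarith
  have G: "cmod (GG e t) \<le> 2 * R1" using GGb[OF e t2] t by linarith
  have t'2: "cmod t' \<le> 2 * R1" using t R1(1) by linarith
  have "phi e t' - phi e (GG e t) = e * d - (phi e (GG e t) - l * phi e t - (phi e t)\<^sup>2 - e * hp e t)"
    unfolding u' d_def by (simp add: algebra_simps)
  also have "cmod ... \<le> C * cmod t ^ (q + 2) + cmod e * cmod d"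
    by (rule norm_triangle_le_diff) (use N4[OF e t2] in \<open>simp add: norm_mult\<close>)
  finally have "2 * cmod (phi e t' - phi e (GG e t)) \<le> 2 * (C * cmod t ^ (q + 2) + cmod e * cmod d)"
    by (intro mult_left_mono) auto
  with phi_bounds(1)[OF e t'2 G]
  show 1: "cmod (t' - GG e t) \<le> 2 * (C * cmod t ^ (q + 2) + cmod e * cmod d)" by (rule order_trans)
  have "d' = (e * d + (hp e (GG e t) - hp e t')) - (hp e (GG e t) - e * hp e t - (phi e t)\<^sup>2)"
    unfolding d_def d'_def by (simp add: algebra_simps)
  also have "cmod ... \<le> (cmod e * cmod d + cmod (t' - GG e t) / 2) + C * cmod t ^ (q + 2)"
  proof (rule norm_triangle_le_diff[OF add_mono])
    show "cmod (e * d + (hp e (GG e t) - hp e t')) \<le> cmod e * cmod d + cmod (t' - GG e t) / 2"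
      by (rule norm_triangle_le) (use phi_bounds(3)[OF e G t'2] in \<open>simp add: norm_mult norm_minus_commute\<close>)
  qed (rule N3[OF e t2])
  finally show "cmod d' \<le> 2 * cmod e * cmod d + 2 * C * cmod t ^ (q + 2)"
    using 1 by simp
qed

text \<open>While the deviation is below \<open>L * cmod t ^ (q + 2)\<close>, the motion is that of
  \<open>GG e\<close> up to order \<open>q + 2\<close>: the next parameter is
  \<open>l * t * (1 + z)\<close> with \<open>z\<close> close to \<open>alp e * t ^ q\<close>. The
  condition persists because \<open>cmod t\<close> shrinks at most by half in a step while
  \<open>L\<close> exceeds \<open>4 * C * 2 ^ (q + 2)\<close>.\<close>

lemma captured_step:
  assumes e: "cmod e \<le> e1" and t: "cmod t \<le> R" "cmod t' \<le> R1" "t \<noteq> 0"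
    and u': "phi e t' = l * phi e t + e * w + (phi e t)\<^sup>2"
    and cap: "cmod (w - hp e t) < L * cmod t ^ (q + 2)"
  shows "t' \<noteq> 0" "cmod (e * w + (phi e t)\<^sup>2 - hp e t') < L * cmod t' ^ (q + 2)"
    "cmod (WW e t' - WW e t - 1) \<le> 1 / 2"
proof -
  have tR: "cmod t \<le> R1" using t(1) R1 by linarith
  have "cmod e * cmod (w - hp e t) \<le> e1 * (L * cmod t ^ (q + 2))"
    using e cap e0 by (intro mult_mono) auto
  also have "... \<le> C * cmod t ^ (q + 2)" using mult_right_mono[OF e1_le(2), of "cmod t ^ (q + 2)"] by (simp add: mult.assoc)
  finally have ed: "cmod e * cmod (w - hp e t) \<le> C * cmod t ^ (q + 2)" .
  note s = step_estimate[OF e tR t(2) u']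
  define X where "X = C * cmod t ^ (q + 2)"
  define Y where "Y = cmod e * cmod (w - hp e t)"
  have X4: "4 * C * cmod t ^ (q + 2) = 4 * X" by (simp add: X_def)
  have 1: "cmod (t' - GG e t) \<le> 4 * C * cmod t ^ (q + 2)"
    using s(1) ed unfolding X4 X_def[symmetric] Y_def[symmetric] by simp
  have 2: "cmod (e * w + (phi e t)\<^sup>2 - hp e t') \<le> 4 * C * cmod t ^ (q + 2)"
    using s(2) ed unfolding X4 mult.assoc X_def[symmetric] Y_def[symmetric] by simp
  have t1: "cmod t \<le> 1/10" using t(1) R1 by linarith
  have al: "a \<le> cmod (alp e)" "cmod (alp e) \<le> C" using alpa alpC e by auto
  have tq: "cmod t ^ q \<le> cmod t" using power_decreasing[of 1 q "cmod t"] q_pos t1 by simp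
  have Ct: "C * cmod t \<le> 1 / 10"
  proof -
    have "C * cmod t \<le> C * R" using t(1) C1 by (intro mult_left_mono) auto
    thus ?thesis using R1(6) by (simp add: mult_ac)
  qed
  define z where "z = (t' - l * t) / (l * t)"
  define r where "r = (t' - GG e t) / (l * t)"
  have t'z: "t' = l * t * (1 + z)" using t(3) l_nz by (simp add: z_def field_simps)
  have zr: "z = alp e * t ^ q + r" using t(3) l_nz by (simp add: z_def r_def GG_def field_simps)
  have rb: "cmod r \<le> 4 * C * cmod t ^ (q + 1)"
  proof -
    have "cmod r = cmod (t' - GG e t) / cmod t" by (simp add: r_def norm_divide norm_mult norm_l)
    also have "... \<le> 4 * C * cmod t ^ (q + 2) / cmod t" using 1 by (intro divide_right_mono) auto
    finally show ?thesis using t(3) by (simp add: field_simps)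
  qed
  have rb2: "cmod r \<le> cmod t ^ q / 2"
  proof -
    have "4 * C * cmod t ^ (q + 1) = 4 * (C * cmod t) * cmod t ^ q" by simp
    also have "... \<le> 4 * (1/10) * cmod t ^ q" using Ct by (intro mult_right_mono mult_left_mono) auto
    finally have "4 * C * cmod t ^ (q + 1) \<le> cmod t ^ q / 2" using zero_le_power[OF norm_ge_zero[of t], of q] by linarith
    thus ?thesis using rb by (rule order_trans[rotated])
  qed
  have az: "cmod (alp e * t ^ q) \<le> C * cmod t"
    unfolding norm_mult norm_power using al tq C1 by (intro mult_mono) auto
  have zb: "cmod z \<le> C * cmod t + cmod t / 2"
    unfolding zr by (rule norm_triangle_le) (use az rb2 tq in linarith)
  have "1 * cmod t \<le> C * cmod t" using C1 by (intro mult_right_mono) auto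
  hence zb2: "cmod z \<le> 2 * (C * cmod t)" using zb norm_ge_zero[of t] by linarith
  have z12: "cmod z \<le> 1/2" using zb2 Ct by linarith
  have "cmod (1 + z) \<ge> 1/2" using z12 norm_triangle_ineq2[of 1 "- z"] by simp
  moreover have "cmod t' = cmod t * cmod (1 + z)" unfolding t'z by (simp add: norm_mult norm_l)
  ultimately have t'b: "cmod t' \<ge> cmod t / 2" using mult_left_mono[of "1/2" "cmod (1 + z)" "cmod t"] by simp
  thus t'0: "t' \<noteq> 0" using t(3) by auto
  have tp: "cmod t ^ (q + 2) \<le> 2 ^ (q + 2) * cmod t' ^ (q + 2)"
  proof -
    have "cmod t ^ (q + 2) \<le> (2 * cmod t') ^ (q + 2)" using t'b by (intro power_mono) auto
    thus ?thesis by (simp only: power_mult_distrib)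
  qed
  have "4 * C * cmod t ^ (q + 2) \<le> 4 * C * (2 ^ (q + 2) * cmod t' ^ (q + 2))"
    using tp C1 by (intro mult_left_mono) auto
  also have "... \<le> 4 * C * (8 ^ (q + 2) * cmod t' ^ (q + 2))"
    using C1 by (intro mult_left_mono mult_right_mono power_mono) auto
  also have "... < L * cmod t' ^ (q + 2)"
    unfolding L_def using C1 t'0 by simp
  finally show "cmod (e * w + (phi e t)\<^sup>2 - hp e t') < L * cmod t' ^ (q + 2)" using 2 by linarith
  have W: "WW e t' = WW e t * (1 / (1 + z) ^ q)"
    unfolding WW_def t'z by (simp add: power_mult_distrib l_q)
  have aq: "alp e * t ^ q \<noteq> 0" using al a0 t(3) by auto
  have "WW e t' - WW e t - 1 = WW e t * (1 / (1 + z) ^ q - 1 + of_nat q * z) + (- (of_nat q * z * WW e t) - 1)"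
    unfolding W by (simp add: algebra_simps)
  also have "- (of_nat q * z * WW e t) - 1 = r / (alp e * t ^ q)"
    using aq q_pos unfolding WW_def zr by (simp add: field_simps)
  finally have eq: "WW e t' - WW e t - 1 = WW e t * (1 / (1 + z) ^ q - 1 + of_nat q * z) + r / (alp e * t ^ q)" .
  have ra: "cmod (r / (alp e * t ^ q)) \<le> 1/4"
  proof -
    have "cmod (r / (alp e * t ^ q)) \<le> 4 * C * cmod t ^ (q + 1) / (a * cmod t ^ q)"
      unfolding norm_divide norm_mult norm_power using rb al a0 t(3) C1
      by (intro frac_le) (auto intro!: mult_right_mono)
    also have "... = 4 * C * cmod t / a" using t(3) by simp
    also have "... \<le> 4 * C * (a / (16 * C)) / a" using t(1) Ra C1 a0 by (intro divide_right_mono mult_left_mono) auto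
    also have "... = 1/4" using C1 a0 by simp
    finally show ?thesis .
  qed
  have "cmod z \<le> 6 * C * R"
  proof -
    have "C * cmod t \<le> C * R" using t(1) C1 by (intro mult_left_mono) auto
    hence "cmod z \<le> 2 * (C * R)" using zb2 by simp
    moreover have "0 \<le> C * R" using C1 R0 by simp
    ultimately show ?thesis by (simp add: mult.assoc)
  qed
  hence "cmod (WW e t * (1 / (1 + z) ^ q - 1 + of_nat q * z)) \<le> cmod (WW e t) * ((1/8) * cmod z)"
    unfolding norm_mult by (intro mult_left_mono Tay) auto
  also have "cmod (WW e t) * ((1/8) * cmod z) = (1/8) * (cmod (1 + r / (alp e * t ^ q)) / real q)"
  proof -
    have "1 + r / (alp e * t ^ q) = z / (alp e * t ^ q)" using aq by (simp add: zr field_simps)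
    thus ?thesis unfolding WW_def by (simp add: norm_divide norm_mult norm_power)
  qed
  also have "... \<le> (1/8) * (2 / 1)"
    using norm_triangle_ineq[of 1 "r / (alp e * t ^ q)"] ra q_pos by (intro mult_left_mono frac_le) auto
  finally show "cmod (WW e t' - WW e t - 1) \<le> 1 / 2"
    unfolding eq using norm_triangle_ineq[of "WW e t * (1 / (1 + z) ^ q - 1 + of_nat q * z)" "r / (alp e * t ^ q)"] ra
    by linarith
qed

end

section \<open>The recursion of order two near its semi-parabolic fixed point\<close>

context parab
begin

text \<open>The second eigenvalue at the fixed point; the product of the two eigenvalues is
  \<open>- b\<close>.\<close>

definition eb :: "complex \<Rightarrow> complex" where "eb b = - b / l"

text \<open>A linear form that one step multiplies by \<open>eb b\<close> to first order; its zero
  line is the eigendirection of \<open>l\<close>.\<close>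

definition ww :: "complex \<Rightarrow> complex \<Rightarrow> complex \<Rightarrow> complex" where
  "ww b x y = (x - bet b) - l * (y - bet b)"

definition recur :: "complex \<Rightarrow> (nat \<Rightarrow> complex) \<Rightarrow> bool" where
  "recur b x \<longleftrightarrow> (\<forall>n. x (Suc (Suc n)) = (x (Suc n))\<^sup>2 + cc b + b * x n)"

lemma norm_eb [simp]: "cmod (eb b) = cmod b"
  by (simp add: eb_def norm_divide norm_l)

lemma shift_step:
  assumes "x' = x\<^sup>2 + cc b + b * y"
  shows "x' - bet b = l * (x - bet b) + eb b * ww b x y + (x - bet b)\<^sup>2"
    and "ww b x' x = eb b * ww b x y + (x - bet b)\<^sup>2"
proof -
  have b: "b = - l * eb b" using l_nz by (simp add: eb_def)
  have bb: "bet b = (l + eb b) / 2" using l_nz by (simp add: bet_def eb_def field_simps)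
  show 1: "x' - bet b = l * (x - bet b) + eb b * ww b x y + (x - bet b)\<^sup>2"
    unfolding assms cc_def ww_def bb by (subst (1 2) b) (simp add: field_simps power2_eq_square)
  show "ww b x' x = eb b * ww b x y + (x - bet b)\<^sup>2"
    using 1 by (simp add: ww_def)
qed

lemma norm_two_bet: "cmod (2 * bet b) \<ge> 1 - cmod b"
proof -
  have "2 * bet b = l - b / l" using l_nz by (simp add: bet_def field_simps)
  thus ?thesis using norm_triangle_ineq2[of l "b / l"] by (simp add: norm_divide norm_l)
qed

end

context local_nf
begin

definition tt :: "complex \<Rightarrow> complex \<Rightarrow> complex" where "tt b x = tau (eb b) (x - bet b)"

text \<open>A cusp around the approximately invariant curve, with the fixed point excluded. Inside
  it the motion is parabolic; outside, the deviation from the curve dominates and the strong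
  eigenvalue takes over.\<close>

definition captured :: "complex \<Rightarrow> complex \<Rightarrow> complex \<Rightarrow> bool" where
  "captured b x y \<longleftrightarrow> tt b x \<noteq> 0 \<and> cmod (ww b x y - hp (eb b) (tt b x)) < L * cmod (tt b x) ^ (q + 2)"

definition pet :: "real \<Rightarrow> complex \<Rightarrow> (complex \<times> complex) set" where
  "pet K b = {(x, y). cmod (x - bet b) < R1 / 2 \<and> captured b x y \<and> Re (WW (eb b) (tt b x)) > K}"

lemma tt:
  assumes "cmod b \<le> e1" "cmod (x - bet b) \<le> R1 / 2"
  shows "cmod (tt b x) \<le> R1" "phi (eb b) (tt b x) = x - bet b" "cmod (tt b x) \<le> 2 * cmod (x - bet b)"
    "cmod (x - bet b) \<le> 3 / 2 * cmod (tt b x)"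
proof -
  have e: "cmod (eb b) \<le> e1" using assms by simp
  show 1: "cmod (tt b x) \<le> R1" "phi (eb b) (tt b x) = x - bet b" "cmod (tt b x) \<le> 2 * cmod (x - bet b)"
    using tau[OF e assms(2)] by (auto simp: tt_def)
  show "cmod (x - bet b) \<le> 3 / 2 * cmod (tt b x)"
    using phi_bounds0(2)[OF e, of "tt b x"] 1 R1(1) by simp
qed

lemma tt_zero_iff: "cmod b \<le> e1 \<Longrightarrow> cmod (x - bet b) \<le> R1 / 2 \<Longrightarrow> tt b x = 0 \<longleftrightarrow> x = bet b"
  using tt(2,3)[of b x] by auto

lemma captured_next:
  assumes b: "cmod b \<le> e1" and x: "cmod (x - bet b) \<le> R1 / 2" "cmod (tt b x) \<le> R" "captured b x y"
    and x': "x' = x\<^sup>2 + cc b + b * y" "cmod (x' - bet b) \<le> R1 / 2"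
  shows "captured b x' x" "cmod (WW (eb b) (tt b x') - WW (eb b) (tt b x) - 1) \<le> 1 / 2"
proof -
  have e: "cmod (eb b) \<le> e1" using b by simp
  note t = tt[OF b x(1)] and t' = tt[OF b x'(2)]
  have c: "tt b x \<noteq> 0" "cmod (ww b x y - hp (eb b) (tt b x)) < L * cmod (tt b x) ^ (q + 2)"
    using x(3) by (auto simp: captured_def)
  have u': "phi (eb b) (tt b x') = l * phi (eb b) (tt b x) + eb b * ww b x y + (phi (eb b) (tt b x))\<^sup>2"
    unfolding t(2) t'(2) by (rule shift_step(1)[OF x'(1)])
  note s = captured_step[OF e x(2) t'(1) c(1) u' c(2)]
  show "captured b x' x" unfolding captured_def shift_step(2)[OF x'(1)] using s(1,2) t(2) by simp
  show "cmod (WW (eb b) (tt b x') - WW (eb b) (tt b x) - 1) \<le> 1 / 2" by (rule s(3))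
qed

text \<open>Off the cusp \<open>cmod t ^ (q + 2)\<close> is at most the deviation divided by
  \<open>L\<close>, so the additive error of \<open>step_estimate\<close> is absorbed and the
  deviation decays by \<open>(1/8) ^ (q + 2)\<close>. Its \<open>(q + 2)\<close>-th root, which
  controls \<open>t\<close>, then decays by \<open>1/8\<close>.\<close>

lemma not_captured_next:
  assumes b: "cmod b \<le> e1" and x: "cmod (x - bet b) \<le> R1 / 2" "\<not> captured b x y"
    and x': "x' = x\<^sup>2 + cc b + b * y" "cmod (x' - bet b) \<le> R1 / 2"
  shows "cmod (tt b x) ^ (q + 2) \<le> cmod (ww b x y - hp (eb b) (tt b x)) / L"
    "cmod (ww b x' x - hp (eb b) (tt b x')) \<le> (1/8) ^ (q + 2) * cmod (ww b x y - hp (eb b) (tt b x))"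
proof -
  have e: "cmod (eb b) \<le> e1" using b by simp
  note t = tt[OF b x(1)] and t' = tt[OF b x'(2)]
  have u': "phi (eb b) (tt b x') = l * phi (eb b) (tt b x) + eb b * ww b x y + (phi (eb b) (tt b x))\<^sup>2"
    unfolding t(2) t'(2) by (rule shift_step(1)[OF x'(1)])
  define d where "d = cmod (ww b x y - hp (eb b) (tt b x))"
  show 1: "cmod (tt b x) ^ (q + 2) \<le> cmod (ww b x y - hp (eb b) (tt b x)) / L"
    using x(2) e1_le(4) by (auto simp: captured_def field_simps)
  have "cmod (ww b x' x - hp (eb b) (tt b x')) \<le> 2 * cmod b * d + 2 * C * cmod (tt b x) ^ (q + 2)"
    using step_estimate(2)[OF e t(1) t'(1) u'] unfolding shift_step(2)[OF x'(1)] t(2) d_def by simp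
  also have "... \<le> 2 * e1 * d + 2 * C * (d / L)"
    using b 1 C1 by (intro add_mono mult_right_mono mult_left_mono) (auto simp: d_def)
  also have "... = (2 * e1 + 2 * C / L) * d" by (simp add: field_simps)
  also have "... \<le> (1/8) ^ (q + 2) * d" using e1_le(3) by (intro mult_right_mono) (auto simp: d_def)
  finally show "cmod (ww b x' x - hp (eb b) (tt b x')) \<le> (1/8) ^ (q + 2) * cmod (ww b x y - hp (eb b) (tt b x))"
    by (simp add: d_def)
qed

lemma WW_norm: "cmod (tt b x) ^ q \<le> 1 / (a * cmod (WW (eb b) (tt b x)))"
  if "tt b x \<noteq> 0" "cmod b \<le> e1"
proof -
  have al: "a \<le> cmod (alp (eb b))" using alpa that by simp
  have q: "1 \<le> real q" using q_pos by simp
  have "a * cmod (WW (eb b) (tt b x)) = a / (real q * cmod (alp (eb b)) * cmod (tt b x) ^ q)"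
    by (simp add: WW_def norm_divide norm_mult norm_power)
  also have "... \<le> a / (1 * a * cmod (tt b x) ^ q)"
    using al less_le_trans[OF a0 al] a0 q that
    by (intro divide_left_mono mult_right_mono mult_mono mult_pos_pos) auto
  also have "... = 1 / cmod (tt b x) ^ q" using a0 by simp
  finally have *: "a * cmod (WW (eb b) (tt b x)) \<le> 1 / cmod (tt b x) ^ q" .
  have "WW (eb b) (tt b x) \<noteq> 0" using al a0 q_pos that by (auto simp: WW_def)
  hence "a * cmod (WW (eb b) (tt b x)) > 0" using a0 by simp
  thus ?thesis using * that by (simp add: field_simps)
qed

lemma pet_small:
  assumes "cmod b \<le> e1" "(x, y) \<in> pet K b" "K \<ge> 1 / (a * r ^ q)" "r > 0"
  shows "cmod (tt b x) < r"
proof -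
  have c: "tt b x \<noteq> 0" "Re (WW (eb b) (tt b x)) > K" using assms(2) by (auto simp: pet_def captured_def)
  have K: "K > 0" using assms(3,4) a0 by (smt (verit) divide_pos_pos mult_pos_pos zero_less_power)
  have W: "cmod (WW (eb b) (tt b x)) > K" using c(2) complex_Re_le_cmod[of "WW (eb b) (tt b x)"] by linarith
  have "cmod (tt b x) ^ q \<le> 1 / (a * cmod (WW (eb b) (tt b x)))" using WW_norm c(1) assms(1) by blast
  also have "... < 1 / (a * K)" using W less_trans[OF K W] K a0 by (intro divide_strict_left_mono mult_strict_left_mono mult_pos_pos) auto
  also have "... \<le> r ^ q" using assms(3,4) K a0 by (simp add: field_simps)
  finally show ?thesis using assms(4) by (meson less_imp_le power_less_imp_less_base)
qed

text \<open>Beyond \<open>captured_next\<close> it has to be seen that the image stays in the domain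
  of the coordinates. In the petal \<open>t\<close> and the deviation are so small that the three
  terms of \<open>shift_step\<close> add up to less than \<open>R1 / 2\<close>.\<close>

lemma pet_step:
  assumes b: "cmod b \<le> e1" and p: "(x, y) \<in> pet K b" and K: "K \<ge> 1 / (a * (R / 10) ^ q)"
    and x': "x' = x\<^sup>2 + cc b + b * y"
  shows "(x', x) \<in> pet K b" "Re (WW (eb b) (tt b x')) \<ge> Re (WW (eb b) (tt b x)) + 1 / 2"
proof -
  have pc: "cmod (x - bet b) \<le> R1 / 2" "captured b x y" "Re (WW (eb b) (tt b x)) > K" using p by (auto simp: pet_def)
  note t = tt[OF b pc(1)]
  have tR: "cmod (tt b x) < R / 10" using pet_small[OF b p K] R0 by simp
  define T where "T = cmod (tt b x)"
  have T: "0 \<le> T" "T < R / 10" "T \<le> 1/100" using tR R1(5) by (auto simp: T_def)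
  have dd: "cmod (ww b x y - hp (eb b) (tt b x)) < L * T ^ (q + 2)" using pc(2) by (auto simp: captured_def T_def)
  have "cmod (eb b * (ww b x y - hp (eb b) (tt b x))) \<le> e1 * (L * T ^ (q + 2))"
    unfolding norm_mult using b dd e0 by (intro mult_mono) auto
  also have "... \<le> C * T ^ (q + 2)" using mult_right_mono[OF e1_le(2), of "T ^ (q + 2)"] T by (simp add: mult.assoc)
  also have "... \<le> C * T ^ 2" using T C1 by (intro mult_left_mono power_decreasing) auto
  also have "... = (C * T) * T" by (simp add: power2_eq_square)
  also have "... \<le> 1 * T"
  proof (intro mult_right_mono)
    have "C * T \<le> C * R" using T C1 R0 by (intro mult_left_mono) auto
    thus "C * T \<le> 1" using R1(6) by (simp add: mult_ac)
  qed (fact T)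
  finally have 1: "cmod (eb b * (ww b x y - hp (eb b) (tt b x))) \<le> T" by simp
  have "cmod (eb b * hp (eb b) (tt b x)) \<le> 1 * (T / 2)"
    unfolding norm_mult using b e1_le(1) phi_bounds0(3)[of "eb b" "tt b x"] t(1) R1(1)
    by (intro mult_mono) (auto simp: T_def)
  with 1 have 2: "cmod (eb b * ww b x y) \<le> 3 / 2 * T"
    using norm_triangle_ineq[of "eb b * (ww b x y - hp (eb b) (tt b x))" "eb b * hp (eb b) (tt b x)"]
    by (simp add: algebra_simps)
  have u: "cmod (x - bet b) \<le> 3 / 2 * T" using t(4) by (simp add: T_def)
  have "cmod ((x - bet b)\<^sup>2) \<le> (3 / 2 * T) * (3 / 2 * T)"
    unfolding power2_eq_square norm_mult using u T(1) by (intro mult_mono) auto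
  also have "... \<le> (3 / 2 * T) * 1" using T by (intro mult_left_mono) auto
  finally have 3: "cmod ((x - bet b)\<^sup>2) \<le> 3 / 2 * T" by simp
  have "cmod (x' - bet b) \<le> 3 / 2 * T + 3 / 2 * T + 3 / 2 * T"
    unfolding shift_step(1)[OF x'] using 2 3 u
    by (intro norm_triangle_le add_mono) (auto simp: norm_mult norm_l)
  also have "... < R1 / 2" using T R1(3) R0 by linarith
  finally have u': "cmod (x' - bet b) < R1 / 2" .
  have tR': "cmod (tt b x) \<le> R" using tR R0 by linarith
  note n = captured_next[OF b pc(1) tR' pc(2) x' less_imp_le[OF u']]
  have "\<bar>Re (WW (eb b) (tt b x') - WW (eb b) (tt b x) - 1)\<bar> \<le> 1 / 2"
    using n(2) abs_Re_le_cmod order_trans by blast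
  thus "Re (WW (eb b) (tt b x')) \<ge> Re (WW (eb b) (tt b x)) + 1 / 2"
    unfolding minus_complex.sel one_complex.sel by linarith
  thus "(x', x) \<in> pet K b" using u' n(1) pc(3) by (auto simp: pet_def)
qed

text \<open>Inside the cusp the real part of \<open>WW\<close> gains at least \<open>1/2\<close> per
  step, so an orbit that remains nearby passes any threshold \<open>K\<close>.\<close>

lemma captured_imp_pet:
  assumes b: "cmod b \<le> e1" and x: "recur b x" "\<And>n. cmod (x (Suc n) - bet b) \<le> R / 4"
    and c: "captured b (x (Suc n0)) (x n0)"
  shows "\<exists>n. (x (Suc n), x n) \<in> pet K b"
proof -
  have xr: "x (Suc (Suc n)) = (x (Suc n))\<^sup>2 + cc b + b * x n" for n using x(1) by (simp add: recur_def)
  have x1: "cmod (x (Suc n) - bet b) < R1 / 2" for n using x(2)[of n] R1(1,3) R0 by linarith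
  have tR: "cmod (tt b (x (Suc n))) \<le> R" for n
    using tt(3)[OF b less_imp_le[OF x1[of n]]] x(2)[of n] R0 by linarith
  let ?W = "\<lambda>n. Re (WW (eb b) (tt b (x (Suc n))))"
  have cap: "captured b (x (Suc (n0 + k))) (x (n0 + k)) \<and> ?W (n0 + k) \<ge> ?W n0 + k / 2" for k
  proof (induction k)
    case (Suc k)
    note n = captured_next[OF b less_imp_le[OF x1[of "n0 + k"]] tR conjunct1[OF Suc] xr less_imp_le[OF x1]]
    have "\<bar>Re (WW (eb b) (tt b (x (Suc (Suc (n0 + k))))) - WW (eb b) (tt b (x (Suc (n0 + k)))) - 1)\<bar> \<le> 1 / 2"
      using n(2) abs_Re_le_cmod order_trans by blast
    hence "?W (n0 + Suc k) \<ge> ?W (n0 + k) + 1 / 2"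
      unfolding minus_complex.sel one_complex.sel add_Suc_right by linarith
    thus ?case using n(1) Suc by (simp add: field_simps)
  qed (use c in auto)
  obtain k :: nat where "real k > 2 * (K - ?W n0)" using reals_Archimedean2 by blast
  hence "?W (n0 + k) > K" using conjunct2[OF cap[of k]] by argo
  hence "(x (Suc (n0 + k)), x (n0 + k)) \<in> pet K b" using cap[of k] x1 by (auto simp: pet_def)
  thus ?thesis by blast
qed

lemma not_captured_decay:
  assumes b: "cmod b \<le> e1" and x: "recur b x" "\<And>n. cmod (x (Suc n) - bet b) \<le> R / 4"
    and c: "\<And>n. \<not> captured b (x (Suc n)) (x n)"
  shows "\<exists>B\<ge>0. \<forall>n. cmod (x (Suc n) - bet b) \<le> B * (1/8) ^ n"
proof -
  have xr: "x (Suc (Suc n)) = (x (Suc n))\<^sup>2 + cc b + b * x n" for n using x(1) by (simp add: recur_def)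
  have x1: "cmod (x (Suc n) - bet b) \<le> R1 / 2" for n using x(2)[of n] R1(1,3) R0 by linarith
  note nc = not_captured_next[OF b x1 c xr x1]
  define d where "d n = cmod (ww b (x (Suc n)) (x n) - hp (eb b) (tt b (x (Suc n))))" for n
  have d: "d n \<le> ((1/8) ^ (q + 2)) ^ n * d 0" for n
  proof (induction n)
    case (Suc n)
    have "d (Suc n) \<le> (1/8) ^ (q + 2) * d n" using nc(2)[of n] by (simp add: d_def)
    also have "... \<le> (1/8) ^ (q + 2) * (((1/8) ^ (q + 2)) ^ n * d 0)" using Suc by (intro mult_left_mono) auto
    finally show ?case by (simp add: mult_ac)
  qed simp
  define B where "B = root (q + 2) (d 0 / L)"
  have B: "B \<ge> 0" "B ^ (q + 2) = d 0 / L"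
  proof -
    have "d 0 / L \<ge> 0" using e1_le(4) by (simp add: d_def)
    thus "B \<ge> 0" "B ^ (q + 2) = d 0 / L"
      unfolding B_def using real_root_pow_pos2[of "q + 2" "d 0 / L"] by simp_all
  qed
  have t: "cmod (tt b (x (Suc n))) \<le> B * (1/8) ^ n" for n
  proof -
    have "cmod (tt b (x (Suc n))) ^ (q + 2) \<le> d n / L" using nc(1)[of n] by (simp add: d_def)
    also have "... \<le> ((1/8) ^ (q + 2)) ^ n * d 0 / L" using d e1_le(4) by (intro divide_right_mono) auto
    also have "... = (B * (1/8) ^ n) ^ (q + 2)"
    proof -
      have "((1/8 :: real) ^ (q + 2)) ^ n = ((1/8) ^ n) ^ (q + 2)" by (metis power_mult mult.commute)
      thus ?thesis unfolding power_mult_distrib B(2) by simp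
    qed
    finally have "cmod (tt b (x (Suc n))) ^ Suc (q + 1) \<le> (B * (1/8) ^ n) ^ Suc (q + 1)" by simp
    thus ?thesis by (rule power_le_imp_le_base) (use B in auto)
  qed
  show ?thesis
  proof (intro exI[of _ "3 / 2 * B"] conjI allI)
    fix n show "cmod (x (Suc n) - bet b) \<le> 3 / 2 * B * (1/8) ^ n"
      using tt(4)[OF b x1[of n]] t[of n] by simp
  qed (use B in auto)
qed

text \<open>Neither orbit is ever captured, so both tend to the fixed point like
  \<open>(1/8) ^ n\<close>. If the first difference exceeded \<open>2 * cmod b\<close> times the
  zeroth, this inequality would persist: the sum of the two points has modulus at least
  \<open>3 / 4\<close>, and the term with \<open>b\<close> takes away at most \<open>1 / 2\<close>.
  The differences would then decrease no faster than \<open>(1/4) ^ n\<close>.\<close>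

lemma strong_stable:
  assumes b: "cmod b \<le> e1" and x: "recur b x" "recur b x'"
    and s: "\<And>n. cmod (x (Suc n) - bet b) \<le> R / 4" "\<And>n. cmod (x' (Suc n) - bet b) \<le> R / 4"
    and p: "\<And>n. (x (Suc n), x n) \<notin> pet K b" "\<And>n. (x' (Suc n), x' n) \<notin> pet K b"
  shows "cmod (x 1 - x' 1) \<le> 2 * cmod b * cmod (x 0 - x' 0)"
proof (rule ccontr)
  assume neg: "\<not> ?thesis"
  define d where "d n = cmod (x n - x' n)" for n
  have R40: "R / 4 \<le> 1/40" using R1(5) by linarith
  have grow: "d (Suc (Suc n)) \<ge> 1/4 * d (Suc n)" if "d (Suc n) > 2 * cmod b * d n" for n
  proof -
    have e: "x (Suc (Suc n)) - x' (Suc (Suc n)) = (x (Suc n) + x' (Suc n)) * (x (Suc n) - x' (Suc n)) + b * (x n - x' n)"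
      using x by (simp add: recur_def algebra_simps power2_eq_square)
    have "2 * bet b = (x (Suc n) + x' (Suc n)) - (x (Suc n) - bet b) - (x' (Suc n) - bet b)" by simp
    hence "cmod (2 * bet b) \<le> cmod (x (Suc n) + x' (Suc n)) + R / 4 + R / 4"
      using s[of n] by (metis (no_types, lifting) norm_triangle_le_diff add_mono order_refl)
    hence "cmod (x (Suc n) + x' (Suc n)) \<ge> 3 / 4" using norm_two_bet[of b] b e1_le(1) R40 by linarith
    hence "cmod ((x (Suc n) + x' (Suc n)) * (x (Suc n) - x' (Suc n))) \<ge> 3 / 4 * d (Suc n)"
      unfolding norm_mult d_def by (intro mult_right_mono) auto
    moreover have "cmod (b * (x n - x' n)) = cmod b * d n" by (simp add: norm_mult d_def)
    moreover have "d (Suc (Suc n)) \<ge> cmod ((x (Suc n) + x' (Suc n)) * (x (Suc n) - x' (Suc n))) - cmod (b * (x n - x' n))"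
      unfolding d_def e by (rule norm_diff_ineq)
    ultimately show ?thesis using that by simp
  qed
  have all: "d (Suc n) > 2 * cmod b * d n \<and> d (Suc n) \<ge> (1/4) ^ n * d 1 \<and> d (Suc n) > 0" for n
  proof (induction n)
    case 0
    have "0 \<le> 2 * cmod b * d 0" by (simp add: d_def)
    thus ?case using neg by (auto simp: d_def)
  next
    case (Suc n)
    hence g: "d (Suc (Suc n)) \<ge> 1/4 * d (Suc n)" using grow by blast
    have "2 * cmod b * d (Suc n) \<le> 2 * (1/48) * d (Suc n)"
      using b e1_le(1) Suc by (intro mult_right_mono) auto
    hence "d (Suc (Suc n)) > 2 * cmod b * d (Suc n)" using g Suc by linarith
    moreover have "(1/4) ^ Suc n * d 1 \<le> d (Suc (Suc n))" using g Suc by simp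
    ultimately show ?case using g Suc by linarith
  qed
  have nc: "\<not> captured b (x (Suc n)) (x n)" "\<not> captured b (x' (Suc n)) (x' n)" for n
    using captured_imp_pet[OF b x(1) s(1)] captured_imp_pet[OF b x(2) s(2)] p by blast+
  obtain B B' where B: "B \<ge> 0" "\<And>n. cmod (x (Suc n) - bet b) \<le> B * (1/8) ^ n"
    "B' \<ge> 0" "\<And>n. cmod (x' (Suc n) - bet b) \<le> B' * (1/8) ^ n"
    using not_captured_decay[OF b x(1) s(1) nc(1)] not_captured_decay[OF b x(2) s(2) nc(2)] by metis
  have bd: "d 1 \<le> (B + B') * (1/2) ^ n" for n
  proof -
    have "(1/4) ^ n * d 1 \<le> d (Suc n)" using all by blast
    also have "d (Suc n) \<le> B * (1/8) ^ n + B' * (1/8) ^ n"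
      unfolding d_def using B(2,4)[of n] norm_triangle_ineq4[of "x (Suc n) - bet b" "x' (Suc n) - bet b"] by simp
    also have "(1/8 :: real) ^ n = (1/4) ^ n * (1/2) ^ n" by (simp flip: power_mult_distrib)
    finally have "(1/4) ^ n * d 1 \<le> (1/4) ^ n * ((B + B') * (1/2) ^ n)" by (simp only: algebra_simps)
    thus ?thesis by (simp only: mult_le_cancel_left_pos zero_less_power zero_less_divide_1_iff zero_less_numeral)
  qed
  have "(\<lambda>n. (B + B') * (1/2) ^ n) \<longlonglongrightarrow> (B + B') * 0"
    by (intro tendsto_mult tendsto_const LIMSEQ_realpow_zero) auto
  hence "d 1 \<le> (B + B') * 0" by (rule tendsto_lowerbound) (use bd in auto)
  thus False using all[of 0] by simp
qed

lemma pet_converges: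
  assumes b: "cmod b \<le> e1" and x: "recur b x" and K: "K \<ge> 1 / (a * (R / 10) ^ q)" and p: "(x 1, x 0) \<in> pet K b"
  shows "x \<longlonglongrightarrow> bet b"
proof -
  have xr: "x (Suc (Suc n)) = (x (Suc n))\<^sup>2 + cc b + b * x n" for n using x(1) by (simp add: recur_def)
  have K0: "K > 0" using K a0 R0 by (smt (verit) divide_pos_pos mult_pos_pos zero_less_power)
  let ?t = "\<lambda>n. tt b (x (Suc n))"
  let ?W = "\<lambda>n. Re (WW (eb b) (?t n))"
  have pn: "(x (Suc n), x n) \<in> pet K b \<and> ?W n \<ge> K + real n / 2" for n
  proof (induction n)
    case (Suc n)
    thus ?case using pet_step[OF b conjunct1[OF Suc] K xr[of n]] by (simp add: add_divide_distrib)
  qed (use p in \<open>auto simp: pet_def\<close>)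
  have bound: "cmod (?t n) ^ q \<le> 1 / (a * (K + real n / 2))" for n
  proof -
    have "cmod (?t n) ^ q \<le> 1 / (a * cmod (WW (eb b) (?t n)))"
      using pn[of n] b by (intro WW_norm) (auto simp: pet_def captured_def)
    also have "... \<le> 1 / (a * (K + real n / 2))"
      using pn[of n] K0 a0 complex_Re_le_cmod[of "WW (eb b) (?t n)"]
      by (intro divide_left_mono mult_left_mono) (auto intro!: mult_pos_pos intro: order_trans)
    finally show ?thesis .
  qed
  have "filterlim (\<lambda>n. a * (K + 1 / 2 * real n)) at_top sequentially"
    by (intro filterlim_tendsto_pos_mult_at_top[OF tendsto_const] filterlim_tendsto_add_at_top[OF tendsto_const]
        filterlim_real_sequentially) (use a0 in simp_all)
  hence "filterlim (\<lambda>n. a * (K + real n / 2)) at_top sequentially" by simp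
  hence "(\<lambda>n. 1 / (a * (K + real n / 2))) \<longlonglongrightarrow> 0"
    by (rule tendsto_divide_0[OF tendsto_const filterlim_at_top_imp_at_infinity])
  hence "(\<lambda>n. cmod (?t n) ^ q) \<longlonglongrightarrow> 0"
    by (rule Lim_null_comparison[OF always_eventually[OF allI], rotated]) (use bound in \<open>simp add: norm_power\<close>)
  hence "(\<lambda>n. root q (cmod (?t n) ^ q)) \<longlonglongrightarrow> root q 0" by (intro tendsto_real_root)
  hence "(\<lambda>n. 3 / 2 * cmod (?t n)) \<longlonglongrightarrow> 3 / 2 * 0"
    using q_pos by (intro tendsto_mult tendsto_const) (simp add: real_root_power_cancel)
  hence lim: "(\<lambda>n. 3 / 2 * cmod (?t n)) \<longlonglongrightarrow> 0" by simp
  have "(\<lambda>n. x (Suc n) - bet b) \<longlonglongrightarrow> 0"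
  proof (rule Lim_null_comparison[OF always_eventually[OF allI] lim])
    fix n show "cmod (x (Suc n) - bet b) \<le> 3 / 2 * cmod (?t n)"
      using tt(4)[OF b] pn[of n] by (auto simp: pet_def)
  qed
  thus ?thesis
    by (simp add: LIM_zero_iff filterlim_sequentially_Suc)
qed

end

context local_nf
begin

text \<open>Openness jointly with the parameter: an orbit entering the petal at \<open>b = 0\<close>
  forces nearby orbits into the petals of nearby parameters. The coordinate \<open>tt\<close> is an
  implicit inverse, so its continuity in both variables is the point to prove.\<close>

lemma pet_open: "open {(b, x, y). cmod b < e1 \<and> (x, y) \<in> pet K b}"
proof -
  define \<Omega> where "\<Omega> = {p :: complex \<times> complex \<times> complex. cmod (fst p) < e1 \<and> cmod (fst (snd p) - bet (fst p)) < R1 / 2}"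
  have bc: "continuous_on S (\<lambda>p :: complex \<times> complex \<times> complex. bet (fst p))"
    and ec: "continuous_on S (\<lambda>p :: complex \<times> complex \<times> complex. eb (fst p))" for S
    using l_nz unfolding bet_def eb_def by (intro continuous_intros; simp)+
  have op: "open \<Omega>"
    unfolding \<Omega>_def by (intro open_Collect_conj open_Collect_less continuous_intros bc)
  have esub: "(\<lambda>p. eb (fst p)) ` \<Omega> \<subseteq> cball 0 (1/2)"
    using e1_le(1) by (auto simp: \<Omega>_def)
  have coef: "continuous_on \<Omega> (\<lambda>p. ph (eb (fst p)) k)" "continuous_on \<Omega> (\<lambda>p. hh (eb (fst p)) k)" for k
    by (rule continuous_on_compose2[OF ph_continuous ec esub], rule continuous_on_compose2[OF hh_continuous ec esub])
  have tc: "continuous_on \<Omega> (\<lambda>p. tt (fst p) (fst (snd p)))"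
    unfolding continuous_on_sequentially
  proof (intro allI ballI impI, elim conjE)
    fix f p assume p: "p \<in> \<Omega>" and f: "\<forall>n. f n \<in> \<Omega>" "f \<longlonglongrightarrow> p"
    let ?t = "tt (fst p) (fst (snd p))"
    \<comment> \<open>The limit parameter \<open>?t\<close> is frozen and tested against the moving
      map: by \<open>phi_bounds\<close> the distance of two parameters is at most twice the distance
      of their images under the same \<open>phi\<close>.\<close>
    let ?g = "\<lambda>n. phi (eb (fst (f n))) ?t"
    have pb: "cmod (fst p) \<le> e1" "cmod (fst (snd p) - bet (fst p)) \<le> R1 / 2"
      and fb: "\<And>n. cmod (fst (f n)) \<le> e1" "\<And>n. cmod (fst (snd (f n)) - bet (fst (f n))) \<le> R1 / 2"
      using p f by (auto simp: \<Omega>_def less_imp_le)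
    note t = tt[OF pb]
    have "continuous_on \<Omega> (\<lambda>r. phi (eb (fst r)) ?t)"
      unfolding phi_def by (intro continuous_intros coef)
    hence 1: "?g \<longlonglongrightarrow> phi (eb (fst p)) ?t"
      using p f unfolding continuous_on_sequentially by (auto simp: o_def)
    have "continuous_on \<Omega> (\<lambda>r. fst (snd r) - bet (fst r))" by (intro continuous_intros bc)
    hence 2: "(\<lambda>n. fst (snd (f n)) - bet (fst (f n))) \<longlonglongrightarrow> fst (snd p) - bet (fst p)"
      using p f unfolding continuous_on_sequentially by (auto simp: o_def)
    have 3: "(\<lambda>n. 2 * cmod ((fst (snd (f n)) - bet (fst (f n))) - ?g n)) \<longlonglongrightarrow> 2 * cmod ((fst (snd p) - bet (fst p)) - phi (eb (fst p)) ?t)"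
      by (intro tendsto_intros 1 2)
    hence 3: "(\<lambda>n. 2 * cmod ((fst (snd (f n)) - bet (fst (f n))) - ?g n)) \<longlonglongrightarrow> 0"
      by (simp add: t(2))
    have "(\<lambda>n. tt (fst (f n)) (fst (snd (f n))) - ?t) \<longlonglongrightarrow> 0"
    proof (rule Lim_null_comparison[OF always_eventually[OF allI] 3])
      fix n
      note tn = tt[OF fb(1,2)[of n]]
      show "cmod (tt (fst (f n)) (fst (snd (f n))) - ?t) \<le> 2 * cmod ((fst (snd (f n)) - bet (fst (f n))) - ?g n)"
        using phi_bounds(1)[of "eb (fst (f n))" "tt (fst (f n)) (fst (snd (f n)))" ?t] fb(1)[of n] tn(1,2) t(1) R1(1) by simp
    qed
    thus "((\<lambda>p. tt (fst p) (fst (snd p))) \<circ> f) \<longlonglongrightarrow> ?t" by (simp add: LIM_zero_iff o_def)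
  qed
  have wc: "continuous_on S (\<lambda>p. ww (fst p) (fst (snd p)) (snd (snd p)))" for S
    unfolding ww_def by (intro continuous_intros bc)
  define \<Omega>1 where "\<Omega>1 = \<Omega> \<inter> (\<lambda>p. tt (fst p) (fst (snd p))) -` (- {0})"
  have op1: "open \<Omega>1" unfolding \<Omega>1_def by (rule continuous_open_preimage[OF tc op]) auto
  have tc1: "continuous_on \<Omega>1 (\<lambda>p. tt (fst p) (fst (snd p)))" using tc by (rule continuous_on_subset) (auto simp: \<Omega>1_def)
  have hc1: "continuous_on \<Omega>1 (\<lambda>p. hh (eb (fst p)) k)" for k
    by (rule continuous_on_subset[OF coef(2)]) (auto simp: \<Omega>1_def)
  have F: "continuous_on \<Omega>1 (\<lambda>p. L * cmod (tt (fst p) (fst (snd p))) ^ (q + 2) -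
      cmod (ww (fst p) (fst (snd p)) (snd (snd p)) - hp (eb (fst p)) (tt (fst p) (fst (snd p)))))"
    unfolding hp_def by (intro continuous_intros wc tc1 hc1)
  have al: "alp (eb (fst p)) \<noteq> 0" if "p \<in> \<Omega>1" for p
    using that alpa[of "eb (fst p)"] a0 by (auto simp: \<Omega>1_def \<Omega>_def)
  have G: "continuous_on \<Omega>1 (\<lambda>p. Re (WW (eb (fst p)) (tt (fst p) (fst (snd p)))))"
    unfolding WW_def alp_def
    by (intro continuous_intros tc1 hc1) (use al q_pos in \<open>auto simp: \<Omega>1_def alp_def\<close>)
  have "open ((\<Omega>1 \<inter> (\<lambda>p. L * cmod (tt (fst p) (fst (snd p))) ^ (q + 2) -
      cmod (ww (fst p) (fst (snd p)) (snd (snd p)) - hp (eb (fst p)) (tt (fst p) (fst (snd p))))) -` {0<..}) \<inter>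
      (\<Omega>1 \<inter> (\<lambda>p. Re (WW (eb (fst p)) (tt (fst p) (fst (snd p))))) -` {K<..}))"
    by (intro open_Int continuous_open_preimage[OF F op1] continuous_open_preimage[OF G op1] open_greaterThan)
  also have "((\<Omega>1 \<inter> (\<lambda>p. L * cmod (tt (fst p) (fst (snd p))) ^ (q + 2) -
      cmod (ww (fst p) (fst (snd p)) (snd (snd p)) - hp (eb (fst p)) (tt (fst p) (fst (snd p))))) -` {0<..}) \<inter>
      (\<Omega>1 \<inter> (\<lambda>p. Re (WW (eb (fst p)) (tt (fst p) (fst (snd p))))) -` {K<..})) =
      {(b, x, y). cmod b < e1 \<and> (x, y) \<in> pet K b}"
    by (auto simp: \<Omega>1_def \<Omega>_def pet_def captured_def)
  finally show ?thesis .
qed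

end

context parab
begin

text \<open>What the global argument uses of the local theory, freed from the normal form
  coordinates. \<open>s0\<close> is the radius of the strong contraction, \<open>s\<close> the scale
  of the petals.\<close>

definition good_pet :: "real \<Rightarrow> real \<Rightarrow> real \<Rightarrow> (complex \<Rightarrow> (complex \<times> complex) set) \<Rightarrow> bool" where
  "good_pet s0 s \<delta> Pet \<longleftrightarrow>
     open {(b, x, y). cmod b < \<delta> \<and> (x, y) \<in> Pet b} \<and>
     (\<forall>b x y. cmod b < \<delta> \<longrightarrow> (x, y) \<in> Pet b \<longrightarrow>
        (x\<^sup>2 + cc b + b * y, x) \<in> Pet b \<and> x \<noteq> bet b \<and> cmod (x - bet b) < s / 4) \<and>
     (\<forall>b x x'. cmod b < \<delta> \<longrightarrow> recur b x \<longrightarrow> recur b x' \<longrightarrow>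
        (\<forall>n. cmod (x (Suc n) - bet b) \<le> s0 \<and> cmod (x' (Suc n) - bet b) \<le> s0 \<and>
             (x (Suc n), x n) \<notin> Pet b \<and> (x' (Suc n), x' n) \<notin> Pet b) \<longrightarrow>
        cmod (x 1 - x' 1) \<le> 2 * cmod b * cmod (x 0 - x' 0)) \<and>
     (\<forall>b x. cmod b < \<delta> \<longrightarrow> recur b x \<longrightarrow> (x 1, x 0) \<in> Pet b \<longrightarrow> x \<longlonglongrightarrow> bet b)"

text \<open>The radius \<open>s0\<close> is chosen before \<open>s\<close>. Smaller petals only need
  a higher threshold \<open>K\<close>, and the contraction keeps its radius, because a captured
  orbit that stays near enters petals of every size.\<close>

theorem local_theory:
  "\<exists>s0>0. s0 \<le> 1/40 \<and> (\<forall>s. 0 < s \<and> s \<le> s0 \<longrightarrow> (\<exists>\<delta>>0. \<delta> \<le> 1/48 \<and> (\<exists>Pet. good_pet s0 s \<delta> Pet)))"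
proof -
  obtain C where C: "C \<ge> 1" and N: "\<And>e. cmod e \<le> 1/2 \<Longrightarrow> cmod (alp e) \<le> C \<and>
    (\<forall>r x y. cmod x \<le> r \<longrightarrow> cmod y \<le> r \<longrightarrow> r \<le> 1 \<longrightarrow>
       cmod (phi e x - phi e y - (x - y)) \<le> C * r * cmod (x - y) \<and>
       cmod (hp e x - hp e y) \<le> C * r * cmod (x - y)) \<and>
    (\<forall>t. cmod t \<le> 1 / (2 * C) \<longrightarrow> cmod (GG e t) \<le> 2 * cmod t \<and>
       cmod (hp e (GG e t) - e * hp e t - (phi e t)\<^sup>2) \<le> C * cmod t ^ (q + 2) \<and>
       cmod (phi e (GG e t) - l * phi e t - (phi e t)\<^sup>2 - e * hp e t) \<le> C * cmod t ^ (q + 2))"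
    using normal_form by blast
  define a where "a = cmod (alp 0) / 2"
  have a: "a > 0" using alp_nonzero by (simp add: a_def)
  have "continuous_on (ball 0 (1/2)) alp"
    unfolding alp_def[abs_def] by (rule continuous_on_subset[OF hh_continuous]) auto
  hence "isCont alp 0" by (simp add: continuous_on_eq_continuous_at)
  then obtain e2 where e2: "e2 > 0" "\<And>e. dist e 0 < e2 \<Longrightarrow> dist (alp e) (alp 0) < a"
    using continuous_at_eps_delta[THEN iffD1, rule_format, of 0 alp a] a by metis
  obtain d where d: "d > 0" "\<And>z. cmod z < d \<Longrightarrow> cmod (1 / (1 + z) ^ q - 1 + of_nat q * z) \<le> (1/8) * cmod z"
    using inv_power_taylor[of "1/8" q] by auto
  \<comment> \<open>The last entry keeps \<open>6 * C * R\<close> inside the disc of the Taylor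
    estimate; the others are the bounds on \<open>R\<close> in \<open>local_nf\<close>.\<close>
  define R where "R = min (1 / (10 * C)) (min (a / (16 * C)) (d / (12 * C)))"
  define L where "L = 6 * C * 8 ^ (q + 2)"
  define e1 where "e1 = min (1 / (6 * 8 ^ (q + 2))) (min (e2 / 2) (1/2))"
  have e1: "e1 > 0" "e1 \<le> 1/2" "e1 < e2" using e2(1) by (auto simp: e1_def)
  interpret nf: local_nf l q C R L e1 a
  proof unfold_locales
    show "0 < R" using C a d by (simp add: R_def)
    show "R \<le> 1 / (10 * C)" "R \<le> a / (16 * C)" by (auto simp: R_def)
    have "R \<le> d / (12 * C)" by (auto simp: R_def)
    hence "6 * C * R \<le> d / 2" using C by (simp add: field_simps)
    thus "cmod (1 / (1 + z) ^ q - 1 + of_nat q * z) \<le> (1/8) * cmod z" if "cmod z \<le> 6 * C * R" for z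
      using d that by auto
    show "e1 \<le> 1 / (6 * 8 ^ (q + 2))" by (simp add: e1_def)
    show "0 < e1" by fact
    fix e assume e: "cmod e \<le> e1"
    hence e': "cmod e \<le> 1/2" using e1 by simp
    show "cmod (phi e x - phi e y - (x - y)) \<le> cmod (x - y) / 2 \<and> cmod (hp e x - hp e y) \<le> cmod (x - y) / 2"
      if "cmod x \<le> 1 / (2 * C)" "cmod y \<le> 1 / (2 * C)" for x y
    proof -
      have "1 / (2 * C) \<le> 1" using C by (simp add: field_simps)
      hence "cmod (phi e x - phi e y - (x - y)) \<le> C * (1 / (2 * C)) * cmod (x - y) \<and>
        cmod (hp e x - hp e y) \<le> C * (1 / (2 * C)) * cmod (x - y)"
        using N[OF e'] that by blast
      thus ?thesis using C by simp
    qed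
    show "cmod (GG e t) \<le> 2 * cmod t" "cmod (hp e (GG e t) - e * hp e t - (phi e t)\<^sup>2) \<le> C * cmod t ^ (q + 2)"
      "cmod (phi e (GG e t) - l * phi e t - (phi e t)\<^sup>2 - e * hp e t) \<le> C * cmod t ^ (q + 2)" if "cmod t \<le> 1 / (2 * C)" for t
      using N[OF e'] that by blast+
    show "cmod (alp e) \<le> C" using N[OF e'] by blast
    have "dist (alp e) (alp 0) < a" using e e1 by (intro e2(2)) auto
    thus "a \<le> cmod (alp e)"
      using norm_triangle_ineq2[of "alp 0" "alp 0 - alp e"] by (simp add: a_def dist_norm norm_minus_commute)
  qed (use C a in \<open>auto simp: L_def\<close>)
  show ?thesis
  proof (rule exI[of _ "R / 4"], intro conjI allI impI)
    show "R / 4 > 0" "R / 4 \<le> 1/40" using nf.R0 nf.R1(5) by auto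
    fix s assume s: "0 < s \<and> s \<le> R / 4"
    define r where "r = min (R / 10) (s / 8)"
    have r: "r > 0" "r \<le> R / 10" "r \<le> s / 8" using s nf.R0 by (auto simp: r_def)
    define K where "K = 1 / (a * r ^ q)"
    have K: "K \<ge> 1 / (a * (R / 10) ^ q)"
      unfolding K_def using r a by (intro divide_left_mono mult_left_mono power_mono) auto
    have Kr: "K \<ge> 1 / (a * r ^ q)" by (simp add: K_def)
    have "good_pet (R / 4) s e1 (nf.pet K)"
      unfolding good_pet_def
    proof (intro conjI allI impI)
      show "open {(b, x, y). cmod b < e1 \<and> (x, y) \<in> nf.pet K b}" by (rule nf.pet_open)
      fix b assume b: "cmod b < e1"
      hence b': "cmod b \<le> e1" by simp
      show "(x\<^sup>2 + cc b + b * y, x) \<in> nf.pet K b" "x \<noteq> bet b" "cmod (x - bet b) < s / 4"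
        if p: "(x, y) \<in> nf.pet K b" for x y
      proof -
        show "(x\<^sup>2 + cc b + b * y, x) \<in> nf.pet K b" by (rule nf.pet_step(1)[OF b' p K refl])
        have t: "nf.tt b x \<noteq> 0" "cmod (x - bet b) \<le> nf.R1 / 2" using p by (auto simp: nf.pet_def nf.captured_def)
        thus "x \<noteq> bet b" using nf.tt_zero_iff[OF b'] by blast
        have "cmod (nf.tt b x) < r" by (rule nf.pet_small[OF b' p Kr r(1)])
        thus "cmod (x - bet b) < s / 4" using nf.tt(4)[OF b' t(2)] r(3) s by linarith
      qed
      show "cmod (x 1 - x' 1) \<le> 2 * cmod b * cmod (x 0 - x' 0)"
        if "recur b x" "recur b x'" "\<forall>n. cmod (x (Suc n) - bet b) \<le> R / 4 \<and> cmod (x' (Suc n) - bet b) \<le> R / 4 \<and>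
             (x (Suc n), x n) \<notin> nf.pet K b \<and> (x' (Suc n), x' n) \<notin> nf.pet K b" for x x'
        using that by (intro nf.strong_stable[OF b']) auto
      show "x \<longlonglongrightarrow> bet b" if "recur b x" "(x 1, x 0) \<in> nf.pet K b" for x
        by (rule nf.pet_converges[OF b' that(1) K that(2)])
    qed
    thus "\<exists>\<delta>>0. \<delta> \<le> 1/48 \<and> (\<exists>Pet. good_pet (R / 4) s \<delta> Pet)"
      using e1(1) nf.e1_le(1) by blast
  qed
qed

end

subsection \<open>Expansion away from the postcritical set\<close>

lemma cauchy_deriv_bound:
  assumes "f holomorphic_on ball z r" "\<And>w. w \<in> ball z r \<Longrightarrow> cmod (f w - c) \<le> B" "r > 0"
  shows "cmod (deriv f z) \<le> 2 * B / r"
proof -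
  have cb: "cball z (r/2) \<subseteq> ball z r" using assms(3) by (auto simp: subset_eq)
  have hol: "(\<lambda>w. f w - c) holomorphic_on ball z r" by (intro holomorphic_intros assms(1))
  have "norm ((deriv ^^ 1) (\<lambda>w. f w - c) z) \<le> fact 1 * B / (r/2) ^ 1"
  proof (rule Cauchy_inequality)
    show "(\<lambda>w. f w - c) holomorphic_on ball z (r/2)"
      using hol cb ball_subset_cball by (meson holomorphic_on_subset order.trans)
    show "continuous_on (cball z (r/2)) (\<lambda>w. f w - c)"
      using hol cb by (meson holomorphic_on_imp_continuous_on holomorphic_on_subset)
    show "norm (f w - c) \<le> B" if "norm (z - w) = r/2" for w
    proof -
      have "w \<in> cball z (r/2)" using that by (simp add: dist_norm)
      thus ?thesis using assms(2) cb by blast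
    qed
  qed (use assms(3) in auto)
  moreover have "deriv (\<lambda>w. f w - c) z = deriv f z"
  proof -
    have "(f has_field_derivative deriv f z) (at z)" using assms(1,3) by (simp add: holomorphic_derivI)
    hence "((\<lambda>w. f w - c) has_field_derivative deriv f z) (at z)" by (auto intro!: derivative_eq_intros)
    thus ?thesis by (rule DERIV_imp_deriv)
  qed
  ultimately show ?thesis by (simp add: field_simps)
qed

context parab
begin

text \<open>The closed postcritical set: critical values start at \<open>Suc n\<close>, and
  \<open>beta\<close> is their limit. It is compact, and countable, so that its complement is
  connected.\<close>

definition PC :: "complex set" where "PC = insert beta (range (\<lambda>n. (P ^^ Suc n) 0))"

lemma compact_PC: "compact PC"
  unfolding PC_def by (intro compact_sequence_with_limit LIMSEQ_Suc critical_orbit(1))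

lemma open_compl_PC: "open (- PC)"
  using compact_PC compact_imp_closed by blast

lemma connected_compl_PC: "connected (- PC)"
  unfolding PC_def by (intro path_connected_imp_connected path_connected_complement_countable) auto

lemma critical_bounded: "cmod ((P ^^ n) 0) \<le> 2"
proof (rule ccontr)
  assume "\<not> ?thesis"
  hence g: "cmod ((P ^^ n) 0) > 2" by simp
  have "cmod ((P ^^ (k + n)) 0) \<ge> 2" for k
  proof -
    have "cmod ((P ^^ k) ((P ^^ n) 0)) \<ge> (13/8) ^ k * cmod ((P ^^ n) 0)" using g by (intro iterate_grow) auto
    moreover have "(13/8) ^ k * cmod ((P ^^ n) 0) \<ge> 1 * cmod ((P ^^ n) 0)" by (intro mult_right_mono) auto
    ultimately show ?thesis using g unfolding funpow_add comp_apply by linarith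
  qed
  moreover have "(\<lambda>k. cmod ((P ^^ (k + n)) 0)) \<longlonglongrightarrow> cmod beta"
    by (intro tendsto_norm LIMSEQ_ignore_initial_segment critical_orbit(1))
  ultimately have "cmod beta \<ge> 2" by (intro tendsto_lowerbound[of _ _ sequentially]) auto
  thus False using norm_beta by simp
qed

lemma PC_bounded: "x \<in> PC \<Longrightarrow> cmod x \<le> 2"
  using critical_bounded norm_beta critical_bounded[of "Suc _"] unfolding PC_def by fastforce

lemma branch_deriv:
  assumes "g holomorphic_on ball \<xi> r" "\<And>y. y \<in> ball \<xi> r \<Longrightarrow> (P ^^ n) (g y) = y" "y \<in> ball \<xi> r"
  shows "deriv (P ^^ n) (g y) * deriv g y = 1"
proof -
  have "(g has_field_derivative deriv g y) (at y)" using assms by (simp add: holomorphic_derivI)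
  hence "((\<lambda>y. (P ^^ n) (g y)) has_field_derivative deriv (P ^^ n) (g y) * deriv g y) (at y)"
    using DERIV_chain2[OF iterate_has_deriv] by blast
  moreover have "((\<lambda>y. (P ^^ n) (g y)) has_field_derivative 1) (at y)"
    by (rule has_field_derivative_transform_within_open[of "\<lambda>y. y" _ _ "ball \<xi> r"])
      (use assms in auto)
  ultimately show ?thesis by (rule DERIV_unique)
qed

lemma inverse_branch_ball:
  assumes "ball \<xi> r \<subseteq> - PC" "(P ^^ n) \<zeta> \<in> ball \<xi> r"
  obtains g where "g holomorphic_on ball \<xi> r" "\<And>y. y \<in> ball \<xi> r \<Longrightarrow> (P ^^ n) (g y) = y"
    "g ((P ^^ n) \<zeta>) = \<zeta>"
proof -
  have "\<exists>F. F holomorphic_on ball \<xi> r \<and> (\<forall>w\<in>ball \<xi> r. (P ^^ n) (F w) = w) \<and> F ((P ^^ n) \<zeta>) = \<zeta>"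
  proof (rule inverse_branch)
    show "(P ^^ Suc j) 0 \<noteq> w" if "w \<in> ball \<xi> r" for w j
      using that assms(1) unfolding PC_def by blast
  qed (use assms in auto)
  thus ?thesis using that by blast
qed

text \<open>Stated at the preimages of the disc and for every \<open>\<kappa>\<close>, it says that
  the derivatives of all inverse branches over the disc tend to 0 uniformly with the order of the
  iterate.\<close>

definition expands_near :: "complex \<Rightarrow> real \<Rightarrow> bool" where
  "expands_near \<xi> \<rho> \<longleftrightarrow> (\<forall>\<kappa>>0. \<exists>n0. \<forall>n\<ge>n0. \<forall>\<zeta>. (P ^^ n) \<zeta> \<in> ball \<xi> \<rho> \<longrightarrow> 1 \<le> \<kappa> * cmod (deriv (P ^^ n) \<zeta>))"

text \<open>If expansion fails, there are inverse branches of orders tending to infinity whose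
  derivatives at points of the half-size disc exceed \<open>\<kappa>\<close>. They are uniformly
  bounded, so by Montel a subsequence converges; a constant limit would make the derivatives small
  by Cauchy. The premise \<open>H\<close>, constancy of limits, is what each application has to
  supply.\<close>

lemma expands_nearI:
  assumes r: "r > 0" and sub: "ball \<xi> r \<subseteq> - PC"
    and H: "\<And>f n g. (\<And>j. n j \<ge> j) \<Longrightarrow> (\<And>j::nat. f j holomorphic_on ball \<xi> r) \<Longrightarrow>
      (\<And>j y. y \<in> ball \<xi> r \<Longrightarrow> (P ^^ n j) (f j y) = y) \<Longrightarrow> g holomorphic_on ball \<xi> r \<Longrightarrow>
      (\<And>y. y \<in> ball \<xi> r \<Longrightarrow> (\<lambda>j. f j y) \<longlonglongrightarrow> g y) \<Longrightarrow>
      (\<And>K. compact K \<Longrightarrow> K \<subseteq> ball \<xi> r \<Longrightarrow> uniform_limit K f g sequentially) \<Longrightarrow> g constant_on ball \<xi> r"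
  shows "expands_near \<xi> (r / 2)"
proof (rule ccontr)
  assume "\<not> ?thesis"
  then obtain \<kappa> where \<kappa>: "\<kappa> > 0" and "\<forall>n0. \<exists>n\<ge>n0. \<exists>\<zeta>. (P ^^ n) \<zeta> \<in> ball \<xi> (r/2) \<and> \<kappa> * cmod (deriv (P ^^ n) \<zeta>) < 1"
    unfolding expands_near_def by (auto simp: not_le)
  then obtain n \<zeta> where n: "\<And>j. n j \<ge> j" and \<zeta>: "\<And>j. (P ^^ n j) (\<zeta> j) \<in> ball \<xi> (r/2)"
    "\<And>j. \<kappa> * cmod (deriv (P ^^ n j) (\<zeta> j)) < 1" by metis
  define w where "w j = (P ^^ n j) (\<zeta> j)" for j
  have w: "w j \<in> ball \<xi> (r/2)" "w j \<in> ball \<xi> r" for j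
  proof -
    show "w j \<in> ball \<xi> (r/2)" using \<zeta>(1) by (simp add: w_def)
    thus "w j \<in> ball \<xi> r" using r by simp
  qed
  have "\<exists>f. f holomorphic_on ball \<xi> r \<and> (\<forall>y\<in>ball \<xi> r. (P ^^ n j) (f y) = y) \<and> f (w j) = \<zeta> j" for j
    using inverse_branch_ball[OF sub w(2)[of j, unfolded w_def]] unfolding w_def by metis
  then obtain f where f: "\<And>j. f j holomorphic_on ball \<xi> r" "\<And>j y. y \<in> ball \<xi> r \<Longrightarrow> (P ^^ n j) (f j y) = y"
    "\<And>j. f j (w j) = \<zeta> j" by metis
  define B where "B = max 2 (cmod \<xi> + r)"
  have B: "cmod (f j y) \<le> B" if "y \<in> ball \<xi> r" for j y
  proof (rule iterate_bound)
    have "cmod y \<le> cmod \<xi> + r" using that norm_triangle_ineq2[of y \<xi>] by (simp add: dist_norm norm_minus_commute)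
    thus "cmod ((P ^^ n j) (f j y)) \<le> B" using f(2)[OF that] by (simp add: B_def)
  qed (simp add: B_def)
  obtain g s where g: "g holomorphic_on ball \<xi> r" and s: "strict_mono (s :: nat \<Rightarrow> nat)"
    and lim: "\<And>y. y \<in> ball \<xi> r \<Longrightarrow> (\<lambda>j. f (s j) y) \<longlonglongrightarrow> g y"
      "\<And>K. compact K \<Longrightarrow> K \<subseteq> ball \<xi> r \<Longrightarrow> uniform_limit K (f \<circ> s) g sequentially"
  proof (rule Montel[of "ball \<xi> r" "range f" f])
    show "\<exists>B. \<forall>h\<in>range f. \<forall>z\<in>K. cmod (h z) \<le> B" if "K \<subseteq> ball \<xi> r" for K
      using B that by (intro exI[of _ B]) auto
  qed (use f in auto)
  have "g constant_on ball \<xi> r"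
  proof (rule H[of "\<lambda>j. n (s j)" "\<lambda>j. f (s j)" g])
    show "j \<le> n (s j)" for j using n[of "s j"] seq_suble[OF s, of j] by linarith
    show "uniform_limit K (\<lambda>j. f (s j)) g sequentially" if "compact K" "K \<subseteq> ball \<xi> r" for K
      using lim(2)[OF that] by (simp add: o_def)
  qed (use f g lim in auto)
  then obtain c where c: "\<And>y. y \<in> ball \<xi> r \<Longrightarrow> g y = c" unfolding constant_on_def by blast
  define \<eta> where "\<eta> = \<kappa> * r / 16"
  have \<eta>: "\<eta> > 0" using \<kappa> r by (simp add: \<eta>_def)
  have cb: "cball \<xi> (3 * r / 4) \<subseteq> ball \<xi> r" using r by (auto simp: subset_eq)
  have "\<forall>\<^sub>F j in sequentially. \<forall>y\<in>cball \<xi> (3 * r / 4). dist ((f \<circ> s) j y) (g y) < \<eta>"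
    using lim(2)[OF compact_cball cb] \<eta> unfolding uniform_limit_iff by blast
  then obtain j where j: "\<And>y. y \<in> cball \<xi> (3 * r / 4) \<Longrightarrow> dist (f (s j) y) (g y) < \<eta>"
    unfolding eventually_sequentially o_def by blast
  have sb: "ball (w (s j)) (r/4) \<subseteq> cball \<xi> (3 * r / 4)"
  proof
    fix x assume "x \<in> ball (w (s j)) (r/4)"
    thus "x \<in> cball \<xi> (3 * r / 4)"
      using w(1)[of "s j"] dist_triangle[of \<xi> x "w (s j)"] by simp
  qed
  have "cmod (deriv (f (s j)) (w (s j))) \<le> 2 * \<eta> / (r/4)"
  proof (rule cauchy_deriv_bound)
    show "f (s j) holomorphic_on ball (w (s j)) (r/4)"
      using f(1) sb cb by (meson holomorphic_on_subset order_trans)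
    show "cmod (f (s j) x - c) \<le> \<eta>" if "x \<in> ball (w (s j)) (r/4)" for x
      using j[of x] c[of x] that sb cb by (auto simp: dist_norm subset_eq less_imp_le)
  qed (use r in auto)
  also have "... = \<kappa> / 2" using r by (simp add: \<eta>_def)
  finally have d1: "cmod (deriv (f (s j)) (w (s j))) \<le> \<kappa> / 2" .
  have "deriv (P ^^ n (s j)) (\<zeta> (s j)) * deriv (f (s j)) (w (s j)) = 1"
    using branch_deriv[OF f(1) f(2) w(2)[of "s j"]] f(3) by metis
  hence "1 = cmod (deriv (P ^^ n (s j)) (\<zeta> (s j))) * cmod (deriv (f (s j)) (w (s j)))"
    by (metis norm_mult norm_one)
  also have "... \<le> cmod (deriv (P ^^ n (s j)) (\<zeta> (s j))) * (\<kappa> / 2)" using d1 by (intro mult_left_mono) auto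
  finally show False using \<zeta>(2)[of "s j"] by (simp add: mult.commute)
qed

lemma expands_near_mono: "expands_near \<xi> \<rho> \<Longrightarrow> ball \<xi>' \<rho>' \<subseteq> ball \<xi> \<rho> \<Longrightarrow> expands_near \<xi>' \<rho>'"
  unfolding expands_near_def by (meson subsetD)

text \<open>Near a point where expansion is known, any limit of branches has arbitrarily small
  Lipschitz constants and is constant; by the identity theorem it is constant on the whole
  disc.\<close>

lemma expands_near_propagate:
  assumes r: "r > 0" and sub: "ball \<xi> r \<subseteq> - PC" and \<xi>': "\<xi>' \<in> ball \<xi> r" "expands_near \<xi>' \<rho>" "\<rho> > 0"
  shows "expands_near \<xi> (r / 2)"
proof (rule expands_nearI[OF r sub])
  fix f n g
  assume n: "\<And>j. n j \<ge> j" and f: "\<And>j::nat. f j holomorphic_on ball \<xi> r"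
    "\<And>j y. y \<in> ball \<xi> r \<Longrightarrow> (P ^^ n j) (f j y) = y" and g: "g holomorphic_on ball \<xi> r"
    and lim: "\<And>y. y \<in> ball \<xi> r \<Longrightarrow> (\<lambda>j. f j y) \<longlonglongrightarrow> g y"
  obtain \<rho>' where \<rho>': "\<rho>' > 0" "\<rho>' \<le> \<rho>" "ball \<xi>' \<rho>' \<subseteq> ball \<xi> r"
  proof -
    obtain d where "d > 0" "ball \<xi>' d \<subseteq> ball \<xi> r" using \<xi>'(1) openE[OF open_ball] by metis
    moreover have "ball \<xi>' (min d \<rho>) \<subseteq> ball \<xi>' d" by auto
    ultimately show ?thesis using that[of "min d \<rho>"] \<xi>'(3) by auto
  qed
  have eq: "g y = g \<xi>'" if y: "y \<in> ball \<xi>' \<rho>'" for y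
  proof -
    have "dist (g y) (g \<xi>') \<le> \<kappa> * dist y \<xi>'" if \<kappa>: "\<kappa> > 0" for \<kappa>
    proof -
      obtain n0 where n0: "\<And>n \<zeta>. n \<ge> n0 \<Longrightarrow> (P ^^ n) \<zeta> \<in> ball \<xi>' \<rho> \<Longrightarrow> 1 \<le> \<kappa> * cmod (deriv (P ^^ n) \<zeta>)"
        using \<xi>'(2) \<kappa> unfolding expands_near_def by blast
      have "dist (f j y) (f j \<xi>') \<le> \<kappa> * dist y \<xi>'" if j: "j \<ge> n0" for j
        unfolding dist_norm
      proof (rule field_differentiable_bound[of "ball \<xi>' \<rho>'" "f j" "deriv (f j)"])
        fix z assume z: "z \<in> ball \<xi>' \<rho>'"
        hence z': "z \<in> ball \<xi> r" using \<rho>' by blast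
        show "(f j has_field_derivative deriv (f j) z) (at z within ball \<xi>' \<rho>')"
          using holomorphic_derivI[OF f(1) open_ball z'] has_field_derivative_at_within by blast
        have 1: "deriv (P ^^ n j) (f j z) * deriv (f j) z = 1" by (rule branch_deriv[OF f(1) f(2) z'])
        have "(P ^^ n j) (f j z) \<in> ball \<xi>' \<rho>" using f(2)[OF z'] z \<rho>'(2) by auto
        moreover have "n j \<ge> n0" using n[of j] j by linarith
        ultimately have "1 \<le> \<kappa> * cmod (deriv (P ^^ n j) (f j z))" using n0 by blast
        hence "1 * cmod (deriv (f j) z) \<le> \<kappa> * cmod (deriv (P ^^ n j) (f j z)) * cmod (deriv (f j) z)"
          by (intro mult_right_mono) auto
        also have "... = \<kappa> * cmod (deriv (P ^^ n j) (f j z) * deriv (f j) z)" by (simp add: norm_mult)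
        finally show "norm (deriv (f j) z) \<le> \<kappa>" by (simp add: 1)
      qed (use y \<rho>' in auto)
      moreover have "(\<lambda>j. dist (f j y) (f j \<xi>')) \<longlonglongrightarrow> dist (g y) (g \<xi>')"
        using lim y \<rho>' \<xi>'(1) by (intro tendsto_dist) auto
      ultimately show ?thesis by (intro LIMSEQ_le_const2) auto
    qed
    hence b: "dist (g y) (g \<xi>') \<le> \<kappa> * dist y \<xi>'" if "\<kappa> > 0" for \<kappa> using that by blast
    show ?thesis
    proof (rule ccontr)
      assume "g y \<noteq> g \<xi>'"
      hence p: "dist (g y) (g \<xi>') > 0" "y \<noteq> \<xi>'" by auto
      hence "dist (g y) (g \<xi>') \<le> dist (g y) (g \<xi>') / (2 * dist y \<xi>') * dist y \<xi>'" by (intro b) auto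
      thus False using p by simp
    qed
  qed
  have "g y = g \<xi>'" if "y \<in> ball \<xi> r" for y
  proof (rule analytic_continuation_open[of "ball \<xi>' \<rho>'" "ball \<xi> r" g "\<lambda>_. g \<xi>'"])
    show "ball \<xi>' \<rho>' \<noteq> {}" using \<rho>'(1) by simp
    show "g z = g \<xi>'" if "z \<in> ball \<xi>' \<rho>'" for z by (rule eq[OF that])
  qed (fact open_ball open_ball connected_ball \<rho>'(3) g holomorphic_on_const that)+
  thus "g constant_on ball \<xi> r" unfolding constant_on_def by blast
qed

text \<open>The starting point lies in the escape region. If the limit were not constant, Hurwitz's
  theorem would give one value taken by two branches of different order; an iterate would then map a
  point of the disc into the disc. Moduli there lie between 4 and 6, but grow by
  \<open>13 / 8 > 6 / 4\<close>.\<close>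

lemma expands_near_base: "expands_near 5 (1 / 2)"
proof (rule expands_nearI)
  have far: "cmod x > 4 \<and> cmod x < 6" if "x \<in> ball 5 1" for x :: complex
    using that norm_triangle_ineq2[of 5 x] norm_triangle_ineq2[of x 5] by (simp add: dist_norm norm_minus_commute)
  thus "ball 5 1 \<subseteq> - PC" using PC_bounded by fastforce
  fix f n g
  assume n: "\<And>j. n j \<ge> j" and f: "\<And>j::nat. f j holomorphic_on ball 5 1"
    "\<And>j y. y \<in> ball 5 1 \<Longrightarrow> (P ^^ n j) (f j y) = y" and g: "g holomorphic_on ball 5 1"
    and ul: "\<And>K. compact K \<Longrightarrow> K \<subseteq> ball 5 1 \<Longrightarrow> uniform_limit K f g sequentially"
  show "g constant_on ball 5 1"
  proof (rule ccontr)
    assume nc: "\<not> g constant_on ball 5 1"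
    define p where "p = g 5"
    have ex: "\<exists>j\<ge>N. \<exists>y\<in>ball 5 1. f j y = p" for N
    proof (rule ccontr)
      assume neg: "\<not> ?thesis"
      have "g 5 - p \<noteq> 0"
      proof (rule Hurwitz_no_zeros[of "ball 5 1" "\<lambda>j z. f (j + N) z - p" "\<lambda>z. g z - p"])
        show "uniform_limit K (\<lambda>j z. f (j + N) z - p) (\<lambda>z. g z - p) sequentially" if "compact K" "K \<subseteq> ball 5 1" for K
        proof (intro uniform_limit_intros)
          show "uniform_limit K (\<lambda>j z. f (j + N) z) g sequentially"
            using filterlim_compose[OF ul[OF that] filterlim_add_const_nat_at_top[of N]] by simp
        qed
        show "\<not> (\<lambda>z. g z - p) constant_on ball 5 1"
          using nc unfolding constant_on_def by (metis diff_add_cancel)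
        show "f (j + N) z - p \<noteq> 0" if "z \<in> ball 5 1" for j z
          using neg that by auto
      qed (use f g in \<open>auto intro!: holomorphic_intros\<close>)
      thus False by (simp add: p_def)
    qed
    obtain j y where j: "y \<in> ball 5 1" "f j y = p" using ex[of 0] by blast
    obtain j' y' where j': "j' \<ge> Suc (n j)" "y' \<in> ball 5 1" "f j' y' = p" using ex by blast
    have 1: "(P ^^ n j) p = y" "(P ^^ n j') p = y'"
      using f(2)[OF j(1), of j] f(2)[OF j'(2), of j'] unfolding j(2) j'(3) by blast+
    have nj: "n j' \<ge> Suc (n j)" using n[of j'] j'(1) by linarith
    have "(P ^^ n j') p = (P ^^ (n j' - n j)) y"
    proof -
      have "n j' = (n j' - n j) + n j" using nj by simp
      hence "(P ^^ n j') p = (P ^^ (n j' - n j)) ((P ^^ n j) p)" by (metis funpow_add comp_apply)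
      thus ?thesis by (simp add: 1(1))
    qed
    moreover have "cmod ((P ^^ (n j' - n j)) y) \<ge> (13/8) ^ (n j' - n j) * cmod y"
      using far[OF j(1)] by (intro iterate_grow) auto
    moreover have "(13/8 :: real) ^ (n j' - n j) \<ge> (13/8) ^ 1" using nj by (intro power_increasing) auto
    ultimately have "cmod y' \<ge> 13/8 * cmod y"
      using 1(2) by (smt (verit) mult_right_mono norm_ge_zero power_one_right)
    thus False using far[OF j(1)] far[OF j'(2)] by linarith
  qed
qed auto

text \<open>The points with expansion in a neighbourhood form an open and closed subset of the
  connected complement of \<open>PC\<close>, containing 5. Closedness comes from
  \<open>clop\<close>: a disc meeting this set has its concentric quarter inside it. Compactness
  makes the order uniform.\<close>

theorem expansion:
  assumes "compact S" "S \<inter> PC = {}" "\<kappa> > 0"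
  shows "\<exists>n0. \<forall>n\<ge>n0. \<forall>\<zeta>. (P ^^ n) \<zeta> \<in> S \<longrightarrow> 1 \<le> \<kappa> * cmod (deriv (P ^^ n) \<zeta>)"
proof -
  define A where "A = {\<xi> \<in> - PC. \<exists>\<rho>>0. expands_near \<xi> \<rho>}"
  have ballPC: "\<exists>r>0. ball \<xi> r \<subseteq> - PC" if "\<xi> \<in> - PC" for \<xi>
    using open_compl_PC that open_contains_ball by blast
  have clop: "ball \<xi> (r/4) \<subseteq> A" if r: "r > 0" "ball \<xi> r \<subseteq> - PC" "ball \<xi> r \<inter> A \<noteq> {}" for \<xi> r
  proof -
    from r(3) have "expands_near \<xi> (r / 2)" using expands_near_propagate[OF r(1,2)] by (auto simp: A_def)
    moreover have "ball x (r/4) \<subseteq> ball \<xi> (r/2)" if "x \<in> ball \<xi> (r/4)" for x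
    proof
      fix y assume "y \<in> ball x (r/4)" thus "y \<in> ball \<xi> (r/2)"
        using that dist_triangle[of \<xi> y x] by simp
    qed
    ultimately have "expands_near x (r/4)" if "x \<in> ball \<xi> (r/4)" for x
      using expands_near_mono that by blast
    moreover have "ball \<xi> (r/4) \<subseteq> ball \<xi> r" using r(1) by auto
    ultimately show ?thesis using r(1,2) unfolding A_def
      by (smt (verit, best) Collect_mem_eq Collect_mono_iff divide_pos_pos mem_Collect_eq subsetD zero_less_numeral)
  qed
  have opA: "open A"
    unfolding open_contains_ball
  proof
    fix \<xi> assume "\<xi> \<in> A"
    then obtain r where "r > 0" "ball \<xi> r \<subseteq> - PC" using ballPC by (auto simp: A_def)
    moreover from this have "ball \<xi> r \<inter> A \<noteq> {}" using \<open>\<xi> \<in> A\<close> by (metis centre_in_ball disjoint_iff)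
    ultimately have "0 < r/4" "ball \<xi> (r/4) \<subseteq> A" using clop[of r \<xi>] by auto
    thus "\<exists>e>0. ball \<xi> e \<subseteq> A" by blast
  qed
  have opB: "open (- PC - A)"
    unfolding open_contains_ball
  proof
    fix \<xi> assume x: "\<xi> \<in> - PC - A"
    then obtain r where r: "r > 0" "ball \<xi> r \<subseteq> - PC" using ballPC by auto
    hence "ball \<xi> r \<inter> A = {}" using clop[OF r] x by force
    thus "\<exists>e>0. ball \<xi> e \<subseteq> - PC - A" using r by blast
  qed
  have "5 \<in> A" using expands_near_base PC_bounded[of 5] by (auto simp: A_def intro!: exI[of _ "1/2"])
  moreover have "A \<inter> - PC = {} \<or> (- PC - A) \<inter> - PC = {}"
    by (rule connectedD[OF connected_compl_PC opA opB]) auto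
  ultimately have "- PC \<subseteq> A" by (auto simp: A_def)
  hence "\<forall>\<xi>\<in>S. \<exists>\<rho>>0. expands_near \<xi> \<rho>" using assms(2) by (auto simp: A_def)
  then obtain \<rho> where \<rho>: "\<And>\<xi>. \<xi> \<in> S \<Longrightarrow> \<rho> \<xi> > 0" "\<And>\<xi>. \<xi> \<in> S \<Longrightarrow> expands_near \<xi> (\<rho> \<xi>)" by metis
  have "S \<subseteq> (\<Union>\<xi>\<in>S. ball \<xi> (\<rho> \<xi>))" using \<rho>(1) by force
  then obtain F where F: "F \<subseteq> S" "finite F" "S \<subseteq> (\<Union>\<xi>\<in>F. ball \<xi> (\<rho> \<xi>))"
    using compactE_image[OF assms(1), of S "\<lambda>\<xi>. ball \<xi> (\<rho> \<xi>)"] by auto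
  have "\<forall>\<xi>\<in>F. \<exists>n0. \<forall>n\<ge>n0. \<forall>\<zeta>. (P ^^ n) \<zeta> \<in> ball \<xi> (\<rho> \<xi>) \<longrightarrow> 1 \<le> \<kappa> * cmod (deriv (P ^^ n) \<zeta>)"
    using \<rho>(2) F(1) assms(3) unfolding expands_near_def by blast
  then obtain N where N: "\<And>\<xi> n \<zeta>. \<xi> \<in> F \<Longrightarrow> n \<ge> N \<xi> \<Longrightarrow> (P ^^ n) \<zeta> \<in> ball \<xi> (\<rho> \<xi>) \<Longrightarrow> 1 \<le> \<kappa> * cmod (deriv (P ^^ n) \<zeta>)"
    by metis
  show ?thesis
  proof (intro exI[of _ "Max (insert 0 (N ` F))"] allI impI)
    fix n \<zeta> assume n: "Max (insert 0 (N ` F)) \<le> n" and z: "(P ^^ n) \<zeta> \<in> S"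
    then obtain \<xi> where \<xi>: "\<xi> \<in> F" "(P ^^ n) \<zeta> \<in> ball \<xi> (\<rho> \<xi>)" using F(3) by blast
    have "N \<xi> \<le> Max (insert 0 (N ` F))" using F(2) \<xi>(1) by (intro Max_ge) auto
    thus "1 \<le> \<kappa> * cmod (deriv (P ^^ n) \<zeta>)" using N[OF \<xi>(1) _ \<xi>(2)] n by linarith
  qed
qed

end

subsection \<open>Uniform separation from the parabolic basin\<close>

lemma (in parab) norm_cc_diff: "cmod (cc b - cc 0) \<le> 3 * cmod b" if "cmod b \<le> 1"
proof -
  have "cc b - cc 0 = b * (1 / 2 - 1 / (2 * l) - l / 2 + b / (2 * l) - b / (4 * l\<^sup>2))"
    using l_nz by (simp add: cc_def bet_def field_simps power2_eq_square)
  also have "cmod ... \<le> cmod b * 3"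
    unfolding norm_mult
  proof (intro mult_left_mono)
    have "cmod (1 / 2 - 1 / (2 * l) - l / 2 + b / (2 * l) - b / (4 * l\<^sup>2)) \<le>
      cmod (1 / 2 :: complex) + cmod (1 / (2 * l)) + cmod (l / 2) + cmod (b / (2 * l)) + cmod (b / (4 * l\<^sup>2))"
      by (intro norm_triangle_le_diff norm_triangle_le add_mono order_refl)
    also have "... \<le> 3" using that by (simp add: norm_mult norm_divide norm_power norm_l)
    finally show "cmod (1 / 2 - 1 / (2 * l) - l / 2 + b / (2 * l) - b / (4 * l\<^sup>2)) \<le> 3" .
  qed simp
  finally show ?thesis by (simp add: mult.commute)
qed

lemma (in parab) norm_bet_diff: "cmod (bet b - beta) = cmod b / 2"
proof -
  have "bet b - beta = - b / (2 * l)" using l_nz by (simp add: bet_def)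
  thus ?thesis by (simp add: norm_divide norm_mult norm_l)
qed

lemma (in parab) beta_cc0: "cmod (beta - cc 0) = 1 / 4"
proof -
  have "beta - cc 0 = beta\<^sup>2" by (simp add: cc_def)
  hence "cmod (beta - cc 0) = (cmod beta)\<^sup>2" by (simp only: norm_power)
  thus ?thesis by (simp add: norm_beta power2_eq_square)
qed

text \<open>\<open>s = s0 / 2\<close> leaves room: a point within \<open>3 * s / 4\<close> of
  \<open>beta\<close>, the drift of \<open>bet b\<close> and a close companion orbit all fit into
  the disc of radius \<open>s0\<close>.\<close>

locale parab_glob = parab +
  fixes s0 s \<delta>0 :: real and Pet :: "complex \<Rightarrow> (complex \<times> complex) set"
  assumes s0_pos: "s0 > 0" and s0_le: "s0 \<le> 1/40" and s_def: "s = s0 / 2"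
    and d0_pos: "\<delta>0 > 0" and d0_le: "\<delta>0 \<le> 1/48" and good: "good_pet s0 s \<delta>0 Pet"
begin

lemma s_pos: "s > 0" "s \<le> 1/80" using s0_pos s0_le s_def by auto

lemma Pet_open: "open {(b, x, y). cmod b < \<delta>0 \<and> (x, y) \<in> Pet b}"
  and Pet_step: "cmod b < \<delta>0 \<Longrightarrow> (x, y) \<in> Pet b \<Longrightarrow> (x\<^sup>2 + cc b + b * y, x) \<in> Pet b"
  and Pet_ne: "cmod b < \<delta>0 \<Longrightarrow> (x, y) \<in> Pet b \<Longrightarrow> x \<noteq> bet b"
  and Pet_small: "cmod b < \<delta>0 \<Longrightarrow> (x, y) \<in> Pet b \<Longrightarrow> cmod (x - bet b) < s / 4"
proof -
  show "open {(b, x, y). cmod b < \<delta>0 \<and> (x, y) \<in> Pet b}"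
    by (rule good[unfolded good_pet_def, THEN conjunct1])
  assume a: "cmod b < \<delta>0" "(x, y) \<in> Pet b"
  note g = good[unfolded good_pet_def, THEN conjunct2, THEN conjunct1, THEN spec, THEN spec, THEN spec, THEN mp, THEN mp, OF a]
  from g show "(x\<^sup>2 + cc b + b * y, x) \<in> Pet b" "x \<noteq> bet b" "cmod (x - bet b) < s / 4" by blast+
qed

lemma strong_stable:
  assumes "cmod b < \<delta>0" "recur b x" "recur b x'"
    "\<And>n. cmod (x (Suc n) - bet b) \<le> s0" "\<And>n. cmod (x' (Suc n) - bet b) \<le> s0"
    "\<And>n. (x (Suc n), x n) \<notin> Pet b" "\<And>n. (x' (Suc n), x' n) \<notin> Pet b"
  shows "cmod (x 1 - x' 1) \<le> 2 * cmod b * cmod (x 0 - x' 0)"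
  by (rule good[unfolded good_pet_def, THEN conjunct2, THEN conjunct2, THEN conjunct1,
        THEN spec, THEN spec, THEN spec, THEN mp, THEN mp, THEN mp, THEN mp])
    (use assms in simp_all)

lemma Pet_converges: "cmod b < \<delta>0 \<Longrightarrow> recur b x \<Longrightarrow> (x 1, x 0) \<in> Pet b \<Longrightarrow> x \<longlonglongrightarrow> bet b"
  using good[unfolded good_pet_def, THEN conjunct2, THEN conjunct2, THEN conjunct2] by simp

lemma Pet_open_fixed: "cmod b < \<delta>0 \<Longrightarrow> open (Pet b)"
proof -
  assume b: "cmod b < \<delta>0"
  have "open ((\<lambda>z. (b, z)) -` {(b, x, y). cmod b < \<delta>0 \<and> (x, y) \<in> Pet b})"
    by (rule open_vimage[OF Pet_open]) (intro continuous_intros)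
  also have "((\<lambda>z. (b, z)) -` {(b, x, y). cmod b < \<delta>0 \<and> (x, y) \<in> Pet b}) = Pet b" using b by auto
  finally show ?thesis .
qed

lemma Pet_forward:
  assumes "cmod b < \<delta>0" "recur b x" "(x (Suc n), x n) \<in> Pet b"
  shows "(x (Suc (n + k)), x (n + k)) \<in> Pet b"
proof (induction k)
  case (Suc k)
  thus ?case using Pet_step[OF assms(1) Suc] assms(2) by (simp add: recur_def)
qed (use assms in auto)

definition Bas :: "complex set" where "Bas = {x. \<exists>n. ((P ^^ Suc n) x, (P ^^ n) x) \<in> Pet 0}"

lemma cmod0: "cmod 0 < \<delta>0" using d0_pos by simp

lemma open_Bas: "open Bas"
proof -
  have "Bas = (\<Union>n. (\<lambda>x. ((P ^^ Suc n) x, (P ^^ n) x)) -` Pet 0)" by (auto simp: Bas_def)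
  moreover have "open ((\<lambda>x. ((P ^^ Suc n) x, (P ^^ n) x)) -` Pet 0)" for n
    by (rule open_vimage[OF Pet_open_fixed[OF cmod0]]) (intro continuous_on_Pair quad_continuous_iterate)
  ultimately show ?thesis by (simp add: open_UN)
qed

lemma recur_iterate: "recur 0 (\<lambda>n. (P ^^ n) x)"
  unfolding recur_def by (simp only: quad_iterate_Suc) simp

lemma recur_shift: "recur b x \<Longrightarrow> recur b (\<lambda>n. x (N + n))"
  by (simp add: recur_def)

lemma recur_bet: "recur b (\<lambda>n. bet b)"
  by (simp add: recur_def cc_def algebra_simps)

lemma Bas_converges: "x \<in> Bas \<Longrightarrow> (\<lambda>n. (P ^^ n) x) \<longlonglongrightarrow> beta"
proof -
  assume "x \<in> Bas"
  then obtain n where n: "((P ^^ Suc n) x, (P ^^ n) x) \<in> Pet 0" by (auto simp: Bas_def)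
  have "(\<lambda>k. (P ^^ (n + k)) x) \<longlonglongrightarrow> beta"
    by (rule Pet_converges[OF cmod0 recur_shift[OF recur_iterate]]) (use n in simp)
  hence "(\<lambda>k. (P ^^ (k + n)) x) \<longlonglongrightarrow> beta" by (simp add: add.commute)
  thus ?thesis by (rule LIMSEQ_offset)
qed

lemma beta_notin_Pet: "cmod b < \<delta>0 \<Longrightarrow> (bet b, y) \<notin> Pet b"
  using Pet_ne by blast

lemma iterate_stay_beta: "(P ^^ m) x = beta \<Longrightarrow> m \<le> n \<Longrightarrow> (P ^^ n) x = beta"
  by (metis funpow_add comp_apply iterate_beta le_add_diff_inverse2)

text \<open>At \<open>b = 0\<close> the contraction factor of \<open>strong_stable\<close> is 0, so
  an orbit that stays near \<open>beta\<close> without meeting the petal is exactly at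
  \<open>beta\<close> one step later.\<close>

lemma BasI_stay:
  assumes "\<And>n. n \<ge> N \<Longrightarrow> cmod ((P ^^ n) x - beta) \<le> s0" "\<And>n. (P ^^ n) x \<noteq> beta"
  shows "x \<in> Bas"
proof (rule ccontr)
  assume nb: "x \<notin> Bas"
  have "cmod ((P ^^ (N + 1)) x - beta) \<le> 2 * cmod 0 * cmod ((P ^^ (N + 0)) x - beta)"
    by (rule strong_stable[OF cmod0 recur_shift[OF recur_iterate] recur_bet])
      (use assms(1)[of "N + Suc _"] s0_pos nb beta_notin_Pet[OF cmod0] in \<open>auto simp: Bas_def simp del: funpow.simps\<close>)
  thus False using assms(2)[of "N + 1"] by simp
qed

lemma BasI: "(\<lambda>n. (P ^^ n) x) \<longlonglongrightarrow> beta \<Longrightarrow> (\<And>n. (P ^^ n) x \<noteq> beta) \<Longrightarrow> x \<in> Bas"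
proof -
  assume "(\<lambda>n. (P ^^ n) x) \<longlonglongrightarrow> beta" and ne: "\<And>n. (P ^^ n) x \<noteq> beta"
  then obtain N where "\<And>n. n \<ge> N \<Longrightarrow> cmod ((P ^^ n) x - beta) < s0" using s0_pos LIMSEQ_D by blast
  thus ?thesis using BasI_stay[of N x] ne by (meson less_imp_le)
qed

lemma critical_in_Bas: "(P ^^ n) 0 \<in> Bas"
proof (rule BasI)
  have eq: "(P ^^ k) ((P ^^ n) 0) = (P ^^ (k + n)) 0" for k by (simp add: funpow_add)
  show "(\<lambda>k. (P ^^ k) ((P ^^ n) 0)) \<longlonglongrightarrow> beta"
    unfolding eq by (rule LIMSEQ_ignore_initial_segment[OF critical_orbit(1)])
  show "(P ^^ k) ((P ^^ n) 0) \<noteq> beta" for k unfolding eq by (rule critical_orbit(2))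
qed

text \<open>A compact substitute for the part of the Julia set away from \<open>beta\<close>; being
  outside the basin, it misses the postcritical set. The distance \<open>s / 2\<close> exceeds the
  size \<open>s / 4\<close> of the petals.\<close>

definition EE :: "complex set" where "EE = {\<xi>. cmod \<xi> \<le> 2 \<and> s / 2 \<le> cmod (\<xi> - beta) \<and> \<xi> \<notin> Bas}"

lemma compact_EE: "compact EE"
proof -
  have "EE = cball 0 2 \<inter> ({\<xi>. s / 2 \<le> cmod (\<xi> - beta)} \<inter> - Bas)" by (auto simp: EE_def)
  moreover have "closed {\<xi>. s / 2 \<le> cmod (\<xi> - beta)}" by (intro closed_Collect_le continuous_intros)
  ultimately show ?thesis using open_Bas by (auto intro!: compact_Int_closed closed_Int)
qed

lemma EE_PC: "EE \<inter> PC = {}"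
  using critical_in_Bas s_pos by (auto simp: EE_def PC_def simp del: funpow.simps)

lemma EE_separated: "\<exists>\<sigma>>0. \<sigma> \<le> s / 32 \<and> (\<forall>\<xi>\<in>EE. \<forall>p\<in>PC. 4 * \<sigma> \<le> dist \<xi> p)"
proof -
  obtain d where d: "d > 0" "\<forall>x\<in>EE. \<forall>y\<in>PC. d \<le> dist x y"
    using separate_compact_closed[OF compact_EE compact_imp_closed[OF compact_PC] EE_PC] by blast
  have "4 * min (s / 32) (d / 4) \<le> d" by auto
  thus ?thesis using d s_pos by (intro exI[of _ "min (s / 32) (d / 4)"]) (auto intro: order_trans)
qed

text \<open>The induction carries along that \<open>b\<close> times the preceding point tends to 0.
  At the start this rests on the bound for \<open>u j 0\<close>, the only point for which no limit
  is assumed.\<close>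

lemma recur_limit:
  assumes "\<And>j::nat. recur (b j) (u j)" "b \<longlonglongrightarrow> 0" "\<And>j. cmod (u j 0) \<le> B" "(\<lambda>j. u j 1) \<longlonglongrightarrow> \<xi>"
  shows "(\<lambda>j. u j (Suc n)) \<longlonglongrightarrow> (P ^^ n) \<xi>"
proof -
  have ccl: "(\<lambda>j. cc (b j)) \<longlonglongrightarrow> cc 0"
    unfolding cc_def bet_def by (intro tendsto_intros assms(2)) (use l_nz in auto)
  have "(\<lambda>j. u j (Suc n)) \<longlonglongrightarrow> (P ^^ n) \<xi> \<and> (\<lambda>j. b j * u j n) \<longlonglongrightarrow> 0"
  proof (induction n)
    case 0
    have "(\<lambda>j. b j * u j 0) \<longlonglongrightarrow> 0"
    proof (rule Lim_null_comparison[OF always_eventually[OF allI]])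
      show "cmod (b j * u j 0) \<le> cmod (b j) * B" for j
        unfolding norm_mult using assms(3) by (intro mult_left_mono) auto
      show "(\<lambda>j. cmod (b j) * B) \<longlonglongrightarrow> 0"
        using tendsto_mult[OF tendsto_norm[OF assms(2)] tendsto_const[of B]] by simp
    qed
    thus ?case using assms(4) by simp
  next
    case (Suc n)
    have "(\<lambda>j. (u j (Suc n))\<^sup>2 + cc (b j) + b j * u j n) \<longlonglongrightarrow> ((P ^^ n) \<xi>)\<^sup>2 + cc 0 + 0"
      using Suc by (intro tendsto_intros ccl) auto
    hence "(\<lambda>j. u j (Suc (Suc n))) \<longlonglongrightarrow> (P ^^ Suc n) \<xi>"
      using assms(1) unfolding recur_def quad_iterate_Suc by simp
    moreover have "(\<lambda>j. b j * u j (Suc n)) \<longlonglongrightarrow> 0 * (P ^^ n) \<xi>"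
      using Suc assms(2) by (intro tendsto_mult) auto
    ultimately show ?case by simp
  qed
  thus ?thesis by blast
qed

lemma Bas_limit:
  assumes "\<And>j::nat. recur (b j) (u j)" "b \<longlonglongrightarrow> 0" "\<And>j. cmod (u j 0) \<le> B" "(\<lambda>j. u j 1) \<longlonglongrightarrow> \<xi>" "\<xi> \<in> Bas"
  shows "\<exists>n. \<forall>\<^sub>F j in sequentially. (u j (Suc (Suc n)), u j (Suc n)) \<in> Pet (b j)"
proof -
  obtain n where n: "((P ^^ Suc n) \<xi>, (P ^^ n) \<xi>) \<in> Pet 0" using assms(5) by (auto simp: Bas_def)
  note lim = recur_limit[OF assms(1-4)]
  have "(\<lambda>j. (b j, u j (Suc (Suc n)), u j (Suc n))) \<longlonglongrightarrow> (0, (P ^^ Suc n) \<xi>, (P ^^ n) \<xi>)"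
    by (intro tendsto_Pair assms(2) lim)
  hence "\<forall>\<^sub>F j in sequentially. (b j, u j (Suc (Suc n)), u j (Suc n)) \<in> {(b, x, y). cmod b < \<delta>0 \<and> (x, y) \<in> Pet b}"
    by (rule topological_tendstoD[OF _ Pet_open]) (use n d0_pos in auto)
  hence "\<forall>\<^sub>F j in sequentially. (u j (Suc (Suc n)), u j (Suc n)) \<in> Pet (b j)"
    by (rule eventually_mono) auto
  thus ?thesis by blast
qed

definition orbit :: "complex \<Rightarrow> (int \<Rightarrow> complex) \<Rightarrow> bool" where
  "orbit b x \<longleftrightarrow> (\<forall>k. x (k + 1) = (x k)\<^sup>2 + cc b + b * x (k - 1))"

text \<open>At \<open>b = 0\<close> this is the natural extension of \<open>P\<close> on its Julia
  set (\<open>SS0_iff\<close>); at the square of \<open>a\<close> it corresponds to the Julia set of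
  the Henon map (\<open>J_eq\<close>).\<close>

definition SS :: "complex \<Rightarrow> (int \<Rightarrow> complex) set" where
  "SS b = {x. orbit b x \<and> (\<forall>k. cmod (x k) \<le> 2) \<and> (\<forall>k. (x k, x (k - 1)) \<notin> Pet b)}"

lemma orbit_recur: "orbit b x \<Longrightarrow> recur b (\<lambda>n. x (k + int n))"
  unfolding orbit_def recur_def by (smt (verit) of_nat_Suc)

text \<open>Counterexamples with \<open>b\<close> tending to 0 have a limit point
  \<open>\<xi>\<close> of the points in question. If \<open>\<xi>\<close> were in the basin,
  \<open>Bas_limit\<close> would push the orbits into petals; otherwise \<open>\<xi>\<close> is in
  \<open>EE\<close> and the points come close to it.\<close>

lemma SS_near_EE:
  assumes "\<sigma> > 0"
  shows "\<exists>\<delta>>0. \<forall>b x k. cmod b < \<delta> \<longrightarrow> x \<in> SS b \<longrightarrow> 3 * s / 4 \<le> cmod (x k - beta) \<longrightarrow> (\<exists>\<xi>\<in>EE. cmod (x k - \<xi>) < \<sigma>)"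
proof (rule ccontr)
  assume neg: "\<not> ?thesis"
  have "\<forall>j::nat. \<exists>b x k. cmod b < min \<delta>0 (inverse (real (Suc j))) \<and> x \<in> SS b \<and> 3 * s / 4 \<le> cmod (x k - beta) \<and>
      (\<forall>\<xi>\<in>EE. \<sigma> \<le> cmod (x k - \<xi>))"
  proof
    fix j :: nat
    have "min \<delta>0 (inverse (real (Suc j))) > 0" using d0_pos by simp
    thus "\<exists>b x k. cmod b < min \<delta>0 (inverse (real (Suc j))) \<and> x \<in> SS b \<and> 3 * s / 4 \<le> cmod (x k - beta) \<and>
      (\<forall>\<xi>\<in>EE. \<sigma> \<le> cmod (x k - \<xi>))" using neg by (metis not_le)
  qed
  then obtain b x k where b: "\<And>j. cmod (b j) < min \<delta>0 (inverse (real (Suc j)))" and x: "\<And>j. x j \<in> SS (b j)"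
    "\<And>j. 3 * s / 4 \<le> cmod (x j (k j) - beta)" "\<And>j \<xi>. \<xi> \<in> EE \<Longrightarrow> \<sigma> \<le> cmod (x j (k j) - \<xi>)" by metis
  have b0: "b \<longlonglongrightarrow> 0"
  proof (rule Lim_null_comparison[OF always_eventually[OF allI] LIMSEQ_inverse_real_of_nat])
    show "cmod (b j) \<le> inverse (real (Suc j))" for j using b[of j] by simp
  qed
  define u where "u j n = x j (k j - 1 + int n)" for j n
  have u: "recur (b j) (u j)" "cmod (u j n) \<le> 2" "(u j (Suc n), u j n) \<notin> Pet (b j)" "u j 1 = x j (k j)" for j n
  proof -
    show "recur (b j) (u j)" unfolding u_def using x(1)[of j] by (intro orbit_recur) (simp add: SS_def)
    show "cmod (u j n) \<le> 2" using x(1)[of j] by (simp add: u_def SS_def)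
    have "(x j (k j - 1 + int n + 1), x j (k j - 1 + int n + 1 - 1)) \<notin> Pet (b j)"
      using x(1)[of j] unfolding SS_def by blast
    thus "(u j (Suc n), u j n) \<notin> Pet (b j)" by (simp add: u_def algebra_simps)
    show "u j 1 = x j (k j)" by (simp add: u_def)
  qed
  have "compact (cball (0::complex) 2)" by simp
  then obtain \<xi> r where \<xi>: "\<xi> \<in> cball 0 2" "strict_mono (r :: nat \<Rightarrow> nat)" "((\<lambda>j. u j 1) \<circ> r) \<longlonglongrightarrow> \<xi>"
    unfolding compact_def using u(2) by (metis mem_cball_0)
  hence lim: "(\<lambda>j. u (r j) 1) \<longlonglongrightarrow> \<xi>" by (simp add: o_def)
  have br: "(\<lambda>j. b (r j)) \<longlonglongrightarrow> 0" using LIMSEQ_subseq_LIMSEQ[OF b0 \<xi>(2)] by (simp add: o_def)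
  have "3 * s / 4 \<le> cmod (\<xi> - beta)"
    by (rule LIMSEQ_le_const[OF tendsto_norm[OF tendsto_diff[OF lim tendsto_const]]]) (use u(4) x(2) in auto)
  hence far: "s / 2 \<le> cmod (\<xi> - beta)" using s_pos by simp
  show False
  proof (cases "\<xi> \<in> Bas")
    case True
    obtain n where "\<forall>\<^sub>F j in sequentially. (u (r j) (Suc (Suc n)), u (r j) (Suc n)) \<in> Pet (b (r j))"
      using Bas_limit[of "\<lambda>j. b (r j)" "\<lambda>j. u (r j)" 2 \<xi>, OF u(1) br u(2) lim True] by blast
    thus False using u(3) by (simp add: eventually_sequentially)
  next
    case False
    hence "\<xi> \<in> EE" using \<xi>(1) far by (simp add: EE_def)
    hence "\<And>j. \<sigma> \<le> cmod (u (r j) 1 - \<xi>)" using x(3) u(4) by simp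
    hence "\<sigma> \<le> cmod (\<xi> - \<xi>)"
      by (intro LIMSEQ_le_const[OF tendsto_norm[OF tendsto_diff[OF lim tendsto_const]]]) auto
    thus False using assms by simp
  qed
qed

text \<open>Such an orbit follows the critical orbit until the petal is reached: during these
  finitely many steps it is within \<open>\<sigma>\<close> of \<open>PC\<close>, which is
  \<open>4 * \<sigma>\<close> from \<open>EE\<close>, and afterwards it stays in the petal, within
  \<open>s / 4\<close> of the fixed point. Read backwards: an orbit that comes near
  \<open>EE\<close> has not passed near the critical value.\<close>

lemma critical_value_trapped:
  assumes \<sigma>: "\<sigma> > 0" "\<sigma> \<le> s / 32" "\<And>\<xi> p. \<xi> \<in> EE \<Longrightarrow> p \<in> PC \<Longrightarrow> 4 * \<sigma> \<le> dist \<xi> p"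
  shows "\<exists>\<delta>>0. \<forall>b u n \<xi>. cmod b < \<delta> \<longrightarrow> recur b u \<longrightarrow> cmod (u 0) \<le> 4 \<longrightarrow> cmod (u 1 - cc 0) < \<delta> \<longrightarrow>
     \<xi> \<in> EE \<longrightarrow> 2 * \<sigma> \<le> cmod (u (Suc n) - \<xi>)"
proof (rule ccontr)
  assume neg: "\<not> ?thesis"
  have "\<forall>j::nat. \<exists>b u n \<xi>. cmod b < min \<delta>0 (inverse (real (Suc j))) \<and> recur b u \<and> cmod (u 0) \<le> 4 \<and>
      cmod (u 1 - cc 0) < inverse (real (Suc j)) \<and> \<xi> \<in> EE \<and> cmod (u (Suc n) - \<xi>) < 2 * \<sigma>"
  proof
    fix j :: nat
    have "min \<delta>0 (inverse (real (Suc j))) > 0" using d0_pos by simp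
    thus "\<exists>b u n \<xi>. cmod b < min \<delta>0 (inverse (real (Suc j))) \<and> recur b u \<and> cmod (u 0) \<le> 4 \<and>
      cmod (u 1 - cc 0) < inverse (real (Suc j)) \<and> \<xi> \<in> EE \<and> cmod (u (Suc n) - \<xi>) < 2 * \<sigma>"
      using neg by (metis not_le min_less_iff_conj)
  qed
  then obtain b u n \<xi> where b: "\<And>j. cmod (b j) < min \<delta>0 (inverse (real (Suc j)))"
    and u: "\<And>j. recur (b j) (u j)" "\<And>j. cmod (u j 0) \<le> 4" "\<And>j. cmod (u j 1 - cc 0) < inverse (real (Suc j))"
    and \<xi>: "\<And>j. \<xi> j \<in> EE" "\<And>j. cmod (u j (Suc (n j)) - \<xi> j) < 2 * \<sigma>" by metis
  have b0: "b \<longlonglongrightarrow> 0"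
  proof (rule Lim_null_comparison[OF always_eventually[OF allI] LIMSEQ_inverse_real_of_nat])
    show "cmod (b j) \<le> inverse (real (Suc j))" for j using b[of j] by simp
  qed
  have "(\<lambda>j. u j 1 - cc 0) \<longlonglongrightarrow> 0"
    by (rule Lim_null_comparison[OF always_eventually[OF allI] LIMSEQ_inverse_real_of_nat]) (use u(3) in \<open>auto intro: less_imp_le\<close>)
  hence u1: "(\<lambda>j. u j 1) \<longlonglongrightarrow> cc 0" by (simp add: LIM_zero_iff)
  have crit: "(P ^^ n) (cc 0) = (P ^^ Suc n) 0" for n by (simp only: quad_iterate_Suc') simp
  have lim: "(\<lambda>j. u j (Suc n)) \<longlonglongrightarrow> (P ^^ Suc n) 0" for n
    using recur_limit[OF u(1) b0 u(2) u1, of n] by (simp only: crit)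
  have "cc 0 \<in> Bas" using critical_in_Bas[of 1] by (simp add: quad_def)
  then obtain N where N: "\<forall>\<^sub>F j in sequentially. (u j (Suc (Suc N)), u j (Suc N)) \<in> Pet (b j)"
    using Bas_limit[OF u(1) b0 u(2) u1] by blast
  have "\<forall>\<^sub>F j in sequentially. \<forall>i\<in>{..N}. cmod (u j (Suc i) - (P ^^ Suc i) 0) < \<sigma>"
  proof (intro eventually_ball_finite ballI)
    fix i show "\<forall>\<^sub>F j in sequentially. cmod (u j (Suc i) - (P ^^ Suc i) 0) < \<sigma>"
      using tendstoD[OF lim \<sigma>(1), of i] by (simp add: dist_norm)
  qed simp
  moreover have "\<forall>\<^sub>F j in sequentially. cmod (b j) < s / 8"
    using tendstoD[OF b0, of "s/8"] s_pos by simp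
  ultimately have "\<forall>\<^sub>F j in sequentially. (u j (Suc (Suc N)), u j (Suc N)) \<in> Pet (b j) \<and>
     (\<forall>i\<in>{..N}. cmod (u j (Suc i) - (P ^^ Suc i) 0) < \<sigma>) \<and> cmod (b j) < s / 8"
    using N by eventually_elim auto
  then obtain j where j: "(u j (Suc (Suc N)), u j (Suc N)) \<in> Pet (b j)"
    "\<And>i. i \<le> N \<Longrightarrow> cmod (u j (Suc i) - (P ^^ Suc i) 0) < \<sigma>" "cmod (b j) < s / 8"
    by (auto simp: eventually_sequentially)
  show False
  proof (cases "n j \<le> N")
    case True
    have "4 * \<sigma> \<le> cmod (\<xi> j - (P ^^ Suc (n j)) 0)" using \<sigma>(3)[OF \<xi>(1)[of j]] by (simp add: PC_def dist_norm)
    moreover have "\<xi> j - (P ^^ Suc (n j)) 0 = (u j (Suc (n j)) - (P ^^ Suc (n j)) 0) - (u j (Suc (n j)) - \<xi> j)" by simp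
    ultimately have "4 * \<sigma> \<le> cmod (u j (Suc (n j)) - (P ^^ Suc (n j)) 0) + cmod (u j (Suc (n j)) - \<xi> j)"
      using norm_triangle_ineq4 order_trans by metis
    thus False using j(2)[OF True] \<xi>(2)[of j] \<sigma>(1) by linarith
  next
    case False
    have bj: "cmod (b j) < \<delta>0" using b[of j] by simp
    obtain i where i: "n j = Suc N + i" using False by (metis add_Suc not_less_eq_eq nat_le_iff_add)
    have "(u j (Suc (Suc N + i)), u j (Suc N + i)) \<in> Pet (b j)"
      by (rule Pet_forward[OF bj u(1) j(1)])
    hence "cmod (u j (Suc (n j)) - bet (b j)) < s / 4" using Pet_small[OF bj] i by simp
    moreover have "cmod (bet (b j) - beta) < s / 16" using j(3) by (simp add: norm_bet_diff)
    moreover have "s / 2 \<le> cmod (\<xi> j - beta)" using \<xi>(1)[of j] by (simp add: EE_def)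
    moreover have "cmod (\<xi> j - beta) \<le> cmod (u j (Suc (n j)) - \<xi> j) + cmod (u j (Suc (n j)) - bet (b j)) + cmod (bet (b j) - beta)"
      using norm_triangle_ineq[of "(u j (Suc (n j)) - bet (b j)) - (u j (Suc (n j)) - \<xi> j)" "bet (b j) - beta"]
        norm_triangle_ineq4[of "u j (Suc (n j)) - bet (b j)" "u j (Suc (n j)) - \<xi> j"] by simp
    ultimately show False using \<xi>(2)[of j] \<sigma>(2) s_pos by linarith
  qed
qed

end

subsection \<open>Inverse branches depending holomorphically on all parameters\<close>

text \<open>The square roots below are selected by continuity over several variables at once; along
  a one-variable slice this recovers holomorphy.\<close>

lemma sqrt_holomorphic:
  assumes "open U" "continuous_on U g" "h holomorphic_on U" "\<And>z. z \<in> U \<Longrightarrow> (g z)\<^sup>2 = h z" "\<And>z. z \<in> U \<Longrightarrow> g z \<noteq> (0::complex)"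
  shows "g holomorphic_on U"
  unfolding holomorphic_on_open[OF assms(1)]
proof
  fix z assume z: "z \<in> U"
  have hd: "(h has_field_derivative deriv h z) (at z)" using assms(1,3) z by (simp add: holomorphic_derivI)
  have gc: "g \<midarrow>z\<rightarrow> g z" using assms(1,2) z by (simp add: continuous_on_eq_continuous_at isCont_def)
  have "((\<lambda>y. (h y - h z) / (y - z) / (g y + g z)) \<longlongrightarrow> deriv h z / (g z + g z)) (at z)"
    using hd assms(5)[OF z] unfolding has_field_derivative_iff by (intro tendsto_intros gc) auto
  moreover have ev: "\<forall>\<^sub>F y in at z. y \<in> U \<and> g y + g z \<noteq> 0"
  proof (rule eventually_conj)
    show "\<forall>\<^sub>F y in at z. y \<in> U" using eventually_at_topological assms(1) z by blast
    have "((\<lambda>y. g y + g z) \<longlongrightarrow> g z + g z) (at z)" by (intro tendsto_intros gc)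
    thus "\<forall>\<^sub>F y in at z. g y + g z \<noteq> 0" by (rule tendsto_imp_eventually_ne) (use assms(5)[OF z] in auto)
  qed
  have "\<forall>\<^sub>F y in at z. (h y - h z) / (y - z) / (g y + g z) = (g y - g z) / (y - z)"
    using ev
  proof eventually_elim
    case (elim y)
    hence "h y - h z = (g y - g z) * (g y + g z)" using assms(4)[of y] assms(4)[OF z]
      by (metis power2_eq_square square_diff_square_factored mult.commute)
    thus ?case using elim by simp
  qed
  ultimately have "((\<lambda>y. (g y - g z) / (y - z)) \<longlongrightarrow> deriv h z / (g z + g z)) (at z)"
    by (rule Lim_transform_eventually)
  thus "\<exists>g'. (g has_field_derivative g') (at z)" unfolding has_field_derivative_iff by blast
qed

text \<open>The root cannot change sign on a connected set where the square oscillates by less than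
  \<open>\<rho>^2\<close>: if it had moved by exactly \<open>\<rho>\<close>, both
  \<open>S z - S x\<close> and \<open>S z + S x\<close> would have modulus at least
  \<open>\<rho>\<close>. So the sum stays large, and the difference of the squares controls that of
  the roots.\<close>

lemma sqrt_lipschitz:
  fixes S :: "'a::topological_space \<Rightarrow> complex"
  assumes conn: "connected X" and cont: "continuous_on X S" and x: "x \<in> X" "y \<in> X"
    and low: "\<And>z. z \<in> X \<Longrightarrow> \<rho> \<le> cmod (S z)" and \<rho>: "\<rho> > 0"
    and osc: "\<And>z. z \<in> X \<Longrightarrow> cmod ((S z)\<^sup>2 - (S x)\<^sup>2) < \<rho>\<^sup>2"
  shows "cmod (S y - S x) \<le> cmod ((S y)\<^sup>2 - (S x)\<^sup>2) / \<rho>"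
proof -
  have prod: "cmod ((S z)\<^sup>2 - (S x)\<^sup>2) = cmod (S z - S x) * cmod (S z + S x)" for z
    by (metis norm_mult power2_eq_square square_diff_square_factored mult.commute)
  have sumb: "cmod (S z + S x) \<ge> 2 * \<rho> - cmod (S z - S x)" if "z \<in> X" for z
  proof -
    have "cmod (2 * S x) \<le> cmod (S z + S x) + cmod (S z - S x)"
      using norm_triangle_ineq4[of "S z + S x" "S z - S x"] by simp
    thus ?thesis using low[OF x(1)] by (simp add: norm_mult)
  qed
  have lt: "cmod (S y - S x) < \<rho>"
  proof (rule ccontr)
    assume ge: "\<not> ?thesis"
    have "connected ((\<lambda>z. cmod (S z - S x)) ` X)"
      by (intro connected_continuous_image continuous_intros cont conn)
    moreover have "0 \<in> (\<lambda>z. cmod (S z - S x)) ` X" using x(1) by (intro image_eqI[of _ _ x]) auto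
    moreover have "cmod (S y - S x) \<in> (\<lambda>z. cmod (S z - S x)) ` X" using x(2) by blast
    ultimately have "{0..cmod (S y - S x)} \<subseteq> (\<lambda>z. cmod (S z - S x)) ` X" by (rule connected_contains_Icc)
    moreover have "\<rho> \<in> {0..cmod (S y - S x)}" using ge \<rho> by auto
    ultimately obtain z where z: "z \<in> X" "cmod (S z - S x) = \<rho>" by auto
    have "\<rho> * \<rho> \<le> cmod (S z - S x) * cmod (S z + S x)"
      using sumb[OF z(1)] z(2) \<rho> by (intro mult_mono) auto
    thus False using osc[OF z(1)] prod by (simp add: power2_eq_square)
  qed
  have "cmod (S y - S x) * \<rho> \<le> cmod (S y - S x) * cmod (S y + S x)"
    using sumb[OF x(2)] lt by (intro mult_left_mono) auto
  thus ?thesis using \<rho> by (simp add: prod field_simps)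
qed

text \<open>\<open>trap\<close> keeps orbits that come near \<open>EE\<close> at distance
  \<open>2 * \<rho>^2\<close> from the critical value, hence pulled back points at distance
  \<open>\<rho>\<close> from the critical point. The cube in the bound on \<open>\<delta>1\<close>
  serves \<open>sqrt_lipschitz\<close>: an oscillation of order \<open>cmod b / \<rho>\<close> has
  to stay below \<open>\<rho>^2\<close>.\<close>

locale parab_branch = parab_glob +
  fixes \<sigma> \<rho> \<delta>1 :: real
  assumes sig: "\<sigma> > 0" "\<sigma> \<le> s / 32" and sep: "\<And>\<xi> p. \<xi> \<in> EE \<Longrightarrow> p \<in> PC \<Longrightarrow> 4 * \<sigma> \<le> dist \<xi> p"
    and rho: "\<rho> > 0" "\<rho> \<le> 1/8" and d1: "\<delta>1 > 0" "\<delta>1 \<le> \<delta>0" "\<delta>1 \<le> \<rho> ^ 3 / 48"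
    and near_EE: "\<And>b x k. cmod b < \<delta>1 \<Longrightarrow> x \<in> SS b \<Longrightarrow> 3 * s / 4 \<le> cmod (x k - beta) \<Longrightarrow> \<exists>\<xi>\<in>EE. cmod (x k - \<xi>) < \<sigma>"
    and trap: "\<And>b u n \<xi>. cmod b < \<delta>1 \<Longrightarrow> recur b u \<Longrightarrow> cmod (u 0) \<le> 4 \<Longrightarrow> \<xi> \<in> EE \<Longrightarrow>
       cmod (u (Suc n) - \<xi>) < 2 * \<sigma> \<Longrightarrow> 2 * \<rho>\<^sup>2 \<le> cmod (u 1 - cc 0)"
begin

lemma b_small:
  assumes "cmod b < \<delta>1"
  shows "cmod b < \<delta>0" "cmod b \<le> 1/48" "48 * cmod b < \<rho> ^ 3" "48 * cmod b \<le> \<rho>\<^sup>2" "2 * cmod b / \<rho> \<le> \<rho> / 2"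
    "8 * (2 * cmod b / \<rho> + cmod b) < \<rho>\<^sup>2" "7 * cmod b \<le> \<rho>\<^sup>2"
proof -
  show "cmod b < \<delta>0" using assms d1 by linarith
  thus "cmod b \<le> 1/48" using d0_le by linarith
  show 1: "48 * cmod b < \<rho> ^ 3" using assms d1(3) by linarith
  have "\<rho> ^ 3 \<le> \<rho> ^ 2" using rho by (intro power_decreasing) auto
  thus 2: "48 * cmod b \<le> \<rho>\<^sup>2" using 1 by linarith
  thus "7 * cmod b \<le> \<rho>\<^sup>2" using norm_ge_zero[of b] by linarith
  have "2 * cmod b \<le> \<rho>\<^sup>2 / 2" using 2 norm_ge_zero[of b] by linarith
  thus "2 * cmod b / \<rho> \<le> \<rho> / 2" using rho by (simp add: field_simps power2_eq_square)
  have "cmod b / \<rho> < \<rho>\<^sup>2 / 48" using 1 rho(1) by (simp add: field_simps power2_eq_square power3_eq_cube)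
  moreover have "cmod b \<le> cmod b / \<rho>"
  proof -
    have "cmod b * \<rho> \<le> cmod b * 1" using rho by (intro mult_left_mono) auto
    thus ?thesis using rho(1) by (simp add: field_simps)
  qed
  moreover have "2 * cmod b / \<rho> = 2 * (cmod b / \<rho>)" by simp
  ultimately show "8 * (2 * cmod b / \<rho> + cmod b) < \<rho>\<^sup>2" using zero_le_power2[of \<rho>] by argo
qed

text \<open>A square root needs the distance to the moving critical value
  \<open>cc b + b * \<zeta>\<close>; half of the margin in \<open>trap\<close> pays for the
  move.\<close>

lemma trap':
  assumes "cmod b < \<delta>1" "recur b u" "cmod (u 0) \<le> 4" "\<xi> \<in> EE" "cmod (u (Suc n) - \<xi>) < 2 * \<sigma>" "cmod \<zeta> \<le> 4"
  shows "\<rho>\<^sup>2 \<le> cmod (u 1 - cc b - b * \<zeta>)"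
proof -
  have "2 * \<rho>\<^sup>2 \<le> cmod (u 1 - cc 0)" using trap assms by blast
  also have "u 1 - cc 0 = (u 1 - cc b - b * \<zeta>) + ((cc b - cc 0) + b * \<zeta>)" by simp
  also have "cmod ... \<le> cmod (u 1 - cc b - b * \<zeta>) + (3 * cmod b + cmod b * 4)"
  proof (intro norm_triangle_le add_mono order_refl)
    show "cmod (cc b - cc 0) \<le> 3 * cmod b" using b_small(2)[OF assms(1)] by (intro norm_cc_diff) auto
    show "cmod (b * \<zeta>) \<le> cmod b * 4" unfolding norm_mult using assms(6) by (intro mult_left_mono) auto
  qed
  finally show ?thesis using b_small(7)[OF assms(1)] by linarith
qed

text \<open>Holomorphy in three variables, encoded as joint continuity together with holomorphy
  along all holomorphic curves. This form is stable under substitution and uniform limits, and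
  one-variable Cauchy estimates apply to it directly.\<close>

definition hol3 :: "complex \<Rightarrow> (complex \<Rightarrow> complex \<Rightarrow> complex \<Rightarrow> complex) \<Rightarrow> bool" where
  "hol3 \<xi>0 f \<longleftrightarrow> continuous_on (ball \<xi>0 (2 * \<sigma>) \<times> ball 0 4 \<times> ball 0 \<delta>1) (\<lambda>(\<xi>, \<zeta>, b). f \<xi> \<zeta> b) \<and>
     (\<forall>U \<gamma>1 \<gamma>2 \<gamma>3. open U \<longrightarrow> \<gamma>1 holomorphic_on U \<longrightarrow> \<gamma>2 holomorphic_on U \<longrightarrow> \<gamma>3 holomorphic_on U \<longrightarrow>
        \<gamma>1 ` U \<subseteq> ball \<xi>0 (2 * \<sigma>) \<longrightarrow> \<gamma>2 ` U \<subseteq> ball 0 4 \<longrightarrow> \<gamma>3 ` U \<subseteq> ball 0 \<delta>1 \<longrightarrow>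
        (\<lambda>t. f (\<gamma>1 t) (\<gamma>2 t) (\<gamma>3 t)) holomorphic_on U)"

text \<open>\<open>f \<xi> \<zeta> b\<close> is the point \<open>n\<close> steps before
  \<open>\<xi>\<close>, and \<open>\<zeta>\<close> is the point preceding it. The recursion has
  order two, so a backward branch needs this extra datum, but its dependence on it is only of order
  \<open>cmod b\<close>. The bound 3, the same for all \<open>n\<close>, feeds the uniform Cauchy
  estimates.\<close>

definition branch :: "complex \<Rightarrow> nat \<Rightarrow> (complex \<Rightarrow> complex \<Rightarrow> complex \<Rightarrow> complex) \<Rightarrow> bool" where
  "branch \<xi>0 n f \<longleftrightarrow> hol3 \<xi>0 f \<and> (\<forall>\<xi> \<zeta> b. \<xi> \<in> ball \<xi>0 (2 * \<sigma>) \<longrightarrow> \<zeta> \<in> ball 0 4 \<longrightarrow> b \<in> ball 0 \<delta>1 \<longrightarrow>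
     cmod (f \<xi> \<zeta> b) < 3 \<and> (n > 0 \<longrightarrow> \<rho> \<le> cmod (f \<xi> \<zeta> b)) \<and>
     (\<exists>u. recur b u \<and> u 0 = \<zeta> \<and> u 1 = f \<xi> \<zeta> b \<and> u (Suc n) = \<xi>) \<and>
     (\<forall>\<zeta>'\<in>ball 0 4. cmod (f \<xi> \<zeta> b - f \<xi> \<zeta>' b) \<le> 2 * cmod b / \<rho> * cmod (\<zeta> - \<zeta>')))"

lemma branch_0: "\<xi>0 \<in> EE \<Longrightarrow> branch \<xi>0 0 (\<lambda>\<xi> \<zeta> b. \<xi>)"
  unfolding branch_def hol3_def
proof (intro conjI allI impI ballI)
  assume E: "\<xi>0 \<in> EE"
  show "continuous_on (ball \<xi>0 (2 * \<sigma>) \<times> ball 0 4 \<times> ball 0 \<delta>1) (\<lambda>(\<xi>, \<zeta>, b). \<xi>)"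
    by (simp add: case_prod_unfold continuous_on_fst)
  fix \<xi> \<zeta> b assume x: "\<xi> \<in> ball \<xi>0 (2 * \<sigma>)"
  have "cmod \<xi> \<le> cmod \<xi>0 + cmod (\<xi>0 - \<xi>)" using norm_triangle_ineq4[of \<xi>0 "\<xi>0 - \<xi>"] by simp
  thus "cmod \<xi> < 3" using x E sig s_pos by (simp add: EE_def dist_norm)
  define u where "u = rec_nat (\<zeta>, \<xi>) (\<lambda>n (y, x). (x, x\<^sup>2 + cc b + b * y))"
  have u: "u 0 = (\<zeta>, \<xi>)" "u (Suc n) = (snd (u n), (snd (u n))\<^sup>2 + cc b + b * fst (u n))" for n
    by (auto simp: u_def case_prod_unfold)
  show "\<exists>u. recur b u \<and> u 0 = \<zeta> \<and> u 1 = \<xi> \<and> u (Suc 0) = \<xi>"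
    by (intro exI[of _ "\<lambda>n. fst (u n)"]) (auto simp: recur_def u)
qed (use rho in auto)

text \<open>The new value \<open>t\<close> must satisfy
  \<open>t^2 = f \<xi> t b - cc b - b * \<zeta>\<close>, with \<open>t\<close> on both sides. A
  continuous root of the right side is chosen over the independent variables
  \<open>(\<xi>, t, \<zeta>, b)\<close>; then \<open>t\<close> is its fixed point, and the root
  contracts in \<open>t\<close> because \<open>f\<close> depends weakly on its second
  argument.\<close>

lemma branch_step:
  assumes E: "\<xi>0 \<in> EE" and f: "branch \<xi>0 n f"
    and tg: "\<xi>s \<in> ball \<xi>0 (2 * \<sigma>)" "ts \<in> ball 0 4" "\<zeta>s \<in> ball 0 4" "bs \<in> ball 0 \<delta>1"
      "ts\<^sup>2 + cc bs + bs * \<zeta>s = f \<xi>s ts bs"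
  shows "\<exists>f'. branch \<xi>0 (Suc n) f' \<and> f' \<xi>s \<zeta>s bs = ts \<and>
     (\<forall>\<xi> \<zeta> b. \<xi> \<in> ball \<xi>0 (2 * \<sigma>) \<longrightarrow> \<zeta> \<in> ball 0 4 \<longrightarrow> b \<in> ball 0 \<delta>1 \<longrightarrow>
        (f' \<xi> \<zeta> b)\<^sup>2 + cc b + b * \<zeta> = f \<xi> (f' \<xi> \<zeta> b) b)"
proof -
  let ?D = "ball \<xi>0 (2 * \<sigma>)" and ?Z = "ball 0 4 :: complex set" and ?B = "ball 0 \<delta>1 :: complex set"
  let ?X = "?D \<times> ?Z \<times> ?Z \<times> ?B"
  have fh: "hol3 \<xi>0 f" and f3: "\<And>\<xi> \<zeta> b. \<xi> \<in> ?D \<Longrightarrow> \<zeta> \<in> ?Z \<Longrightarrow> b \<in> ?B \<Longrightarrow> cmod (f \<xi> \<zeta> b) < 3"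
    and fr: "\<And>\<xi> \<zeta> b. \<xi> \<in> ?D \<Longrightarrow> \<zeta> \<in> ?Z \<Longrightarrow> b \<in> ?B \<Longrightarrow> \<exists>u. recur b u \<and> u 0 = \<zeta> \<and> u 1 = f \<xi> \<zeta> b \<and> u (Suc n) = \<xi>"
    and fl: "\<And>\<xi> \<zeta> b \<zeta>'. \<xi> \<in> ?D \<Longrightarrow> \<zeta> \<in> ?Z \<Longrightarrow> b \<in> ?B \<Longrightarrow> \<zeta>' \<in> ?Z \<Longrightarrow> cmod (f \<xi> \<zeta> b - f \<xi> \<zeta>' b) \<le> 2 * cmod b / \<rho> * cmod (\<zeta> - \<zeta>')"
    using f unfolding branch_def by blast+
  have fc: "continuous_on (?D \<times> ?Z \<times> ?B) (\<lambda>p. f (fst p) (fst (snd p)) (snd (snd p)))"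
    using fh unfolding hol3_def by (simp add: case_prod_unfold)
  define Q where "Q p = f (fst p) (fst (snd p)) (snd (snd (snd p))) - cc (snd (snd (snd p))) - snd (snd (snd p)) * fst (snd (snd p))" for p :: "complex \<times> complex \<times> complex \<times> complex"
  \<comment> \<open>The orbit through \<open>t\<close> and \<open>f \<xi> t b\<close> ends at
    \<open>\<xi>\<close>, near \<open>EE\<close>, so the trap keeps the radicand away from
    0.\<close>
  have Qlow: "\<rho>\<^sup>2 \<le> cmod (Q p)" if p: "p \<in> ?X" for p
  proof -
    obtain u where u: "recur (snd (snd (snd p))) u" "u 0 = fst (snd p)" "u 1 = f (fst p) (fst (snd p)) (snd (snd (snd p)))" "u (Suc n) = fst p"
      using fr[of "fst p" "fst (snd p)" "snd (snd (snd p))"] p by auto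
    have "\<rho>\<^sup>2 \<le> cmod (u 1 - cc (snd (snd (snd p))) - snd (snd (snd p)) * fst (snd (snd p)))"
      by (rule trap'[OF _ u(1) _ E, of n]) (use p u in \<open>auto simp: dist_norm norm_minus_commute\<close>)
    thus ?thesis by (simp only: Q_def u)
  qed
  have Qup: "cmod (Q p) < 9" if p: "p \<in> ?X" for p
  proof -
    let ?b = "snd (snd (snd p))"
    have b: "cmod ?b < \<delta>1" using p by auto
    have "cmod (Q p) \<le> cmod (f (fst p) (fst (snd p)) ?b) + cmod (cc ?b) + cmod (?b * fst (snd (snd p)))"
      unfolding Q_def by (intro norm_triangle_le_diff add_mono order_refl)
    moreover have "cmod (f (fst p) (fst (snd p)) ?b) < 3" using p by (intro f3) auto
    moreover have "cmod (cc ?b) \<le> cmod (cc 0) + 3 * cmod ?b"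
      using norm_triangle_ineq[of "cc ?b - cc 0" "cc 0"] norm_cc_diff[of ?b] b_small(2)[OF b] by simp
    moreover have "cmod (?b * fst (snd (snd p))) \<le> 1 * 4"
      unfolding norm_mult using p b_small(2)[OF b] by (intro mult_mono) auto
    ultimately show ?thesis using norm_cc0 b_small(2)[OF b] by linarith
  qed
  have Qc: "continuous_on ?X Q"
    unfolding Q_def cc_def bet_def
  proof (intro continuous_intros)
    show "continuous_on ?X (\<lambda>p. f (fst p) (fst (snd p)) (snd (snd (snd p))))"
      by (rule continuous_on_compose2[OF fc, of ?X "\<lambda>p. (fst p, fst (snd p), snd (snd (snd p)))", simplified])
        (auto intro!: continuous_intros)
  qed (use l_nz in auto)
  have Qnz: "Q p \<noteq> 0" if "p \<in> ?X" for p using Qlow[OF that] rho by auto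
  \<comment> \<open>A product of discs is convex, so a global root exists; its sign is set by the
    prescribed value \<open>ts\<close>.\<close>
  have "contractible ?X" by (intro convex_imp_contractible convex_Times convex_ball)
  then obtain S0 where S0: "continuous_on ?X S0" "\<And>p. p \<in> ?X \<Longrightarrow> Q p = (S0 p)\<^sup>2"
    using continuous_sqrt_on_contractible[OF Qc _ Qnz] by blast
  have ps: "(\<xi>s, ts, \<zeta>s, bs) \<in> ?X" using tg by auto
  have "Q (\<xi>s, ts, \<zeta>s, bs) = ts\<^sup>2" using tg(5) by (simp add: Q_def algebra_simps)
  hence "S0 (\<xi>s, ts, \<zeta>s, bs) = ts \<or> - S0 (\<xi>s, ts, \<zeta>s, bs) = ts"
    using S0(2)[OF ps] by (metis minus_minus power2_eq_iff)
  then obtain S where S: "continuous_on ?X S" "\<And>p. p \<in> ?X \<Longrightarrow> (S p)\<^sup>2 = Q p" "S (\<xi>s, ts, \<zeta>s, bs) = ts"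
  proof
    assume "S0 (\<xi>s, ts, \<zeta>s, bs) = ts" thus ?thesis using that[of S0] S0 by auto
  next
    assume "- S0 (\<xi>s, ts, \<zeta>s, bs) = ts" thus ?thesis
      using that[of "\<lambda>p. - S0 p"] S0 by (auto intro!: continuous_intros)
  qed
  have Slow: "\<rho> \<le> cmod (S p)" if "p \<in> ?X" for p
  proof -
    have "\<rho>\<^sup>2 \<le> (cmod (S p))\<^sup>2" using Qlow[OF that] S(2)[OF that] by (metis norm_power)
    thus ?thesis by (rule power2_le_imp_le) simp
  qed
  have Sup: "cmod (S p) < 3" if "p \<in> ?X" for p
  proof -
    have "(cmod (S p))\<^sup>2 < 3\<^sup>2" using Qup[OF that] S(2)[OF that] by (simp flip: norm_power)
    thus ?thesis by (rule power_less_imp_less_base) simp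
  qed
  have Slip: "cmod (S (\<xi>, t', \<zeta>', b) - S (\<xi>, t, \<zeta>, b)) \<le> (2 * cmod b / \<rho> * cmod (t' - t) + cmod b * cmod (\<zeta>' - \<zeta>)) / \<rho>"
    if h: "\<xi> \<in> ?D" "b \<in> ?B" "t \<in> ?Z" "t' \<in> ?Z" "\<zeta> \<in> ?Z" "\<zeta>' \<in> ?Z" for \<xi> t t' \<zeta> \<zeta>' b
  proof -
    have b: "cmod b < \<delta>1" using h by simp
    define R where "R = (\<lambda>r :: complex \<times> complex. S (\<xi>, fst r, snd r, b))"
    have Qd: "cmod ((R r)\<^sup>2 - (R (t, \<zeta>))\<^sup>2) \<le> 2 * cmod b / \<rho> * cmod (fst r - t) + cmod b * cmod (snd r - \<zeta>)" if r: "r \<in> ?Z \<times> ?Z" for r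
    proof -
      have "(R r)\<^sup>2 - (R (t, \<zeta>))\<^sup>2 = (f \<xi> (fst r) b - f \<xi> t b) - b * (snd r - \<zeta>)"
      proof -
        have eq: "(R r)\<^sup>2 = Q (\<xi>, fst r, snd r, b)" "(R (t, \<zeta>))\<^sup>2 = Q (\<xi>, t, \<zeta>, b)"
          unfolding R_def fst_conv snd_conv using h r by (intro S(2); auto)+
        show ?thesis unfolding eq Q_def by (simp add: algebra_simps)
      qed
      also have "cmod ... \<le> 2 * cmod b / \<rho> * cmod (fst r - t) + cmod b * cmod (snd r - \<zeta>)"
        by (rule norm_triangle_le_diff, rule add_mono) (use fl[of \<xi> "fst r" b t] h r in \<open>auto simp: norm_mult\<close>)
      finally show ?thesis .
    qed
    have d8: "cmod (x - y) \<le> 8" if "x \<in> ?Z" "y \<in> ?Z" for x y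
      using that norm_triangle_ineq4[of x y] by simp
    have "cmod (R (t', \<zeta>') - R (t, \<zeta>)) \<le> cmod ((R (t', \<zeta>'))\<^sup>2 - (R (t, \<zeta>))\<^sup>2) / \<rho>"
    proof (rule sqrt_lipschitz[of "?Z \<times> ?Z"])
      show "connected (?Z \<times> ?Z)" by (intro convex_connected convex_Times convex_ball)
      show "continuous_on (?Z \<times> ?Z) R"
        unfolding R_def by (rule continuous_on_compose2[OF S(1)]) (use h in \<open>auto intro!: continuous_intros\<close>)
      show "\<rho> \<le> cmod (R z)" if "z \<in> ?Z \<times> ?Z" for z unfolding R_def using that h by (intro Slow) auto
      show "cmod ((R z)\<^sup>2 - (R (t, \<zeta>))\<^sup>2) < \<rho>\<^sup>2" if z: "z \<in> ?Z \<times> ?Z" for z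
      proof -
        have "cmod ((R z)\<^sup>2 - (R (t, \<zeta>))\<^sup>2) \<le> 2 * cmod b / \<rho> * 8 + cmod b * 8"
          using rho z h by (intro order_trans[OF Qd[OF z]] add_mono mult_left_mono d8) auto
        also have "... < \<rho>\<^sup>2" using b_small(6)[OF b] by (simp add: algebra_simps)
        finally show ?thesis .
      qed
    qed (use h rho in auto)
    also have "... \<le> (2 * cmod b / \<rho> * cmod (t' - t) + cmod b * cmod (\<zeta>' - \<zeta>)) / \<rho>"
      using Qd[of "(t', \<zeta>')"] h rho by (intro divide_right_mono) auto
    finally show ?thesis by (simp add: R_def)
  qed
  have Scon: "cmod (S (\<xi>, t', \<zeta>, b) - S (\<xi>, t, \<zeta>, b)) \<le> 1/2 * cmod (t' - t)"
    if h: "\<xi> \<in> ?D" "b \<in> ?B" "t \<in> ?Z" "t' \<in> ?Z" "\<zeta> \<in> ?Z" for \<xi> t t' \<zeta> b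
  proof -
    have b: "cmod b < \<delta>1" using h by simp
    have "cmod (S (\<xi>, t', \<zeta>, b) - S (\<xi>, t, \<zeta>, b)) \<le> (2 * cmod b / \<rho>) * cmod (t' - t) / \<rho>"
      using Slip[OF h h(5)] by simp
    also have "... \<le> (\<rho> / 2) * cmod (t' - t) / \<rho>"
      using b_small(5)[OF b] rho by (intro divide_right_mono mult_right_mono) auto
    finally show ?thesis using rho by simp
  qed
  \<comment> \<open>Picard iterates started at 0. Their uniform convergence transfers continuity and
    holomorphy to the fixed point \<open>F\<close>.\<close>
  define T where "T = rec_nat (\<lambda>\<xi> \<zeta> b. 0) (\<lambda>k g \<xi> \<zeta> b. S (\<xi>, g \<xi> \<zeta> b, \<zeta>, b))"
  have T0: "T 0 \<xi> \<zeta> b = 0" and TS: "T (Suc k) \<xi> \<zeta> b = S (\<xi>, T k \<xi> \<zeta> b, \<zeta>, b)" for k \<xi> \<zeta> b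
    by (simp_all add: T_def)
  have T3: "cmod (T k \<xi> \<zeta> b) < 3" if "\<xi> \<in> ?D" "\<zeta> \<in> ?Z" "b \<in> ?B" for k \<xi> \<zeta> b
  proof (induction k)
    case (Suc k) thus ?case unfolding TS using that by (intro Sup) auto
  qed (simp add: T0)
  have fixpt: "\<exists>t. cmod t < 3 \<and> S (\<xi>, t, \<zeta>, b) = t" if h: "\<xi> \<in> ?D" "\<zeta> \<in> ?Z" "b \<in> ?B" for \<xi> \<zeta> b
  proof -
    have "\<exists>!t\<in>cball 0 3. S (\<xi>, t, \<zeta>, b) = t"
    proof (rule Banach_fix[where c = "1/2"])
      show "complete (cball 0 3 :: complex set)" by (simp add: complete_eq_closed)
      show "(\<lambda>t. S (\<xi>, t, \<zeta>, b)) ` cball 0 3 \<subseteq> cball 0 3"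
      proof (rule image_subsetI)
        fix t :: complex assume "t \<in> cball 0 3"
        hence "cmod (S (\<xi>, t, \<zeta>, b)) < 3" using h by (intro Sup) auto
        thus "S (\<xi>, t, \<zeta>, b) \<in> cball 0 3" by simp
      qed
      show "dist (S (\<xi>, x, \<zeta>, b)) (S (\<xi>, y, \<zeta>, b)) \<le> 1/2 * dist x y" if "x \<in> cball 0 3" "y \<in> cball 0 3" for x y
        using Scon[of \<xi> b y x \<zeta>] h that by (simp add: dist_norm)
    qed auto
    then obtain t where t: "t \<in> cball 0 3" "S (\<xi>, t, \<zeta>, b) = t" by blast
    have "cmod (S (\<xi>, t, \<zeta>, b)) < 3" using t h by (intro Sup) auto
    thus ?thesis using t by auto
  qed
  define F where "F \<xi> \<zeta> b = (SOME t. cmod t < 3 \<and> S (\<xi>, t, \<zeta>, b) = t)" for \<xi> \<zeta> b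
  have F: "cmod (F \<xi> \<zeta> b) < 3" "S (\<xi>, F \<xi> \<zeta> b, \<zeta>, b) = F \<xi> \<zeta> b" if "\<xi> \<in> ?D" "\<zeta> \<in> ?Z" "b \<in> ?B" for \<xi> \<zeta> b
    using someI_ex[OF fixpt[OF that]] by (auto simp: F_def)
  have Funiq: "t = F \<xi> \<zeta> b" if h: "\<xi> \<in> ?D" "\<zeta> \<in> ?Z" "b \<in> ?B" and t: "t \<in> ?Z" "S (\<xi>, t, \<zeta>, b) = t" for t \<xi> \<zeta> b
    using Scon[OF h(1,3) _ t(1) h(2), of "F \<xi> \<zeta> b"] F[OF h] t by auto
  have Tlim: "cmod (T k \<xi> \<zeta> b - F \<xi> \<zeta> b) \<le> 3 * (1/2) ^ k" if h: "\<xi> \<in> ?D" "\<zeta> \<in> ?Z" "b \<in> ?B" for k \<xi> \<zeta> b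
  proof (induction k)
    case 0 thus ?case using F(1)[OF h] by (simp add: T0)
  next
    case (Suc k)
    have "cmod (T (Suc k) \<xi> \<zeta> b - F \<xi> \<zeta> b) = cmod (S (\<xi>, T k \<xi> \<zeta> b, \<zeta>, b) - S (\<xi>, F \<xi> \<zeta> b, \<zeta>, b))"
      using F(2)[OF h] by (simp add: TS)
    also have "... \<le> 1/2 * cmod (T k \<xi> \<zeta> b - F \<xi> \<zeta> b)"
      using T3[OF h, of k] F(1)[OF h] h by (intro Scon) auto
    finally show ?case using Suc by simp
  qed
  have lim0: "(\<lambda>k. 3 * (1/2) ^ k :: real) \<longlonglongrightarrow> 0"
    using tendsto_mult[OF tendsto_const LIMSEQ_realpow_zero[of "1/2"], of 3] by simp
  have unif: "uniform_limit A (\<lambda>k x. T k (g1 x) (g2 x) (g3 x)) (\<lambda>x. F (g1 x) (g2 x) (g3 x)) sequentially"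
    if "\<And>x. x \<in> A \<Longrightarrow> g1 x \<in> ?D" "\<And>x. x \<in> A \<Longrightarrow> g2 x \<in> ?Z" "\<And>x. x \<in> A \<Longrightarrow> g3 x \<in> ?B" for A :: "'z set" and g1 g2 g3
    unfolding uniform_limit_iff
  proof (intro allI impI)
    fix e :: real assume "e > 0"
    hence "\<forall>\<^sub>F k in sequentially. 3 * (1/2) ^ k < e" using order_tendstoD(2)[OF lim0] by blast
    thus "\<forall>\<^sub>F k in sequentially. \<forall>x\<in>A. dist (T k (g1 x) (g2 x) (g3 x)) (F (g1 x) (g2 x) (g3 x)) < e"
    proof eventually_elim
      case (elim k)
      show ?case
      proof
        fix x assume "x \<in> A"
        thus "dist (T k (g1 x) (g2 x) (g3 x)) (F (g1 x) (g2 x) (g3 x)) < e"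
          using Tlim[of "g1 x" "g2 x" "g3 x" k] that elim unfolding dist_norm by fastforce
      qed
    qed
  qed
  have Tc: "continuous_on (?D \<times> ?Z \<times> ?B) (\<lambda>p. T k (fst p) (fst (snd p)) (snd (snd p)))" for k
  proof (induction k)
    case (Suc k)
    show ?case unfolding TS
    proof (rule continuous_on_compose2[OF S(1)])
      show "continuous_on (?D \<times> ?Z \<times> ?B) (\<lambda>x. (fst x, T k (fst x) (fst (snd x)) (snd (snd x)), fst (snd x), snd (snd x)))"
        by (intro continuous_intros Suc)
      show "(\<lambda>x. (fst x, T k (fst x) (fst (snd x)) (snd (snd x)), fst (snd x), snd (snd x))) ` (?D \<times> ?Z \<times> ?B) \<subseteq> ?X"
        using less_trans[OF T3, of _ _ _ 4] by auto
    qed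
  qed (simp add: T0)
  have Fc: "continuous_on (?D \<times> ?Z \<times> ?B) (\<lambda>p. F (fst p) (fst (snd p)) (snd (snd p)))"
    by (rule uniform_limit_theorem[OF always_eventually[OF allI[OF Tc]] unif]) auto
  have Th: "(\<lambda>t. T k (\<gamma>1 t) (\<gamma>2 t) (\<gamma>3 t)) holomorphic_on U"
    if h: "open U" "\<gamma>1 holomorphic_on U" "\<gamma>2 holomorphic_on U" "\<gamma>3 holomorphic_on U"
      "\<gamma>1 ` U \<subseteq> ?D" "\<gamma>2 ` U \<subseteq> ?Z" "\<gamma>3 ` U \<subseteq> ?B" for k U \<gamma>1 \<gamma>2 \<gamma>3
  proof (induction k)
    case (Suc k)
    have i: "\<gamma>1 t \<in> ?D" "\<gamma>2 t \<in> ?Z" "\<gamma>3 t \<in> ?B" if "t \<in> U" for t using h that by blast+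
    let ?p = "\<lambda>t. (\<gamma>1 t, T k (\<gamma>1 t) (\<gamma>2 t) (\<gamma>3 t), \<gamma>2 t, \<gamma>3 t)"
    have TZ: "T k (\<gamma>1 t) (\<gamma>2 t) (\<gamma>3 t) \<in> ?Z" if "t \<in> U" for t using T3[OF i[OF that], of k] by simp
    have p: "?p t \<in> ?X" if "t \<in> U" for t using i[OF that] TZ[OF that] by simp
    show ?case unfolding TS
    proof (rule sqrt_holomorphic[OF h(1)])
      have c: "continuous_on U \<gamma>1" "continuous_on U \<gamma>2" "continuous_on U \<gamma>3" "continuous_on U (\<lambda>t. T k (\<gamma>1 t) (\<gamma>2 t) (\<gamma>3 t))"
        using h Suc by (auto intro: holomorphic_on_imp_continuous_on)
      show "continuous_on U (\<lambda>t. S (?p t))"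
        by (rule continuous_on_compose2[OF S(1)]) (use p c in \<open>auto intro!: continuous_intros\<close>)
      have "(\<lambda>t. f (\<gamma>1 t) (T k (\<gamma>1 t) (\<gamma>2 t) (\<gamma>3 t)) (\<gamma>3 t)) holomorphic_on U"
        using fh h Suc TZ unfolding hol3_def by (blast intro: image_subsetI)
      thus "(\<lambda>t. Q (?p t)) holomorphic_on U"
        unfolding Q_def cc_def bet_def using h l_nz by (auto intro!: holomorphic_intros)
      show "(S (?p t))\<^sup>2 = Q (?p t)" if "t \<in> U" for t by (rule S(2)[OF p[OF that]])
      show "S (?p t) \<noteq> 0" if "t \<in> U" for t using Slow[OF p[OF that]] rho by auto
    qed
  qed (simp add: T0)
  have Fh: "(\<lambda>t. F (\<gamma>1 t) (\<gamma>2 t) (\<gamma>3 t)) holomorphic_on U"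
    if h: "open U" "\<gamma>1 holomorphic_on U" "\<gamma>2 holomorphic_on U" "\<gamma>3 holomorphic_on U"
      "\<gamma>1 ` U \<subseteq> ?D" "\<gamma>2 ` U \<subseteq> ?Z" "\<gamma>3 ` U \<subseteq> ?B" for U \<gamma>1 \<gamma>2 \<gamma>3
  proof (rule holomorphic_uniform_sequence[OF h(1) Th[OF h]])
    fix x assume "x \<in> U"
    then obtain d where d: "d > 0" "cball x d \<subseteq> U" using h(1) open_contains_cball by blast
    have "uniform_limit (cball x d) (\<lambda>k t. T k (\<gamma>1 t) (\<gamma>2 t) (\<gamma>3 t)) (\<lambda>t. F (\<gamma>1 t) (\<gamma>2 t) (\<gamma>3 t)) sequentially"
      by (rule unif) (use d h in blast)+
    thus "\<exists>d>0. cball x d \<subseteq> U \<and> uniform_limit (cball x d) (\<lambda>k t. T k (\<gamma>1 t) (\<gamma>2 t) (\<gamma>3 t)) (\<lambda>t. F (\<gamma>1 t) (\<gamma>2 t) (\<gamma>3 t)) sequentially"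
      using d by blast
  qed
  have FZ: "F \<xi> \<zeta> b \<in> ?Z" "(\<xi>, F \<xi> \<zeta> b, \<zeta>, b) \<in> ?X" if h: "\<xi> \<in> ?D" "\<zeta> \<in> ?Z" "b \<in> ?B" for \<xi> \<zeta> b
    using F(1)[OF h] h by auto
  have rel: "(F \<xi> \<zeta> b)\<^sup>2 + cc b + b * \<zeta> = f \<xi> (F \<xi> \<zeta> b) b" if h: "\<xi> \<in> ?D" "\<zeta> \<in> ?Z" "b \<in> ?B" for \<xi> \<zeta> b
  proof -
    have "(F \<xi> \<zeta> b)\<^sup>2 = Q (\<xi>, F \<xi> \<zeta> b, \<zeta>, b)" using S(2)[OF FZ(2)[OF h]] F(2)[OF h] by simp
    thus ?thesis by (simp add: Q_def)
  qed
  have "branch \<xi>0 (Suc n) F"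
    unfolding branch_def
  proof (intro conjI allI impI ballI)
    show "hol3 \<xi>0 F" unfolding hol3_def using Fc Fh by (simp add: case_prod_unfold)
    fix \<xi> \<zeta> b assume h: "\<xi> \<in> ?D" "\<zeta> \<in> ?Z" "b \<in> ?B"
    show "cmod (F \<xi> \<zeta> b) < 3" by (rule F(1)[OF h])
    show "\<rho> \<le> cmod (F \<xi> \<zeta> b)" using Slow[OF FZ(2)[OF h]] F(2)[OF h] by simp
    obtain u where u: "recur b u" "u 0 = F \<xi> \<zeta> b" "u 1 = f \<xi> (F \<xi> \<zeta> b) b" "u (Suc n) = \<xi>"
      using fr[OF h(1) FZ(1)[OF h] h(3)] by blast
    show "\<exists>u. recur b u \<and> u 0 = \<zeta> \<and> u 1 = F \<xi> \<zeta> b \<and> u (Suc (Suc n)) = \<xi>"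
    proof (intro exI[of _ "case_nat \<zeta> u"] conjI)
      show "recur b (case_nat \<zeta> u)" unfolding recur_def
      proof
        fix k show "case_nat \<zeta> u (Suc (Suc k)) = (case_nat \<zeta> u (Suc k))\<^sup>2 + cc b + b * case_nat \<zeta> u k"
          using u rel[OF h] by (cases k) (auto simp: recur_def)
      qed
    qed (use u in auto)
    fix \<zeta>' assume z: "\<zeta>' \<in> ?Z"
    note h' = h(1) z h(3)
    have b: "cmod b < \<delta>1" using h by simp
    define d where "d = cmod (F \<xi> \<zeta> b - F \<xi> \<zeta>' b)"
    \<comment> \<open>The Lipschitz bound in \<open>\<zeta>\<close> reproduces itself:
      \<open>d\<close> recurs on the right with factor at most \<open>1 / 2\<close>, which restores
      the constant \<open>2 * cmod b / \<rho>\<close> at the next depth.\<close>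
    have "d \<le> (2 * cmod b / \<rho> * d + cmod b * cmod (\<zeta> - \<zeta>')) / \<rho>"
      using Slip[OF h(1,3) FZ(1)[OF h'] FZ(1)[OF h] z h(2)] F(2)[OF h] F(2)[OF h'] by (simp add: d_def)
    also have "... \<le> (\<rho> / 2 * d + cmod b * cmod (\<zeta> - \<zeta>')) / \<rho>"
      using b_small(5)[OF b] rho by (intro divide_right_mono add_mono mult_right_mono) (auto simp: d_def)
    also have "... = d / 2 + cmod b / \<rho> * cmod (\<zeta> - \<zeta>')" using rho by (simp add: field_simps)
    finally show "d \<le> 2 * cmod b / \<rho> * cmod (\<zeta> - \<zeta>')" by simp
  qed
  moreover have "F \<xi>s \<zeta>s bs = ts" using Funiq[OF tg(1,3,4,2) S(3)] by simp
  ultimately show ?thesis using rel by blast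
qed

end

section \<open>Branches along a backward orbit and their contraction\<close>

context parab_branch
begin

definition bseq :: "complex \<Rightarrow> (nat \<Rightarrow> complex) \<Rightarrow> bool" where
  "bseq b X \<longleftrightarrow> (\<forall>n. (X (Suc n))\<^sup>2 + cc b + b * X (Suc (Suc n)) = X n)"

definition branch_seq :: "complex \<Rightarrow> (nat \<Rightarrow> complex \<Rightarrow> complex \<Rightarrow> complex \<Rightarrow> complex) \<Rightarrow> bool" where
  "branch_seq \<xi>0 G \<longleftrightarrow> G 0 = (\<lambda>\<xi> \<zeta> b. \<xi>) \<and> (\<forall>n. branch \<xi>0 n (G n) \<and>
     (\<forall>\<xi> \<zeta> b. \<xi> \<in> ball \<xi>0 (2 * \<sigma>) \<longrightarrow> \<zeta> \<in> ball 0 4 \<longrightarrow> b \<in> ball 0 \<delta>1 \<longrightarrow>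
        (G (Suc n) \<xi> \<zeta> b)\<^sup>2 + cc b + b * \<zeta> = G n \<xi> (G (Suc n) \<xi> \<zeta> b) b))"

text \<open>The backward orbit \<open>X\<close> selects the sign of the root at each depth. The
  relation in \<open>branch_seq\<close> ties consecutive depths together, so that orbits for other
  endpoints and parameters can be assembled from the same branches.\<close>

lemma branch_seq_exists:
  assumes E: "\<xi>0 \<in> EE" and X: "X 0 \<in> ball \<xi>0 (2 * \<sigma>)" "\<And>n. cmod (X n) < 4" "bseq b X" and b: "cmod b < \<delta>1"
  shows "\<exists>G. branch_seq \<xi>0 G \<and> (\<forall>n. G n (X 0) (X (Suc n)) b = X n)"
proof -
  define A where "A n f \<longleftrightarrow> branch \<xi>0 n f \<and> f (X 0) (X (Suc n)) b = X n \<and> (n = 0 \<longrightarrow> f = (\<lambda>\<xi> \<zeta> b. \<xi>))" for n f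
  define B where "B n f f' \<longleftrightarrow> (\<forall>\<xi> \<zeta> b. \<xi> \<in> ball \<xi>0 (2 * \<sigma>) \<longrightarrow> \<zeta> \<in> ball 0 4 \<longrightarrow> b \<in> ball 0 \<delta>1 \<longrightarrow>
        (f' \<xi> \<zeta> b)\<^sup>2 + cc b + b * \<zeta> = f \<xi> (f' \<xi> \<zeta> b) b)" for n :: nat and f f' :: "complex \<Rightarrow> complex \<Rightarrow> complex \<Rightarrow> complex"
  have "\<exists>G. \<forall>n. A n (G n) \<and> B n (G n) (G (Suc n))"
  proof (rule dependent_nat_choice)
    show "\<exists>f. A 0 f" using branch_0[OF E] by (auto simp: A_def)
    fix f n assume A: "A n f"
    have "\<exists>f'. branch \<xi>0 (Suc n) f' \<and> f' (X 0) (X (Suc (Suc n))) b = X (Suc n) \<and> B n f f'"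
      unfolding B_def using A X b by (intro branch_step[OF E]) (auto simp: A_def bseq_def)
    thus "\<exists>f'. A (Suc n) f' \<and> B n f f'" by (auto simp: A_def)
  qed
  then obtain G where "\<And>n. A n (G n)" "\<And>n. B n (G n) (G (Suc n))" by blast
  thus ?thesis
    by (intro exI[of _ G] conjI) (simp_all add: A_def B_def branch_seq_def)
qed

lemma branchD:
  assumes "branch \<xi>0 n f" "\<xi> \<in> ball \<xi>0 (2 * \<sigma>)" "\<zeta> \<in> ball 0 4" "b \<in> ball 0 \<delta>1"
  shows "cmod (f \<xi> \<zeta> b) < 3" "n > 0 \<Longrightarrow> \<rho> \<le> cmod (f \<xi> \<zeta> b)"
    "\<exists>u. recur b u \<and> u 0 = \<zeta> \<and> u 1 = f \<xi> \<zeta> b \<and> u (Suc n) = \<xi>"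
    "\<zeta>' \<in> ball 0 4 \<Longrightarrow> cmod (f \<xi> \<zeta> b - f \<xi> \<zeta>' b) \<le> 2 * cmod b / \<rho> * cmod (\<zeta> - \<zeta>')"
  using assms unfolding branch_def by blast+

lemma branch_curve:
  assumes "branch \<xi>0 n f" "open U" "\<gamma>1 holomorphic_on U" "\<gamma>2 holomorphic_on U" "\<gamma>3 holomorphic_on U"
    "\<gamma>1 ` U \<subseteq> ball \<xi>0 (2 * \<sigma>)" "\<gamma>2 ` U \<subseteq> ball 0 4" "\<gamma>3 ` U \<subseteq> ball 0 \<delta>1"
  shows "(\<lambda>t. f (\<gamma>1 t) (\<gamma>2 t) (\<gamma>3 t)) holomorphic_on U"
  using assms unfolding branch_def hol3_def by simp

lemma branch_holomorphic:
  assumes "branch \<xi>0 n f"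
  shows "\<zeta> \<in> ball 0 4 \<Longrightarrow> b \<in> ball 0 \<delta>1 \<Longrightarrow> (\<lambda>\<xi>. f \<xi> \<zeta> b) holomorphic_on ball \<xi>0 (2 * \<sigma>)"
    "\<xi> \<in> ball \<xi>0 (2 * \<sigma>) \<Longrightarrow> b \<in> ball 0 \<delta>1 \<Longrightarrow> (\<lambda>\<zeta>. f \<xi> \<zeta> b) holomorphic_on ball 0 4"
    "\<xi> \<in> ball \<xi>0 (2 * \<sigma>) \<Longrightarrow> \<zeta> \<in> ball 0 4 \<Longrightarrow> (\<lambda>b. f \<xi> \<zeta> b) holomorphic_on ball 0 \<delta>1"
  by (rule branch_curve[OF assms open_ball]; simp add: image_subset_iff)+

text \<open>\<open>15 / (2 * \<sigma>)\<close> is \<open>5 * 3 / (2 * \<sigma>)\<close>, from the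
  bound 3 on a disc of radius \<open>2 * \<sigma>\<close>; the depth \<open>n\<close> does not
  enter.\<close>

lemma branch_lipschitz_\<xi>:
  assumes "branch \<xi>0 n f" "\<zeta> \<in> ball 0 4" "b \<in> ball 0 \<delta>1" "\<xi> \<in> ball \<xi>0 (3 * \<sigma> / 2)" "\<xi>' \<in> ball \<xi>0 (3 * \<sigma> / 2)"
  shows "cmod (f \<xi> \<zeta> b - f \<xi>' \<zeta> b) \<le> 15 / (2 * \<sigma>) * cmod (\<xi> - \<xi>')"
  using holomorphic_lipschitz[OF branch_holomorphic(1)[OF assms(1-3)], of 3 \<xi> \<xi>'] branchD(1)[OF assms(1) _ assms(2,3)] assms(4,5)
  by (auto intro: less_imp_le)

lemma branch_lipschitz_b:
  assumes "branch \<xi>0 n f" "\<xi> \<in> ball \<xi>0 (2 * \<sigma>)" "\<zeta> \<in> ball 0 4" "cmod b < 3 * \<delta>1 / 4"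
  shows "cmod (f \<xi> \<zeta> b - f \<xi> \<zeta> 0) \<le> 15 / \<delta>1 * cmod b"
  using holomorphic_lipschitz[OF branch_holomorphic(3)[OF assms(1-3)], of 3 b 0] branchD(1)[OF assms(1-3)] assms(4) d1
  by (auto intro: less_imp_le)

lemma branch_zero:
  assumes "branch \<xi>0 n f" "\<xi> \<in> ball \<xi>0 (2 * \<sigma>)" "\<zeta> \<in> ball 0 4"
  shows "(P ^^ n) (f \<xi> \<zeta> 0) = \<xi>" "\<zeta>' \<in> ball 0 4 \<Longrightarrow> f \<xi> \<zeta>' 0 = f \<xi> \<zeta> 0"
proof -
  have b0: "0 \<in> ball (0::complex) \<delta>1" using d1 by simp
  obtain u where u: "recur 0 u" "u 1 = f \<xi> \<zeta> 0" "u (Suc n) = \<xi>" using branchD(3)[OF assms b0] by blast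
  have "u (Suc k) = (P ^^ k) (u 1)" for k
  proof (induction k)
    case (Suc k)
    have "u (Suc (Suc k)) = (u (Suc k))\<^sup>2 + cc 0" using u(1) by (simp add: recur_def)
    thus ?case unfolding quad_iterate_Suc Suc .
  qed simp
  thus "(P ^^ n) (f \<xi> \<zeta> 0) = \<xi>" using u by metis
  show "\<zeta>' \<in> ball 0 4 \<Longrightarrow> f \<xi> \<zeta>' 0 = f \<xi> \<zeta> 0" using branchD(4)[OF assms b0, of \<zeta>'] by simp
qed

lemma expansion_EE:
  assumes "\<kappa> > 0"
  shows "\<exists>n0. \<forall>n\<ge>n0. \<forall>\<zeta> \<xi>. \<xi> \<in> EE \<longrightarrow> (P ^^ n) \<zeta> \<in> cball \<xi> (2 * \<sigma>) \<longrightarrow> 1 \<le> \<kappa> * cmod (deriv (P ^^ n) \<zeta>)"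
proof -
  let ?S = "(\<lambda>p. fst p + snd p) ` (EE \<times> cball 0 (2 * \<sigma>))"
  have c: "compact ?S"
    by (intro compact_continuous_image compact_Times compact_EE compact_cball continuous_intros)
  have "?S \<inter> PC = {}"
  proof (rule ccontr)
    assume "?S \<inter> PC \<noteq> {}"
    then obtain \<xi> w where w: "\<xi> \<in> EE" "cmod w \<le> 2 * \<sigma>" "\<xi> + w \<in> PC" by auto
    hence "4 * \<sigma> \<le> cmod w" using sep[OF w(1,3)] by (simp add: dist_norm)
    thus False using w(2) sig by linarith
  qed
  then obtain n0 where n0: "\<And>n \<zeta>. n \<ge> n0 \<Longrightarrow> (P ^^ n) \<zeta> \<in> ?S \<Longrightarrow> 1 \<le> \<kappa> * cmod (deriv (P ^^ n) \<zeta>)"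
    using expansion[OF c _ assms] by blast
  show ?thesis
  proof (intro exI[of _ n0] allI impI)
    fix n \<zeta> \<xi> assume h: "n0 \<le> n" "\<xi> \<in> EE" "(P ^^ n) \<zeta> \<in> cball \<xi> (2 * \<sigma>)"
    have "(P ^^ n) \<zeta> \<in> ?S"
      using h(2,3) by (intro image_eqI[of _ _ "(\<xi>, (P ^^ n) \<zeta> - \<xi>)"]) (auto simp: dist_norm norm_minus_commute)
    thus "1 \<le> \<kappa> * cmod (deriv (P ^^ n) \<zeta>)" using n0 h(1) by blast
  qed
qed

lemma branch_contraction_0:
  assumes "\<kappa> > 0"
  shows "\<exists>n0. \<forall>n\<ge>n0. \<forall>\<xi>0 f \<xi> \<xi>' \<zeta>. \<xi>0 \<in> EE \<longrightarrow> branch \<xi>0 n f \<longrightarrow> \<xi> \<in> ball \<xi>0 (2 * \<sigma>) \<longrightarrow> \<xi>' \<in> ball \<xi>0 (2 * \<sigma>) \<longrightarrow> \<zeta> \<in> ball 0 4 \<longrightarrow>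
     cmod (f \<xi> \<zeta> 0 - f \<xi>' \<zeta> 0) \<le> \<kappa> * cmod (\<xi> - \<xi>')"
proof -
  obtain n0 where n0: "\<And>n \<zeta> \<xi>. n \<ge> n0 \<Longrightarrow> \<xi> \<in> EE \<Longrightarrow> (P ^^ n) \<zeta> \<in> cball \<xi> (2 * \<sigma>) \<Longrightarrow> 1 \<le> \<kappa> * cmod (deriv (P ^^ n) \<zeta>)"
    using expansion_EE[OF assms] by blast
  show ?thesis
  proof (intro exI[of _ n0] allI impI)
    fix n f and \<xi>0 \<xi> \<xi>' \<zeta> :: complex
    assume h: "n0 \<le> n" "\<xi>0 \<in> EE" "branch \<xi>0 n f" "\<xi> \<in> ball \<xi>0 (2 * \<sigma>)" "\<xi>' \<in> ball \<xi>0 (2 * \<sigma>)" "\<zeta> \<in> ball 0 4"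
    have b0: "0 \<in> ball (0::complex) \<delta>1" using d1 by simp
    let ?g = "\<lambda>\<xi>. f \<xi> \<zeta> 0"
    have g: "?g holomorphic_on ball \<xi>0 (2 * \<sigma>)" by (rule branch_holomorphic(1)[OF h(3,6) b0])
    show "cmod (f \<xi> \<zeta> 0 - f \<xi>' \<zeta> 0) \<le> \<kappa> * cmod (\<xi> - \<xi>')"
    proof (rule field_differentiable_bound[of "ball \<xi>0 (2 * \<sigma>)" ?g "deriv ?g"])
      fix z assume z: "z \<in> ball \<xi>0 (2 * \<sigma>)"
      show "(?g has_field_derivative deriv ?g z) (at z within ball \<xi>0 (2 * \<sigma>))"
        using holomorphic_derivI[OF g open_ball z] has_field_derivative_at_within by blast
      have 1: "deriv (P ^^ n) (?g z) * deriv ?g z = 1"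
        by (rule branch_deriv[OF g branch_zero(1)[OF h(3) _ h(6)] z])
      have "(P ^^ n) (?g z) \<in> cball \<xi>0 (2 * \<sigma>)" using branch_zero(1)[OF h(3) z h(6)] z by auto
      hence "1 * cmod (deriv ?g z) \<le> \<kappa> * cmod (deriv (P ^^ n) (?g z)) * cmod (deriv ?g z)"
        using n0[OF h(1,2)] by (intro mult_right_mono) auto
      also have "... = \<kappa> * cmod (deriv (P ^^ n) (?g z) * deriv ?g z)" by (simp add: norm_mult)
      finally show "norm (deriv ?g z) \<le> \<kappa>" by (simp add: 1)
    qed (use h in auto)
  qed
qed

definition \<delta>2 :: real where "\<delta>2 = min (\<delta>1 / 2) (\<delta>1 * \<sigma> / 600)"

lemma d2: "\<delta>2 > 0" "\<delta>2 \<le> \<delta>1 / 2" "\<delta>2 \<le> \<delta>1 * \<sigma> / 600" "cmod b < \<delta>2 \<Longrightarrow> cmod b < \<delta>1" "cmod b < \<delta>2 \<Longrightarrow> cmod b < 3 * \<delta>1 / 4"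
  "cmod b < \<delta>2 \<Longrightarrow> cmod b < \<delta>0"
  using d1 sig by (auto simp: \<delta>2_def)

lemma kappa_small: "cmod b < \<delta>1 \<Longrightarrow> 2 * cmod b / \<rho> \<le> 1/8"
  using b_small(5)[of b] rho by linarith

text \<open>At \<open>b = 0\<close> deep branches contract by \<open>1 / 16\<close>, by expansion
  away from \<open>PC\<close>. For fixed \<open>\<xi>\<close> and \<open>\<xi>'\<close> the
  difference of the values is holomorphic in \<open>b\<close> and bounded by a multiple of
  \<open>cmod (\<xi> - \<xi>')\<close>, so by Cauchy's estimate in \<open>b\<close> it changes by at
  most another \<open>1 / 16\<close> on the disc of radius \<open>\<delta>2\<close>; this is where
  600 comes from. Hence one depth \<open>n0\<close> serves all small \<open>b\<close>.\<close>

lemma branch_contraction: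
  "\<exists>n0. \<forall>n\<ge>n0. \<forall>\<xi>0 f \<xi> \<xi>' \<zeta> \<zeta>' b. \<xi>0 \<in> EE \<longrightarrow> branch \<xi>0 n f \<longrightarrow> \<xi> \<in> ball \<xi>0 (3 * \<sigma> / 2) \<longrightarrow> \<xi>' \<in> ball \<xi>0 (3 * \<sigma> / 2) \<longrightarrow>
     \<zeta> \<in> ball 0 4 \<longrightarrow> \<zeta>' \<in> ball 0 4 \<longrightarrow> cmod b < \<delta>2 \<longrightarrow>
     cmod (f \<xi> \<zeta> b - f \<xi>' \<zeta>' b) \<le> 1/8 * cmod (\<xi> - \<xi>') + 1/8 * cmod (\<zeta> - \<zeta>')"
proof -
  obtain n0 where n0: "\<And>n \<xi>0 f \<xi> \<xi>' \<zeta>. n \<ge> n0 \<Longrightarrow> \<xi>0 \<in> EE \<Longrightarrow> branch \<xi>0 n f \<Longrightarrow> \<xi> \<in> ball \<xi>0 (2 * \<sigma>) \<Longrightarrow> \<xi>' \<in> ball \<xi>0 (2 * \<sigma>) \<Longrightarrow>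
     \<zeta> \<in> ball 0 4 \<Longrightarrow> cmod (f \<xi> \<zeta> 0 - f \<xi>' \<zeta> 0) \<le> 1/16 * cmod (\<xi> - \<xi>')"
    using branch_contraction_0[of "1/16"] by (metis zero_less_divide_1_iff zero_less_numeral)
  show ?thesis
  proof (intro exI[of _ n0] allI impI)
    fix n f and \<xi>0 \<xi> \<xi>' \<zeta> \<zeta>' b :: complex
    assume h: "n0 \<le> n" "\<xi>0 \<in> EE" "branch \<xi>0 n f" "\<xi> \<in> ball \<xi>0 (3 * \<sigma> / 2)" "\<xi>' \<in> ball \<xi>0 (3 * \<sigma> / 2)"
      "\<zeta> \<in> ball 0 4" "\<zeta>' \<in> ball 0 4" "cmod b < \<delta>2"
    have x: "\<xi> \<in> ball \<xi>0 (2 * \<sigma>)" "\<xi>' \<in> ball \<xi>0 (2 * \<sigma>)" using h(4,5) sig by auto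
    have b: "b \<in> ball 0 \<delta>1" using d2(4)[OF h(8)] by simp
    have 1: "cmod (f \<xi>' \<zeta> b - f \<xi>' \<zeta>' b) \<le> 1/8 * cmod (\<zeta> - \<zeta>')"
    proof -
      have "cmod (f \<xi>' \<zeta> b - f \<xi>' \<zeta>' b) \<le> 2 * cmod b / \<rho> * cmod (\<zeta> - \<zeta>')" by (rule branchD(4)[OF h(3) x(2) h(6) b h(7)])
      also have "... \<le> 1/8 * cmod (\<zeta> - \<zeta>')" using kappa_small d2(4)[OF h(8)] by (intro mult_right_mono) auto
      finally show ?thesis .
    qed
    let ?F = "\<lambda>b. f \<xi> \<zeta> b - f \<xi>' \<zeta> b"
    have "cmod (?F b - ?F 0) \<le> 5 * (15 / (2 * \<sigma>) * cmod (\<xi> - \<xi>')) / \<delta>1 * cmod (b - 0)"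
    proof (rule holomorphic_lipschitz[of ?F 0 \<delta>1])
      show "?F holomorphic_on ball 0 \<delta>1"
        using branch_holomorphic(3)[OF h(3) x(1) h(6)] branch_holomorphic(3)[OF h(3) x(2) h(6)] by (intro holomorphic_intros)
      show "cmod (?F w) \<le> 15 / (2 * \<sigma>) * cmod (\<xi> - \<xi>')" if "w \<in> ball 0 \<delta>1" for w
        by (rule branch_lipschitz_\<xi>[OF h(3,6) that h(4,5)])
    qed (use d1 d2(5)[OF h(8)] in auto)
    also have "... = 75 / (2 * \<sigma> * \<delta>1) * cmod b * cmod (\<xi> - \<xi>')" by simp
    also have "... \<le> 75 / (2 * \<sigma> * \<delta>1) * (\<delta>1 * \<sigma> / 600) * cmod (\<xi> - \<xi>')"
      using h(8) d2(3) sig d1 by (intro mult_right_mono mult_left_mono) auto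
    also have "... = 1/16 * cmod (\<xi> - \<xi>')" using sig d1 by simp
    finally have 2: "cmod (?F b - ?F 0) \<le> 1/16 * cmod (\<xi> - \<xi>')" .
    have 3: "cmod (?F 0) \<le> 1/16 * cmod (\<xi> - \<xi>')" by (rule n0[OF h(1-3) x h(6)])
    have "f \<xi> \<zeta> b - f \<xi>' \<zeta>' b = (?F b - ?F 0) + ?F 0 + (f \<xi>' \<zeta> b - f \<xi>' \<zeta>' b)" by simp
    also have "cmod ... \<le> 1/16 * cmod (\<xi> - \<xi>') + 1/16 * cmod (\<xi> - \<xi>') + 1/8 * cmod (\<zeta> - \<zeta>')"
      by (intro norm_triangle_le add_mono 1 2 3)
    finally show "cmod (f \<xi> \<zeta> b - f \<xi>' \<zeta>' b) \<le> 1/8 * cmod (\<xi> - \<xi>') + 1/8 * cmod (\<zeta> - \<zeta>')" by simp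
  qed
qed

text \<open>A perturbation of this size, magnified by the Lipschitz constant of the branches, stays
  below \<open>\<rho>\<close>, so that it cannot change the sign of a root.\<close>

definition \<eta>0 :: real where "\<eta>0 = \<rho> * \<sigma> / 20"

lemma eta0: "\<eta>0 > 0" "(15 / (2 * \<sigma>) + 2) * \<eta>0 \<le> \<rho>" "\<eta>0 < \<sigma> / 2" "\<eta>0 \<le> s / 64" "\<eta>0 \<le> \<rho> / 4"
proof -
  show e: "\<eta>0 > 0" using rho sig by (simp add: \<eta>0_def)
  have s1: "\<sigma> \<le> 1" using sig s_pos by linarith
  have "15 / (2 * \<sigma>) + 2 \<le> 20 / \<sigma>" using s1 sig by (simp add: field_simps)
  hence "(15 / (2 * \<sigma>) + 2) * \<eta>0 \<le> 20 / \<sigma> * \<eta>0" using e by (intro mult_right_mono) auto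
  also have "... = \<rho>" using sig by (simp add: \<eta>0_def)
  finally show "(15 / (2 * \<sigma>) + 2) * \<eta>0 \<le> \<rho>" .
  have "\<eta>0 \<le> (1/8) * \<sigma> / 20" unfolding \<eta>0_def using rho sig by (intro divide_right_mono mult_right_mono) auto
  thus "\<eta>0 < \<sigma> / 2" "\<eta>0 \<le> s / 64" using sig s_pos by linarith+
  have "\<eta>0 \<le> \<rho> * 1 / 20" unfolding \<eta>0_def using rho s1 by (intro divide_right_mono mult_left_mono) auto
  thus "\<eta>0 \<le> \<rho> / 4" using rho by linarith
qed

text \<open>A backward orbit \<open>Y\<close> close to \<open>X\<close> uses the same signs: either
  \<open>Y (Suc n)\<close> is the value \<open>T\<close> of the branch or the two are nearly
  opposite. Both are close to \<open>X (Suc n)\<close>, whose modulus is at least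
  \<open>\<rho>\<close>, which excludes the second case.\<close>

lemma branch_follow:
  assumes G: "branch_seq \<xi>0 G" and b: "cmod b < \<delta>1"
    and X: "X 0 \<in> ball \<xi>0 (3 * \<sigma> / 2)" "\<And>n. cmod (X n) < 4" "\<And>n. G n (X 0) (X (Suc n)) b = X n"
    and Y: "Y 0 \<in> ball \<xi>0 (3 * \<sigma> / 2)" "\<And>n. cmod (Y n) < 4" "bseq b Y"
    and close: "\<And>n. cmod (X n - Y n) \<le> \<eta>0"
  shows "G n (Y 0) (Y (Suc n)) b = Y n"
proof (induction n)
  case 0
  thus ?case using G by (simp add: branch_seq_def)
next
  case (Suc n)
  have bb: "b \<in> ball 0 \<delta>1" using b by simp
  have XY: "X 0 \<in> ball \<xi>0 (2 * \<sigma>)" "Y 0 \<in> ball \<xi>0 (2 * \<sigma>)" using X(1) Y(1) sig by auto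
  have Z: "X k \<in> ball 0 4" "Y k \<in> ball 0 4" for k using X(2) Y(2) by auto
  have br: "branch \<xi>0 k (G k)" for k using G by (simp add: branch_seq_def)
  define T where "T = G (Suc n) (Y 0) (Y (Suc (Suc n))) b"
  have T: "T\<^sup>2 + cc b + b * Y (Suc (Suc n)) = G n (Y 0) T b"
    unfolding T_def using G XY(2) Z(2) bb unfolding branch_seq_def by blast
  have TZ: "T \<in> ball 0 4"
    using branchD(1)[OF br XY(2) Z(2) bb, of "Suc n" "Suc (Suc n)"] unfolding T_def mem_ball_0 by linarith
  have "(Y (Suc n))\<^sup>2 + cc b + b * Y (Suc (Suc n)) = G n (Y 0) (Y (Suc n)) b"
    using Y(3) Suc by (simp add: bseq_def)
  hence "(Y (Suc n))\<^sup>2 - T\<^sup>2 = G n (Y 0) (Y (Suc n)) b - G n (Y 0) T b" using T by (metis add_diff_cancel_right)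
  hence "cmod ((Y (Suc n))\<^sup>2 - T\<^sup>2) \<le> 2 * cmod b / \<rho> * cmod (Y (Suc n) - T)"
    using branchD(4)[OF br XY(2) Z(2)[of "Suc n"] bb TZ, of n] by simp
  moreover have "(Y (Suc n))\<^sup>2 - T\<^sup>2 = (Y (Suc n) - T) * (Y (Suc n) + T)"
    by (simp add: algebra_simps power2_eq_square)
  ultimately have "cmod (Y (Suc n) - T) * cmod (Y (Suc n) + T) \<le> cmod (Y (Suc n) - T) * (2 * cmod b / \<rho>)"
    by (simp add: norm_mult mult.commute)
  \<comment> \<open>The difference of the squares has the factor \<open>Y (Suc n) - T\<close>, and
    is itself bounded by a multiple of this factor, since the branch of depth \<open>n\<close>
    depends weakly on its second argument.\<close>
  hence alt: "Y (Suc n) = T \<or> cmod (Y (Suc n) + T) \<le> 2 * cmod b / \<rho>"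
    by (metis mult_le_cancel_left_pos zero_less_norm_iff right_minus_eq)
  have "X (Suc n) - T = (G (Suc n) (X 0) (X (Suc (Suc n))) b - G (Suc n) (Y 0) (X (Suc (Suc n))) b) +
      (G (Suc n) (Y 0) (X (Suc (Suc n))) b - G (Suc n) (Y 0) (Y (Suc (Suc n))) b)"
    using X(3)[of "Suc n"] by (simp add: T_def)
  also have "cmod ... \<le> 15 / (2 * \<sigma>) * \<eta>0 + \<eta>0"
  proof (intro norm_triangle_le add_mono)
    have "cmod (G (Suc n) (X 0) (X (Suc (Suc n))) b - G (Suc n) (Y 0) (X (Suc (Suc n))) b) \<le> 15 / (2 * \<sigma>) * cmod (X 0 - Y 0)"
      by (rule branch_lipschitz_\<xi>[OF br Z(1) bb X(1) Y(1)])
    also have "... \<le> 15 / (2 * \<sigma>) * \<eta>0" using close[of 0] sig by (intro mult_left_mono) auto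
    finally show "cmod (G (Suc n) (X 0) (X (Suc (Suc n))) b - G (Suc n) (Y 0) (X (Suc (Suc n))) b) \<le> 15 / (2 * \<sigma>) * \<eta>0" .
    have "cmod (G (Suc n) (Y 0) (X (Suc (Suc n))) b - G (Suc n) (Y 0) (Y (Suc (Suc n))) b) \<le> 2 * cmod b / \<rho> * cmod (X (Suc (Suc n)) - Y (Suc (Suc n)))"
      by (rule branchD(4)[OF br XY(2) Z(1) bb Z(2)])
    also have "... \<le> 1 * \<eta>0"
      using close[of "Suc (Suc n)"] kappa_small[OF b] eta0(1) rho by (intro mult_mono) auto
    finally show "cmod (G (Suc n) (Y 0) (X (Suc (Suc n))) b - G (Suc n) (Y 0) (Y (Suc (Suc n))) b) \<le> \<eta>0" by simp
  qed
  finally have XT: "cmod (X (Suc n) - T) \<le> 15 / (2 * \<sigma>) * \<eta>0 + \<eta>0" .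
  have "\<rho> \<le> cmod (X (Suc n))" using branchD(2)[OF br XY(1) Z(1) bb, of "Suc n"] X(3)[of "Suc n"] by (metis zero_less_Suc)
  moreover have "2 * X (Suc n) = (Y (Suc n) + T) + ((X (Suc n) - Y (Suc n)) + (X (Suc n) - T))" by simp
  hence "cmod (2 * X (Suc n)) \<le> cmod (Y (Suc n) + T) + (\<eta>0 + (15 / (2 * \<sigma>) * \<eta>0 + \<eta>0))"
    using close[of "Suc n"] XT by (metis (no_types, lifting) add_mono norm_triangle_le order_refl)
  ultimately have "2 * \<rho> \<le> cmod (Y (Suc n) + T) + (15 / (2 * \<sigma>) + 2) * \<eta>0"
    by (simp add: norm_mult algebra_simps)
  hence "cmod (Y (Suc n) + T) \<ge> \<rho>" using eta0(2) by linarith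
  hence "\<not> cmod (Y (Suc n) + T) \<le> 2 * cmod b / \<rho>" using b_small(5)[OF b] rho by linarith
  thus ?case using alt by (simp add: T_def)
qed

end

context parab_branch
begin

subsection \<open>Expansivity\<close>

definition \<delta>3 :: real where "\<delta>3 = min \<delta>2 (min (s / 16) (\<sigma> * \<rho> / 100))"

lemma d3: "\<delta>3 > 0" "cmod b < \<delta>3 \<Longrightarrow> cmod b < \<delta>2" "cmod b < \<delta>3 \<Longrightarrow> cmod b < \<delta>1" "cmod b < \<delta>3 \<Longrightarrow> cmod b < \<delta>0"
  "cmod b < \<delta>3 \<Longrightarrow> cmod b < s / 16" "cmod b < \<delta>3 \<Longrightarrow> cmod b < \<sigma> * \<rho> / 100"
  using d2 s_pos sig rho by (auto simp: \<delta>3_def)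

definition far :: "(int \<Rightarrow> complex) \<Rightarrow> int \<Rightarrow> bool" where "far x k \<longleftrightarrow> 3 * s / 4 \<le> cmod (x k - beta)"

lemma SS_D: "x \<in> SS b \<Longrightarrow> orbit b x" "x \<in> SS b \<Longrightarrow> cmod (x k) \<le> 2" "x \<in> SS b \<Longrightarrow> (x k, x (k - 1)) \<notin> Pet b"
  by (auto simp: SS_def)

lemma orbit_step: "orbit b x \<Longrightarrow> x (k + 1) = (x k)\<^sup>2 + cc b + b * x (k - 1)"
  by (auto simp: orbit_def)

lemma orbit_bseq: "orbit b x \<Longrightarrow> bseq b (\<lambda>n. x (M - int n))"
  unfolding bseq_def
proof
  fix n assume "orbit b x"
  from orbit_step[OF this, of "M - int (Suc n)"]
  show "(x (M - int (Suc n)))\<^sup>2 + cc b + b * x (M - int (Suc (Suc n))) = x (M - int n)"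
    by (simp add: algebra_simps)
qed

text \<open>If the orbit is far at some time after \<open>k\<close>, then \<open>near_EE\<close> and
  \<open>trap\<close> keep \<open>x (k + 1)\<close> away from the critical value; if not,
  \<open>x (k + 1)\<close> is near \<open>beta\<close>, at distance \<open>1 / 4\<close> from that
  value. Either way the recursion keeps \<open>x k\<close> away from 0.\<close>

lemma SS_lower:
  assumes b: "cmod b < \<delta>1" and x: "x \<in> SS b"
  shows "\<rho> \<le> cmod (x k)"
proof -
  note o = SS_D(1)[OF x] and x2 = SS_D(2)[OF x]
  have r2: "\<rho>\<^sup>2 \<le> 1 / 64" using power_mono[OF rho(2), of 2] rho(1) by (simp add: power2_eq_square)
  have "2 * \<rho>\<^sup>2 \<le> cmod (x (k + 1) - cc 0)"
  proof (cases "\<exists>m\<ge>k + 1. far x m")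
    case True
    then obtain m where m: "m \<ge> k + 1" "far x m" by blast
    then obtain \<xi> where \<xi>: "\<xi> \<in> EE" "cmod (x m - \<xi>) < \<sigma>" using near_EE[OF b x] by (auto simp: far_def)
    define u where "u n = x (k + int n)" for n
    have "2 * \<rho>\<^sup>2 \<le> cmod (u 1 - cc 0)"
    proof (rule trap[OF b _ _ \<xi>(1)])
      show "recur b u" unfolding u_def by (rule orbit_recur[OF o])
      show "cmod (u 0) \<le> 4" using x2[of k] by (simp add: u_def)
      show "cmod (u (Suc (nat (m - k - 1))) - \<xi>) < 2 * \<sigma>" using \<xi>(2) sig(1) m(1) by (simp add: u_def)
    qed
    thus ?thesis by (simp add: u_def)
  next
    case False
    hence "\<not> far x (k + 1)" by blast
    hence "cmod (x (k + 1) - beta) < 3 * s / 4" by (auto simp: far_def not_le)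
    moreover have "cmod (beta - cc 0) \<le> cmod (x (k + 1) - cc 0) + cmod (x (k + 1) - beta)"
      using norm_triangle_ineq4[of "x (k + 1) - cc 0" "x (k + 1) - beta"] by simp
    ultimately show ?thesis using beta_cc0 r2 s_pos by linarith
  qed
  also have "x (k + 1) - cc 0 = (x k)\<^sup>2 + ((cc b - cc 0) + b * x (k - 1))" using orbit_step[OF o, of k] by simp
  also have "cmod ... \<le> (cmod (x k))\<^sup>2 + (3 * cmod b + cmod b * 2)"
  proof (intro norm_triangle_le add_mono)
    show "cmod (cc b - cc 0) \<le> 3 * cmod b" using b_small(2)[OF b] by (intro norm_cc_diff) auto
    show "cmod (b * x (k - 1)) \<le> cmod b * 2" unfolding norm_mult using x2 by (intro mult_left_mono) auto
  qed (simp add: norm_power)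
  finally have "\<rho>\<^sup>2 \<le> (cmod (x k))\<^sup>2" using b_small(7)[OF b] norm_ge_zero[of b] by linarith
  thus ?thesis by (rule power2_le_imp_le) simp
qed

lemma SS_stay:
  assumes b: "cmod b < \<delta>3" and x: "\<not> far x k" and y: "cmod (x k - y k) \<le> \<eta>0"
  shows "cmod (x k - bet b) \<le> s0" "cmod (y k - bet b) \<le> s0"
proof -
  have 1: "cmod (x k - beta) < 3 * s / 4" using x by (auto simp: far_def)
  have 2: "cmod (bet b - beta) \<le> s / 32" using d3(5)[OF b] by (simp add: norm_bet_diff)
  have 3: "cmod (x k - bet b) \<le> cmod (x k - beta) + cmod (bet b - beta)"
    using norm_triangle_ineq4[of "x k - beta" "bet b - beta"] by simp
  show "cmod (x k - bet b) \<le> s0" using 1 2 3 s_def s_pos by linarith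
  have "cmod (y k - bet b) \<le> cmod (x k - bet b) + cmod (x k - y k)"
    using norm_triangle_ineq4[of "x k - bet b" "x k - y k"] by simp
  thus "cmod (y k - bet b) \<le> s0" using 1 2 3 y eta0(4) s_def s_pos by linarith
qed

lemma SS_stable_step:
  assumes b: "cmod b < \<delta>3" and x: "x \<in> SS b" "y \<in> SS b" and c: "\<And>k. cmod (x k - y k) \<le> \<eta>0"
    and nf: "\<And>m. m > k \<Longrightarrow> \<not> far x m"
  shows "cmod (x (k + 1) - y (k + 1)) \<le> 2 * cmod b * cmod (x k - y k)"
proof -
  have "cmod (x (k + int 1) - y (k + int 1)) \<le> 2 * cmod b * cmod (x (k + int 0) - y (k + int 0))"
  proof (rule strong_stable[OF d3(4)[OF b] orbit_recur[OF SS_D(1)[OF x(1)]] orbit_recur[OF SS_D(1)[OF x(2)]]])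
    fix n
    show "cmod (x (k + int (Suc n)) - bet b) \<le> s0" "cmod (y (k + int (Suc n)) - bet b) \<le> s0"
      using SS_stay[of b x "k + int (Suc n)" y, OF b nf c] by simp_all
    show "(x (k + int (Suc n)), x (k + int n)) \<notin> Pet b" using SS_D(3)[OF x(1), of "k + int (Suc n)"] by (simp add: algebra_simps)
    show "(y (k + int (Suc n)), y (k + int n)) \<notin> Pet b" using SS_D(3)[OF x(2), of "k + int (Suc n)"] by (simp add: algebra_simps)
  qed
  thus ?thesis by simp
qed

lemma SS_branch:
  assumes b: "cmod b < \<delta>1" and x: "x \<in> SS b" and fr: "far x M"
  obtains \<xi>0 G where "\<xi>0 \<in> EE" "cmod (x M - \<xi>0) < \<sigma>" "branch_seq \<xi>0 G"
    "\<And>n. G n (x M) (x (M - int n - 1)) b = x (M - int n)"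
proof -
  obtain \<xi>0 where \<xi>: "\<xi>0 \<in> EE" "cmod (x M - \<xi>0) < \<sigma>" using near_EE[OF b x] fr by (auto simp: far_def)
  define X where "X n = x (M - int n)" for n
  have "\<exists>G. branch_seq \<xi>0 G \<and> (\<forall>n. G n (X 0) (X (Suc n)) b = X n)"
  proof (rule branch_seq_exists[OF \<xi>(1)])
    show "X 0 \<in> ball \<xi>0 (2 * \<sigma>)" using \<xi>(2) sig(1) by (simp add: X_def dist_norm norm_minus_commute)
    show "cmod (X n) < 4" for n using SS_D(2)[OF x, of "M - int n"] by (simp add: X_def)
    show "bseq b X" unfolding X_def by (rule orbit_bseq[OF SS_D(1)[OF x]])
  qed (rule b)
  then obtain G where G: "branch_seq \<xi>0 G" "\<And>n. G n (X 0) (X (Suc n)) b = X n" by blast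
  show ?thesis
  proof (rule that[OF \<xi> G(1)])
    fix n show "G n (x M) (x (M - int n - 1)) b = x (M - int n)" using G(2)[of n] by (simp add: X_def algebra_simps)
  qed
qed

lemma SS_branch_close:
  assumes b: "cmod b < \<delta>1" and x: "x \<in> SS b" "y \<in> SS b" and c: "\<And>k. cmod (x k - y k) \<le> \<eta>0" and fr: "far x M"
  obtains \<xi>0 G where "\<xi>0 \<in> EE" "branch_seq \<xi>0 G" "x M \<in> ball \<xi>0 (3 * \<sigma> / 2)" "y M \<in> ball \<xi>0 (3 * \<sigma> / 2)"
    "\<And>n. G n (x M) (x (M - int n - 1)) b = x (M - int n)" "\<And>n. G n (y M) (y (M - int n - 1)) b = y (M - int n)"
proof -
  obtain \<xi>0 G where G: "\<xi>0 \<in> EE" "cmod (x M - \<xi>0) < \<sigma>" "branch_seq \<xi>0 G"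
    "\<And>n. G n (x M) (x (M - int n - 1)) b = x (M - int n)" using SS_branch[OF b x(1) fr] by metis
  have xM: "x M \<in> ball \<xi>0 (3 * \<sigma> / 2)" using G(2) sig(1) by (simp add: dist_norm norm_minus_commute)
  have "cmod (y M - \<xi>0) \<le> cmod (x M - \<xi>0) + cmod (x M - y M)"
    using norm_triangle_ineq4[of "x M - \<xi>0" "x M - y M"] by simp
  hence yM: "y M \<in> ball \<xi>0 (3 * \<sigma> / 2)"
    using G(2) c[of M] eta0(3) by (simp add: dist_norm norm_minus_commute)
  define X Y where "X n = x (M - int n)" "Y n = y (M - int n)" for n
  have GY: "G n (Y 0) (Y (Suc n)) b = Y n" for n
  proof (rule branch_follow[OF G(3) b, of X])
    show "bseq b Y" unfolding X_Y_def by (rule orbit_bseq[OF SS_D(1)[OF x(2)]])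
    show "cmod (X n) < 4" "cmod (Y n) < 4" for n
      using SS_D(2)[OF x(1), of "M - int n"] SS_D(2)[OF x(2), of "M - int n"] by (auto simp: X_Y_def)
    show "G n (X 0) (X (Suc n)) b = X n" for n using G(4)[of n] by (simp add: X_Y_def algebra_simps)
  qed (use xM yM c in \<open>auto simp: X_Y_def\<close>)
  show ?thesis
  proof (rule that[OF G(1,3) xM yM G(4)])
    fix n show "G n (y M) (y (M - int n - 1)) b = y (M - int n)" using GY[of n] by (simp add: X_Y_def algebra_simps)
  qed
qed

text \<open>With \<open>D\<close> the supremum of all distances, each distance is shown to be at
  most \<open>D / 2\<close>. If the orbit is far at arbitrarily late times, this is the contraction
  of a deep branch. Otherwise the strong contraction works after the last far time \<open>M0\<close>
  and makes the distance at \<open>M0\<close> of order \<open>cmod b * D\<close>; earlier times are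
  reached by a branch of any depth, for which the plain Lipschitz bound is enough.\<close>

theorem expansivity:
  assumes b: "cmod b < \<delta>3" and x: "x \<in> SS b" "y \<in> SS b" and c: "\<And>k. cmod (x k - y k) \<le> \<eta>0"
  shows "x = y"
proof -
  define d where "d k = cmod (x k - y k)" for k
  define D where "D = (SUP k. d k)"
  have bdd: "bdd_above (range d)" using c by (auto simp: d_def bdd_above_def)
  have dD: "d k \<le> D" for k unfolding D_def by (rule cSUP_upper[OF _ bdd]) simp
  have d0: "0 \<le> d k" for k by (simp add: d_def)
  have D0: "D \<ge> 0" using dD[of 0] d0[of 0] by linarith
  note b1 = d3(3)[OF b] and b2 = d3(2)[OF b]
  have Z: "x k \<in> ball 0 4" "y k \<in> ball 0 4" for k using SS_D(2)[OF x(1), of k] SS_D(2)[OF x(2), of k] by auto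
  have key: "d k \<le> D / 2" for k
  proof (cases "\<forall>N. \<exists>M\<ge>N. far x M")
    case True
    obtain n0 where n0: "\<And>n \<xi>0 f \<xi> \<xi>' \<zeta> \<zeta>'. n \<ge> n0 \<Longrightarrow> \<xi>0 \<in> EE \<Longrightarrow> branch \<xi>0 n f \<Longrightarrow> \<xi> \<in> ball \<xi>0 (3 * \<sigma> / 2) \<Longrightarrow>
      \<xi>' \<in> ball \<xi>0 (3 * \<sigma> / 2) \<Longrightarrow> \<zeta> \<in> ball 0 4 \<Longrightarrow> \<zeta>' \<in> ball 0 4 \<Longrightarrow>
      cmod (f \<xi> \<zeta> b - f \<xi>' \<zeta>' b) \<le> 1/8 * cmod (\<xi> - \<xi>') + 1/8 * cmod (\<zeta> - \<zeta>')"
      using branch_contraction b2 by blast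
    obtain M where M: "M \<ge> k + int n0" "far x M" using True by blast
    obtain \<xi>0 G where G: "\<xi>0 \<in> EE" "branch_seq \<xi>0 G" "x M \<in> ball \<xi>0 (3 * \<sigma> / 2)" "y M \<in> ball \<xi>0 (3 * \<sigma> / 2)"
      "\<And>n. G n (x M) (x (M - int n - 1)) b = x (M - int n)" "\<And>n. G n (y M) (y (M - int n - 1)) b = y (M - int n)"
      using SS_branch_close[OF b1 x c M(2)] by metis
    define n where "n = nat (M - k)"
    have n: "n \<ge> n0" "M - int n = k" using M(1) by (auto simp: n_def)
    have br: "branch \<xi>0 n (G n)" using G(2) by (simp add: branch_seq_def)
    have "d k = cmod (G n (x M) (x (k - 1)) b - G n (y M) (y (k - 1)) b)"
      using G(5,6)[of n] n(2) by (simp add: d_def)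
    also have "... \<le> 1/8 * d M + 1/8 * d (k - 1)"
      unfolding d_def by (rule n0[OF n(1) G(1) br G(3,4) Z])
    also have "... \<le> 1/8 * D + 1/8 * D" using dD by (intro add_mono mult_left_mono) auto
    finally show ?thesis using D0 by simp
  next
    case False
    then obtain N where N: "\<And>M. M \<ge> N \<Longrightarrow> \<not> far x M" by blast
    have b18: "2 * cmod b \<le> 1/2" using b_small(2)[OF b1] by simp
    have st: "d (m + 1) \<le> 2 * cmod b * d m" if "\<And>j. j > m \<Longrightarrow> \<not> far x j" for m
      unfolding d_def by (rule SS_stable_step[OF b x c that])
    have st2: "d (m + 1) \<le> D / 2" if "\<And>j. j > m \<Longrightarrow> \<not> far x j" for m
    proof -
      have "2 * cmod b * d m \<le> 1/2 * D" using b18 dD d0 by (intro mult_mono) auto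
      moreover have "d (m + 1) \<le> 2 * cmod b * d m" using that by (rule st)
      ultimately show ?thesis by simp
    qed
    show ?thesis
    proof (cases "\<exists>M. far x M")
      case False
      thus ?thesis using st2[of "k - 1"] by simp
    next
      case True
      then obtain m where m: "far x m" by blast
      define M0 where "M0 = Max {M \<in> {m..N}. far x M}"
      have mN: "m \<le> N" using N m by (meson linear)
      have fin: "finite {M \<in> {m..N}. far x M}" "{M \<in> {m..N}. far x M} \<noteq> {}"
        proof -
          show "finite {M \<in> {m..N}. far x M}" by (rule finite_subset[of _ "{m..N}"]) auto
          show "{M \<in> {m..N}. far x M} \<noteq> {}" using m mN by auto
        qed
      have M0: "far x M0" using Max_in[OF fin] by (auto simp: M0_def)
      have M0': "\<not> far x j" if "j > M0" for j
      proof
        assume f: "far x j"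
        have "j \<le> N" using N f by (meson linear)
        moreover have "m \<le> j" using Max_ge[OF fin(1), of m] m mN that by (simp add: M0_def)
        ultimately have "j \<le> M0" unfolding M0_def using f by (intro Max_ge fin(1)) auto
        thus False using that by simp
      qed
      show ?thesis
      proof (cases "k > M0")
        case True
        thus ?thesis using st2[of "k - 1"] M0' by auto
      next
        case False
        have s1: "d (M0 + 1) \<le> 2 * cmod b * D"
          using st[of M0] M0' mult_left_mono[OF dD[of M0], of "2 * cmod b"] by auto
        \<comment> \<open>The recursion is solved for the difference at \<open>M0\<close>: the next
          difference is already small, and the sum of the two points has modulus at least
          \<open>\<rho>\<close>.\<close>
        have e: "x (M0 + 1) - y (M0 + 1) = (x M0 + y M0) * (x M0 - y M0) + b * (x (M0 - 1) - y (M0 - 1))"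
          using orbit_step[OF SS_D(1)[OF x(1)], of M0] orbit_step[OF SS_D(1)[OF x(2)], of M0]
          by (simp add: algebra_simps power2_eq_square)
        have "2 * x M0 = (x M0 + y M0) + (x M0 - y M0)" by simp
        hence "cmod (2 * x M0) \<le> cmod (x M0 + y M0) + \<eta>0"
          using c[of M0] norm_triangle_ineq[of "x M0 + y M0" "x M0 - y M0"] by (smt (verit))
        hence "\<rho> \<le> cmod (x M0 + y M0)"
          using SS_lower[OF b1 x(1), of M0] eta0(5) rho(1) unfolding norm_mult norm_numeral by linarith
        hence "\<rho> * d M0 \<le> cmod ((x M0 + y M0) * (x M0 - y M0))"
          unfolding norm_mult d_def by (intro mult_right_mono) auto
        also have "... \<le> d (M0 + 1) + cmod b * d (M0 - 1)"
          using norm_triangle_ineq4[of "x (M0 + 1) - y (M0 + 1)" "b * (x (M0 - 1) - y (M0 - 1))"] e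
          by (simp add: d_def norm_mult)
        also have "... \<le> 2 * cmod b * D + cmod b * D"
          using s1 dD by (intro add_mono mult_left_mono) auto
        finally have dM: "d M0 \<le> 3 * cmod b / \<rho> * D" using rho(1) by (simp add: field_simps)
        obtain \<xi>0 G where G: "\<xi>0 \<in> EE" "branch_seq \<xi>0 G" "x M0 \<in> ball \<xi>0 (3 * \<sigma> / 2)" "y M0 \<in> ball \<xi>0 (3 * \<sigma> / 2)"
          "\<And>n. G n (x M0) (x (M0 - int n - 1)) b = x (M0 - int n)" "\<And>n. G n (y M0) (y (M0 - int n - 1)) b = y (M0 - int n)"
          using SS_branch_close[OF b1 x c M0] by metis
        define n where "n = nat (M0 - k)"
        have n: "M0 - int n = k" using False by (auto simp: n_def)
        have br: "branch \<xi>0 n (G n)" using G(2) by (simp add: branch_seq_def)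
        have bb: "b \<in> ball 0 \<delta>1" using b1 by simp
        have y2: "y M0 \<in> ball \<xi>0 (2 * \<sigma>)" using G(4) sig(1) by auto
        have "x k - y k = (G n (x M0) (x (k - 1)) b - G n (y M0) (x (k - 1)) b) + (G n (y M0) (x (k - 1)) b - G n (y M0) (y (k - 1)) b)"
          using G(5,6)[of n] n by simp
        hence "d k \<le> cmod (G n (x M0) (x (k - 1)) b - G n (y M0) (x (k - 1)) b) + cmod (G n (y M0) (x (k - 1)) b - G n (y M0) (y (k - 1)) b)"
          unfolding d_def by (metis norm_triangle_ineq)
        also have "... \<le> 15 / (2 * \<sigma>) * d M0 + 2 * cmod b / \<rho> * d (k - 1)"
          unfolding d_def
          by (intro add_mono branch_lipschitz_\<xi>[OF br Z(1) bb G(3,4)] branchD(4)[OF br y2 Z(1) bb Z(2)])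
        also have "... \<le> 15 / (2 * \<sigma>) * (3 * cmod b / \<rho> * D) + 1/8 * D"
          using dM dD sig rho kappa_small[OF b1] d0 D0 by (intro add_mono mult_left_mono mult_mono) auto
        also have "15 / (2 * \<sigma>) * (3 * cmod b / \<rho> * D) = 45 / (2 * \<sigma> * \<rho>) * cmod b * D" by simp
        also have "... \<le> 45 / (2 * \<sigma> * \<rho>) * (\<sigma> * \<rho> / 100) * D"
          using d3(6)[OF b] sig rho D0 by (intro mult_right_mono mult_left_mono) auto
        also have "... = 45 / 200 * D" using sig rho by simp
        finally show ?thesis using D0 by simp
      qed
    qed
  qed
  have "D \<le> D / 2" unfolding D_def using key D_def by (intro cSUP_least) auto
  hence "D = 0" using D0 by simp
  hence "d k = 0" for k using dD[of k] d0[of k] by simp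
  thus ?thesis by (simp add: d_def fun_eq_iff)
qed

end

subsection \<open>Shadowing\<close>

lemma pointwise_subsequence:
  fixes f :: "nat \<Rightarrow> int \<Rightarrow> complex"
  assumes "\<And>j k. cmod (f j k) \<le> B"
  shows "\<exists>r g. strict_mono (r :: nat \<Rightarrow> nat) \<and> (\<forall>k. (\<lambda>j. f (r j) k) \<longlonglongrightarrow> g k)"
proof -
  have "compactin (product_topology (\<lambda>i::int. euclidean) UNIV) (PiE UNIV (\<lambda>i. cball (0::complex) B))"
    by (simp add: compactin_PiE)
  hence "compact (PiE UNIV (\<lambda>i::int. cball (0::complex) B))"
    by (simp add: euclidean_product_topology)
  moreover have "f j \<in> PiE UNIV (\<lambda>i::int. cball (0::complex) B)" for j using assms by auto
  ultimately obtain g r where r: "strict_mono (r :: nat \<Rightarrow> nat)" "(f \<circ> r) \<longlonglongrightarrow> g"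
    unfolding compact_def by metis
  have "(\<lambda>j. f (r j) k) \<longlonglongrightarrow> g k" for k
  proof -
    have "continuous_on UNIV (\<lambda>x :: int \<Rightarrow> complex. x k)" by (rule continuous_on_product_coordinates)
    hence "isCont (\<lambda>x :: int \<Rightarrow> complex. x k) g"
      unfolding continuous_on_eq_continuous_at[OF open_UNIV] by blast
    from isCont_tendsto_compose[OF this r(2)] show ?thesis by (simp add: o_def)
  qed
  thus ?thesis using r by blast
qed

context parab_branch
begin

text \<open>Solving the recursion for the square shows that the supremum \<open>S\<close> satisfies
  \<open>S^2 \<le> S + 13/16 + S/48\<close>, which excludes \<open>S > 2\<close>. Limits built with
  the bound 3 thus fall back under the bound in \<open>SS\<close>.\<close>

lemma orbit_bound:
  assumes b: "cmod b < \<delta>1" and o: "orbit b x" and B: "\<And>k. cmod (x k) \<le> B"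
  shows "cmod (x k) \<le> 2"
proof -
  define S where "S = (SUP k. cmod (x k))"
  have bdd: "bdd_above (range (\<lambda>k. cmod (x k)))" using B by (auto simp: bdd_above_def)
  have le: "cmod (x k) \<le> S" for k unfolding S_def by (rule cSUP_upper[OF _ bdd]) simp
  have S0: "S \<ge> 0" using le[of 0] norm_ge_zero order_trans by blast
  have b1: "cmod b \<le> 1/48" using b_small(2)[OF b] .
  have ccb: "cmod (cc b) \<le> 13 / 16"
    using norm_triangle_ineq[of "cc b - cc 0" "cc 0"] norm_cc_diff[of b] norm_cc0 b1 by simp
  define T where "T = S + 13/16 + 1/48 * S"
  have "(cmod (x k))\<^sup>2 \<le> T" for k
  proof -
    have "(x k)\<^sup>2 = x (k + 1) - cc b - b * x (k - 1)" using orbit_step[OF o, of k] by simp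
    hence "(cmod (x k))\<^sup>2 = cmod (x (k + 1) - cc b - b * x (k - 1))" by (metis norm_power)
    also have "... \<le> S + 13/16 + 1/48 * S"
    proof (intro norm_triangle_le_diff add_mono le ccb)
      show "cmod (b * x (k - 1)) \<le> 1/48 * S" unfolding norm_mult using b1 le S0 by (intro mult_mono) auto
    qed
    finally show ?thesis by (simp add: T_def)
  qed
  hence "cmod (x k) \<le> sqrt T" for k by (simp add: real_le_rsqrt)
  hence "S \<le> sqrt T" unfolding S_def by (intro cSUP_least) auto
  moreover have "T \<ge> 0" using S0 by (simp add: T_def)
  ultimately have ST: "S * S \<le> T" using S0 by (metis mult_mono real_sqrt_ge_zero real_sqrt_mult_self abs_of_nonneg)
  have "S \<le> 2"
  proof (rule ccontr)
    assume "\<not> S \<le> 2"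
    hence "2 * S \<le> S * S" by (intro mult_right_mono) auto
    thus False using ST \<open>\<not> S \<le> 2\<close> unfolding T_def by linarith
  qed
  thus ?thesis using le[of k] by simp
qed

text \<open>A point of the petal stays within \<open>s / 4\<close> of the fixed point for ever, so
  returns to distance \<open>s / 2\<close> from \<open>beta\<close> at arbitrarily late times
  exclude the petals.\<close>

lemma SSI_far:
  assumes b: "cmod b < \<delta>3" and o: "orbit b x" and B: "\<And>k. cmod (x k) \<le> B"
    and f: "\<And>N. \<exists>M\<ge>N. s / 2 \<le> cmod (x M - beta)"
  shows "x \<in> SS b"
  unfolding SS_def
proof (intro CollectI conjI allI)
  fix k
  show "cmod (x k) \<le> 2" by (rule orbit_bound[OF d3(3)[OF b] o B])
  show "(x k, x (k - 1)) \<notin> Pet b"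
  proof
    assume p: "(x k, x (k - 1)) \<in> Pet b"
    obtain M where M: "M \<ge> k" "s / 2 \<le> cmod (x M - beta)" using f by blast
    have "(x (k - 1 + int (Suc (0 + nat (M - k)))), x (k - 1 + int (0 + nat (M - k)))) \<in> Pet b"
      by (rule Pet_forward[OF d3(4)[OF b] orbit_recur[OF o]]) (use p in simp)
    hence "(x M, x (M - 1)) \<in> Pet b" using M(1) by simp
    hence "cmod (x M - bet b) < s / 4" by (rule Pet_small[OF d3(4)[OF b]])
    moreover have "cmod (bet b - beta) \<le> s / 32" using d3(5)[OF b] by (simp add: norm_bet_diff)
    moreover have "cmod (x M - beta) \<le> cmod (x M - bet b) + cmod (bet b - beta)"
      using norm_triangle_ineq[of "x M - bet b" "bet b - beta"] by simp
    ultimately show False using M(2) s_pos by linarith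
  qed
qed (fact o)

definition \<delta>4 :: real where "\<delta>4 = min \<delta>3 (min (\<delta>1 * \<eta>0 / 60) (s * \<sigma> * \<eta>0 / 1000))"

lemma d4: "\<delta>4 > 0" "cmod b < \<delta>4 \<Longrightarrow> cmod b < \<delta>3" "cmod b < \<delta>4 \<Longrightarrow> cmod b < \<delta>1"
  "cmod b < \<delta>4 \<Longrightarrow> 15 / \<delta>1 * cmod b \<le> \<eta>0 / 4" "cmod b < \<delta>4 \<Longrightarrow> 1000 * cmod b \<le> s * \<sigma> * \<eta>0"
  "cmod b < \<delta>4 \<Longrightarrow> 1000 * cmod b \<le> \<eta>0"
proof -
  show "\<delta>4 > 0" using d3(1) d1 eta0 s_pos sig by (simp add: \<delta>4_def)
  show "cmod b < \<delta>4 \<Longrightarrow> cmod b < \<delta>3" by (simp add: \<delta>4_def)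
  thus "cmod b < \<delta>4 \<Longrightarrow> cmod b < \<delta>1" using d3(3) by blast
  show "cmod b < \<delta>4 \<Longrightarrow> 15 / \<delta>1 * cmod b \<le> \<eta>0 / 4" using d1 by (simp add: \<delta>4_def field_simps)
  show 1: "cmod b < \<delta>4 \<Longrightarrow> 1000 * cmod b \<le> s * \<sigma> * \<eta>0" by (simp add: \<delta>4_def)
  have "s * \<sigma> \<le> 1 * 1" using s_pos sig by (intro mult_mono) auto
  hence "s * \<sigma> * \<eta>0 \<le> 1 * \<eta>0" using eta0(1) by (intro mult_right_mono) auto
  thus "cmod b < \<delta>4 \<Longrightarrow> 1000 * cmod b \<le> \<eta>0" using 1 by simp
qed

text \<open>Half of the expansivity constant: two orbits with a common shadow are within
  \<open>\<eta>0\<close> of each other and coincide.\<close>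

definition shadows :: "(int \<Rightarrow> complex) \<Rightarrow> (int \<Rightarrow> complex) \<Rightarrow> bool" where
  "shadows x z \<longleftrightarrow> (\<forall>k. cmod (x k - z k) \<le> \<eta>0 / 2)"

lemma orbit_limit:
  assumes lim: "\<And>k. (\<lambda>j. f j k) \<longlonglongrightarrow> g k"
    and ev: "\<And>k. \<forall>\<^sub>F j in sequentially. f j (k + 1) = (f j k)\<^sup>2 + cc b + b * f j (k - 1)"
  shows "orbit b g"
  unfolding orbit_def
proof
  fix k
  have "(\<lambda>j. (f j k)\<^sup>2 + cc b + b * f j (k - 1)) \<longlonglongrightarrow> (g k)\<^sup>2 + cc b + b * g (k - 1)"
    by (intro tendsto_intros lim)
  hence "(\<lambda>j. f j (k + 1)) \<longlonglongrightarrow> (g k)\<^sup>2 + cc b + b * g (k - 1)"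
    by (rule Lim_transform_eventually) (use ev[of k] in \<open>auto elim: eventually_mono\<close>)
  thus "g (k + 1) = (g k)\<^sup>2 + cc b + b * g (k - 1)" by (rule LIMSEQ_unique[OF lim])
qed

lemma far_shadow:
  assumes "far x M" "cmod (x M - z M) \<le> \<eta>0" shows "s / 2 \<le> cmod (z M - beta)"
proof -
  have "cmod (x M - beta) \<le> cmod (x M - z M) + cmod (z M - beta)"
    using norm_triangle_ineq[of "x M - z M" "z M - beta"] by simp
  thus ?thesis using assms eta0(4) s_pos by (simp add: far_def)
qed

lemma branch_seq_zero:
  assumes G: "branch_seq \<xi>0 G" and \<xi>: "\<xi> \<in> ball \<xi>0 (2 * \<sigma>)"
  shows "(G (Suc n) \<xi> 0 0)\<^sup>2 + cc 0 = G n \<xi> 0 0" "cmod (G n \<xi> 0 0) < 3"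
    "\<zeta> \<in> ball 0 4 \<Longrightarrow> cmod b < \<delta>4 \<Longrightarrow> cmod (G n \<xi> \<zeta> b - G n \<xi> 0 0) \<le> \<eta>0 / 4"
proof -
  have br: "branch \<xi>0 n (G n)" for n using G by (simp add: branch_seq_def)
  have b0: "0 \<in> ball (0::complex) \<delta>1" "(0::complex) \<in> ball 0 4" using d1 by auto
  show l: "cmod (G n \<xi> 0 0) < 3" for n by (rule branchD(1)[OF br \<xi> b0(2,1)])
  have "(G (Suc n) \<xi> 0 0)\<^sup>2 + cc 0 + 0 * 0 = G n \<xi> (G (Suc n) \<xi> 0 0) 0"
    using G \<xi> b0 unfolding branch_seq_def by blast
  also have "... = G n \<xi> 0 0" using l[of "Suc n"] by (intro branch_zero(2)[OF br \<xi> b0(2)]) auto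
  finally show "(G (Suc n) \<xi> 0 0)\<^sup>2 + cc 0 = G n \<xi> 0 0" by simp
  assume \<zeta>: "\<zeta> \<in> ball 0 4" and b: "cmod b < \<delta>4"
  have "cmod (G n \<xi> \<zeta> b - G n \<xi> \<zeta> 0) \<le> 15 / \<delta>1 * cmod b"
    by (rule branch_lipschitz_b[OF br \<xi> \<zeta>]) (use d2(5) d3(2) d4(2)[OF b] in blast)
  moreover have "G n \<xi> \<zeta> 0 = G n \<xi> 0 0" by (rule branch_zero(2)[OF br \<xi> b0(2) \<zeta>])
  ultimately show "cmod (G n \<xi> \<zeta> b - G n \<xi> 0 0) \<le> \<eta>0 / 4" using d4(4)[OF b] by simp
qed

lemma zero_lt_d: "cmod 0 < \<delta>1" "cmod 0 < \<delta>3" "cmod 0 < \<delta>4"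
  using d1 d3(1) d4(1) by auto

text \<open>From a far time \<open>M\<close> the branches of \<open>x\<close> are evaluated at
  \<open>b = 0\<close> with the same endpoint \<open>x M\<close>. Changing \<open>b\<close> to 0
  costs at most \<open>15 / \<delta>1 * cmod b\<close> at every depth, so errors do not accumulate.
  A limit over \<open>M\<close> gives a full orbit.\<close>

lemma shadow_to_zero_far:
  assumes b: "cmod b < \<delta>4" and x: "x \<in> SS b" and inf: "\<And>N. \<exists>M\<ge>N. far x M"
  shows "\<exists>z\<in>SS 0. shadows x z"
proof -
  have "\<forall>j::nat. \<exists>M z. M \<ge> int j \<and> (\<forall>k. cmod (z k) \<le> 3) \<and> (\<forall>k\<le>M. cmod (x k - z k) \<le> \<eta>0 / 4) \<and>
      (\<forall>k<M. z (k + 1) = (z k)\<^sup>2 + cc 0 + 0 * z (k - 1))"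
  proof
    fix j :: nat
    obtain M where M: "M \<ge> int j" "far x M" using inf by blast
    obtain \<xi>0 G where G: "\<xi>0 \<in> EE" "cmod (x M - \<xi>0) < \<sigma>" "branch_seq \<xi>0 G"
      "\<And>n. G n (x M) (x (M - int n - 1)) b = x (M - int n)" using SS_branch[OF d4(3)[OF b] x M(2)] by metis
    have xM: "x M \<in> ball \<xi>0 (2 * \<sigma>)" using G(2) sig(1) by (simp add: dist_norm norm_minus_commute)
    note g = branch_seq_zero[OF G(3) xM]
    \<comment> \<open>The value 0 beyond \<open>M\<close> keeps the sequence bounded for the
      compactness argument; every index is eventually below \<open>M\<close>.\<close>
    define z where "z k = (if k \<le> M then G (nat (M - k)) (x M) 0 0 else 0)" for k
    show "\<exists>M z. M \<ge> int j \<and> (\<forall>k. cmod (z k) \<le> 3) \<and> (\<forall>k\<le>M. cmod (x k - z k) \<le> \<eta>0 / 4) \<and>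
      (\<forall>k<M. z (k + 1) = (z k)\<^sup>2 + cc 0 + 0 * z (k - 1))"
    proof (intro exI[of _ M] exI[of _ z] conjI allI impI M(1))
      show "cmod (z k) \<le> 3" for k using g(2) by (auto simp: z_def less_imp_le)
      show "cmod (x k - z k) \<le> \<eta>0 / 4" if "k \<le> M" for k
        using g(3)[OF _ b, of "x (k - 1)" "nat (M - k)"] G(4)[of "nat (M - k)"] SS_D(2)[OF x, of "k - 1"] that
        by (simp add: z_def)
      show "z (k + 1) = (z k)\<^sup>2 + cc 0 + 0 * z (k - 1)" if "k < M" for k
      proof -
        have "nat (M - k) = Suc (nat (M - (k + 1)))" using that by simp
        thus ?thesis using g(1)[of "nat (M - (k + 1))"] that by (simp add: z_def)
      qed
    qed
  qed
  then obtain M z where z: "\<And>j. M j \<ge> int j" "\<And>j k. cmod (z j k) \<le> 3" "\<And>j k. k \<le> M j \<Longrightarrow> cmod (x k - z j k) \<le> \<eta>0 / 4"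
    "\<And>j k. k < M j \<Longrightarrow> z j (k + 1) = (z j k)\<^sup>2 + cc 0 + 0 * z j (k - 1)" by metis
  obtain r g where r: "strict_mono (r :: nat \<Rightarrow> nat)" and g: "\<And>k. (\<lambda>j. z (r j) k) \<longlonglongrightarrow> g k"
    using pointwise_subsequence[of z 3] z(2) by blast
  have big: "\<forall>\<^sub>F j in sequentially. k < M (r j)" for k
    unfolding eventually_sequentially
  proof (intro exI[of _ "nat (k + 1)"] allI impI)
    fix j assume "nat (k + 1) \<le> j"
    thus "k < M (r j)" using z(1)[of "r j"] seq_suble[OF r, of j] by linarith
  qed
  have o: "orbit 0 g"
    by (rule orbit_limit[OF g]) (rule eventually_mono[OF big], rule z(4))
  have cl: "cmod (x k - g k) \<le> \<eta>0 / 4" for k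
  proof -
    have "(\<lambda>j. cmod (x k - z (r j) k)) \<longlonglongrightarrow> cmod (x k - g k)" by (intro tendsto_intros g)
    thus ?thesis
      by (rule tendsto_upperbound) (use eventually_mono[OF big[of k]] z(3) in \<open>auto simp: less_imp_le\<close>)
  qed
  have gB: "cmod (g k) \<le> 3" for k
    by (rule LIMSEQ_le_const2[OF tendsto_norm[OF g]]) (use z(2) in auto)
  have "g \<in> SS 0"
  proof (rule SSI_far[OF zero_lt_d(2) o gB])
    fix N obtain K where K: "K \<ge> N" "far x K" using inf by blast
    thus "\<exists>M\<ge>N. s / 2 \<le> cmod (g M - beta)"
      using far_shadow[OF K(2), of g] cl[of K] eta0(1) by (intro exI[of _ K]) auto
  qed
  moreover have "shadows x g" unfolding shadows_def
  proof
    fix k show "cmod (x k - g k) \<le> \<eta>0 / 2" using cl[of k] eta0(1) by linarith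
  qed
  ultimately show ?thesis by blast
qed

text \<open>For general \<open>b\<close> a branch asks for the preceding point, which is not known
  in advance. The construction starts at time \<open>- j\<close> with 0 as preceding point and runs
  forward, each value serving as the preceding point of the next; the relation in
  \<open>branch_seq\<close> makes this an orbit up to \<open>M\<close>. The false start enters only
  through the second argument, so the distance to \<open>z\<close> stays below
  \<open>\<eta>0 / 4\<close>.\<close>

lemma shadow_from_zero_far:
  assumes b: "cmod b < \<delta>4" and z: "z \<in> SS 0" and inf: "\<And>N. \<exists>M\<ge>N. far z M"
  shows "\<exists>x\<in>SS b. shadows x z"
proof -
  have bb: "b \<in> ball 0 \<delta>1" using d4(3)[OF b] by simp
  have "\<forall>j::nat. \<exists>M x. M \<ge> int j \<and> (\<forall>k. cmod (x k) \<le> 3) \<and> (\<forall>k\<in>{- int j..M}. cmod (x k - z k) \<le> \<eta>0 / 4) \<and>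
      (\<forall>k\<in>{- int j<..<M}. x (k + 1) = (x k)\<^sup>2 + cc b + b * x (k - 1))"
  proof
    fix j :: nat
    obtain M where M: "M \<ge> int j" "far z M" using inf by blast
    obtain \<xi>0 G where G: "\<xi>0 \<in> EE" "cmod (z M - \<xi>0) < \<sigma>" "branch_seq \<xi>0 G"
      "\<And>n. G n (z M) (z (M - int n - 1)) 0 = z (M - int n)" using SS_branch[OF zero_lt_d(1) z M(2)] by metis
    have zM: "z M \<in> ball \<xi>0 (2 * \<sigma>)" using G(2) sig(1) by (simp add: dist_norm norm_minus_commute)
    note g = branch_seq_zero[OF G(3) zM]
    have br: "branch \<xi>0 n (G n)" for n using G(3) by (simp add: branch_seq_def)
    have b0: "0 \<in> ball (0::complex) \<delta>1" "(0::complex) \<in> ball 0 4" using d1 by auto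
    have Gz: "z (M - int n) = G n (z M) 0 0" for n
      using G(4)[of n] branch_zero(2)[OF br zM b0(2), of "z (M - int n - 1)" n] SS_D(2)[OF z, of "M - int n - 1"] by simp
    define N where "N = nat (M + int j)"
    have N: "int N = M + int j" using M(1) by (simp add: N_def)
    \<comment> \<open>\<open>W i\<close> belongs to time \<open>i - j\<close>, which is
      \<open>N - i\<close> steps before \<open>M\<close>.\<close>
    define W where "W = rec_nat (G N (z M) 0 b) (\<lambda>i w. G (N - Suc i) (z M) w b)"
    have W0: "W 0 = G N (z M) 0 b" and WS: "W (Suc i) = G (N - Suc i) (z M) (W i) b" for i by (simp_all add: W_def)
    have W3: "cmod (W i) < 3" for i
    proof (induction i)
      case 0 thus ?case unfolding W0 by (rule branchD(1)[OF br zM b0(2) bb])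
    next
      case (Suc i) thus ?case unfolding WS by (intro branchD(1)[OF br zM _ bb]) auto
    qed
    define x where "x k = (if - int j \<le> k \<and> k \<le> M then W (nat (k + int j)) else 0)" for k
    show "\<exists>M x. M \<ge> int j \<and> (\<forall>k. cmod (x k) \<le> 3) \<and> (\<forall>k\<in>{- int j..M}. cmod (x k - z k) \<le> \<eta>0 / 4) \<and>
      (\<forall>k\<in>{- int j<..<M}. x (k + 1) = (x k)\<^sup>2 + cc b + b * x (k - 1))"
    proof (intro exI[of _ M] exI[of _ x] conjI allI impI ballI M(1))
      show "cmod (x k) \<le> 3" for k using W3 by (auto simp: x_def less_imp_le)
      show "cmod (x k - z k) \<le> \<eta>0 / 4" if k: "k \<in> {- int j..M}" for k
      proof -
        define i where "i = nat (k + int j)"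
        have i: "M - int (N - i) = k" "i \<le> N" using k N by (auto simp: i_def)
        have "\<exists>w\<in>ball 0 4. W i = G (N - i) (z M) w b"
        proof (cases i)
          case 0 thus ?thesis using W0 b0 by auto
        next
          case (Suc i') thus ?thesis using WS[of i'] W3[of i'] by (intro bexI[of _ "W i'"]) auto
        qed
        then obtain w where w: "w \<in> ball 0 4" "W i = G (N - i) (z M) w b" by blast
        have "x k = W i" using k by (simp add: x_def i_def)
        moreover have "z k = G (N - i) (z M) 0 0" using Gz[of "N - i"] i by simp
        ultimately show ?thesis using g(3)[OF w(1) b, of "N - i"] w(2) by simp
      qed
      show "x (k + 1) = (x k)\<^sup>2 + cc b + b * x (k - 1)" if k: "k \<in> {- int j<..<M}" for k
      proof -
        define i where "i = nat (k - 1 + int j)"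
        have i: "Suc (Suc i) \<le> N" using k N by (auto simp: i_def)
        have xk: "x (k - 1) = W i" "x k = W (Suc i)" "x (k + 1) = W (Suc (Suc i))"
          using k by (auto simp: x_def i_def nat_add_distrib nat_diff_distrib' intro!: arg_cong[of _ _ W])
        have e: "N - Suc i = Suc (N - Suc (Suc i))" using i by simp
        have "(G (N - Suc i) (z M) (W i) b)\<^sup>2 + cc b + b * W i = G (N - Suc (Suc i)) (z M) (G (N - Suc i) (z M) (W i) b) b"
          unfolding e using G(3) zM bb W3[of i] by (simp add: branch_seq_def)
        thus ?thesis unfolding xk using WS by simp
      qed
    qed
  qed
  then obtain M x where x: "\<And>j. M j \<ge> int j" "\<And>j k. cmod (x j k) \<le> 3"
    "\<And>j k. - int j \<le> k \<Longrightarrow> k \<le> M j \<Longrightarrow> cmod (x j k - z k) \<le> \<eta>0 / 4"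
    "\<And>j k. - int j < k \<Longrightarrow> k < M j \<Longrightarrow> x j (k + 1) = (x j k)\<^sup>2 + cc b + b * x j (k - 1)"
    by (metis atLeastAtMost_iff greaterThanLessThan_iff)
  obtain r g where r: "strict_mono (r :: nat \<Rightarrow> nat)" and g: "\<And>k. (\<lambda>j. x (r j) k) \<longlonglongrightarrow> g k"
    using pointwise_subsequence[of x 3] x(2) by blast
  have big: "\<forall>\<^sub>F j in sequentially. - int (r j) < k \<and> k < M (r j)" for k
    unfolding eventually_sequentially
  proof (intro exI[of _ "nat (\<bar>k\<bar> + 1)"] allI impI)
    fix j assume "nat (\<bar>k\<bar> + 1) \<le> j"
    thus "- int (r j) < k \<and> k < M (r j)" using x(1)[of "r j"] seq_suble[OF r, of j] by linarith
  qed
  have o: "orbit b g"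
    by (rule orbit_limit[OF g]) (rule eventually_mono[OF big], use x(4) in blast)
  have cl: "cmod (g k - z k) \<le> \<eta>0 / 4" for k
  proof -
    have "(\<lambda>j. cmod (x (r j) k - z k)) \<longlonglongrightarrow> cmod (g k - z k)" by (intro tendsto_intros g)
    thus ?thesis
      by (rule tendsto_upperbound) (use eventually_mono[OF big[of k]] x(3) in \<open>auto simp: less_imp_le\<close>)
  qed
  have gB: "cmod (g k) \<le> 3" for k
    by (rule LIMSEQ_le_const2[OF tendsto_norm[OF g]]) (use x(2) in auto)
  have "g \<in> SS b"
  proof (rule SSI_far[OF d4(2)[OF b] o gB])
    fix N obtain K where K: "K \<ge> N" "far z K" using inf by blast
    thus "\<exists>M\<ge>N. s / 2 \<le> cmod (g M - beta)"
      using far_shadow[OF K(2), of g] cl[of K] eta0(1) by (intro exI[of _ K]) (auto simp: norm_minus_commute)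
  qed
  moreover have "shadows g z" unfolding shadows_def
  proof
    fix k show "cmod (g k - z k) \<le> \<eta>0 / 2" using cl[of k] eta0(1) by linarith
  qed
  ultimately show ?thesis by blast
qed

lemma const_SS: "cmod b < \<delta>1 \<Longrightarrow> (\<lambda>k. bet b) \<in> SS b"
proof -
  assume b: "cmod b < \<delta>1"
  have "cmod (bet b) \<le> cmod (bet b - beta) + cmod beta" using norm_triangle_ineq[of "bet b - beta" beta] by simp
  hence "cmod (bet b) \<le> 2" using b_small(2)[OF b] by (simp add: norm_bet_diff norm_beta)
  thus ?thesis using beta_notin_Pet[OF b_small(1)[OF b]]
    by (auto simp: SS_def orbit_def cc_def algebra_simps)
qed

lemma stable_bet:
  assumes b: "cmod b < \<delta>3" and x: "x \<in> SS b" and nf: "\<And>m. m > k \<Longrightarrow> \<not> far x m"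
  shows "cmod (x (k + 1) - bet b) \<le> 2 * cmod b * cmod (x k - bet b)"
proof -
  have "cmod (x (k + int 1) - bet b) \<le> 2 * cmod b * cmod (x (k + int 0) - bet b)"
  proof (rule strong_stable[OF d3(4)[OF b] orbit_recur[OF SS_D(1)[OF x]] recur_bet])
    fix n
    show "cmod (x (k + int (Suc n)) - bet b) \<le> s0"
      using SS_stay(1)[of b x "k + int (Suc n)" x, OF b nf] eta0(1) by simp
    show "(x (k + int (Suc n)), x (k + int n)) \<notin> Pet b" using SS_D(3)[OF x, of "k + int (Suc n)"] by (simp add: algebra_simps)
  qed (use s0_pos beta_notin_Pet[OF d3(4)[OF b]] in auto)
  thus ?thesis by simp
qed

lemma norm_bet_le: "cmod b < \<delta>1 \<Longrightarrow> cmod (bet b) \<le> 1"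
  using norm_triangle_ineq[of "bet b - beta" beta] b_small(2)[of b] by (simp add: norm_bet_diff norm_beta)

text \<open>An orbit near the fixed point for all times, past included, admits any number of strong
  contractions; \<open>1/24\<close> is twice the bound \<open>1/48\<close> on
  \<open>cmod b\<close>.\<close>

lemma no_far_imp_const:
  assumes b: "cmod b < \<delta>3" and x: "x \<in> SS b" and nf: "\<And>m. \<not> far x m"
  shows "x k = bet b"
proof -
  have b1: "cmod b \<le> 1/48" by (rule b_small(2)[OF d3(3)[OF b]])
  have "cmod (x k - bet b) \<le> 3 * (1/24) ^ n" for n k
  proof (induction n arbitrary: k)
    case 0
    show ?case using norm_triangle_ineq4[of "x k" "bet b"] SS_D(2)[OF x, of k] norm_bet_le[OF d3(3)[OF b]] by simp
  next
    case (Suc n)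
    have "cmod (x k - bet b) \<le> 2 * cmod b * cmod (x (k - 1) - bet b)"
      using stable_bet[OF b x nf, of "k - 1"] by simp
    also have "... \<le> (1/24) * (3 * (1/24) ^ n)" using b1 Suc by (intro mult_mono) auto
    finally show ?case by simp
  qed
  note bd = this
  have lim: "(\<lambda>n. 3 * (1/24) ^ n :: real) \<longlonglongrightarrow> 0"
    using tendsto_mult[OF tendsto_const LIMSEQ_realpow_zero[of "1/24"], of 3] by simp
  have "cmod (x k - bet b) \<le> 0" by (rule LIMSEQ_le_const[OF lim]) (use bd in blast)
  thus ?thesis by simp
qed

lemma last_far:
  assumes "\<not> (\<forall>N. \<exists>M\<ge>N. far x M)" "far x m"
  obtains M0 where "far x M0" "\<And>j. j > M0 \<Longrightarrow> \<not> far x j"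
proof -
  obtain N where N: "\<And>M. M \<ge> N \<Longrightarrow> \<not> far x M" using assms(1) by blast
  let ?A = "{M \<in> {m..N}. far x M}"
  have fin: "finite ?A" by (rule finite_subset[of _ "{m..N}"]) auto
  have "m \<le> N" using N assms(2) by (meson linear)
  hence ne: "?A \<noteq> {}" using assms(2) by auto
  show ?thesis
  proof (rule that[of "Max ?A"])
    show "far x (Max ?A)" using Max_in[OF fin ne] by blast
    fix j assume j: "j > Max ?A"
    show "\<not> far x j"
    proof
      assume f: "far x j"
      have "j \<le> N" using N f by (meson linear)
      moreover have "m \<le> Max ?A" using \<open>m \<le> N\<close> assms(2) by (intro Max_ge fin) auto
      ultimately have "j \<le> Max ?A" using f j by (intro Max_ge fin) auto
      thus False using j by simp
    qed
  qed
qed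

text \<open>The remaining orbits have a last far time \<open>M0\<close>, or none. After
  \<open>M0\<close> they are near the fixed point, so the square of \<open>x M0\<close> is near that
  of \<open>beta\<close>; being far from \<open>beta\<close>, the point \<open>x M0\<close> is near
  \<open>- beta\<close>. The shadow is pulled back from \<open>- beta\<close> and continued by
  \<open>beta\<close> for ever.\<close>

lemma shadow_to_zero:
  assumes b: "cmod b < \<delta>4" and x: "x \<in> SS b"
  shows "\<exists>z\<in>SS 0. shadows x z"
proof (cases "\<forall>N. \<exists>M\<ge>N. far x M")
  case True
  thus ?thesis using shadow_to_zero_far[OF b x] by blast
next
  case fin: False
  note b3 = d4(2)[OF b] and b1 = d4(3)[OF b]
  have bn: "1000 * cmod b \<le> \<eta>0" by (rule d4(6)[OF b])
  show ?thesis
  proof (cases "\<exists>m. far x m")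
    case False
    hence "x k = bet b" for k using no_far_imp_const[OF b3 x] by blast
    moreover have "cmod (bet b - beta) \<le> \<eta>0 / 2" using bn norm_ge_zero[of b] unfolding norm_bet_diff by linarith
    ultimately have "shadows x (\<lambda>k. beta)" unfolding shadows_def by simp
    thus ?thesis using const_SS[OF zero_lt_d(1)] by blast
  next
    case True
    then obtain M0 where M0: "far x M0" "\<And>j. j > M0 \<Longrightarrow> \<not> far x j" using last_far[OF fin] by blast
    have xb: "cmod (x k - bet b) \<le> 3" for k
      using norm_triangle_ineq4[of "x k" "bet b"] SS_D(2)[OF x, of k] norm_bet_le[OF b1] by simp
    have late: "cmod (x k - bet b) \<le> 6 * cmod b" if "k > M0" for k
    proof -
      have "cmod (x (k - 1 + 1) - bet b) \<le> 2 * cmod b * cmod (x (k - 1) - bet b)"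
        using that M0(2) by (intro stable_bet[OF b3 x]) auto
      also have "... \<le> 2 * cmod b * 3" using xb by (intro mult_left_mono) auto
      finally show ?thesis by simp
    qed
    have late2: "cmod (x k - beta) \<le> 7 * cmod b" if "k > M0" for k
    proof -
      have "cmod (x k - beta) \<le> cmod (x k - bet b) + cmod (bet b - beta)"
        using norm_triangle_ineq[of "x k - bet b" "bet b - beta"] by simp
      thus ?thesis using late[OF that] norm_ge_zero[of b] norm_bet_diff[of b] by linarith
    qed
    have "(x M0)\<^sup>2 - beta\<^sup>2 = (x (M0 + 1) - beta) - (cc b - cc 0) - b * x (M0 - 1)"
      using orbit_step[OF SS_D(1)[OF x], of M0] P_beta unfolding P_eq by (simp add: algebra_simps)
    also have "cmod ... \<le> 7 * cmod b + 3 * cmod b + cmod b * 2"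
    proof (rule norm_triangle_le_diff[OF add_mono[OF norm_triangle_le_diff[OF add_mono]]])
      show "cmod (x (M0 + 1) - beta) \<le> 7 * cmod b" by (rule late2) simp
      show "cmod (cc b - cc 0) \<le> 3 * cmod b" using b_small(2)[OF b1] by (intro norm_cc_diff) auto
      show "cmod (b * x (M0 - 1)) \<le> cmod b * 2" unfolding norm_mult using SS_D(2)[OF x] by (intro mult_left_mono) auto
    qed
    finally have "cmod ((x M0 - beta) * (x M0 + beta)) \<le> 12 * cmod b"
      by (simp add: algebra_simps power2_eq_square)
    moreover have "3 * s / 4 * cmod (x M0 + beta) \<le> cmod ((x M0 - beta) * (x M0 + beta))"
      unfolding norm_mult using M0(1) by (intro mult_right_mono) (auto simp: far_def)
    ultimately have "s * cmod (x M0 + beta) \<le> 16 * cmod b" by simp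
    also have "... \<le> 16 * (s * \<sigma> * \<eta>0) / 1000" using d4(5)[OF b] by linarith
    also have "... = s * (16 * \<sigma> * \<eta>0 / 1000)" by (simp only: mult_ac times_divide_eq_right)
    finally have "s * cmod (x M0 + beta) \<le> s * (16 * \<sigma> * \<eta>0 / 1000)" .
    hence near: "cmod (x M0 + beta) \<le> 16 * \<sigma> * \<eta>0 / 1000" using s_pos(1) by simp
    obtain \<xi>0 G where G: "\<xi>0 \<in> EE" "cmod (x M0 - \<xi>0) < \<sigma>" "branch_seq \<xi>0 G"
      "\<And>n. G n (x M0) (x (M0 - int n - 1)) b = x (M0 - int n)" using SS_branch[OF b1 x M0(1)] by metis
    have xM: "x M0 \<in> ball \<xi>0 (3 * \<sigma> / 2)" using G(2) sig(1) by (simp add: dist_norm norm_minus_commute)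
    have sm: "16 * \<sigma> * \<eta>0 / 1000 \<le> \<sigma> * 1 / 10"
    proof -
      have "\<sigma> * \<eta>0 \<le> \<sigma> * 1" using eta0(5) rho sig(1) by (intro mult_left_mono) auto
      thus ?thesis using sig(1) by simp
    qed
    have "- beta - \<xi>0 = (x M0 - \<xi>0) - (x M0 + beta)" by simp
    hence "cmod (- beta - \<xi>0) \<le> cmod (x M0 - \<xi>0) + cmod (x M0 + beta)" by (metis norm_triangle_ineq4)
    hence "cmod (- beta - \<xi>0) < 3 * \<sigma> / 2" using sm G(2) near sig(1) by linarith
    hence bM: "- beta \<in> ball \<xi>0 (3 * \<sigma> / 2)" by (simp add: dist_norm norm_minus_commute)
    hence bM2: "- beta \<in> ball \<xi>0 (2 * \<sigma>)" using sig(1) by auto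
    note g = branch_seq_zero[OF G(3) bM2]
    have br: "branch \<xi>0 n (G n)" for n using G(3) by (simp add: branch_seq_def)
    have bb: "b \<in> ball 0 \<delta>1" using b1 by simp
    define z where "z k = (if k \<le> M0 then G (nat (M0 - k)) (- beta) 0 0 else beta)" for k
    have zM: "z M0 = - beta" using G(3) by (simp add: z_def branch_seq_def)
    have o: "orbit 0 z" unfolding orbit_def
    proof
      fix k
      consider "k > M0" | "k = M0" | "k < M0" by linarith
      thus "z (k + 1) = (z k)\<^sup>2 + cc 0 + 0 * z (k - 1)"
      proof cases
        case 1 thus ?thesis using P_beta unfolding P_eq by (simp add: z_def)
      next
        case 2 thus ?thesis using zM P_beta unfolding P_eq by (simp add: z_def)
      next
        case 3
        hence "nat (M0 - k) = Suc (nat (M0 - (k + 1)))" by simp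
        thus ?thesis using g(1)[of "nat (M0 - (k + 1))"] 3 by (simp add: z_def)
      qed
    qed
    have z3: "cmod (z k) \<le> 3" for k using g(2) norm_beta by (auto simp: z_def less_imp_le)
    have "z \<in> SS 0" unfolding SS_def
    proof (intro CollectI conjI allI o)
      show "cmod (z k) \<le> 2" for k by (rule orbit_bound[OF zero_lt_d(1) o z3])
      show "(z k, z (k - 1)) \<notin> Pet 0" for k
      proof
        assume p: "(z k, z (k - 1)) \<in> Pet 0"
        define n where "n = nat (M0 + 1 - k)"
        have "(z (k - 1 + int (Suc (0 + n))), z (k - 1 + int (0 + n))) \<in> Pet 0"
          by (rule Pet_forward[OF d3(4)[OF zero_lt_d(2)] orbit_recur[OF o]]) (use p in simp)
        moreover have "z (k - 1 + int (Suc (0 + n))) = beta" by (auto simp: z_def n_def)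
        ultimately show False using beta_notin_Pet[OF cmod0] by metis
      qed
    qed
    moreover have "shadows x z" unfolding shadows_def
    proof
      fix k show "cmod (x k - z k) \<le> \<eta>0 / 2"
      proof (cases "k \<le> M0")
        case False
        hence "cmod (x k - beta) \<le> \<eta>0 / 2" using late2[of k] bn norm_ge_zero[of b] by linarith
        thus ?thesis using False by (simp add: z_def)
      next
        case True
        define n where "n = nat (M0 - k)"
        have n: "M0 - int n = k" using True by (simp add: n_def)
        have Z: "x (k - 1) \<in> ball 0 4" using SS_D(2)[OF x, of "k - 1"] by simp
        have "cmod (G n (x M0) (x (k - 1)) b - G n (- beta) (x (k - 1)) b) \<le> 15 / (2 * \<sigma>) * cmod (x M0 - - beta)"
          by (rule branch_lipschitz_\<xi>[OF br Z bb xM bM])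
        also have "... \<le> 15 / (2 * \<sigma>) * (16 * \<sigma> * \<eta>0 / 1000)" using near sig(1) by (intro mult_left_mono) auto
        also have "... \<le> \<eta>0 / 4" using sig(1) eta0(1) by simp
        finally have 1: "cmod (G n (x M0) (x (k - 1)) b - G n (- beta) (x (k - 1)) b) \<le> \<eta>0 / 4" .
        have 2: "cmod (G n (- beta) (x (k - 1)) b - G n (- beta) 0 0) \<le> \<eta>0 / 4" by (rule g(3)[OF Z b])
        have "x k - z k = (G n (x M0) (x (k - 1)) b - G n (- beta) (x (k - 1)) b) + (G n (- beta) (x (k - 1)) b - G n (- beta) 0 0)"
          using G(4)[of n] n True by (simp add: z_def n_def)
        thus ?thesis using norm_triangle_mono[OF 1 2] by simp
      qed
    qed
    ultimately show ?thesis by blast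
  qed
qed

end

context parab_branch
begin

subsection \<open>The Julia set of the quadratic polynomial and its orbits\<close>

abbreviation KP :: "complex set" where "KP \<equiv> filled_julia P"
abbreviation JP :: "complex set" where "JP \<equiv> julia_poly P"

lemma parabolic_poly_eq: "parabolic_poly l = P"
  by (auto simp: fun_eq_iff parabolic_poly_def quad_def cc0_eq)

lemma KP_iff: "x \<in> KP \<longleftrightarrow> (\<forall>n. cmod ((P ^^ n) x) \<le> 2)"
proof
  assume "x \<in> KP"
  then obtain B where B: "\<And>n. cmod ((P ^^ n) x) \<le> B" by (auto simp: filled_julia_def bounded_iff)
  show "\<forall>n. cmod ((P ^^ n) x) \<le> 2"
  proof (rule allI, rule ccontr)
    fix n assume "\<not> cmod ((P ^^ n) x) \<le> 2"
    hence g: "cmod ((P ^^ n) x) > 2" by simp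
    obtain k where "B < (13/8) ^ k" using real_arch_pow[of "13/8" B] by auto
    moreover have "cmod ((P ^^ k) ((P ^^ n) x)) \<ge> (13/8) ^ k * cmod ((P ^^ n) x)" using g by (intro iterate_grow) auto
    moreover have "(13/8) ^ k * cmod ((P ^^ n) x) \<ge> (13/8 :: real) ^ k * 1" using g by (intro mult_left_mono) auto
    ultimately show False using B[of "k + n"] unfolding funpow_add comp_apply by linarith
  qed
next
  assume "\<forall>n. cmod ((P ^^ n) x) \<le> 2"
  thus "x \<in> KP" by (auto simp: filled_julia_def bounded_iff)
qed

lemma closed_KP: "closed KP"
proof -
  have "KP = (\<Inter>n. {x. cmod ((P ^^ n) x) \<le> 2})" by (auto simp: KP_iff)
  moreover have "closed {x. cmod ((P ^^ n) x) \<le> 2}" for n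
    by (intro closed_Collect_le continuous_intros quad_continuous_iterate)
  ultimately show ?thesis by (simp add: closed_INT)
qed

lemma JP_eq: "JP = KP - interior KP"
  using closed_KP by (simp add: julia_poly_def frontier_def)

lemma JP_bound: "x \<in> JP \<Longrightarrow> cmod x \<le> 2"
  using KP_iff[of x] by (metis JP_eq DiffD1 funpow_0)

lemma compact_JP: "compact JP"
  unfolding compact_eq_bounded_closed
  using JP_bound by (auto simp: julia_poly_def bounded_iff)

lemma KP_step: "P x \<in> KP \<longleftrightarrow> x \<in> KP"
proof
  assume "x \<in> KP"
  thus "P x \<in> KP" unfolding KP_iff by (metis funpow_Suc_right comp_apply)
next
  assume "P x \<in> KP"
  hence "\<And>n. cmod ((P ^^ Suc n) x) \<le> 2" unfolding KP_iff by (metis funpow_Suc_right comp_apply)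
  moreover from this have "cmod ((P ^^ 0) x) \<le> 2" using iterate_bound[of 1 x 2] by (metis One_nat_def order_refl funpow_0)
  ultimately show "x \<in> KP" unfolding KP_iff by (metis not0_implies_Suc)
qed

lemma P_holomorphic: "P holomorphic_on S"
  using quad_holomorphic_iterate[of 1 "cc 0" S] by simp

lemma P_continuous: "continuous_on S P"
  by (rule holomorphic_on_imp_continuous_on[OF P_holomorphic])

lemma JP_step: "P x \<in> JP \<longleftrightarrow> x \<in> JP"
proof -
  have "P x \<in> interior KP \<longleftrightarrow> x \<in> interior KP"
  proof
    assume "P x \<in> interior KP"
    moreover have "open (P -` interior KP)" by (rule open_vimage[OF open_interior P_continuous])
    moreover have "P -` interior KP \<subseteq> KP" using KP_step interior_subset by blast
    ultimately show "x \<in> interior KP" using interior_maximal by blast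
  next
    assume x: "x \<in> interior KP"
    have nc: "\<not> P constant_on UNIV"
    proof
      assume "P constant_on UNIV"
      hence "P 0 = P 1" unfolding constant_on_def by (metis UNIV_I)
      thus False by (simp add: P_eq)
    qed
    have "open (P ` interior KP)"
      by (rule open_mapping_thm[OF P_holomorphic open_UNIV connected_UNIV open_interior _ nc]) simp
    moreover have "P ` interior KP \<subseteq> KP" using KP_step interior_subset by blast
    ultimately show "P x \<in> interior KP" using x interior_maximal by blast
  qed
  thus ?thesis by (simp add: JP_eq KP_step)
qed

lemma JP_iterate: "(P ^^ n) x \<in> JP \<longleftrightarrow> x \<in> JP"
  by (induction n) (simp_all add: JP_step)

lemma Bas_interior: "Bas \<subseteq> interior KP"
proof (rule interior_maximal[OF _ open_Bas])
  show "Bas \<subseteq> KP"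
    using Bas_converges convergent_imp_bounded by (fastforce simp: filled_julia_def)
qed

lemma orbit0_iff: "orbit 0 z \<longleftrightarrow> (\<forall>k. z (k + 1) = P (z k))"
  by (simp add: orbit_def P_eq)

lemma orbit0_iterate: "orbit 0 z \<Longrightarrow> z (k + int n) = (P ^^ n) (z k)"
proof (induction n)
  case (Suc n)
  have "z (k + int n + 1) = P (z (k + int n))" using Suc.prems orbit0_iff by blast
  thus ?case using Suc by (simp add: algebra_simps)
qed simp

lemma not_infinitely_far:
  assumes z: "z \<in> SS 0" and fin: "\<not> (\<forall>N. \<exists>M\<ge>N. far z M)"
  shows "\<exists>N. \<forall>k\<ge>N. z k = beta"
proof -
  obtain N where N: "\<And>M. M \<ge> N \<Longrightarrow> \<not> far z M" using fin by blast
  have "z (k + 1) = beta" if "k \<ge> N" for k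
  proof -
    have "cmod (z (k + 1) - bet 0) \<le> 2 * cmod 0 * cmod (z k - bet 0)"
      by (rule stable_bet[OF zero_lt_d(2) z]) (use N that in auto)
    thus ?thesis by simp
  qed
  hence "z k = beta" if "k \<ge> N + 1" for k using that by (metis add_le_cancel_right diff_add_cancel)
  thus ?thesis by blast
qed

text \<open>Were \<open>beta\<close> interior to the filled Julia set, nearby points would all
  converge to \<open>beta\<close>, either landing on it or lying in the basin, and the iterates
  would form a normal family there. Derivatives at \<open>beta\<close> would become small along a
  subsequence, but they are \<open>l ^ n\<close>, of modulus 1.\<close>

lemma beta_in_JP: "beta \<in> JP"
proof -
  have "beta \<in> KP" using norm_beta by (simp add: KP_iff iterate_beta)
  moreover have "beta \<notin> interior KP"
  proof
    assume "beta \<in> interior KP"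
    then obtain r where r: "r > 0" "ball beta r \<subseteq> KP" by (auto simp: mem_interior)
    have b2: "cmod ((P ^^ n) x) \<le> 2" if "x \<in> ball beta r" for n x using r that by (auto simp: KP_iff)
    \<comment> \<open>\<open>s0 * r / 10\<close> compensates the Lipschitz constant
      \<open>5 * 2 / r\<close> of the iterates, so that whole orbits stay within \<open>s0\<close>
      of \<open>beta\<close>.\<close>
    define r' where "r' = min (3 * r / 4) (s0 * r / 10)"
    have r': "r' > 0" "r' \<le> 3 * r / 4" "r' \<le> s0 * r / 10" using r s0_pos by (auto simp: r'_def)
    have lim: "(\<lambda>n. (P ^^ n) x) \<longlonglongrightarrow> beta" if x: "x \<in> ball beta r'" for x
    proof (cases "\<exists>n. (P ^^ n) x = beta")
      case True
      then obtain n where "(P ^^ n) x = beta" by blast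
      hence "\<forall>\<^sub>F k in sequentially. (P ^^ k) x = beta"
        unfolding eventually_sequentially using iterate_stay_beta by blast
      thus ?thesis by (rule tendsto_eventually)
    next
      case False
      have "cmod ((P ^^ n) x - beta) \<le> s0" for n
      proof -
        have "cmod ((P ^^ n) x - (P ^^ n) beta) \<le> (5 * 2 / r) * cmod (x - beta)"
          by (rule holomorphic_lipschitz[OF quad_holomorphic_iterate b2]) (use x r r' in auto)
        also have "... \<le> (5 * 2 / r) * (s0 * r / 10)"
          using x r r' by (intro mult_left_mono) (auto simp: dist_norm norm_minus_commute)
        also have "... = s0" using r by simp
        finally show ?thesis by (simp add: iterate_beta)
      qed
      hence "x \<in> Bas" using False by (intro BasI_stay[of 0]) auto
      thus ?thesis by (rule Bas_converges)
    qed
    obtain g q' where g: "strict_mono (q' :: nat \<Rightarrow> nat)"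
      "\<And>x. x \<in> ball beta r' \<Longrightarrow> ((\<lambda>n. (P ^^ q' n) x) \<longlonglongrightarrow> g x)"
      "\<And>K. \<lbrakk>compact K; K \<subseteq> ball beta r'\<rbrakk> \<Longrightarrow> uniform_limit K ((\<lambda>n. P ^^ n) \<circ> q') g sequentially"
    proof (rule Montel[of "ball beta r'" "range (\<lambda>n. P ^^ n)" "\<lambda>n. P ^^ n"])
      show "\<exists>B. \<forall>h\<in>range (\<lambda>n. P ^^ n). \<forall>z\<in>K. cmod (h z) \<le> B" if "K \<subseteq> ball beta r'" for K
      proof (intro exI[of _ 2] ballI)
        fix h z assume "h \<in> range (\<lambda>n. P ^^ n)" "z \<in> K"
        thus "cmod (h z) \<le> 2" using b2 that r' r by (auto simp: subset_eq)
      qed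
    qed (auto intro: quad_holomorphic_iterate)
    have gb: "g x = beta" if "x \<in> ball beta r'" for x
      using LIMSEQ_unique[OF g(2)[OF that]] LIMSEQ_subseq_LIMSEQ[OF lim[OF that] g(1)] by (simp add: o_def)
    have "\<forall>\<^sub>F n in sequentially. \<forall>x\<in>cball beta (r'/2). dist (((\<lambda>n. P ^^ n) \<circ> q') n x) (g x) < r' / 8"
    proof -
      have "cball beta (r'/2) \<subseteq> ball beta r'" using r' by (auto simp: subset_eq)
      thus ?thesis using g(3)[OF compact_cball] r' unfolding uniform_limit_iff by (meson divide_pos_pos zero_less_numeral)
    qed
    then obtain n where n: "\<And>x. x \<in> cball beta (r'/2) \<Longrightarrow> dist ((P ^^ q' n) x) (g x) < r' / 8"
      unfolding eventually_sequentially o_def by blast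
    have "cmod (deriv (P ^^ q' n) beta) \<le> 2 * (r' / 8) / (r' / 2)"
    proof (rule cauchy_deriv_bound[OF quad_holomorphic_iterate])
      show "cmod ((P ^^ q' n) w - beta) \<le> r' / 8" if "w \<in> ball beta (r'/2)" for w
        using n[of w] gb[of w] that r' by (auto simp: dist_norm less_imp_le)
    qed (use r' in auto)
    also have "... = 1 / 2" using r' by simp
    finally show False by (simp add: iterate_deriv_beta norm_power norm_l)
  qed
  ultimately show ?thesis by (simp add: JP_eq)
qed

text \<open>At late far times the derivative of the iterate is at least \<open>8 / r\<close> by
  expansion, whereas Cauchy's inequality bounds it by \<open>4 / r\<close> if the disc of radius
  \<open>r\<close> lies in the filled Julia set.\<close>

lemma far_imp_JP:
  assumes z: "z \<in> SS 0" and inf: "\<And>N. \<exists>M\<ge>N. far z M"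
  shows "z k \<in> JP"
proof -
  note o = SS_D(1)[OF z]
  have "cmod ((P ^^ n) (z k)) \<le> 2" for n using orbit0_iterate[OF o, of k n] SS_D(2)[OF z] by metis
  hence "z k \<in> KP" by (simp add: KP_iff)
  moreover have "z k \<notin> interior KP"
  proof
    assume "z k \<in> interior KP"
    then obtain r where r: "r > 0" "ball (z k) r \<subseteq> KP" by (auto simp: mem_interior)
    obtain n0 where n0: "\<And>n \<zeta> \<xi>. n \<ge> n0 \<Longrightarrow> \<xi> \<in> EE \<Longrightarrow> (P ^^ n) \<zeta> \<in> cball \<xi> (2 * \<sigma>) \<Longrightarrow> 1 \<le> (r / 8) * cmod (deriv (P ^^ n) \<zeta>)"
      using expansion_EE[of "r / 8"] r(1) by auto
    obtain M where M: "M \<ge> k + int n0" "far z M" using inf by blast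
    obtain \<xi> where \<xi>: "\<xi> \<in> EE" "cmod (z M - \<xi>) < \<sigma>" using near_EE[OF zero_lt_d(1) z] M(2) by (auto simp: far_def)
    define n where "n = nat (M - k)"
    have n: "n \<ge> n0" "(P ^^ n) (z k) = z M" using M(1) orbit0_iterate[OF o, of k n] by (auto simp: n_def)
    have "1 \<le> (r / 8) * cmod (deriv (P ^^ n) (z k))"
      using n0[OF n(1) \<xi>(1)] \<xi>(2) sig(1) by (simp add: n(2) dist_norm norm_minus_commute)
    moreover have "cmod (deriv (P ^^ n) (z k)) \<le> 2 * 2 / r"
    proof (rule cauchy_deriv_bound[of "P ^^ n" "z k" r 0 2, OF quad_holomorphic_iterate])
      show "cmod ((P ^^ n) w - 0) \<le> 2" if "w \<in> ball (z k) r" for w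
        using r(2) that by (auto simp: KP_iff subset_eq)
    qed (use r(1) in simp)
    hence "(r / 8) * cmod (deriv (P ^^ n) (z k)) \<le> (r / 8) * (2 * 2 / r)" using r(1) by (intro mult_left_mono) auto
    ultimately show False using r(1) by simp
  qed
  ultimately show ?thesis by (simp add: JP_eq)
qed

text \<open>An orbit of \<open>SS 0\<close> is either far at arbitrarily late times, where
  \<open>far_imp_JP\<close> applies, or it lands on \<open>beta\<close>. Conversely the petal
  belongs to the basin, which is interior to the filled Julia set.\<close>

lemma SS0_iff: "z \<in> SS 0 \<longleftrightarrow> (\<forall>k. z (k + 1) = P (z k) \<and> z k \<in> JP)"
proof
  assume z: "z \<in> SS 0"
  have "z k \<in> JP" for k
  proof (cases "\<forall>N. \<exists>M\<ge>N. far z M")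
    case True thus ?thesis using far_imp_JP[OF z] by blast
  next
    case False
    then obtain N where N: "\<And>k. k \<ge> N \<Longrightarrow> z k = beta" using not_infinitely_far[OF z] by blast
    have "(P ^^ nat (N - k)) (z k) = beta"
      using orbit0_iterate[OF SS_D(1)[OF z], of k "nat (N - k)"] N[of "k + int (nat (N - k))"] by simp
    thus ?thesis using beta_in_JP JP_iterate by metis
  qed
  thus "\<forall>k. z (k + 1) = P (z k) \<and> z k \<in> JP" using SS_D(1)[OF z] by (auto simp: orbit0_iff)
next
  assume z: "\<forall>k. z (k + 1) = P (z k) \<and> z k \<in> JP"
  hence o: "orbit 0 z" by (simp add: orbit0_iff)
  show "z \<in> SS 0" unfolding SS_def
  proof (intro CollectI conjI allI o)
    show "cmod (z k) \<le> 2" for k using z JP_bound by blast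
    show "(z k, z (k - 1)) \<notin> Pet 0" for k
    proof
      assume "(z k, z (k - 1)) \<in> Pet 0"
      moreover have "z k = P (z (k - 1))" using z by (metis diff_add_cancel)
      ultimately have "z (k - 1) \<in> Bas" by (auto simp: Bas_def intro!: exI[of _ 0])
      thus False using Bas_interior z by (auto simp: JP_eq)
    qed
  qed
qed

lemma JP_not_Bas: "x \<in> JP \<Longrightarrow> x \<notin> Bas"
  using Bas_interior by (auto simp: JP_eq)

text \<open>If the iterates omit \<open>\<zeta>\<close> on the disc, they omit its preimages
  \<open>s\<close> and \<open>- s\<close>, which are distinct because the Julia set misses the
  critical value. Schottky's theorem then bounds all iterates on a smaller disc, which would be
  interior to the filled Julia set.\<close>

lemma backward_dense:
  assumes "\<zeta> \<in> JP" "\<xi> \<in> JP" "r > 0"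
  shows "\<exists>n. \<exists>\<tau>\<in>ball \<xi> r. (P ^^ n) \<tau> = \<zeta>"
proof (rule ccontr)
  assume neg: "\<not> ?thesis"
  define s where "s = csqrt (\<zeta> - cc 0)"
  have s2: "s\<^sup>2 = \<zeta> - cc 0" by (simp add: s_def)
  have "cc 0 \<in> Bas" using critical_in_Bas[of 1] by (simp add: quad_def)
  hence s0: "s \<noteq> 0" using JP_not_Bas[OF assms(1)] s2 by auto
  have omit: "(P ^^ n) \<tau> \<noteq> s \<and> (P ^^ n) \<tau> \<noteq> - s" if "\<tau> \<in> ball \<xi> r" for n \<tau>
  proof -
    have "(P ^^ Suc n) \<tau> \<noteq> \<zeta>" using neg that by blast
    hence "((P ^^ n) \<tau>)\<^sup>2 \<noteq> s\<^sup>2" unfolding quad_iterate_Suc s2 by (metis diff_add_cancel)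
    thus ?thesis by auto
  qed
  define B where "B = exp (pi * exp (pi * (2 + 2 * ((2 + cmod s) / (2 * cmod s)) + 12 * (1/2) / (1 - 1/2))))"
  have bd: "cmod ((P ^^ n) x) \<le> 2 * cmod s * B + cmod s" if x: "x \<in> ball \<xi> (r / 4)" for n x
  proof -
    \<comment> \<open>The disc of radius \<open>r / 2\<close> is scaled to the unit disc, and the
      omitted values \<open>- s\<close> and \<open>s\<close> are moved to 0 and 1.\<close>
    define f where "f w = ((P ^^ n) (\<xi> + of_real (r / 2) * w) + s) / (2 * s)" for w
    have inb: "\<xi> + of_real (r / 2) * w \<in> ball \<xi> r" if "w \<in> cball 0 1" for w
    proof -
      have "r / 2 * cmod w \<le> r / 2 * 1" using that assms(3) by (intro mult_left_mono) auto
      thus ?thesis using assms(3) by (simp add: dist_norm norm_mult)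
    qed
    define w where "w = (x - \<xi>) / of_real (r / 2)"
    have "cmod (x - \<xi>) \<le> r / 4" using x by (auto simp: dist_norm norm_minus_commute)
    moreover have "cmod w = cmod (x - \<xi>) / (r / 2)"
      unfolding w_def norm_divide using assms(3) by (simp only: norm_of_real)
    moreover have "of_real (r / 2) * w = x - \<xi>" unfolding w_def using assms(3) by (simp del: of_real_divide)
    ultimately have w: "cmod w \<le> 1/2" "\<xi> + of_real (r / 2) * w = x" using assms(3)
      by (simp add: pos_divide_le_eq, simp only: add_diff_cancel_left' add.commute[of _ "x - \<xi>"] diff_add_cancel)
    have "cmod (f w) \<le> exp (pi * exp (pi * (2 + 2 * ((2 + cmod s) / (2 * cmod s)) + 12 * (1/2) / (1 - 1/2))))"
    proof (rule Schottky[of f "(2 + cmod s) / (2 * cmod s)" "1/2" w])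
      have "(P ^^ n) holomorphic_on UNIV" by (rule quad_holomorphic_iterate)
      hence "((P ^^ n) \<circ> (\<lambda>w. \<xi> + of_real (r / 2) * w)) holomorphic_on cball 0 1"
        by (intro holomorphic_on_compose_gen[of _ _ _ UNIV] holomorphic_intros) auto
      thus "f holomorphic_on cball 0 1"
        unfolding f_def using s0 by (intro holomorphic_intros) (auto simp: o_def)
      have "cmod ((P ^^ n) \<xi>) \<le> 2" using assms(2) JP_eq KP_iff by blast
      hence "cmod ((P ^^ n) \<xi> + s) \<le> 2 + cmod s" by (intro norm_triangle_le) auto
      thus "cmod (f 0) \<le> (2 + cmod s) / (2 * cmod s)"
        unfolding f_def by (simp add: norm_divide norm_mult divide_right_mono)
      show "\<not> (f z = 0 \<or> f z = 1)" if "z \<in> cball 0 1" for z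
      proof -
        have "(P ^^ n) (\<xi> + of_real (r / 2) * z) + s \<noteq> 0" "(P ^^ n) (\<xi> + of_real (r / 2) * z) + s \<noteq> 2 * s"
          using omit[OF inb[OF that], of n] by (metis add_eq_0_iff2, metis add_right_cancel mult_2)
        thus ?thesis unfolding f_def using s0 by simp
      qed
    qed (use w in auto)
    hence fB: "cmod (f w) \<le> B" by (simp add: B_def)
    have "(P ^^ n) x = 2 * s * f w - s" unfolding f_def w(2) using s0 by simp
    hence "cmod ((P ^^ n) x) \<le> cmod (2 * s * f w) + cmod s" by (metis norm_triangle_ineq4)
    also have "... \<le> 2 * cmod s * B + cmod s" using fB by (simp add: norm_mult mult_left_mono)
    finally show ?thesis .
  qed
  have "ball \<xi> (r / 4) \<subseteq> KP"
    using bd unfolding filled_julia_def bounded_iff by blast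
  hence "\<xi> \<in> interior KP" using assms(3) by (auto simp: mem_interior intro!: exI[of _ "r/4"])
  thus False using assms(2) by (simp add: JP_eq)
qed

text \<open>Entering the petal would make the orbit converge to \<open>beta\<close>, which a
  periodic orbit with a point other than \<open>beta\<close> cannot do; for the same reason it does
  not stay near \<open>beta\<close> in the long run.\<close>

lemma periodic_SS:
  assumes o: "orbit 0 z" and per: "\<And>k. z (k + int p) = z k" "p \<ge> 1" and B: "\<And>k. cmod (z k) \<le> B" and ne: "z k0 \<noteq> beta"
  shows "z \<in> SS 0" "\<forall>N. \<exists>M\<ge>N. far z M"
proof -
  have perm: "z (k + int (p * m)) = z k" for k m
  proof (induction m)
    case (Suc m)
    have "z (k + int (p * Suc m)) = z (k + int (p * m) + int p)" by (simp add: algebra_simps)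
    thus ?case using per(1) Suc by simp
  qed simp
  have notlim: "\<not> (\<lambda>n. z (k0 + int n)) \<longlonglongrightarrow> beta"
  proof
    assume "(\<lambda>n. z (k0 + int n)) \<longlonglongrightarrow> beta"
    moreover have "strict_mono (\<lambda>m. p * m)" using per(2) by (auto simp: strict_mono_def)
    ultimately have "((\<lambda>n. z (k0 + int n)) \<circ> (\<lambda>m. p * m)) \<longlonglongrightarrow> beta" by (rule LIMSEQ_subseq_LIMSEQ)
    hence "(\<lambda>m. z k0) \<longlonglongrightarrow> beta" using perm[of k0] by (simp add: o_def)
    thus False using ne LIMSEQ_const_iff by metis
  qed
  show SS: "z \<in> SS 0" unfolding SS_def
  proof (intro CollectI conjI allI o)
    show "cmod (z k) \<le> 2" for k by (rule orbit_bound[OF zero_lt_d(1) o B])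
    show "(z k, z (k - 1)) \<notin> Pet 0" for k
    proof
      assume p': "(z k, z (k - 1)) \<in> Pet 0"
      have "(\<lambda>n. z (k - 1 + int n)) \<longlonglongrightarrow> beta"
        by (rule Pet_converges[OF cmod0 orbit_recur[OF o]]) (use p' in simp)
      hence l: "(\<lambda>n. (P ^^ n) (z (k - 1))) \<longlonglongrightarrow> beta" using orbit0_iterate[OF o] by simp
      obtain m where m: "k0 + int (p * m) \<ge> k - 1"
      proof -
        have "int (p * nat \<bar>k - 1 - k0\<bar>) \<ge> \<bar>k - 1 - k0\<bar>"
          using per(2) by (simp add: mult_le_cancel_right1)
        thus ?thesis using that[of "nat \<bar>k - 1 - k0\<bar>"] by linarith
      qed
      define i where "i = nat (k0 + int (p * m) - (k - 1))"
      have i: "k - 1 + int i = k0 + int (p * m)" using m by (simp add: i_def)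
      have "(\<lambda>n. (P ^^ (n + i)) (z (k - 1))) \<longlonglongrightarrow> beta" by (rule LIMSEQ_ignore_initial_segment[OF l])
      moreover have "(P ^^ (n + i)) (z (k - 1)) = z (k0 + int n)" for n
      proof -
        have "(P ^^ (n + i)) (z (k - 1)) = z (k - 1 + int (n + i))" using orbit0_iterate[OF o] by metis
        also have "k - 1 + int (n + i) = k0 + int n + int (p * m)" using i by simp
        finally show ?thesis using perm by simp
      qed
      ultimately show False using notlim by simp
    qed
  qed
  show "\<forall>N. \<exists>M\<ge>N. far z M"
  proof (rule ccontr)
    assume "\<not> ?thesis"
    then obtain N where N: "\<And>k. k \<ge> N \<Longrightarrow> z k = beta" using not_infinitely_far[OF SS] by blast
    have "int (p * nat \<bar>N - k0\<bar>) \<ge> \<bar>N - k0\<bar>" using per(2) by (simp add: mult_le_cancel_right1)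
    hence "z (k0 + int (p * nat \<bar>N - k0\<bar>)) = beta" by (intro N) linarith
    thus False using perm[of k0] ne by metis
  qed
qed

text \<open>The other fixed point \<open>1 - beta\<close> serves unless it equals
  \<open>beta\<close>, that is, unless \<open>l = 1\<close>. In that case the polynomial is
  \<open>x^2 + 1/4\<close>, and the cycle of \<open>-1/2 + i\<close> and \<open>-1/2 - i\<close> is
  used.\<close>

lemma exists_never_beta: "\<exists>\<omega>\<in>JP. \<forall>n. (P ^^ n) \<omega> \<noteq> beta"
proof (cases "l = 1")
  case False
  define \<omega> where "\<omega> = 1 - beta"
  have "beta\<^sup>2 + cc 0 = beta" using P_beta by (simp add: P_eq)
  hence P\<omega>: "P \<omega> = \<omega>" by (simp add: P_eq \<omega>_def power2_diff algebra_simps)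
  have ne: "\<omega> \<noteq> beta" using False by (auto simp: \<omega>_def beta_eq field_simps)
  have it: "(P ^^ n) \<omega> = \<omega>" for n by (induction n) (simp_all add: P\<omega>)
  have "(\<lambda>k. \<omega>) \<in> SS 0"
    by (rule periodic_SS(1)[of _ 1 "cmod \<omega>"]) (use P\<omega> ne in \<open>auto simp: orbit0_iff\<close>)
  hence "\<omega> \<in> JP" by (simp add: SS0_iff)
  thus ?thesis using it ne by metis
next
  case True
  define \<omega> where "\<omega> = Complex (-1/2) 1"
  define \<omega>' where "\<omega>' = Complex (-1/2) (-1)"
  have c: "cc 0 = Complex (1/4) 0" using True by (simp add: cc0_eq complex_eq_iff)
  have P1: "P \<omega> = \<omega>'" "P \<omega>' = \<omega>"
    unfolding c \<omega>_def \<omega>'_def quad_def by (simp_all add: complex_eq_iff power2_eq_square)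
  have be: "beta = Complex (1/2) 0" using True by (simp add: beta_eq complex_eq_iff)
  have ne: "\<omega> \<noteq> beta" "\<omega>' \<noteq> beta" by (simp_all add: be \<omega>_def \<omega>'_def)
  have it: "(P ^^ n) \<omega> \<in> {\<omega>, \<omega>'}" for n by (induction n) (use P1 in auto)
  define z where "z k = (if even k then \<omega> else \<omega>')" for k :: int
  have "z \<in> SS 0"
    by (rule periodic_SS(1)[of _ 2 "max (cmod \<omega>) (cmod \<omega>')" 0]) (use P1 ne in \<open>auto simp: orbit0_iff z_def\<close>)
  hence "z 0 \<in> JP" by (simp add: SS0_iff)
  hence "\<omega> \<in> JP" by (simp add: z_def)
  thus ?thesis using it ne by (metis insertE singletonD)
qed

end

context parab_branch
begin

subsection \<open>Density of periodic orbits\<close>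

lemma inverse_contraction:
  assumes \<kappa>: "\<And>\<zeta>. (P ^^ n) \<zeta> \<in> cball \<xi>0 (2 * \<sigma>) \<Longrightarrow> 1 \<le> \<kappa> * cmod (deriv (P ^^ n) \<zeta>)"
    and g: "g holomorphic_on ball \<xi>0 (2 * \<sigma>)" "\<And>y. y \<in> ball \<xi>0 (2 * \<sigma>) \<Longrightarrow> (P ^^ n) (g y) = y"
    and xy: "x \<in> ball \<xi>0 (2 * \<sigma>)" "y \<in> ball \<xi>0 (2 * \<sigma>)"
  shows "cmod (g x - g y) \<le> \<kappa> * cmod (x - y)"
proof (rule field_differentiable_bound[of "ball \<xi>0 (2 * \<sigma>)" g "deriv g"])
  fix z assume z: "z \<in> ball \<xi>0 (2 * \<sigma>)"
  show "(g has_field_derivative deriv g z) (at z within ball \<xi>0 (2 * \<sigma>))"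
    using holomorphic_derivI[OF g(1) open_ball z] has_field_derivative_at_within by blast
  have 1: "deriv (P ^^ n) (g z) * deriv g z = 1" by (rule branch_deriv[OF g z])
  have "(P ^^ n) (g z) \<in> cball \<xi>0 (2 * \<sigma>)" using g(2)[OF z] z by auto
  hence "1 * cmod (deriv g z) \<le> \<kappa> * cmod (deriv (P ^^ n) (g z)) * cmod (deriv g z)"
    using \<kappa> by (intro mult_right_mono) auto
  also have "... = \<kappa> * cmod (deriv (P ^^ n) (g z) * deriv g z)" by (simp add: norm_mult)
  finally show "norm (deriv g z) \<le> \<kappa>" by (simp add: 1)
qed (use xy in auto)

lemma periodic_orbit_of_point:
  fixes c :: int
  assumes w: "(P ^^ p) w = w" "p \<ge> 1"
  obtains y where "orbit 0 y" "\<And>k. y (k + int p) = y k" "\<And>k j. k + c = int j \<Longrightarrow> y k = (P ^^ j) w"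
    "\<And>k. cmod (y k) \<le> (\<Sum>j<p. cmod ((P ^^ j) w))"
proof
  define y where "y = (\<lambda>k. (P ^^ nat ((k + c) mod int p)) w)"
  have eq: "y k = (P ^^ j) w" if "(k + c) mod int p = int j mod int p" for k j
  proof -
    have "(k + c) mod int p = int (j mod p)" using that by (simp add: zmod_int)
    thus ?thesis unfolding y_def by (simp add: funpow_mod_eq[OF w(1)])
  qed
  thus "k + c = int j \<Longrightarrow> y k = (P ^^ j) w" for k j by simp
  show "y (k + int p) = y k" for k by (simp add: y_def add.assoc add.commute[of "int p"]) (simp flip: add.assoc)
  have r: "0 \<le> (k + c) mod int p" "(k + c) mod int p < int p" for k using w(2) by auto
  show "cmod (y k) \<le> (\<Sum>j<p. cmod ((P ^^ j) w))" for k
    unfolding y_def by (rule member_le_sum) (use r[of k] in \<open>auto simp: nat_less_iff\<close>)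
  show "orbit 0 y" unfolding orbit0_iff
  proof
    fix k
    define j where "j = nat ((k + c) mod int p)"
    have "(k + c) mod int p = int j mod int p" unfolding j_def using r[of k] by simp
    hence "(k + 1 + c) mod int p = int (Suc j) mod int p" using mod_add_cong[of "k + c" "int p" "int j" 1 1] by (simp add: algebra_simps)
    hence "y (k + 1) = (P ^^ Suc j) w" by (rule eq)
    moreover have "y k = (P ^^ j) w" by (simp add: y_def j_def)
    ultimately show "y (k + 1) = P (y k)" by simp
  qed
qed

text \<open>A closing argument. By \<open>backward_dense\<close> there is an iterated preimage
  \<open>\<tau>\<close> of \<open>z (- K)\<close> near a far point \<open>z M\<close>, so the orbit
  of \<open>\<tau>\<close> runs along \<open>z\<close> from time \<open>- K\<close> to
  \<open>M\<close> and ends near its start. The inverse branch of \<open>P ^^ N\<close> taking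
  \<open>z M\<close> to \<open>\<tau>\<close> maps a disc about \<open>z M\<close> into itself and
  contracts; its fixed point is periodic. Since \<open>M\<close> exceeds \<open>K\<close> by at
  least \<open>n1\<close>, the contraction is still effective on the whole window.\<close>

lemma periodic_approx_far:
  assumes z: "z \<in> SS 0" and inf: "\<And>N. \<exists>M\<ge>N. far z M" and e: "e > 0"
  shows "\<exists>p\<ge>1. \<exists>y\<in>SS 0. (\<forall>k. y (k + int p) = y k) \<and> (\<forall>N. \<exists>M\<ge>N. far y M) \<and>
    (\<forall>k. \<bar>k\<bar> \<le> int K \<longrightarrow> cmod (y k - z k) < e)"
proof -
  note o = SS_D(1)[OF z]
  define \<kappa> where "\<kappa> = min (1/8) (e / (8 * \<sigma>))"
  have \<kappa>: "\<kappa> > 0" "\<kappa> \<le> 1/8" "\<kappa> \<le> e / (8 * \<sigma>)" using e sig by (auto simp: \<kappa>_def)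
  obtain n1 where n1: "\<And>n \<zeta> \<xi>. n \<ge> n1 \<Longrightarrow> \<xi> \<in> EE \<Longrightarrow> (P ^^ n) \<zeta> \<in> cball \<xi> (2 * \<sigma>) \<Longrightarrow> 1 \<le> \<kappa> * cmod (deriv (P ^^ n) \<zeta>)"
    using expansion_EE[OF \<kappa>(1)] by blast
  obtain M where M: "M \<ge> int K + int n1 + 1" "far z M" using inf by blast
  obtain \<xi>0 where \<xi>: "\<xi>0 \<in> EE" "cmod (z M - \<xi>0) < \<sigma>" using near_EE[OF zero_lt_d(1) z] M(2) by (auto simp: far_def)
  have JP: "z k \<in> JP" for k using z SS0_iff by blast
  obtain m \<tau> where \<tau>: "\<tau> \<in> ball (z M) (\<sigma> / 8)" "(P ^^ m) \<tau> = z (- int K)"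
    using backward_dense[OF JP JP, of "\<sigma> / 8" M "- int K"] sig by auto
  define n where "n = nat (M + int K)"
  have n: "int n = M + int K" "n \<ge> 1" using M(1) by (auto simp: n_def)
  define N where "N = m + n"
  have zi: "(P ^^ (m + i)) \<tau> = z (- int K + int i)" for i
    using orbit0_iterate[OF o, of "- int K" i] \<tau>(2) by (simp add: add.commute[of m] funpow_add)
  have zM: "(P ^^ N) \<tau> = z M" using zi[of n] n(1) by (simp add: N_def)
  have sub: "cball (z M) (\<sigma> / 2) \<subseteq> ball \<xi>0 (2 * \<sigma>)"
  proof
    fix y assume "y \<in> cball (z M) (\<sigma> / 2)"
    hence "dist \<xi>0 y \<le> dist \<xi>0 (z M) + \<sigma> / 2" using dist_triangle[of \<xi>0 y "z M"] by simp
    thus "y \<in> ball \<xi>0 (2 * \<sigma>)" using \<xi>(2) sig by (simp add: dist_norm norm_minus_commute)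
  qed
  have zMb: "z M \<in> ball \<xi>0 (2 * \<sigma>)" using sub sig by (metis centre_in_cball half_gt_zero_iff less_imp_le subsetD)
  have "ball \<xi>0 (2 * \<sigma>) \<subseteq> - PC"
    using sep[OF \<xi>(1)] sig by fastforce
  then obtain g where g: "g holomorphic_on ball \<xi>0 (2 * \<sigma>)" "\<And>y. y \<in> ball \<xi>0 (2 * \<sigma>) \<Longrightarrow> (P ^^ N) (g y) = y" "g (z M) = \<tau>"
    using inverse_branch_ball[of \<xi>0 "2 * \<sigma>" N \<tau>] zM zMb by metis
  have contr: "cmod ((P ^^ i) (g x) - (P ^^ i) (g y)) \<le> \<kappa> * cmod (x - y)"
    if "i + n1 \<le> N" "x \<in> cball (z M) (\<sigma> / 2)" "y \<in> cball (z M) (\<sigma> / 2)" for i x y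
  proof (rule inverse_contraction[of "N - i" \<xi>0 \<kappa> "\<lambda>w. (P ^^ i) (g w)"])
    show "1 \<le> \<kappa> * cmod (deriv (P ^^ (N - i)) \<zeta>)" if "(P ^^ (N - i)) \<zeta> \<in> cball \<xi>0 (2 * \<sigma>)" for \<zeta>
      using n1[OF _ \<xi>(1) that] \<open>i + n1 \<le> N\<close> by simp
    show "(\<lambda>w. (P ^^ i) (g w)) holomorphic_on ball \<xi>0 (2 * \<sigma>)"
      using holomorphic_on_compose_gen[OF g(1) quad_holomorphic_iterate[of i "cc 0" UNIV]] by (simp add: o_def)
    show "(P ^^ (N - i)) ((P ^^ i) (g w)) = w" if "w \<in> ball \<xi>0 (2 * \<sigma>)" for w
      using g(2)[OF that] \<open>i + n1 \<le> N\<close> by (metis add_leD1 comp_apply funpow_add le_add_diff_inverse2)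
  qed (use that sub in auto)
  have n1N: "n1 \<le> N" using M(1) n(1) by (simp add: N_def)
  have maps: "g ` cball (z M) (\<sigma> / 2) \<subseteq> cball (z M) (\<sigma> / 2)"
  proof
    fix v assume "v \<in> g ` cball (z M) (\<sigma> / 2)"
    then obtain y where y: "y \<in> cball (z M) (\<sigma> / 2)" "v = g y" by blast
    have "cmod (g y - g (z M)) \<le> \<kappa> * cmod (y - z M)" using contr[of 0 y "z M"] y n1N sig by simp
    also have "... \<le> 1/8 * (\<sigma> / 2)" using y \<kappa> by (intro mult_mono) (auto simp: dist_norm norm_minus_commute)
    finally have "cmod (g y - \<tau>) \<le> \<sigma> / 16" by (simp add: g(3))
    moreover have "cmod (\<tau> - z M) < \<sigma> / 8" using \<tau>(1) by (simp add: dist_norm norm_minus_commute)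
    ultimately have "cmod (g y - z M) \<le> \<sigma> / 2" using norm_triangle_ineq[of "g y - \<tau>" "\<tau> - z M"] sig by simp
    thus "v \<in> cball (z M) (\<sigma> / 2)" by (simp add: y(2) dist_norm norm_minus_commute)
  qed
  have "\<exists>!x\<in>cball (z M) (\<sigma> / 2). g x = x"
  proof (rule Banach_fix[of _ "1/8"])
    show "complete (cball (z M) (\<sigma> / 2))" by (simp add: complete_eq_closed)
    fix x y assume xy: "x \<in> cball (z M) (\<sigma> / 2)" "y \<in> cball (z M) (\<sigma> / 2)"
    have "cmod (g x - g y) \<le> \<kappa> * cmod (x - y)" using contr[of 0 x y] xy n1N by simp
    also have "... \<le> 1/8 * cmod (x - y)" using \<kappa> by (intro mult_right_mono) auto
    finally show "dist (g x) (g y) \<le> 1/8 * dist x y" by (simp add: dist_norm)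
  qed (use maps sig in auto)
  then obtain w where w: "w \<in> cball (z M) (\<sigma> / 2)" "g w = w" by blast
  have Pw: "(P ^^ N) w = w" using g(2)[of w] w sub by auto
  have N1: "N \<ge> 1" using n(2) by (simp add: N_def)
  obtain y where y: "orbit 0 y" "\<And>k. y (k + int N) = y k" "\<And>k j. k + (int K + int m) = int j \<Longrightarrow> y k = (P ^^ j) w"
    "\<And>k. cmod (y k) \<le> (\<Sum>j<N. cmod ((P ^^ j) w))"
    using periodic_orbit_of_point[OF Pw N1, of "int K + int m"] by blast
  have "y M = w" using y(3)[of M N] n(1) Pw by (simp add: N_def)
  moreover have "w \<noteq> beta"
  proof
    assume "w = beta"
    hence "cmod (z M - beta) \<le> \<sigma> / 2" using w(1) by (simp add: dist_norm)
    thus False using M(2) sig s_pos by (simp add: far_def)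
  qed
  ultimately have SS: "y \<in> SS 0" "\<forall>N. \<exists>M\<ge>N. far y M"
    using periodic_SS[OF y(1,2) N1 y(4)] by auto
  have "cmod (y k - z k) < e" if k: "\<bar>k\<bar> \<le> int K" for k
  proof -
    define i where "i = nat (k + int K)"
    have i: "int i = k + int K" "m + i + n1 \<le> N" using k M(1) n(1) by (auto simp: i_def N_def)
    have yk: "y k = (P ^^ (m + i)) (g w)" using y(3)[of k "m + i"] i(1) w(2) by simp
    have "z k = (P ^^ (m + i)) (g (z M))" using zi[of i] i(1) by (simp add: g(3))
    hence "cmod (y k - z k) \<le> \<kappa> * cmod (w - z M)" using contr[OF i(2) w(1), of "z M"] sig yk by simp
    also have "... \<le> e / (8 * \<sigma>) * (\<sigma> / 2)" using w \<kappa> e sig by (intro mult_mono) (auto simp: dist_norm norm_minus_commute)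
    also have "... < e" using e sig by simp
    finally show ?thesis .
  qed
  thus ?thesis using SS N1 y(2) by (intro exI[of _ N] conjI N1 bexI[of _ y]) auto
qed

text \<open>The window of \<open>z\<close> is imitated by a point \<open>\<tau>\<close> near
  \<open>z (- K)\<close> that is eventually mapped to a point whose orbit never meets
  \<open>beta\<close>; by \<open>not_infinitely_far\<close> such an orbit is far at arbitrarily late
  times. Its past is filled in by arbitrary square roots.\<close>

lemma approx_far:
  assumes z: "z \<in> SS 0" and e: "e > 0"
  shows "\<exists>y\<in>SS 0. (\<forall>N. \<exists>M\<ge>N. far y M) \<and> (\<forall>k. \<bar>k\<bar> \<le> int K \<longrightarrow> cmod (y k - z k) < e)"
proof -
  note o = SS_D(1)[OF z]
  have JP: "z k \<in> JP" for k using z SS0_iff by blast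
  obtain \<omega> where \<omega>: "\<omega> \<in> JP" "\<And>n. (P ^^ n) \<omega> \<noteq> beta" using exists_never_beta by blast
  have "\<exists>r>0. \<forall>x. dist x (z (- int K)) < r \<longrightarrow> dist ((P ^^ i) x) ((P ^^ i) (z (- int K))) < e" for i
  proof -
    have "continuous_on UNIV (P ^^ i)" by (rule quad_continuous_iterate)
    thus ?thesis using e unfolding continuous_on_iff by (metis UNIV_I)
  qed
  then obtain r where r: "\<And>i. r i > 0" "\<And>i x. dist x (z (- int K)) < r i \<Longrightarrow> dist ((P ^^ i) x) ((P ^^ i) (z (- int K))) < e"
    by metis
  define R where "R = Min (r ` {..2 * K})"
  have R: "R > 0" "\<And>i. i \<le> 2 * K \<Longrightarrow> R \<le> r i" using r(1) by (auto simp: R_def)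
  obtain m \<tau> where \<tau>: "\<tau> \<in> ball (z (- int K)) R" "(P ^^ m) \<tau> = \<omega>"
    using backward_dense[OF \<omega>(1) JP R(1)] by blast
  have \<tau>J: "\<tau> \<in> JP" using \<tau>(2) \<omega>(1) JP_iterate by metis
  define c where "c j = ((\<lambda>x. csqrt (x - cc 0)) ^^ j) \<tau>" for j
  have cS: "P (c (Suc j)) = c j" for j by (simp add: c_def P_eq)
  have cJ: "c j \<in> JP" for j
  proof (induction j)
    case 0 thus ?case using \<tau>J by (simp add: c_def)
  next
    case (Suc j) thus ?case using JP_step[of "c (Suc j)"] cS[of j] by simp
  qed
  define y where "y k = (if - int K \<le> k then (P ^^ nat (k + int K)) \<tau> else c (nat (- int K - k)))" for k
  have y1: "y (k + 1) = P (y k)" for k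
  proof (cases "- int K \<le> k")
    case True
    hence "nat (k + 1 + int K) = Suc (nat (k + int K))" by simp
    thus ?thesis using True by (simp add: y_def)
  next
    case False
    hence "nat (- int K - k) = Suc (nat (- int K - (k + 1)))" by simp
    moreover have "y (k + 1) = c (nat (- int K - (k + 1)))" using False by (cases "k + 1 = - int K") (auto simp: y_def c_def)
    ultimately show ?thesis using False cS by (simp add: y_def)
  qed
  have "y k \<in> JP" for k using cJ \<tau>J JP_iterate by (auto simp: y_def)
  hence SS: "y \<in> SS 0" using y1 SS0_iff by blast
  have "\<forall>N. \<exists>M\<ge>N. far y M"
  proof (rule ccontr)
    assume "\<not> ?thesis"
    then obtain N where N: "\<And>k. k \<ge> N \<Longrightarrow> y k = beta" using not_infinitely_far[OF SS] by blast
    define i where "i = nat \<bar>N\<bar>"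
    have "y (int (i + m)) = (P ^^ (K + i)) \<omega>"
    proof -
      have "y (int (i + m)) = (P ^^ (i + m + K)) \<tau>" by (simp add: y_def nat_add_distrib)
      also have "i + m + K = (K + i) + m" by simp
      finally show ?thesis using \<tau>(2) by (simp only: funpow_add comp_apply)
    qed
    moreover have "y (int (i + m)) = beta" by (intro N) (simp add: i_def)
    ultimately show False using \<omega>(2) by metis
  qed
  moreover have "cmod (y k - z k) < e" if k: "\<bar>k\<bar> \<le> int K" for k
  proof -
    define i where "i = nat (k + int K)"
    have i: "i \<le> 2 * K" "k = - int K + int i" using k by (auto simp: i_def)
    have "dist \<tau> (z (- int K)) < r i" using \<tau>(1) R(2)[OF i(1)] by (simp add: dist_commute)
    hence "dist ((P ^^ i) \<tau>) ((P ^^ i) (z (- int K))) < e" by (rule r(2))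
    thus ?thesis using orbit0_iterate[OF o, of "- int K" i] i k by (simp add: y_def dist_norm)
  qed
  ultimately show ?thesis using SS by blast
qed

lemma periodic_approx:
  assumes z: "z \<in> SS 0" and e: "e > 0"
  shows "\<exists>p\<ge>1. \<exists>y\<in>SS 0. (\<forall>k. y (k + int p) = y k) \<and> (\<forall>N. \<exists>M\<ge>N. far y M) \<and>
    (\<forall>k. \<bar>k\<bar> \<le> int K \<longrightarrow> cmod (y k - z k) < e)"
proof -
  have e2: "e / 2 > 0" using e by simp
  obtain z' where z': "z' \<in> SS 0" "\<And>N. \<exists>M\<ge>N. far z' M" "\<And>k. \<bar>k\<bar> \<le> int K \<Longrightarrow> cmod (z' k - z k) < e / 2"
    using approx_far[OF z e2, of K] by blast
  obtain p y where y: "p \<ge> 1" "y \<in> SS 0" "\<forall>k. y (k + int p) = y k" "\<forall>N. \<exists>M\<ge>N. far y M"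
    "\<And>k. \<bar>k\<bar> \<le> int K \<Longrightarrow> cmod (y k - z' k) < e / 2"
    using periodic_approx_far[OF z'(1,2) e2, of K] by blast
  have "cmod (y k - z k) < e" if "\<bar>k\<bar> \<le> int K" for k
    using norm_triangle_ineq[of "y k - z' k" "z' k - z k"] y(5)[OF that] z'(3)[OF that] by simp
  thus ?thesis using y by (intro exI[of _ p] conjI bexI[of _ y]) auto
qed

subsection \<open>The orbit spaces are homeomorphic\<close>

lemma SS_closed_limit:
  assumes b: "cmod b < \<delta>1" and f: "\<And>j. f j \<in> SS b" and lim: "\<And>k. (\<lambda>j. f j k) \<longlonglongrightarrow> g k"
  shows "g \<in> SS b"
  unfolding SS_def
proof (intro CollectI conjI allI)
  show "orbit b g" by (rule orbit_limit[OF lim]) (use SS_D(1)[OF f] in \<open>auto simp: orbit_def\<close>)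
  show "cmod (g k) \<le> 2" for k
    by (rule LIMSEQ_le_const2[OF tendsto_norm[OF lim[of k]]]) (use SS_D(2)[OF f] in blast)
  show "(g k, g (k - 1)) \<notin> Pet b" for k
  proof
    assume h: "(g k, g (k - 1)) \<in> Pet b"
    have "(\<lambda>j. (b, f j k, f j (k - 1))) \<longlonglongrightarrow> (b, g k, g (k - 1))" by (intro tendsto_intros lim)
    moreover have "(b, g k, g (k - 1)) \<in> {(b, x, y). cmod b < \<delta>0 \<and> (x, y) \<in> Pet b}" using h b_small(1)[OF b] by simp
    ultimately have "\<forall>\<^sub>F j in sequentially. (b, f j k, f j (k - 1)) \<in> {(b, x, y). cmod b < \<delta>0 \<and> (x, y) \<in> Pet b}"
      using Pet_open topological_tendstoD by blast
    then obtain j where "(f j k, f j (k - 1)) \<in> Pet b" unfolding eventually_sequentially by auto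
    thus False using SS_D(3)[OF f] by blast
  qed
qed

lemma shadow_limit:
  assumes "\<And>j. shadows (f j) (h j)" "\<And>k. (\<lambda>j. f j k) \<longlonglongrightarrow> g k" "\<And>k. (\<lambda>j. h j k) \<longlonglongrightarrow> i k"
  shows "shadows g i"
  unfolding shadows_def
proof
  fix k
  show "cmod (g k - i k) \<le> \<eta>0 / 2"
    by (rule LIMSEQ_le_const2[OF tendsto_norm[OF tendsto_diff[OF assms(2,3)[of k]]]])
      (use assms(1) in \<open>auto simp: shadows_def\<close>)
qed

lemma close_tendsto:
  assumes y: "\<And>j k. \<bar>k\<bar> \<le> int j \<Longrightarrow> cmod (y j k - z k) < 1 / real (Suc j)" and r: "strict_mono (r :: nat \<Rightarrow> nat)"
  shows "(\<lambda>j. y (r j) k) \<longlonglongrightarrow> z k"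
proof -
  have "(\<lambda>j. y j k) \<longlonglongrightarrow> z k"
  proof (rule LIM_zero_cancel, rule Lim_null_comparison)
    show "\<forall>\<^sub>F j in sequentially. norm (y j k - z k) \<le> 1 / real (Suc j)"
      using eventually_ge_at_top[of "nat \<bar>k\<bar>"] by eventually_elim (use y in \<open>force intro: less_imp_le\<close>)
    show "(\<lambda>j. 1 / real (Suc j)) \<longlonglongrightarrow> 0" by (rule LIMSEQ_Suc[OF lim_1_over_n])
  qed
  thus ?thesis using LIMSEQ_subseq_LIMSEQ[OF _ r] by (auto simp: o_def)
qed

text \<open>Orbits that are far at arbitrarily late times are dense in \<open>SS 0\<close> and
  shadowing passes to limits; this covers the orbits that end at \<open>beta\<close>.\<close>

lemma shadow_from_zero:
  assumes b: "cmod b < \<delta>4" and z: "z \<in> SS 0"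
  shows "\<exists>x\<in>SS b. shadows x z"
proof -
  have "\<exists>y\<in>SS 0. (\<forall>N. \<exists>M\<ge>N. far y M) \<and> (\<forall>k. \<bar>k\<bar> \<le> int j \<longrightarrow> cmod (y k - z k) < 1 / real (Suc j))" for j
    by (rule approx_far[OF z]) simp
  then obtain y where y: "\<And>j. y j \<in> SS 0" "\<And>j N. \<exists>M\<ge>N. far (y j) M"
    "\<And>j k. \<bar>k\<bar> \<le> int j \<Longrightarrow> cmod (y j k - z k) < 1 / real (Suc j)" by metis
  have "\<exists>x\<in>SS b. shadows x (y j)" for j by (rule shadow_from_zero_far[OF b y(1) y(2)])
  then obtain x where x: "\<And>j. x j \<in> SS b" "\<And>j. shadows (x j) (y j)" by metis
  obtain r g where r: "strict_mono (r :: nat \<Rightarrow> nat)" "\<And>k. (\<lambda>j. x (r j) k) \<longlonglongrightarrow> g k"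
    using pointwise_subsequence[of x 2] SS_D(2)[OF x(1)] by blast
  have yl: "(\<lambda>j. y (r j) k) \<longlonglongrightarrow> z k" for k by (rule close_tendsto[OF y(3) r(1)])
  have "g \<in> SS b" by (rule SS_closed_limit[OF d4(3)[OF b] x(1) r(2)])
  moreover have "shadows g z" by (rule shadow_limit[OF x(2) r(2) yl])
  ultimately show ?thesis by blast
qed

lemma tendsto_fun_iff: "(f \<longlongrightarrow> g) F \<longleftrightarrow> (\<forall>k. ((\<lambda>j. f j k) \<longlongrightarrow> g k) F)" for f :: "_ \<Rightarrow> int \<Rightarrow> complex"
  using limitin_componentwise[of "\<lambda>_. euclidean" UNIV f g F] by (simp add: euclidean_product_topology)

lemma compact_SS: "cmod b < \<delta>1 \<Longrightarrow> compact (SS b)"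
  unfolding compact_eq_seq_compact_metric seq_compact_def
proof (intro allI impI)
  fix f :: "nat \<Rightarrow> int \<Rightarrow> complex" assume b: "cmod b < \<delta>1" and f: "\<forall>n. f n \<in> SS b"
  obtain r g where r: "strict_mono (r :: nat \<Rightarrow> nat)" "\<And>k. (\<lambda>j. f (r j) k) \<longlonglongrightarrow> g k"
    using pointwise_subsequence[of f 2] SS_D(2) f by blast
  have "g \<in> SS b" by (rule SS_closed_limit[OF b _ r(2)]) (use f in auto)
  thus "\<exists>l\<in>SS b. \<exists>r. strict_mono r \<and> (f \<circ> r) \<longlonglongrightarrow> l"
    using r by (auto simp: tendsto_fun_iff o_def)
qed

text \<open>Compactness of the graph replaces any estimate for the continuity of the shadow: both
  projections are continuous bijections from a compact set.\<close>

lemma SS_homeomorphic: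
  assumes b: "cmod b < \<delta>4"
  shows "SS b homeomorphic SS 0"
proof -
  define \<Gamma> where "\<Gamma> = {p \<in> SS b \<times> SS 0. shadows (fst p) (snd p)}"
  have "closed {p :: (int \<Rightarrow> complex) \<times> (int \<Rightarrow> complex). shadows (fst p) (snd p)}"
  proof -
    have "closed {p :: (int \<Rightarrow> complex) \<times> (int \<Rightarrow> complex). cmod (fst p k - snd p k) \<le> \<eta>0 / 2}" for k
      by (intro closed_Collect_le continuous_intros continuous_on_product_then_coordinatewise[where i = k])
    moreover have "{p :: (int \<Rightarrow> complex) \<times> (int \<Rightarrow> complex). shadows (fst p) (snd p)} = (\<Inter>k. {p. cmod (fst p k - snd p k) \<le> \<eta>0 / 2})"
      by (auto simp: shadows_def)
    ultimately show ?thesis by (simp add: closed_INT)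
  qed
  from compact_Int_closed[OF compact_Times[OF compact_SS[OF d4(3)[OF b]] compact_SS[OF zero_lt_d(1)]] this]
  have c: "compact \<Gamma>" unfolding \<Gamma>_def Int_def mem_Collect_eq .
  have 1: "\<Gamma> homeomorphic SS b"
  proof (rule homeomorphic_compact[OF c continuous_on_fst[OF continuous_on_id]])
    show "fst ` \<Gamma> = SS b" using shadow_to_zero[OF b] by (force simp: \<Gamma>_def)
    show "inj_on fst \<Gamma>"
    proof (rule inj_onI)
      fix p p' assume p: "p \<in> \<Gamma>" "p' \<in> \<Gamma>" "fst p = fst p'"
      have "snd p = snd p'"
      proof (rule expansivity[OF zero_lt_d(2)])
        show "cmod (snd p k - snd p' k) \<le> \<eta>0" for k
        proof -
          have "cmod (fst p k - snd p' k) \<le> \<eta>0 / 2" "cmod (fst p k - snd p k) \<le> \<eta>0 / 2"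
            using p unfolding \<Gamma>_def shadows_def by simp_all
          thus ?thesis using norm_triangle_ineq4[of "fst p k - snd p' k" "fst p k - snd p k"] by simp
        qed
      qed (use p in \<open>auto simp: \<Gamma>_def\<close>)
      thus "p = p'" using p(3) by (simp add: prod_eq_iff)
    qed
  qed
  have 2: "\<Gamma> homeomorphic SS 0"
  proof (rule homeomorphic_compact[OF c continuous_on_snd[OF continuous_on_id]])
    show "snd ` \<Gamma> = SS 0" using shadow_from_zero[OF b] by (force simp: \<Gamma>_def)
    show "inj_on snd \<Gamma>"
    proof (rule inj_onI)
      fix p p' assume p: "p \<in> \<Gamma>" "p' \<in> \<Gamma>" "snd p = snd p'"
      have "fst p = fst p'"
      proof (rule expansivity[OF d4(2)[OF b]])
        show "cmod (fst p k - fst p' k) \<le> \<eta>0" for k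
        proof -
          have "cmod (fst p k - snd p k) \<le> \<eta>0 / 2" "cmod (fst p' k - snd p k) \<le> \<eta>0 / 2"
            using p unfolding \<Gamma>_def shadows_def by simp_all
          thus ?thesis using norm_triangle_ineq4[of "fst p k - snd p k" "fst p' k - snd p k"] by simp
        qed
      qed (use p in \<open>auto simp: \<Gamma>_def\<close>)
      thus "p = p'" using p(3) by (simp add: prod_eq_iff)
    qed
  qed
  show ?thesis using 1 2 homeomorphic_sym homeomorphic_trans by blast
qed

end

subsection \<open>Holomorphic maps of the plane\<close>

definition complex_linear :: "(complex \<times> complex \<Rightarrow> complex \<times> complex) \<Rightarrow> bool" where
  "complex_linear D \<longleftrightarrow> (\<forall>t w. D (t * fst w, t * snd w) = (t * fst (D w), t * snd (D w)))"

text \<open>Holomorphic maps of the plane, encoded through their restrictions to entire curves,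
  which give access to Cauchy's inequality, and through complex linearity of the real derivative,
  which lets eigenvectors be scaled by complex numbers.\<close>

definition hol2 :: "(complex \<times> complex \<Rightarrow> complex \<times> complex) \<Rightarrow> bool" where
  "hol2 F \<longleftrightarrow> (\<forall>f g. f holomorphic_on UNIV \<longrightarrow> g holomorphic_on UNIV \<longrightarrow>
      (\<lambda>t. fst (F (f t, g t))) holomorphic_on UNIV \<and> (\<lambda>t. snd (F (f t, g t))) holomorphic_on UNIV) \<and>
    (\<forall>p. \<exists>D. (F has_derivative D) (at p) \<and> complex_linear D)"

lemma hol2_holomorphic:
  assumes "hol2 F" "f holomorphic_on UNIV" "g holomorphic_on UNIV"
  shows "(\<lambda>t. fst (F (f t, g t))) holomorphic_on UNIV" "(\<lambda>t. snd (F (f t, g t))) holomorphic_on UNIV"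
  using assms unfolding hol2_def by blast+

lemma hol2_derivative:
  assumes "hol2 F" obtains D where "(F has_derivative D) (at p)" "complex_linear D"
  using assms unfolding hol2_def by blast

lemma hol2_id: "hol2 (\<lambda>p. p)"
  unfolding hol2_def complex_linear_def by (auto intro!: exI[of _ "\<lambda>p. p"])

lemma hol2_comp:
  assumes "hol2 F" "hol2 G" shows "hol2 (\<lambda>p. F (G p))"
  unfolding hol2_def
proof (intro conjI allI impI)
  fix f g :: "complex \<Rightarrow> complex" assume h: "f holomorphic_on UNIV" "g holomorphic_on UNIV"
  note G = hol2_holomorphic[OF assms(2) h]
  show "(\<lambda>t. fst (F (G (f t, g t)))) holomorphic_on UNIV" "(\<lambda>t. snd (F (G (f t, g t)))) holomorphic_on UNIV"
    using hol2_holomorphic[OF assms(1) G] by simp_all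
next
  fix p
  obtain E where E: "(G has_derivative E) (at p)" "complex_linear E" using hol2_derivative[OF assms(2)] by blast
  obtain D where D: "(F has_derivative D) (at (G p))" "complex_linear D" using hol2_derivative[OF assms(1)] by blast
  have "((\<lambda>p. F (G p)) has_derivative (\<lambda>w. D (E w))) (at p)" using has_derivative_compose[OF E(1) D(1)] .
  moreover have "complex_linear (\<lambda>w. D (E w))" using D(2) E(2) by (simp add: complex_linear_def)
  ultimately show "\<exists>D. ((\<lambda>p. F (G p)) has_derivative D) (at p) \<and> complex_linear D" by blast
qed

lemma hol2_funpow: "hol2 F \<Longrightarrow> hol2 (F ^^ n)"
proof (induction n)
  case 0 show ?case using hol2_id by (simp add: id_def)
next
  case (Suc n)
  thus ?case using hol2_comp[of F "F ^^ n"] by (simp add: o_def)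
qed

lemma hol2_continuous: "hol2 F \<Longrightarrow> continuous_on S F"
  by (metis hol2_derivative has_derivative_continuous continuous_at_imp_continuous_on)

lemma hol2_complex_linear: "hol2 F \<Longrightarrow> (F has_derivative D) (at p) \<Longrightarrow> complex_linear D"
  by (metis hol2_derivative has_derivative_unique)

lemma funpow_fixed_derivative:
  assumes "(F has_derivative D) (at z)" "F z = z"
  shows "(F ^^ j has_derivative D ^^ j) (at z) \<and> (F ^^ j) z = z"
proof (induction j)
  case 0 show ?case using has_derivative_ident by (simp add: id_def)
next
  case (Suc j)
  hence "((\<lambda>p. F ((F ^^ j) p)) has_derivative (\<lambda>w. D ((D ^^ j) w))) (at z)"
    using has_derivative_compose[of "F ^^ j" "D ^^ j" z UNIV F D] assms by auto
  thus ?case using Suc assms(2) by (simp add: o_def)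
qed

text \<open>On the complex line through \<open>z\<close> in the direction \<open>v\<close>, the
  derivative of \<open>F ^^ j\<close> is \<open>\<mu> ^ j\<close> times \<open>v\<close>, while
  Cauchy's inequality would bound it.\<close>

lemma expanding_unbounded:
  assumes F: "hol2 F" "F z = z" "(F has_derivative D) (at z)"
    and v: "D v = (\<mu> * fst v, \<mu> * snd v)" "v \<noteq> 0" "cmod \<mu> > 1" and r: "r > 0"
    and B: "\<And>p j. p \<in> ball z r \<Longrightarrow> cmod (fst ((F ^^ j) p)) \<le> B" "\<And>p j. p \<in> ball z r \<Longrightarrow> cmod (snd ((F ^^ j) p)) \<le> B"
  shows False
proof -
  have D: "complex_linear D" by (rule hol2_complex_linear[OF F(1,3)])
  have Dj: "(D ^^ j) (t * fst v, t * snd v) = (t * \<mu> ^ j * fst v, t * \<mu> ^ j * snd v)" for j t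
  proof (induction j)
    case (Suc j)
    have "D (t * \<mu> ^ j * fst v, t * \<mu> ^ j * snd v) = (t * \<mu> ^ j * fst (D v), t * \<mu> ^ j * snd (D v))"
      using D unfolding complex_linear_def by blast
    thus ?case using Suc v(1) by (simp add: algebra_simps)
  qed simp
  define L where "L t = (fst z + t * fst v, snd z + t * snd v)" for t
  have L: "(L has_derivative (\<lambda>t. (t * fst v, t * snd v))) (at 0)"
    unfolding L_def by (auto intro!: derivative_eq_intros)
  have L0: "L 0 = z" by (simp add: L_def)
  define r' where "r' = r / (norm v + 1)"
  have r': "r' > 0" using r by (simp add: r'_def add_nonneg_pos)
  have Lr: "L t \<in> ball z r" if "t \<in> ball 0 r'" for t
  proof -
    have "dist z (L t) = norm (t * fst v, t * snd v)" by (simp add: L_def dist_norm norm_prod_def norm_minus_commute)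
    also have "... = cmod t * norm v"
      by (simp add: norm_prod_def norm_mult power_mult_distrib real_sqrt_mult flip: distrib_left)
    also have "... \<le> cmod t * (norm v + 1)" by (simp add: mult_left_mono)
    also have "... < r' * (norm v + 1)" using that by (intro mult_strict_right_mono) (auto simp: add_nonneg_pos)
    also have "... = r" by (simp add: r'_def add_nonneg_eq_0_iff)
    finally show ?thesis by simp
  qed
  have der: "((\<lambda>t. (F ^^ j) (L t)) has_derivative (\<lambda>t. (t * \<mu> ^ j * fst v, t * \<mu> ^ j * snd v))) (at 0)" for j
    using has_derivative_compose[OF L, of "F ^^ j" "D ^^ j"] funpow_fixed_derivative[OF F(3,2), of j] by (simp add: L0 Dj)
  have hol: "(\<lambda>t. fst ((F ^^ j) (L t))) holomorphic_on UNIV" "(\<lambda>t. snd ((F ^^ j) (L t))) holomorphic_on UNIV" for j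
    unfolding L_def by (rule hol2_holomorphic[OF hol2_funpow[OF F(1)]]; intro holomorphic_intros)+
  have key: "cmod (\<mu> ^ j * w) \<le> 2 * B / r'"
    if "f holomorphic_on UNIV" "(f has_derivative (\<lambda>t. t * \<mu> ^ j * w)) (at 0)" "\<And>t. t \<in> ball 0 r' \<Longrightarrow> cmod (f t) \<le> B" for f j w
  proof -
    have "(f has_field_derivative \<mu> ^ j * w) (at 0)"
    proof -
      have "(\<lambda>t. t * \<mu> ^ j * w) = (*) (\<mu> ^ j * w)" by (auto simp: fun_eq_iff)
      thus ?thesis using that(2) by (simp add: has_field_derivative_def)
    qed
    hence "deriv f 0 = \<mu> ^ j * w" by (rule DERIV_imp_deriv)
    thus ?thesis using cauchy_deriv_bound[of f 0 r' 0 B] holomorphic_on_subset[OF that(1)] that(3) r' by simp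
  qed
  have 1: "cmod (\<mu> ^ j * fst v) \<le> 2 * B / r'" for j
    by (rule key[OF hol(1)]) (use has_derivative_fst[OF der[of j]] B(1)[OF Lr] in auto)
  have 2: "cmod (\<mu> ^ j * snd v) \<le> 2 * B / r'" for j
    by (rule key[OF hol(2)]) (use has_derivative_snd[OF der[of j]] B(2)[OF Lr] in auto)
  have "w = 0" if w: "\<And>j. cmod (\<mu> ^ j * w) \<le> 2 * B / r'" for w
  proof (rule ccontr)
    assume w0: "w \<noteq> 0"
    obtain j where "2 * B / r' / cmod w < cmod \<mu> ^ j" using real_arch_pow[OF v(3)] by blast
    hence "2 * B / r' < cmod \<mu> ^ j * cmod w" using w0 pos_divide_less_eq[of "cmod w" "2 * B / r'"] by (simp del: divide_divide_eq_left)
    thus False using w[of j] by (simp add: norm_mult norm_power)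
  qed
  hence "fst v = 0" "snd v = 0" using 1 2 by blast+
  thus False using v(2) by (simp add: prod_eq_iff)
qed

text \<open>The bound on an orbit may depend on its starting point through the continuous function
  \<open>\<beta>\<close>; on a small closed ball it is uniform. It is applied to
  \<open>K_plus\<close>, and to \<open>K_minus\<close> with the inverse map.\<close>

lemma expanding_not_interior:
  assumes F: "hol2 F" "(F ^^ n) z = z" "(F ^^ n has_derivative D) (at z)"
    and v: "D v = (\<mu> * fst v, \<mu> * snd v)" "v \<noteq> 0" "cmod \<mu> > 1"
    and c: "continuous_on UNIV \<beta>"
    and K: "\<And>p j. p \<in> K \<Longrightarrow> cmod (fst ((F ^^ j) p)) \<le> \<beta> p" "\<And>p j. p \<in> K \<Longrightarrow> cmod (snd ((F ^^ j) p)) \<le> C * \<beta> p"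
  shows "z \<notin> interior K"
proof
  assume "z \<in> interior K"
  then obtain r where r: "r > 0" "cball z r \<subseteq> K" by (auto simp: mem_interior_cball)
  have "compact (\<beta> ` cball z r)" by (rule compact_continuous_image[OF continuous_on_subset[OF c] compact_cball]) simp
  then obtain B where B: "\<And>p. p \<in> cball z r \<Longrightarrow> \<bar>\<beta> p\<bar> \<le> B" using compact_imp_bounded bounded_iff by (metis imageI real_norm_def)
  have "cmod (fst (((F ^^ n) ^^ j) p)) \<le> max B (\<bar>C\<bar> * B)" "cmod (snd (((F ^^ n) ^^ j) p)) \<le> max B (\<bar>C\<bar> * B)" if "p \<in> ball z r" for p j
  proof -
    have p: "p \<in> K" "\<bar>\<beta> p\<bar> \<le> B" using that r(2) B by auto
    have "C * \<beta> p \<le> \<bar>C\<bar> * \<bar>\<beta> p\<bar>" by (metis abs_ge_self abs_mult)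
    also have "... \<le> \<bar>C\<bar> * B" by (rule mult_left_mono[OF p(2)]) simp
    finally show "cmod (fst (((F ^^ n) ^^ j) p)) \<le> max B (\<bar>C\<bar> * B)" "cmod (snd (((F ^^ n) ^^ j) p)) \<le> max B (\<bar>C\<bar> * B)"
      using K(1)[OF p(1), of "n * j"] K(2)[OF p(1), of "n * j"] p(2) by (simp_all add: funpow_mult)
  qed
  thus False by (rule expanding_unbounded[OF hol2_funpow[OF F(1)] F(2,3) v r(1)])
qed

text \<open>For the eigenvalues \<open>m1\<close> and \<open>m2\<close> the product
  \<open>(cmod m1 - 1) * (cmod m2 - 1)\<close> is at most one plus the modulus of the determinant
  minus that of the trace, hence negative.\<close>

lemma eigenvalue_split:
  fixes \<alpha> \<beta> \<gamma> \<delta> :: complex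
  assumes "cmod (\<alpha> + \<delta>) > 1 + cmod (\<alpha> * \<delta> - \<beta> * \<gamma>)"
  defines "D \<equiv> \<lambda>(u, v). (\<alpha> * u + \<beta> * v, \<gamma> * u + \<delta> * v)"
  shows "\<exists>\<mu>. cmod \<mu> < 1 \<and> (\<exists>v. v \<noteq> 0 \<and> D v = (\<mu> * fst v, \<mu> * snd v))"
    "\<exists>\<mu>. cmod \<mu> > 1 \<and> (\<exists>v. v \<noteq> 0 \<and> D v = (\<mu> * fst v, \<mu> * snd v))"
proof -
  define s where "s = csqrt ((\<alpha> + \<delta>)\<^sup>2 - 4 * (\<alpha> * \<delta> - \<beta> * \<gamma>))"
  have s2: "s\<^sup>2 = (\<alpha> + \<delta>)\<^sup>2 - 4 * (\<alpha> * \<delta> - \<beta> * \<gamma>)" by (simp add: s_def)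
  define m1 m2 where m: "m1 = (\<alpha> + \<delta> + s) / 2" "m2 = (\<alpha> + \<delta> - s) / 2"
  have ev: "\<exists>v. v \<noteq> 0 \<and> D v = (\<mu> * fst v, \<mu> * snd v)" if ch: "\<mu>\<^sup>2 - (\<alpha> + \<delta>) * \<mu> + (\<alpha> * \<delta> - \<beta> * \<gamma>) = 0" for \<mu>
  proof -
    have ch': "(\<mu> - \<alpha>) * (\<mu> - \<delta>) = \<beta> * \<gamma>" using ch by (simp add: algebra_simps power2_eq_square)
    consider "\<beta> \<noteq> 0" | "\<gamma> \<noteq> 0" | "\<beta> = 0" "\<gamma> = 0" "\<mu> = \<alpha>" | "\<beta> = 0" "\<gamma> = 0" "\<mu> = \<delta>" using ch' by fastforce
    thus ?thesis
    proof cases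
      case 1
      thus ?thesis using ch' by (intro exI[of _ "(\<beta>, \<mu> - \<alpha>)"]) (simp add: D_def zero_prod_def algebra_simps)
    next
      case 2
      thus ?thesis using ch' by (intro exI[of _ "(\<mu> - \<delta>, \<gamma>)"]) (simp add: D_def zero_prod_def algebra_simps)
    next
      case 3 thus ?thesis by (intro exI[of _ "(1, 0)"]) (simp add: D_def zero_prod_def)
    next
      case 4 thus ?thesis by (intro exI[of _ "(0, 1)"]) (simp add: D_def zero_prod_def)
    qed
  qed
  have sum: "m1 + m2 = \<alpha> + \<delta>" by (simp add: m field_simps)
  have prd: "m1 * m2 = \<alpha> * \<delta> - \<beta> * \<gamma>"
  proof -
    have "m1 * m2 = ((\<alpha> + \<delta>)\<^sup>2 - s\<^sup>2) / 4" by (simp add: m power2_eq_square algebra_simps)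
    also have "... = \<alpha> * \<delta> - \<beta> * \<gamma>" unfolding s2 by simp
    finally show ?thesis .
  qed
  have ch: "m\<^sup>2 - (\<alpha> + \<delta>) * m + (\<alpha> * \<delta> - \<beta> * \<gamma>) = 0" if "m = m1 \<or> m = m2" for m
    unfolding sum[symmetric] prd[symmetric] using that by (auto simp: algebra_simps power2_eq_square)
  have "(cmod m1 - 1) * (cmod m2 - 1) = cmod (m1 * m2) + 1 - (cmod m1 + cmod m2)" by (simp add: norm_mult algebra_simps)
  also have "... \<le> cmod (m1 * m2) + 1 - cmod (m1 + m2)" using norm_triangle_ineq[of m1 m2] by simp
  also have "... < 0" using assms(1) by (simp add: sum prd)
  finally have "cmod m1 < 1 \<and> cmod m2 > 1 \<or> cmod m1 > 1 \<and> cmod m2 < 1" by (auto simp: mult_less_0_iff)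
  thus "\<exists>\<mu>. cmod \<mu> < 1 \<and> (\<exists>v. v \<noteq> 0 \<and> D v = (\<mu> * fst v, \<mu> * snd v))"
    "\<exists>\<mu>. cmod \<mu> > 1 \<and> (\<exists>v. v \<noteq> 0 \<and> D v = (\<mu> * fst v, \<mu> * snd v))" using ev ch by metis+
qed

text \<open>Boundedness is turned into the condition of never growing strictly above 3. This is
  closed at each index and bounds the sequence by its initial value; closedness of
  \<open>K_plus\<close> and \<open>K_minus\<close> and the locally uniform bounds come from
  it.\<close>

lemma escape_seq:
  fixes u :: "nat \<Rightarrow> complex"
  assumes step: "\<forall>n. 3 < cmod (u (Suc n)) \<and> cmod (u n) \<le> cmod (u (Suc n)) \<longrightarrow> 3/2 * cmod (u (Suc n)) \<le> cmod (u (Suc (Suc n)))"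
  shows "(\<exists>B. \<forall>n. cmod (u n) \<le> B) \<longleftrightarrow> (\<forall>n. \<not> (3 < cmod (u (Suc n)) \<and> cmod (u n) < cmod (u (Suc n))))"
    "(\<exists>B. \<forall>n. cmod (u n) \<le> B) \<Longrightarrow> cmod (u n) \<le> max 3 (cmod (u 0))"
proof -
  have 1: "cmod (u n) \<le> max 3 (cmod (u 0))" if "\<forall>n. \<not> (3 < cmod (u (Suc n)) \<and> cmod (u n) < cmod (u (Suc n)))" for n
  proof (induction n)
    case (Suc n)
    thus ?case using that[rule_format, of n] by linarith
  qed simp
  have 2: "\<not> (3 < cmod (u (Suc n)) \<and> cmod (u n) < cmod (u (Suc n)))" if B: "\<And>n. cmod (u n) \<le> B" for n B
  proof
    assume h: "3 < cmod (u (Suc n)) \<and> cmod (u n) < cmod (u (Suc n))"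
    have "3 * (3/2) ^ j < cmod (u (Suc n + j)) \<and> cmod (u (n + j)) \<le> cmod (u (Suc n + j))" for j
    proof (induction j)
      case 0 thus ?case using h by simp
    next
      case (Suc j)
      have "(1::real) \<le> (3/2) ^ j" by (rule one_le_power) simp
      hence g: "3 < cmod (u (Suc (n + j)))" using conjunct1[OF Suc] unfolding add_Suc by linarith
      hence "3/2 * cmod (u (Suc (n + j))) \<le> cmod (u (Suc (Suc (n + j))))" using Suc by (intro step[rule_format]) auto
      thus ?case using Suc g by simp
    qed
    moreover obtain j where "B < (3/2) ^ j" using real_arch_pow[of "3/2" B] by auto
    ultimately have "B < cmod (u (Suc n + j))" by (smt (verit) zero_le_power divide_nonneg_nonneg)
    thus False using B[of "Suc n + j"] by linarith
  qed
  show "(\<exists>B. \<forall>n. cmod (u n) \<le> B) \<longleftrightarrow> (\<forall>n. \<not> (3 < cmod (u (Suc n)) \<and> cmod (u n) < cmod (u (Suc n))))"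
    using 1 2 by blast
  thus "(\<exists>B. \<forall>n. cmod (u n) \<le> B) \<Longrightarrow> cmod (u n) \<le> max 3 (cmod (u 0))" using 1 by blast
qed

section \<open>The Henon map with parameters on the curve\<close>

locale parab_henon = parab_branch +
  fixes a :: complex
  assumes a_nz: "a \<noteq> 0" and a_small: "cmod (a\<^sup>2) < \<delta>4"
begin

abbreviation "H \<equiv> henon (cc (a\<^sup>2)) a"
abbreviation "Hinv \<equiv> inv (henon (cc (a\<^sup>2)) a)"
abbreviation "Kp \<equiv> K_plus (cc (a\<^sup>2)) a"
abbreviation "Km \<equiv> K_minus (cc (a\<^sup>2)) a"

definition pt :: "(int \<Rightarrow> complex) \<Rightarrow> int \<Rightarrow> complex \<times> complex" where
  "pt x k = (x k, a * x (k - 1))"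

lemma small: "cmod (a\<^sup>2) < \<delta>3" "cmod (a\<^sup>2) < \<delta>1" "cmod (a\<^sup>2) < \<delta>0" "cmod (a\<^sup>2) \<le> 1/48" "48 * cmod (a\<^sup>2) \<le> \<rho>\<^sup>2"
  using d4(2,3)[OF a_small] d3(4) b_small(2,4) by blast+

lemma H_pt: "orbit (a\<^sup>2) x \<Longrightarrow> H (pt x k) = pt x (k + 1)"
  by (simp add: pt_def henon_def orbit_step power2_eq_square)

lemma Hinv_H: "Hinv (H p) = p"
  using bij_henon[OF a_nz] by (simp add: bij_is_inj)

lemma H_Hinv: "H (Hinv p) = p"
  using bij_henon[OF a_nz] by (simp add: bij_is_surj surj_f_inv_f)

lemma Hinv_pt: "orbit (a\<^sup>2) x \<Longrightarrow> Hinv (pt x k) = pt x (k - 1)"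
  using H_pt[of x "k - 1"] Hinv_H[of "pt x (k - 1)"] by simp

lemma H_pt_funpow: "orbit (a\<^sup>2) x \<Longrightarrow> (H ^^ n) (pt x k) = pt x (k + int n)"
  by (induction n) (simp_all add: H_pt algebra_simps)

lemma Hinv_pt_funpow: "orbit (a\<^sup>2) x \<Longrightarrow> (Hinv ^^ n) (pt x k) = pt x (k - int n)"
  by (induction n) (simp_all add: Hinv_pt algebra_simps)

lemma pt_exists: "\<exists>x. orbit (a\<^sup>2) x \<and> p = pt x 0"
proof -
  define X where "X k = (if k \<ge> 0 then (H ^^ nat k) p else (Hinv ^^ nat (- k)) p)" for k :: int
  have X1: "X (k + 1) = H (X k)" for k
  proof (cases "k \<ge> 0")
    case True
    hence "nat (k + 1) = Suc (nat k)" by simp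
    thus ?thesis using True by (simp add: X_def)
  next
    case False
    hence "nat (- k) = Suc (nat (- (k + 1)))" by simp
    moreover have "X (k + 1) = (Hinv ^^ nat (- (k + 1))) p" using False by (cases "k + 1 = 0") (auto simp: X_def)
    ultimately show ?thesis using False by (simp add: X_def H_Hinv)
  qed
  define x where "x k = fst (X k)" for k
  have s: "snd (X k) = a * x (k - 1)" for k
    using X1[of "k - 1"] by (simp add: x_def henon_def case_prod_unfold)
  have "orbit (a\<^sup>2) x" unfolding orbit_def
  proof
    fix k
    show "x (k + 1) = (x k)\<^sup>2 + cc (a\<^sup>2) + a\<^sup>2 * x (k - 1)"
      using X1[of k] s[of k] by (simp add: x_def henon_def case_prod_unfold power2_eq_square)
  qed
  moreover have "p = pt x 0" using s[of 0] by (simp add: pt_def x_def X_def prod_eq_iff)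
  ultimately show ?thesis by blast
qed

text \<open>The square of a modulus above 3 must be balanced by one of the two neighbours; if one of
  them is not larger than \<open>x k\<close>, the other is larger by \<open>3 / 2\<close>. The two
  inequalities serve the forward and the backward orbit.\<close>

lemma henon_escape:
  assumes o: "orbit (a\<^sup>2) x" and k: "3 < cmod (x k)"
  shows "cmod (x (k - 1)) \<le> cmod (x k) \<Longrightarrow> 3/2 * cmod (x k) \<le> cmod (x (k + 1))"
    "cmod (x (k + 1)) \<le> cmod (x k) \<Longrightarrow> 3/2 * cmod (x k) \<le> cmod (x (k - 1))"
proof -
  have c: "cmod (cc (a\<^sup>2)) \<le> 1"
    using norm_triangle_ineq[of "cc (a\<^sup>2) - cc 0" "cc 0"] norm_cc_diff[of "a\<^sup>2"] norm_cc0 small(4) by simp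
  have sq: "3 * cmod (x k) \<le> (cmod (x k))\<^sup>2" unfolding power2_eq_square using k by (intro mult_right_mono) auto
  have e: "x (k + 1) = (x k)\<^sup>2 + cc (a\<^sup>2) + a\<^sup>2 * x (k - 1)" by (rule orbit_step[OF o])
  {
    assume h: "cmod (x (k - 1)) \<le> cmod (x k)"
    have "cmod (a\<^sup>2 * x (k - 1)) \<le> 1/48 * cmod (x k)" unfolding norm_mult using small(4) h by (intro mult_mono) auto
    moreover have "cmod ((x k)\<^sup>2) \<le> cmod (x (k + 1)) + cmod (cc (a\<^sup>2)) + cmod (a\<^sup>2 * x (k - 1))"
      using norm_triangle_ineq4[of "x (k + 1)" "cc (a\<^sup>2)"] norm_triangle_ineq4[of "x (k + 1) - cc (a\<^sup>2)" "a\<^sup>2 * x (k - 1)"] e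
      by (simp add: algebra_simps)
    ultimately show "3/2 * cmod (x k) \<le> cmod (x (k + 1))" using sq c k unfolding norm_power by linarith
  next
    assume h: "cmod (x (k + 1)) \<le> cmod (x k)"
    have "cmod (a\<^sup>2 * x (k - 1)) \<le> 1 * cmod (x (k - 1))" unfolding norm_mult using small(4) by (intro mult_right_mono) auto
    moreover have "cmod ((x k)\<^sup>2) \<le> cmod (x (k + 1)) + cmod (cc (a\<^sup>2)) + cmod (a\<^sup>2 * x (k - 1))"
      using norm_triangle_ineq4[of "x (k + 1)" "cc (a\<^sup>2)"] norm_triangle_ineq4[of "x (k + 1) - cc (a\<^sup>2)" "a\<^sup>2 * x (k - 1)"] e
      by (simp add: algebra_simps)
    ultimately show "3/2 * cmod (x k) \<le> cmod (x (k - 1))" using sq c k h unfolding norm_power by linarith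
  }
qed

lemma bounded_pair_iff:
  "bounded (range (\<lambda>n :: nat. (v n, a * w n))) \<longleftrightarrow> (\<exists>B. \<forall>n. cmod (v n) \<le> B \<and> cmod (w n) \<le> B)"
proof
  assume "bounded (range (\<lambda>n. (v n, a * w n)))"
  then obtain B where B: "\<And>n. norm (v n, a * w n) \<le> B" by (auto simp: bounded_iff)
  have "cmod (v n) \<le> B" "cmod (w n) \<le> B / cmod a" for n
    using order_trans[OF norm_fst_le B[of n]] order_trans[OF norm_snd_le B[of n]] a_nz by (simp_all add: norm_mult field_simps)
  thus "\<exists>B. \<forall>n. cmod (v n) \<le> B \<and> cmod (w n) \<le> B" by (intro exI[of _ "max B (B / cmod a)"]) (simp add: le_max_iff_disj)
next
  assume "\<exists>B. \<forall>n. cmod (v n) \<le> B \<and> cmod (w n) \<le> B"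
  then obtain B where B: "\<And>n. cmod (v n) \<le> B" "\<And>n. cmod (w n) \<le> B" by blast
  have "norm (v n, a * w n) \<le> B + cmod a * B" for n
    using norm_Pair_le[of "v n" "a * w n"] B(1)[of n] mult_left_mono[OF B(2)[of n], of "cmod a"] by (simp add: norm_mult)
  thus "bounded (range (\<lambda>n. (v n, a * w n)))" by (auto simp: bounded_iff)
qed

lemma K_plus_iff: "orbit (a\<^sup>2) x \<Longrightarrow> pt x 0 \<in> Kp \<longleftrightarrow> (\<exists>B. \<forall>n. cmod (x (int n - 1)) \<le> B)"
  and K_minus_iff: "orbit (a\<^sup>2) x \<Longrightarrow> pt x 0 \<in> Km \<longleftrightarrow> (\<exists>B. \<forall>n. cmod (x (- int n)) \<le> B)"
proof -
  assume o: "orbit (a\<^sup>2) x"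
  have 1: "(\<exists>B. \<forall>n. cmod (u (Suc n)) \<le> B \<and> cmod (u n) \<le> B) \<longleftrightarrow> (\<exists>B. \<forall>n. cmod (u n) \<le> B)" for u :: "nat \<Rightarrow> complex" by blast
  show "pt x 0 \<in> Kp \<longleftrightarrow> (\<exists>B. \<forall>n. cmod (x (int n - 1)) \<le> B)"
    using 1[of "\<lambda>n. x (int n - 1)"] unfolding K_plus_def mem_Collect_eq H_pt_funpow[OF o] by (simp add: pt_def bounded_pair_iff)
  have 2: "- 1 - int n = - int n - 1" for n by simp
  show "pt x 0 \<in> Km \<longleftrightarrow> (\<exists>B. \<forall>n. cmod (x (- int n)) \<le> B)"
    using 1[of "\<lambda>n. x (- int n)"] unfolding K_minus_def mem_Collect_eq Hinv_pt_funpow[OF o]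
    by (simp add: pt_def bounded_pair_iff conj_commute 2)
qed

lemma hol2_H: "hol2 H"
  unfolding hol2_def
proof (intro conjI allI impI)
  fix f g :: "complex \<Rightarrow> complex" assume "f holomorphic_on UNIV" "g holomorphic_on UNIV"
  thus "(\<lambda>t. fst (H (f t, g t))) holomorphic_on UNIV" "(\<lambda>t. snd (H (f t, g t))) holomorphic_on UNIV"
    by (auto simp: henon_def intro!: holomorphic_intros)
next
  fix p
  show "\<exists>D. (H has_derivative D) (at p) \<and> complex_linear D"
    by (rule exI[of _ "\<lambda>(u, v). (2 * fst p * u + a * v, a * u)"])
      (use has_derivative_henon[of "cc (a\<^sup>2)" a "fst p" "snd p"] in \<open>auto simp: complex_linear_def algebra_simps\<close>)
qed

lemma hol2_Hinv: "hol2 Hinv"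
  unfolding hol2_def inv_henon[OF a_nz]
proof (intro conjI allI impI)
  fix f g :: "complex \<Rightarrow> complex" assume "f holomorphic_on UNIV" "g holomorphic_on UNIV"
  thus "(\<lambda>t. fst (case (f t, g t) of (u, v) \<Rightarrow> (v / a, (u - (v / a)\<^sup>2 - cc (a\<^sup>2)) / a))) holomorphic_on UNIV"
    "(\<lambda>t. snd (case (f t, g t) of (u, v) \<Rightarrow> (v / a, (u - (v / a)\<^sup>2 - cc (a\<^sup>2)) / a))) holomorphic_on UNIV"
    using a_nz by (auto intro!: holomorphic_intros)
next
  fix p
  have "((\<lambda>w. (snd w / a, (fst w - (snd w / a)\<^sup>2 - cc (a\<^sup>2)) / a)) has_derivative
      (\<lambda>w. (snd w / a, (fst w - 2 * (snd p / a) * (snd w / a)) / a))) (at p)"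
    using a_nz by (auto intro!: derivative_eq_intros simp: fun_eq_iff power2_eq_square)
  thus "\<exists>D. ((\<lambda>(u, v). (v / a, (u - (v / a)\<^sup>2 - cc (a\<^sup>2)) / a)) has_derivative D) (at p) \<and> complex_linear D"
    using a_nz unfolding case_prod_unfold
    by (intro exI[of _ "\<lambda>w. (snd w / a, (fst w - 2 * (snd p / a) * (snd w / a)) / a)"])
      (auto simp: complex_linear_def field_simps)
qed

lemma K_plus_bounds:
  shows "p \<in> Kp \<longleftrightarrow> (\<forall>n. \<not> (3 < cmod (fst ((H ^^ n) p)) \<and> cmod (snd ((H ^^ n) p)) < cmod a * cmod (fst ((H ^^ n) p))))"
    "p \<in> Kp \<Longrightarrow> cmod (fst ((H ^^ n) p)) \<le> max 3 (cmod (snd p / a))"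
    "p \<in> Kp \<Longrightarrow> cmod (snd ((H ^^ n) p)) \<le> cmod a * max 3 (cmod (snd p / a))"
proof -
  obtain x where x: "orbit (a\<^sup>2) x" "p = pt x 0" using pt_exists by blast
  define u where "u n = x (int n - 1)" for n
  have step: "\<forall>n. 3 < cmod (u (Suc n)) \<and> cmod (u n) \<le> cmod (u (Suc n)) \<longrightarrow> 3/2 * cmod (u (Suc n)) \<le> cmod (u (Suc (Suc n)))"
  proof (intro allI impI)
    fix n assume "3 < cmod (u (Suc n)) \<and> cmod (u n) \<le> cmod (u (Suc n))"
    thus "3/2 * cmod (u (Suc n)) \<le> cmod (u (Suc (Suc n)))"
      using henon_escape(1)[OF x(1), of "int n"] by (simp add: u_def add.commute)
  qed
  note E = escape_seq[of u, OF step]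
  have K: "p \<in> Kp \<longleftrightarrow> (\<exists>B. \<forall>n. cmod (u n) \<le> B)" using K_plus_iff[OF x(1)] x(2) by (simp add: u_def)
  have f: "fst ((H ^^ n) p) = u (Suc n)" "snd ((H ^^ n) p) = a * u n" for n
    unfolding x(2) H_pt_funpow[OF x(1)] by (simp_all add: pt_def u_def)
  have u0: "snd p / a = u 0" using f(2)[of 0] a_nz by simp
  show "p \<in> Kp \<longleftrightarrow> (\<forall>n. \<not> (3 < cmod (fst ((H ^^ n) p)) \<and> cmod (snd ((H ^^ n) p)) < cmod a * cmod (fst ((H ^^ n) p))))"
    unfolding K f E(1) using a_nz by (simp add: norm_mult)
  show "p \<in> Kp \<Longrightarrow> cmod (fst ((H ^^ n) p)) \<le> max 3 (cmod (snd p / a))"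
    "p \<in> Kp \<Longrightarrow> cmod (snd ((H ^^ n) p)) \<le> cmod a * max 3 (cmod (snd p / a))"
    unfolding K f u0 norm_mult using E(2) by (simp_all only: mult_left_mono norm_ge_zero)
qed

lemma K_minus_bounds:
  shows "p \<in> Km \<longleftrightarrow> (\<forall>n. \<not> (3 < cmod (snd ((Hinv ^^ n) p) / a) \<and> cmod (fst ((Hinv ^^ n) p)) < cmod (snd ((Hinv ^^ n) p) / a)))"
    "p \<in> Km \<Longrightarrow> cmod (fst ((Hinv ^^ n) p)) \<le> max 3 (cmod (fst p))"
    "p \<in> Km \<Longrightarrow> cmod (snd ((Hinv ^^ n) p)) \<le> cmod a * max 3 (cmod (fst p))"
proof -
  obtain x where x: "orbit (a\<^sup>2) x" "p = pt x 0" using pt_exists by blast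
  define u where "u n = x (- int n)" for n
  have step: "\<forall>n. 3 < cmod (u (Suc n)) \<and> cmod (u n) \<le> cmod (u (Suc n)) \<longrightarrow> 3/2 * cmod (u (Suc n)) \<le> cmod (u (Suc (Suc n)))"
  proof (intro allI impI)
    fix n assume "3 < cmod (u (Suc n)) \<and> cmod (u n) \<le> cmod (u (Suc n))"
    thus "3/2 * cmod (u (Suc n)) \<le> cmod (u (Suc (Suc n)))"
      using henon_escape(2)[OF x(1), of "- int (Suc n)"] by (simp add: u_def)
  qed
  note E = escape_seq[of u, OF step]
  have K: "p \<in> Km \<longleftrightarrow> (\<exists>B. \<forall>n. cmod (u n) \<le> B)" using K_minus_iff[OF x(1)] x(2) by (simp add: u_def)
  have f: "fst ((Hinv ^^ n) p) = u n" "snd ((Hinv ^^ n) p) = a * u (Suc n)" for n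
    unfolding x(2) Hinv_pt_funpow[OF x(1)] by (simp_all add: pt_def u_def minus_diff_commute)
  have u0: "fst p = u 0" using f(1)[of 0] by simp
  show "p \<in> Km \<longleftrightarrow> (\<forall>n. \<not> (3 < cmod (snd ((Hinv ^^ n) p) / a) \<and> cmod (fst ((Hinv ^^ n) p)) < cmod (snd ((Hinv ^^ n) p) / a)))"
    unfolding K f E(1) using a_nz by simp
  show "p \<in> Km \<Longrightarrow> cmod (fst ((Hinv ^^ n) p)) \<le> max 3 (cmod (fst p))"
    "p \<in> Km \<Longrightarrow> cmod (snd ((Hinv ^^ n) p)) \<le> cmod a * max 3 (cmod (fst p))"
    unfolding K f u0 norm_mult using E(2) by (simp_all only: mult_left_mono norm_ge_zero)
qed

lemma closed_K: "closed Kp" "closed Km"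
proof -
  have "Kp = (\<Inter>n. - ({p. 3 < cmod (fst ((H ^^ n) p))} \<inter> {p. cmod (snd ((H ^^ n) p)) < cmod a * cmod (fst ((H ^^ n) p))}))"
    by (auto simp: K_plus_bounds(1))
  also have "closed ..."
    by (intro closed_INT ballI closed_Compl open_Int open_Collect_less continuous_intros hol2_continuous hol2_funpow hol2_H)
  finally show "closed Kp" .
  have "Km = (\<Inter>n. - ({p. 3 < cmod (snd ((Hinv ^^ n) p) / a)} \<inter> {p. cmod (fst ((Hinv ^^ n) p)) < cmod (snd ((Hinv ^^ n) p) / a)}))"
    by (auto simp: K_minus_bounds(1))
  also have "closed ..."
    using a_nz by (intro closed_INT ballI closed_Compl open_Int open_Collect_less continuous_intros hol2_continuous hol2_funpow hol2_Hinv) auto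
  finally show "closed Km" .
qed

lemma closed_henon_julia: "closed (henon_julia (cc (a\<^sup>2)) a)"
  by (simp add: henon_julia_def J_plus_def J_minus_def closed_Int)

text \<open>The expanding eigenvalue excludes the point from the interior of \<open>K_plus\<close>;
  the contracting one becomes expanding for the inverse map and excludes it from the interior of
  \<open>K_minus\<close>.\<close>

lemma saddle_in_J:
  assumes "saddle_periodic_point H z" shows "z \<in> henon_julia (cc (a\<^sup>2)) a"
proof -
  obtain n \<mu> \<mu>' where n: "n \<ge> 1" "(H ^^ n) z = z" and ev: "deriv_eigenvalue (H ^^ n) z \<mu>" "cmod \<mu> > 1"
    "deriv_eigenvalue (H ^^ n) z \<mu>'" "cmod \<mu>' < 1"
    using assms unfolding saddle_periodic_point_def by blast
  have inv1: "(Hinv ^^ n) ((H ^^ n) p) = p" for n p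
  proof (induction n arbitrary: p)
    case (Suc n)
    have "(Hinv ^^ Suc n) ((H ^^ Suc n) p) = (Hinv ^^ n) (Hinv (H ((H ^^ n) p)))" by (simp only: funpow_Suc_right[of n Hinv] funpow.simps(2)[of n H] o_apply)
    thus ?case by (simp only: Hinv_H Suc)
  qed simp
  have n': "(Hinv ^^ n) z = z" using inv1[of n z] n(2) by simp
  have fin: "(F ^^ k) z \<in> (\<lambda>j. (F ^^ j) z) ` {..<n}" if "(F ^^ n) z = z" for F :: "complex \<times> complex \<Rightarrow> complex \<times> complex" and k
    using funpow_mod_eq[OF that, of k] n(1) by (intro image_eqI[of _ _ "k mod n"]) auto
  have bd: "bounded (range (\<lambda>k. (F ^^ k) z))" if "(F ^^ n) z = z" for F :: "complex \<times> complex \<Rightarrow> complex \<times> complex"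
    by (rule bounded_subset[OF finite_imp_bounded[of "(\<lambda>j. (F ^^ j) z) ` {..<n}"]]) (use fin[OF that] in auto)
  have K: "z \<in> Kp" "z \<in> Km"
    using bd[OF n(2)] bd[OF n'] by (simp_all add: K_plus_def K_minus_def)
  obtain D v where D: "(H ^^ n has_derivative D) (at z)" "v \<noteq> 0" "D v = (\<mu> * fst v, \<mu> * snd v)"
    using ev(1) unfolding deriv_eigenvalue_def by blast
  have 1: "z \<notin> interior Kp"
  proof (rule expanding_not_interior[OF hol2_H n(2) D(1,3,2) ev(2)])
    show "continuous_on UNIV (\<lambda>p. max 3 (cmod (snd p / a)))"
      using a_nz by (intro continuous_on_max continuous_intros) auto
  qed (use K_plus_bounds(2,3) in auto)
  have 2: "z \<notin> interior Km"
  proof -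
    obtain D v where D: "(H ^^ n has_derivative D) (at z)" "v \<noteq> 0" "D v = (\<mu>' * fst v, \<mu>' * snd v)"
      using ev(3) unfolding deriv_eigenvalue_def by blast
    obtain E where E: "(Hinv ^^ n has_derivative E) (at z)" "complex_linear E" using hol2_derivative[OF hol2_funpow[OF hol2_Hinv]] by blast
    have "((\<lambda>p. (Hinv ^^ n) ((H ^^ n) p)) has_derivative (\<lambda>w. E (D w))) (at z)"
      using has_derivative_compose[OF D(1)] E(1) n(2) by metis
    hence "((\<lambda>p. p) has_derivative (\<lambda>w. E (D w))) (at z)" by (simp only: inv1)
    hence "(\<lambda>w. E (D w)) = (\<lambda>w. w)" using has_derivative_unique has_derivative_ident by blast
    hence "v = E (D v)" by metis
    also have "... = (\<mu>' * fst (E v), \<mu>' * snd (E v))" using E(2) unfolding D(3) complex_linear_def by blast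
    finally have v: "v = (\<mu>' * fst (E v), \<mu>' * snd (E v))" .
    hence m0: "\<mu>' \<noteq> 0" using D(2) by (auto simp: zero_prod_def)
    have Ev: "E v = (inverse \<mu>' * fst v, inverse \<mu>' * snd v)"
      using arg_cong[OF v, of fst] arg_cong[OF v, of snd] m0 by (simp add: prod_eq_iff field_simps)
    have m1: "cmod (inverse \<mu>') > 1" using ev(4) m0 by (simp add: norm_inverse one_less_inverse)
    show ?thesis
    proof (rule expanding_not_interior[OF hol2_Hinv n' E(1) Ev D(2) m1])
      show "continuous_on UNIV (\<lambda>p :: complex \<times> complex. max 3 (cmod (fst p)))"
        by (intro continuous_on_max continuous_intros)
    qed (use K_minus_bounds(2,3) in auto)
  qed
  show ?thesis using K 1 2 closed_K by (simp add: henon_julia_def J_plus_def J_minus_def frontier_def)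
qed

lemma J_subset_SS: "henon_julia (cc (a\<^sup>2)) a \<subseteq> (\<lambda>x. pt x 0) ` SS (a\<^sup>2)"
proof
  fix p assume p: "p \<in> henon_julia (cc (a\<^sup>2)) a"
  hence K: "p \<in> Kp" "p \<in> Km" "p \<notin> interior Kp"
    using closed_K by (auto simp: henon_julia_def J_plus_def J_minus_def frontier_def)
  obtain x where x: "orbit (a\<^sup>2) x" "p = pt x 0" using pt_exists by blast
  obtain B1 where B1: "\<And>n. cmod (x (int n - 1)) \<le> B1" using K(1) K_plus_iff[OF x(1)] x(2) by blast
  obtain B2 where B2: "\<And>n. cmod (x (- int n)) \<le> B2" using K(2) K_minus_iff[OF x(1)] x(2) by blast
  have B: "cmod (x k) \<le> max B1 B2" for k
  proof (cases "k \<ge> 0")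
    case True
    thus ?thesis using B1[of "nat (k + 1)"] by simp
  next
    case False
    thus ?thesis using B2[of "nat (- k)"] by simp
  qed
  have "x \<in> SS (a\<^sup>2)" unfolding SS_def
  proof (intro CollectI conjI allI x(1))
    show "cmod (x k) \<le> 2" for k by (rule orbit_bound[OF small(2) x(1) B])
    show "(x k, x (k - 1)) \<notin> Pet (a\<^sup>2)" for k
    proof
      assume h: "(x k, x (k - 1)) \<in> Pet (a\<^sup>2)"
      have hn: "(x (k + int n), x (k + int n - 1)) \<in> Pet (a\<^sup>2)" for n
      proof (induction n)
        case 0 thus ?case using h by simp
      next
        case (Suc n)
        have "((x (k + int n))\<^sup>2 + cc (a\<^sup>2) + a\<^sup>2 * x (k + int n - 1), x (k + int n)) \<in> Pet (a\<^sup>2)" by (rule Pet_step[OF small(3) Suc])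
        hence "(x (k + int n + 1), x (k + int n)) \<in> Pet (a\<^sup>2)" unfolding orbit_step[OF x(1)] .
        thus ?case by (simp add: algebra_simps)
      qed
      obtain m where m: "(x (int m), x (int m - 1)) \<in> Pet (a\<^sup>2)"
        using hn[of "nat \<bar>k\<bar>"] that[of "nat (k + \<bar>k\<bar>)"] by (cases "k \<ge> 0") auto
      \<comment> \<open>The points whose \<open>m\<close>-th image lies in the petal. The entry time
        \<open>k\<close> may be negative, so the orbit is first followed inside the petal to a time
        \<open>m \<ge> 0\<close>.\<close>
      define V where "V = {q. (a\<^sup>2, fst ((H ^^ m) q), snd ((H ^^ m) q) / a) \<in> {(b, x, y). cmod b < \<delta>0 \<and> (x, y) \<in> Pet b}}"
      have "open V"
      proof -
        have "V = (\<lambda>q. (a\<^sup>2, fst ((H ^^ m) q), snd ((H ^^ m) q) / a)) -` {(b, x, y). cmod b < \<delta>0 \<and> (x, y) \<in> Pet b}"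
          unfolding V_def vimage_def ..
        moreover have "continuous_on UNIV (\<lambda>q. (a\<^sup>2, fst ((H ^^ m) q), snd ((H ^^ m) q) / a))"
          by (intro continuous_on_Pair continuous_on_const continuous_on_divide continuous_on_fst continuous_on_snd
              hol2_continuous[OF hol2_funpow[OF hol2_H]]) (use a_nz in simp)
        ultimately show ?thesis using open_vimage[OF Pet_open] by (simp only:)
      qed
      moreover have "V \<subseteq> Kp"
      proof
        fix q assume q: "q \<in> V"
        obtain y where y: "orbit (a\<^sup>2) y" "q = pt y 0" using pt_exists by blast
        have "(y (int m), y (int m - 1)) \<in> Pet (a\<^sup>2)" using q a_nz unfolding V_def mem_Collect_eq y(2) H_pt_funpow[OF y(1)] by (simp add: pt_def)
        hence hn: "(y (int (m + n)), y (int (m + n) - 1)) \<in> Pet (a\<^sup>2)" for n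
        proof (induction n)
          case (Suc n)
          have "((y (int (m + n)))\<^sup>2 + cc (a\<^sup>2) + a\<^sup>2 * y (int (m + n) - 1), y (int (m + n))) \<in> Pet (a\<^sup>2)"
            by (rule Pet_step[OF small(3)]) (rule Suc.IH[OF Suc.prems])
          hence "(y (int (m + n) + 1), y (int (m + n))) \<in> Pet (a\<^sup>2)" unfolding orbit_step[OF y(1)] .
          thus ?case by (simp add: algebra_simps)
        qed simp
        have ym: "cmod (y (int (m + n))) \<le> 2" for n
          using Pet_small[OF small(3) hn[of n]] norm_triangle_ineq[of "y (int (m + n)) - bet (a\<^sup>2)" "bet (a\<^sup>2)"] norm_bet_le[OF small(2)] s_pos(2) by simp
        have "cmod (y (int n - 1)) \<le> 2 + (\<Sum>j<Suc m. cmod (y (int j - 1)))" for n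
        proof (cases "n \<ge> Suc m")
          case True
          have "int n - 1 = int (m + (n - Suc m))" using True by simp
          hence "cmod (y (int n - 1)) \<le> 2" using ym by metis
          thus ?thesis by (simp add: sum_nonneg add_increasing2)
        next
          case False
          hence "cmod (y (int n - 1)) \<le> (\<Sum>j<Suc m. cmod (y (int j - 1)))" by (intro member_le_sum) auto
          thus ?thesis by simp
        qed
        thus "q \<in> Kp" using K_plus_iff[OF y(1)] y(2) by blast
      qed
      moreover have "p \<in> V" using m a_nz small(3) unfolding V_def mem_Collect_eq x(2) H_pt_funpow[OF x(1)] by (simp add: pt_def)
      ultimately show False using K(3) interior_maximal by blast
    qed
  qed
  thus "p \<in> (\<lambda>x. pt x 0) ` SS (a\<^sup>2)" using x(2) by blast
qed

end

subsection \<open>Periodic orbits are saddles\<close>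

context parab_henon
begin

lemma deriv_le_lipschitz:
  assumes "(f has_field_derivative f') (at (z::complex))" "open S" "z \<in> S"
    "\<And>w. w \<in> S \<Longrightarrow> cmod (f w - f z) \<le> L * cmod (w - z)"
  shows "cmod f' \<le> L"
proof (rule tendsto_upperbound[OF tendsto_norm])
  show "((\<lambda>w. (f w - f z) / (w - z)) \<longlongrightarrow> f') (at z)" using assms(1) by (simp add: has_field_derivative_iff)
  have "\<forall>\<^sub>F w in at z. w \<in> S" using eventually_at_topological assms(2,3) by blast
  moreover have "\<forall>\<^sub>F w in at z. w \<noteq> z" by (simp add: eventually_at_filter)
  ultimately show "\<forall>\<^sub>F w in at z. cmod ((f w - f z) / (w - z)) \<le> L"
    by eventually_elim (use assms(4) in \<open>simp add: norm_divide pos_divide_le_eq\<close>)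
qed simp

abbreviation lin2 :: "complex \<Rightarrow> complex \<Rightarrow> complex \<Rightarrow> complex \<Rightarrow> complex \<times> complex \<Rightarrow> complex \<times> complex" where
  "lin2 \<alpha> \<beta> \<gamma> \<delta> \<equiv> (\<lambda>w. (\<alpha> * fst w + \<beta> * snd w, \<gamma> * fst w + \<delta> * snd w))"

lemma H_derivative: "(H has_derivative lin2 (2 * fst p) a a 0) (at p)"
  using has_derivative_henon[of "cc (a\<^sup>2)" a "fst p" "snd p"] by (simp add: case_prod_unfold)

text \<open>Along with the determinant, a cone condition on the first column is carried: as points
  have modulus at least \<open>\<rho>\<close>, the factor \<open>2 * X\<close> dominates and
  \<open>\<gamma>\<close> stays controlled by \<open>\<alpha>\<close>. It bounds the off-diagonal
  product in \<open>periodic_saddle\<close>.\<close>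

lemma iterate_derivative:
  assumes o: "orbit (a\<^sup>2) x" and low: "\<And>k. \<rho> \<le> cmod (x k)"
  shows "\<exists>\<alpha> \<beta> \<gamma> \<delta>. (H ^^ n has_derivative lin2 \<alpha> \<beta> \<gamma> \<delta>) (at (pt x k)) \<and>
    \<alpha> * \<delta> - \<beta> * \<gamma> = (- (a\<^sup>2)) ^ n \<and> \<rho> * cmod \<gamma> \<le> cmod a * cmod \<alpha>"
proof (induction n)
  case 0
  show ?case
    by (rule exI[of _ 1], rule exI[of _ 0], rule exI[of _ 0], rule exI[of _ 1]) (simp add: id_def)
next
  case (Suc n)
  then obtain \<alpha> \<beta> \<gamma> \<delta> where D: "(H ^^ n has_derivative lin2 \<alpha> \<beta> \<gamma> \<delta>) (at (pt x k))"
    and det: "\<alpha> * \<delta> - \<beta> * \<gamma> = (- (a\<^sup>2)) ^ n" and \<gamma>: "\<rho> * cmod \<gamma> \<le> cmod a * cmod \<alpha>" by blast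
  define X where "X = x (k + int n)"
  have "((\<lambda>p. H ((H ^^ n) p)) has_derivative (\<lambda>w. lin2 (2 * fst ((H ^^ n) (pt x k))) a a 0 (lin2 \<alpha> \<beta> \<gamma> \<delta> w))) (at (pt x k))"
    by (rule has_derivative_compose[OF D H_derivative])
  moreover have "fst ((H ^^ n) (pt x k)) = X" unfolding H_pt_funpow[OF o] by (simp add: pt_def X_def)
  moreover have "(\<lambda>w. lin2 (2 * X) a a 0 (lin2 \<alpha> \<beta> \<gamma> \<delta> w)) = lin2 (2 * X * \<alpha> + a * \<gamma>) (2 * X * \<beta> + a * \<delta>) (a * \<alpha>) (a * \<beta>)"
    by (simp add: fun_eq_iff algebra_simps)
  ultimately have 1: "(H ^^ Suc n has_derivative lin2 (2 * X * \<alpha> + a * \<gamma>) (2 * X * \<beta> + a * \<delta>) (a * \<alpha>) (a * \<beta>)) (at (pt x k))"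
    by (simp add: o_def)
  have "(2 * X * \<alpha> + a * \<gamma>) * (a * \<beta>) - (2 * X * \<beta> + a * \<delta>) * (a * \<alpha>) = - (a\<^sup>2) * (\<alpha> * \<delta> - \<beta> * \<gamma>)"
    by (simp add: algebra_simps power2_eq_square)
  hence 2: "(2 * X * \<alpha> + a * \<gamma>) * (a * \<beta>) - (2 * X * \<beta> + a * \<delta>) * (a * \<alpha>) = (- (a\<^sup>2)) ^ Suc n" by (simp add: det)
  have "\<rho> * cmod \<alpha> \<le> cmod (2 * X * \<alpha> + a * \<gamma>)"
  proof -
    have "\<rho> * cmod (a * \<gamma>) = cmod a * (\<rho> * cmod \<gamma>)" by (simp add: norm_mult)
    also have "... \<le> cmod a * (cmod a * cmod \<alpha>)" by (rule mult_left_mono[OF \<gamma>]) simp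
    also have "... = cmod (a\<^sup>2) * cmod \<alpha>" by (simp add: norm_mult power2_eq_square)
    also have "... \<le> \<rho>\<^sup>2 * cmod \<alpha>" using small(5) norm_ge_zero[of "a\<^sup>2"] by (intro mult_right_mono[OF _ norm_ge_zero]) linarith
    also have "... = \<rho> * (\<rho> * cmod \<alpha>)" by (simp add: power2_eq_square)
    finally have "cmod (a * \<gamma>) \<le> \<rho> * cmod \<alpha>" using rho(1) by (rule mult_left_le_imp_le)
    moreover have "2 * \<rho> * cmod \<alpha> \<le> cmod (2 * X * \<alpha>)" using low[of "k + int n"] by (simp add: norm_mult X_def mult_right_mono)
    ultimately show ?thesis using norm_triangle_ineq4[of "2 * X * \<alpha> + a * \<gamma>" "a * \<gamma>"] by simp
  qed
  hence 3: "\<rho> * cmod (a * \<alpha>) \<le> cmod a * cmod (2 * X * \<alpha> + a * \<gamma>)"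
    using mult_left_mono[of "\<rho> * cmod \<alpha>" _ "cmod a"] by (simp add: norm_mult mult.left_commute)
  show ?case using 1 2 3 by blast
qed

lemma H_recur: "recur (a\<^sup>2) u \<Longrightarrow> (H ^^ n) (u 1, a * u 0) = (u (Suc n), a * u n)"
  by (induction n) (simp_all add: recur_def henon_def power2_eq_square)

lemma saddle_H:
  assumes "saddle_periodic_point H z" shows "saddle_periodic_point H (H z)"
proof -
  obtain n where n: "n \<ge> 1" "(H ^^ n) z = z" and ev: "\<exists>\<mu>. deriv_eigenvalue (H ^^ n) z \<mu> \<and> cmod \<mu> < 1"
    "\<exists>\<mu>. deriv_eigenvalue (H ^^ n) z \<mu> \<and> cmod \<mu> > 1"
    using assms unfolding saddle_periodic_point_def by blast
  have sw: "(H ^^ n) (H p) = H ((H ^^ n) p)" for p by (simp add: funpow_swap1)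
  have tr: "deriv_eigenvalue (H ^^ n) (H z) \<mu>" if e: "deriv_eigenvalue (H ^^ n) z \<mu>" for \<mu>
  proof -
    obtain D v where D: "(H ^^ n has_derivative D) (at z)" "v \<noteq> 0" "D v = (\<mu> * fst v, \<mu> * snd v)"
      using e unfolding deriv_eigenvalue_def by blast
    obtain D' where D': "(H ^^ n has_derivative D') (at (H z))" using hol2_derivative[OF hol2_funpow[OF hol2_H]] by blast
    let ?E = "lin2 (2 * fst z) a a 0"
    have 1: "((\<lambda>p. (H ^^ n) (H p)) has_derivative (\<lambda>w. D' (?E w))) (at z)" by (rule has_derivative_compose[OF H_derivative D'])
    have "(H has_derivative ?E) (at ((H ^^ n) z))" unfolding n(2) by (rule H_derivative)
    hence 2: "((\<lambda>p. H ((H ^^ n) p)) has_derivative (\<lambda>w. ?E (D w))) (at z)" by (rule has_derivative_compose[OF D(1)])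
    have "(\<lambda>w. D' (?E w)) = (\<lambda>w. ?E (D w))" using has_derivative_unique[OF 1] 2 unfolding sw by blast
    hence "D' (?E v) = ?E (D v)" by metis
    also have "... = (\<mu> * fst (?E v), \<mu> * snd (?E v))" by (simp add: D(3) algebra_simps)
    finally have "D' (?E v) = (\<mu> * fst (?E v), \<mu> * snd (?E v))" .
    moreover have "?E v \<noteq> 0" using D(2) a_nz by (auto simp: zero_prod_def prod_eq_iff)
    ultimately show ?thesis using D' unfolding deriv_eigenvalue_def by blast
  qed
  have "(H ^^ n) (H z) = H z" by (simp add: sw n(2))
  thus ?thesis unfolding saddle_periodic_point_def using n(1) ev tr by blast
qed

lemma periodic_multiple: "(\<And>k. x (k + int p) = x k) \<Longrightarrow> x (k + int (p * m)) = (x k :: complex)"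
proof (induction m)
  case (Suc m)
  have "x (k + int (p * Suc m)) = x (k + int (p * m) + int p)" by (simp add: algebra_simps)
  thus ?case using Suc by simp
qed simp

lemma pt_periodic: "(\<And>k. x (k + int p) = x k) \<Longrightarrow> pt x (k + int (p * m)) = pt x k"
  using periodic_multiple[of x p k m] periodic_multiple[of x p "k - 1" m]
  by (simp add: pt_def algebra_simps)

lemma SS_shift:
  assumes "x \<in> SS b" shows "(\<lambda>k. x (k + m)) \<in> SS b"
proof -
  have "x (k + 1 + m) = (x (k + m))\<^sup>2 + cc b + b * x (k - 1 + m)" for k
    using orbit_step[OF SS_D(1)[OF assms], of "k + m"] by (simp add: algebra_simps)
  moreover have "(x (k + m), x (k - 1 + m)) \<notin> Pet b" for k
    using SS_D(3)[OF assms, of "k + m"] by (simp add: algebra_simps)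
  ultimately show ?thesis using SS_D(2)[OF assms] by (simp add: SS_def orbit_def)
qed

text \<open>\<open>H ^^ N\<close> undoes the branch \<open>f\<close>; differentiating this gives
  \<open>\<alpha> * f1 = 1\<close> in the endpoint and
  \<open>\<alpha> * f2 + \<beta> * a = 0\<close> in the preceding point. The contraction
  \<open>cmod f1 \<le> 1/8\<close> makes \<open>cmod \<alpha> \<ge> 8\<close>; smallness of
  \<open>f2\<close> and the cone condition bound \<open>\<beta> * \<gamma>\<close>, and the small
  determinant then bounds \<open>\<delta>\<close>. So the trace is large enough for
  \<open>eigenvalue_split\<close>.\<close>

lemma periodic_saddle:
  assumes x: "x \<in> SS (a\<^sup>2)" and p: "p \<ge> 1" "\<And>k. x (k + int p) = x k" and fr: "far x M"
  shows "saddle_periodic_point H (pt x 0)"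
proof -
  note o = SS_D(1)[OF x] and low = SS_lower[OF small(2) x]
  obtain \<xi>0 G where G: "\<xi>0 \<in> EE" "cmod (x M - \<xi>0) < \<sigma>" "branch_seq \<xi>0 G"
    "\<And>n. G n (x M) (x (M - int n - 1)) (a\<^sup>2) = x (M - int n)" using SS_branch[OF small(2) x fr] by metis
  obtain n0 where n0: "\<forall>n\<ge>n0. \<forall>\<xi>0 f \<xi> \<xi>' \<zeta> \<zeta>' b. \<xi>0 \<in> EE \<longrightarrow> branch \<xi>0 n f \<longrightarrow> \<xi> \<in> ball \<xi>0 (3 * \<sigma> / 2) \<longrightarrow> \<xi>' \<in> ball \<xi>0 (3 * \<sigma> / 2) \<longrightarrow>
     \<zeta> \<in> ball 0 4 \<longrightarrow> \<zeta>' \<in> ball 0 4 \<longrightarrow> cmod b < \<delta>2 \<longrightarrow>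
     cmod (f \<xi> \<zeta> b - f \<xi>' \<zeta>' b) \<le> 1/8 * cmod (\<xi> - \<xi>') + 1/8 * cmod (\<zeta> - \<zeta>')" using branch_contraction by blast
  \<comment> \<open>A multiple of the period that is at least \<open>n0\<close>, so that the branch
    of this depth contracts.\<close>
  define N where "N = p * (n0 + 1)"
  have N: "N \<ge> n0" "N \<ge> 1" using p(1) by (simp_all add: N_def trans_le_add1 add_increasing)
  define k where "k = M - int N"
  define \<zeta> where "\<zeta> = x (k - 1)"
  define f where "f = G N"
  have f: "branch \<xi>0 N f" using G(3) by (simp add: branch_seq_def f_def)
  have b1: "a\<^sup>2 \<in> ball 0 \<delta>1" using small(2) by simp
  have \<zeta>: "\<zeta> \<in> ball 0 4" using SS_D(2)[OF x, of "k - 1"] by (simp add: \<zeta>_def)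
  have f0: "f (x M) \<zeta> (a\<^sup>2) = x k" using G(4)[of N] by (simp add: f_def \<zeta>_def k_def)
  have HN: "fst ((H ^^ N) (f \<xi> z (a\<^sup>2), a * z)) = \<xi>" if h: "\<xi> \<in> ball \<xi>0 (2 * \<sigma>)" "z \<in> ball 0 4" for \<xi> z
  proof -
    obtain u where u: "recur (a\<^sup>2) u" "u 0 = z" "u 1 = f \<xi> z (a\<^sup>2)" "u (Suc N) = \<xi>" using branchD(3)[OF f h b1] by blast
    show ?thesis using H_recur[OF u(1), of N] by (simp add: u(2,3,4) del: One_nat_def)
  qed
  have xM: "x M \<in> ball \<xi>0 (3 * \<sigma> / 2)" "x M \<in> ball \<xi>0 (2 * \<sigma>)" using G(2) sig by (auto simp: dist_norm norm_minus_commute)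
  obtain \<alpha> \<beta> \<gamma> \<delta> where D: "(H ^^ N has_derivative lin2 \<alpha> \<beta> \<gamma> \<delta>) (at (pt x k))"
    and det: "\<alpha> * \<delta> - \<beta> * \<gamma> = (- (a\<^sup>2)) ^ N" and \<gamma>: "\<rho> * cmod \<gamma> \<le> cmod a * cmod \<alpha>"
    using iterate_derivative[OF o low] by blast
  have pk: "pt x k = (x k, a * \<zeta>)" by (simp add: pt_def \<zeta>_def)
  obtain f1 where f1: "((\<lambda>\<xi>. f \<xi> \<zeta> (a\<^sup>2)) has_field_derivative f1) (at (x M))"
    using holomorphic_derivI[OF branch_holomorphic(1)[OF f \<zeta> b1] open_ball xM(2)] by blast
  obtain f2 where f2: "((\<lambda>z. f (x M) z (a\<^sup>2)) has_field_derivative f2) (at \<zeta>)"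
    using holomorphic_derivI[OF branch_holomorphic(2)[OF f xM(2) b1] open_ball \<zeta>] by blast
  have n1: "cmod f1 \<le> 1/8"
  proof (rule deriv_le_lipschitz[OF f1 open_ball xM(1)])
    fix w assume "w \<in> ball \<xi>0 (3 * \<sigma> / 2)"
    thus "cmod (f w \<zeta> (a\<^sup>2) - f (x M) \<zeta> (a\<^sup>2)) \<le> 1/8 * cmod (w - x M)"
      using n0[rule_format, OF N(1) G(1) f _ xM(1) \<zeta> \<zeta>, of w "a\<^sup>2"] d3(2)[OF small(1)] by simp
  qed
  have n2: "cmod f2 \<le> 2 * cmod (a\<^sup>2) / \<rho>"
    by (rule deriv_le_lipschitz[OF f2 open_ball \<zeta>]) (use branchD(4)[OF f xM(2) _ b1 \<zeta>] in auto)
  have "((\<lambda>\<xi>. fst ((H ^^ N) (f \<xi> \<zeta> (a\<^sup>2), a * \<zeta>))) has_field_derivative \<alpha> * f1) (at (x M))"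
  proof -
    have "((\<lambda>\<xi>. (f \<xi> \<zeta> (a\<^sup>2), a * \<zeta>)) has_derivative (\<lambda>t. (f1 * t, 0))) (at (x M))"
      using f1 unfolding has_field_derivative_def by (intro has_derivative_Pair) auto
    moreover have "(H ^^ N has_derivative lin2 \<alpha> \<beta> \<gamma> \<delta>) (at (f (x M) \<zeta> (a\<^sup>2), a * \<zeta>))" using D by (simp add: f0 pk)
    ultimately have "((\<lambda>\<xi>. (H ^^ N) (f \<xi> \<zeta> (a\<^sup>2), a * \<zeta>)) has_derivative (\<lambda>t. lin2 \<alpha> \<beta> \<gamma> \<delta> (f1 * t, 0))) (at (x M))"
      by (rule has_derivative_compose)
    from has_derivative_fst[OF this]
    have "((\<lambda>\<xi>. fst ((H ^^ N) (f \<xi> \<zeta> (a\<^sup>2), a * \<zeta>))) has_derivative (\<lambda>t. \<alpha> * (f1 * t))) (at (x M))" by simp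
    moreover have "(\<lambda>t. \<alpha> * (f1 * t)) = (*) (\<alpha> * f1)" by (simp add: fun_eq_iff)
    ultimately show ?thesis by (simp only: has_field_derivative_def)
  qed
  moreover have "((\<lambda>\<xi>. fst ((H ^^ N) (f \<xi> \<zeta> (a\<^sup>2), a * \<zeta>))) has_field_derivative 1) (at (x M))"
    by (rule has_field_derivative_transform_within_open[OF DERIV_ident open_ball xM(2)]) (use HN \<zeta> in auto)
  ultimately have e1: "\<alpha> * f1 = 1" by (rule DERIV_unique)
  have "((\<lambda>z. fst ((H ^^ N) (f (x M) z (a\<^sup>2), a * z))) has_field_derivative \<alpha> * f2 + \<beta> * a) (at \<zeta>)"
  proof -
    have "((\<lambda>z. (f (x M) z (a\<^sup>2), a * z)) has_derivative (\<lambda>t. (f2 * t, a * t))) (at \<zeta>)"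
      using f2 unfolding has_field_derivative_def by (intro has_derivative_Pair) (auto intro!: derivative_eq_intros)
    moreover have "(H ^^ N has_derivative lin2 \<alpha> \<beta> \<gamma> \<delta>) (at (f (x M) \<zeta> (a\<^sup>2), a * \<zeta>))" using D by (simp add: f0 pk)
    ultimately have "((\<lambda>z. (H ^^ N) (f (x M) z (a\<^sup>2), a * z)) has_derivative (\<lambda>t. lin2 \<alpha> \<beta> \<gamma> \<delta> (f2 * t, a * t))) (at \<zeta>)"
      by (rule has_derivative_compose)
    from has_derivative_fst[OF this]
    have "((\<lambda>z. fst ((H ^^ N) (f (x M) z (a\<^sup>2), a * z))) has_derivative (\<lambda>t. \<alpha> * (f2 * t) + \<beta> * (a * t))) (at \<zeta>)" by simp
    moreover have "(\<lambda>t. \<alpha> * (f2 * t) + \<beta> * (a * t)) = (*) (\<alpha> * f2 + \<beta> * a)" by (simp add: fun_eq_iff algebra_simps)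
    ultimately show ?thesis by (simp only: has_field_derivative_def)
  qed
  moreover have "((\<lambda>z. fst ((H ^^ N) (f (x M) z (a\<^sup>2), a * z))) has_field_derivative 0) (at \<zeta>)"
    by (rule has_field_derivative_transform_within_open[OF DERIV_const open_ball \<zeta>]) (use HN xM(2) in auto)
  ultimately have e2: "\<alpha> * f2 + \<beta> * a = 0" by (rule DERIV_unique)
  have \<alpha>8: "8 \<le> cmod \<alpha>"
  proof -
    have "1 = cmod \<alpha> * cmod f1" using arg_cong[OF e1, of cmod] by (simp add: norm_mult)
    also have "... \<le> cmod \<alpha> * (1/8)" by (rule mult_left_mono[OF n1]) simp
    finally show ?thesis by simp
  qed
  have \<beta>\<gamma>: "cmod (\<beta> * \<gamma>) \<le> cmod \<alpha> * cmod \<alpha> / 24"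
  proof -
    have "\<beta> * a = - (\<alpha> * f2)" using e2 by (simp add: eq_neg_iff_add_eq_0 add.commute)
    hence "cmod \<beta> * cmod a = cmod \<alpha> * cmod f2" by (metis norm_minus_cancel norm_mult)
    also have "... \<le> cmod \<alpha> * (2 * cmod (a\<^sup>2) / \<rho>)" by (rule mult_left_mono[OF n2]) simp
    finally have 1: "cmod \<beta> * cmod a \<le> cmod \<alpha> * (2 * cmod (a\<^sup>2) / \<rho>)" .
    have "\<rho> * (cmod (\<beta> * \<gamma>)) = cmod \<beta> * (\<rho> * cmod \<gamma>)" by (simp add: norm_mult)
    also have "... \<le> cmod \<beta> * (cmod a * cmod \<alpha>)" by (rule mult_left_mono[OF \<gamma>]) simp
    also have "... = (cmod \<beta> * cmod a) * cmod \<alpha>" by simp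
    also have "... \<le> cmod \<alpha> * (2 * cmod (a\<^sup>2) / \<rho>) * cmod \<alpha>" by (rule mult_right_mono[OF 1]) simp
    also have "... \<le> cmod \<alpha> * (\<rho> / 24) * cmod \<alpha>"
    proof (intro mult_right_mono mult_left_mono)
      show "2 * cmod (a\<^sup>2) / \<rho> \<le> \<rho> / 24" using small(5) rho(1) by (simp add: pos_divide_le_eq power2_eq_square)
    qed auto
    also have "... = \<rho> * (cmod \<alpha> * cmod \<alpha> / 24)" by simp
    finally show ?thesis using rho(1) by (rule mult_left_le_imp_le)
  qed
  have d48: "cmod (\<alpha> * \<delta> - \<beta> * \<gamma>) \<le> 1/48"
  proof -
    have "cmod (\<alpha> * \<delta> - \<beta> * \<gamma>) = cmod (a\<^sup>2) ^ N" by (simp add: det norm_power)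
    also have "... \<le> cmod (a\<^sup>2) ^ 1" using small(4) N(2) by (intro power_decreasing) auto
    finally show ?thesis using small(4) by simp
  qed
  have \<delta>: "cmod \<delta> \<le> cmod \<alpha> / 24 + 1 / 48"
  proof -
    have "cmod \<alpha> * cmod \<delta> \<le> cmod (\<alpha> * \<delta> - \<beta> * \<gamma>) + cmod (\<beta> * \<gamma>)"
      using norm_triangle_ineq[of "\<alpha> * \<delta> - \<beta> * \<gamma>" "\<beta> * \<gamma>"] by (simp add: norm_mult)
    also have "... \<le> 1/48 + cmod \<alpha> * cmod \<alpha> / 24" using d48 \<beta>\<gamma> by linarith
    also have "... \<le> cmod \<alpha> * (1/48) + cmod \<alpha> * cmod \<alpha> / 24" using \<alpha>8 by simp
    also have "... = cmod \<alpha> * (cmod \<alpha> / 24 + 1/48)" by (simp add: algebra_simps)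
    finally show ?thesis using \<alpha>8 by (simp only: mult_le_cancel_left_pos)
  qed
  have tr: "cmod (\<alpha> + \<delta>) > 1 + cmod (\<alpha> * \<delta> - \<beta> * \<gamma>)"
    using norm_triangle_ineq4[of "\<alpha> + \<delta>" \<delta>] \<delta> d48 \<alpha>8 by simp
  note ev = eigenvalue_split[OF tr, unfolded case_prod_unfold]
  have fix': "(H ^^ N) (pt x k) = pt x k"
    unfolding H_pt_funpow[OF o] N_def by (rule pt_periodic) (rule p(2))
  have "saddle_periodic_point H (pt x k)"
    unfolding saddle_periodic_point_def deriv_eigenvalue_def using N(2) fix' D ev by blast
  \<comment> \<open>The saddle is found at time \<open>k\<close>, possibly negative. Forward images
    of saddles are saddles, and some multiple of the period, which has the same point as time 0,
    lies after \<open>k\<close>.\<close>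
  hence "saddle_periodic_point H ((H ^^ m) (pt x k))" for m by (induction m) (simp_all add: saddle_H)
  hence s: "saddle_periodic_point H (pt x (k + int m))" for m unfolding H_pt_funpow[OF o] .
  have "k \<le> int (p * nat \<bar>k\<bar>)"
  proof -
    have "1 * \<bar>k\<bar> \<le> int p * \<bar>k\<bar>" using p(1) by (intro mult_right_mono) auto
    thus ?thesis by simp
  qed
  hence "k + int (nat (int (p * nat \<bar>k\<bar>) - k)) = 0 + int (p * nat \<bar>k\<bar>)" by simp
  hence "saddle_periodic_point H (pt x (0 + int (p * nat \<bar>k\<bar>)))" using s by metis
  moreover have "pt x (0 + int (p * nat \<bar>k\<bar>)) = pt x 0"
    by (rule pt_periodic) (rule p(2))
  ultimately show ?thesis by simp
qed

text \<open>The shadow of a periodic orbit is periodic, since its translate by the period shadows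
  the same orbit. Shadows of periodic orbits tending to \<open>z\<close> accumulate at an orbit
  shadowing \<open>z\<close>, which is \<open>x\<close> by expansivity.\<close>

lemma SS_subset_J_star: "(\<lambda>x. pt x 0) ` SS (a\<^sup>2) \<subseteq> J_star (cc (a\<^sup>2)) a"
proof
  fix p assume "p \<in> (\<lambda>x. pt x 0) ` SS (a\<^sup>2)"
  then obtain x where x: "x \<in> SS (a\<^sup>2)" "p = pt x 0" by blast
  obtain z where z: "z \<in> SS 0" "shadows x z" using shadow_to_zero[OF a_small x(1)] by blast
  have "\<exists>p\<ge>1. \<exists>y\<in>SS 0. (\<forall>k. y (k + int p) = y k) \<and> (\<forall>N. \<exists>M\<ge>N. far y M) \<and>
    (\<forall>k. \<bar>k\<bar> \<le> int j \<longrightarrow> cmod (y k - z k) < 1 / real (Suc j))" for j by (rule periodic_approx[OF z(1)]) simp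
  then obtain p' y where y: "\<And>j. p' j \<ge> 1" "\<And>j. y j \<in> SS 0" "\<And>j k. y j (k + int (p' j)) = y j k" "\<And>j N. \<exists>M\<ge>N. far (y j) M"
    "\<And>j k. \<bar>k\<bar> \<le> int j \<Longrightarrow> cmod (y j k - z k) < 1 / real (Suc j)" by metis
  have "\<exists>x\<in>SS (a\<^sup>2). shadows x (y j)" for j by (rule shadow_from_zero[OF a_small y(2)])
  then obtain X where X: "\<And>j. X j \<in> SS (a\<^sup>2)" "\<And>j. shadows (X j) (y j)" by metis
  have per: "X j (k + int (p' j)) = X j k" for j k
  proof -
    define X' where "X' k = X j (k + int (p' j))" for k
    have "X' \<in> SS (a\<^sup>2)" unfolding X'_def by (rule SS_shift[OF X(1)])
    moreover have "cmod (X' k - X j k) \<le> \<eta>0" for k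
    proof -
      have "cmod (X' k - y j k) \<le> \<eta>0 / 2" using X(2)[of j] y(3)[of j k] unfolding shadows_def X'_def by metis
      moreover have "cmod (X j k - y j k) \<le> \<eta>0 / 2" using X(2)[of j] unfolding shadows_def by blast
      ultimately show ?thesis using norm_triangle_ineq4[of "X' k - y j k" "X j k - y j k"] by simp
    qed
    ultimately have "X' = X j" using expansivity[OF small(1) _ X(1)] by blast
    thus ?thesis unfolding X'_def by metis
  qed
  have fr: "\<exists>M. far (X j) M" for j
  proof (rule ccontr)
    assume "\<not> ?thesis"
    hence c: "X j k = bet (a\<^sup>2)" for k using no_far_imp_const[OF small(1) X(1)] by blast
    obtain M where M: "far (y j) M" using y(4) by blast
    have "cmod (bet (a\<^sup>2) - y j M) \<le> \<eta>0 / 2" using X(2)[of j] c unfolding shadows_def by metis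
    moreover have "cmod (bet (a\<^sup>2) - beta) = cmod (a\<^sup>2) / 2" by (rule norm_bet_diff)
    moreover have "3 * s / 4 \<le> cmod (y j M - beta)" using M by (simp add: far_def)
    moreover have "cmod (y j M - beta) \<le> cmod (bet (a\<^sup>2) - beta) + cmod (bet (a\<^sup>2) - y j M)"
      using norm_triangle_ineq4[of "bet (a\<^sup>2) - beta" "bet (a\<^sup>2) - y j M"] by simp
    ultimately show False using eta0(4) d3(5)[OF small(1)] s_pos by linarith
  qed
  have sad: "saddle_periodic_point H (pt (X j) 0)" for j
    using periodic_saddle[OF X(1) y(1) per] fr by blast
  obtain r g where r: "strict_mono (r :: nat \<Rightarrow> nat)" "\<And>k. (\<lambda>j. X (r j) k) \<longlonglongrightarrow> g k"
    using pointwise_subsequence[of X 2] SS_D(2)[OF X(1)] by blast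
  have yl: "(\<lambda>j. y (r j) k) \<longlonglongrightarrow> z k" for k by (rule close_tendsto[OF y(5) r(1)])
  have g: "g \<in> SS (a\<^sup>2)" by (rule SS_closed_limit[OF small(2) X(1) r(2)])
  have gz: "shadows g z" by (rule shadow_limit[OF X(2) r(2) yl])
  have "g = x"
  proof (rule expansivity[OF small(1) g x(1)])
    fix k
    have "cmod (g k - z k) \<le> \<eta>0 / 2" "cmod (x k - z k) \<le> \<eta>0 / 2" using gz z(2) unfolding shadows_def by blast+
    thus "cmod (g k - x k) \<le> \<eta>0" using norm_triangle_ineq4[of "g k - z k" "x k - z k"] by simp
  qed
  hence "(\<lambda>j. pt (X (r j)) 0) \<longlonglongrightarrow> p" unfolding x(2) pt_def using r(2) by (auto intro!: tendsto_intros)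
  thus "p \<in> J_star (cc (a\<^sup>2)) a" unfolding J_star_def closure_sequential using sad by (intro exI[of _ "\<lambda>j. pt (X (r j)) 0"]) simp
qed

lemma J_eq: "henon_julia (cc (a\<^sup>2)) a = (\<lambda>x. pt x 0) ` SS (a\<^sup>2)" "henon_julia (cc (a\<^sup>2)) a = J_star (cc (a\<^sup>2)) a"
proof -
  have "J_star (cc (a\<^sup>2)) a \<subseteq> henon_julia (cc (a\<^sup>2)) a"
    unfolding J_star_def by (rule closure_minimal[OF _ closed_henon_julia]) (use saddle_in_J in blast)
  thus "henon_julia (cc (a\<^sup>2)) a = (\<lambda>x. pt x 0) ` SS (a\<^sup>2)" "henon_julia (cc (a\<^sup>2)) a = J_star (cc (a\<^sup>2)) a"
    using J_subset_SS SS_subset_J_star by blast+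
qed

lemma orbit_pt_unique: "orbit (a\<^sup>2) x \<Longrightarrow> orbit (a\<^sup>2) y \<Longrightarrow> pt x 0 = pt y 0 \<Longrightarrow> x = y"
proof
  fix k assume o: "orbit (a\<^sup>2) x" "orbit (a\<^sup>2) y" and e: "pt x 0 = pt y 0"
  show "x k = y k"
  proof (cases "k \<ge> 0")
    case True
    hence "pt x k = pt y k" using H_pt_funpow[OF o(1), of "nat k" 0] H_pt_funpow[OF o(2), of "nat k" 0] unfolding e by simp
    thus ?thesis by (simp add: pt_def)
  next
    case False
    hence "pt x k = pt y k" using Hinv_pt_funpow[OF o(1), of "nat (- k)" 0] Hinv_pt_funpow[OF o(2), of "nat (- k)" 0] unfolding e by simp
    thus ?thesis by (simp add: pt_def)
  qed
qed

lemma SS_homeomorphic_J: "SS (a\<^sup>2) homeomorphic henon_julia (cc (a\<^sup>2)) a"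
proof (rule homeomorphic_compact[OF compact_SS[OF small(2)]])
  show "(\<lambda>x. pt x 0) ` SS (a\<^sup>2) = henon_julia (cc (a\<^sup>2)) a" by (rule J_eq(1)[symmetric])
  show "inj_on (\<lambda>x. pt x 0) (SS (a\<^sup>2))" using orbit_pt_unique SS_D(1) by (meson inj_onI)
  show "continuous_on (SS (a\<^sup>2)) (\<lambda>x. pt x 0)" unfolding pt_def
    by (intro continuous_intros continuous_on_product_then_coordinatewise continuous_on_id)
qed

end

subsection \<open>Connectedness of the Julia set\<close>

text \<open>In a separation with 0 in \<open>A\<close>, the symmetric sets \<open>A'\<close> and
  \<open>B'\<close> separate the preimage too; by symmetry their images are disjoint and separate
  \<open>S\<close>. That \<open>A'\<close> is nonempty uses \<open>c \<in> S\<close>, which puts 0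
  into the preimage.\<close>

lemma connected_quadratic_preimage:
  fixes S :: "complex set" and c :: complex
  assumes "compact S" "connected S" "c \<in> S"
  shows "connected {x. x\<^sup>2 + c \<in> S}"
proof -
  let ?Q = "{x. x\<^sup>2 + c \<in> S}"
  have cl: "closed ?Q"
  proof -
    have "closed ((\<lambda>x. x\<^sup>2 + c) -` S)" using assms(1) by (intro continuous_closed_vimage compact_imp_closed continuous_intros) auto
    thus ?thesis by (simp add: vimage_def)
  qed
  have bd: "bounded ?Q"
  proof -
    obtain B where B: "\<And>y. y \<in> S \<Longrightarrow> cmod y \<le> B" using compact_imp_bounded[OF assms(1)] by (auto simp: bounded_iff)
    have "cmod x \<le> sqrt (B + cmod c)" if "x \<in> ?Q" for x
    proof (rule real_le_rsqrt)
      have "(cmod x)\<^sup>2 = cmod (x\<^sup>2 + c - c)" by (simp add: norm_power)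
      also have "... \<le> cmod (x\<^sup>2 + c) + cmod c" by (rule norm_triangle_ineq4)
      finally show "(cmod x)\<^sup>2 \<le> B + cmod c" using B[of "x\<^sup>2 + c"] that by simp
    qed
    thus ?thesis unfolding bounded_iff by blast
  qed
  show ?thesis
  proof (rule ccontr)
    assume "\<not> ?thesis"
    then obtain A B where AB: "closed A" "closed B" "A \<noteq> {}" "B \<noteq> {}" "A \<union> B = ?Q" "A \<inter> B = {}"
      using connected_closed_set[OF cl] by blast
    have *: False if AB: "closed A" "closed B" "B \<noteq> {}" "A \<union> B = ?Q" "A \<inter> B = {}" "0 \<in> A" for A B
    proof -
      define A' B' where "A' = A \<inter> uminus ` A" and "B' = B \<union> uminus ` B"
      have cA: "closed A'" "closed B'" using AB closed_negations by (auto simp: A'_def B'_def)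
      have sym: "- x \<in> ?Q \<longleftrightarrow> x \<in> ?Q" for x by simp
      have mA: "x \<in> A' \<longleftrightarrow> x \<in> A \<and> - x \<in> A" "x \<in> B' \<longleftrightarrow> x \<in> B \<or> - x \<in> B" for x
        by (auto simp: A'_def B'_def image_iff intro: bexI[of _ "- x"])
      have un: "A' \<union> B' = ?Q" using AB(4) sym mA by blast
      have dj: "A' \<inter> B' = {}" using AB(5) mA by blast
      have comp: "compact A'" "compact B'" using cA un bd by (auto simp: compact_eq_bounded_closed intro: bounded_subset)
      let ?f = "\<lambda>x. x\<^sup>2 + c"
      have "closed (?f ` A')" "closed (?f ` B')"
        by (intro compact_imp_closed compact_continuous_image comp continuous_intros)+
      moreover have "?f ` A' \<union> ?f ` B' = S"
      proof -
        have "?f ` A' \<union> ?f ` B' = ?f ` ?Q" by (simp only: un flip: image_Un)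
        also have "... = S"
        proof
          show "S \<subseteq> ?f ` ?Q"
          proof
            fix y assume "y \<in> S"
            thus "y \<in> ?f ` ?Q" by (intro image_eqI[of _ _ "csqrt (y - c)"]) auto
          qed
        qed auto
        finally show ?thesis .
      qed
      moreover have "?f ` A' \<inter> ?f ` B' = {}"
      proof (rule ccontr)
        assume "?f ` A' \<inter> ?f ` B' \<noteq> {}"
        then obtain x y where "x \<in> A'" "y \<in> B'" "x\<^sup>2 = y\<^sup>2" by auto
        hence "x \<in> A'" "x \<in> B'" using mA by (auto simp: power2_eq_iff)
        thus False using dj by blast
      qed
      moreover have "0 \<in> A'" using AB(6) mA by simp
      hence "?f ` A' \<noteq> {}" by blast
      moreover have "?f ` B' \<noteq> {}" using AB(3) mA by blast
      ultimately show False using assms(2) connected_closed_set[OF compact_imp_closed[OF assms(1)]] by metis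
    qed
    have "0 \<in> ?Q" using assms(3) by simp
    then consider "0 \<in> A" | "0 \<in> B" using AB(5) by blast
    thus False
    proof cases
      case 1 thus ?thesis using *[of A B] AB by blast
    next
      case 2 thus ?thesis using *[of B A] AB by blast
    qed
  qed
qed

context parab_branch
begin

lemma zero_in_KP: "0 \<in> KP" "0 \<in> interior KP"
proof -
  have "P 0 \<in> Bas" using critical_in_Bas[of 1] by simp
  hence "P 0 \<in> interior KP" using Bas_interior by blast
  thus "0 \<in> KP" using KP_step interior_subset by blast
  show "0 \<in> interior KP"
  proof (rule ccontr)
    assume "0 \<notin> interior KP"
    hence "0 \<in> JP" using \<open>0 \<in> KP\<close> by (simp add: JP_eq)
    hence "P 0 \<in> JP" by (simp only: JP_step)
    thus False using JP_not_Bas \<open>P 0 \<in> Bas\<close> by blast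
  qed
qed

text \<open>A decreasing intersection of compact sets, each the preimage of the one before; all of
  them contain the critical value because the critical orbit is bounded.\<close>

lemma connected_KP: "connected KP"
proof -
  define S where "S n = {x. cmod ((P ^^ n) x) \<le> 2}" for n
  have nest: "S (Suc n) \<subseteq> S n" for n
  proof
    fix x assume x: "x \<in> S (Suc n)"
    show "x \<in> S n"
    proof (rule ccontr)
      assume "x \<notin> S n"
      hence g: "cmod ((P ^^ n) x) > 2" by (simp add: S_def)
      hence "cmod ((P ^^ 1) ((P ^^ n) x)) \<ge> (13/8) ^ 1 * cmod ((P ^^ n) x)" by (intro iterate_grow) auto
      thus False using x g by (simp add: S_def)
    qed
  qed
  have nest': "m \<le> n \<Longrightarrow> S n \<subseteq> S m" for m n by (rule lift_Suc_antimono_le[of S]) (use nest in auto)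
  have S0: "S 0 = cball 0 2" by (auto simp: S_def)
  have comp: "compact (S n)" for n
    unfolding compact_eq_bounded_closed
  proof
    show "bounded (S n)" using nest'[of 0 n] S0 bounded_cball bounded_subset by (metis zero_le)
    show "closed (S n)" unfolding S_def by (intro closed_Collect_le continuous_intros quad_continuous_iterate)
  qed
  have conn: "connected (S n)" for n
  proof (induction n)
    case 0 show ?case by (simp add: S0)
  next
    case (Suc n)
    have "P 0 \<in> KP" using zero_in_KP(1) by (simp only: KP_step)
    hence "cc 0 \<in> S n" by (simp add: KP_iff S_def P_eq)
    from connected_quadratic_preimage[OF comp Suc this]
    have "connected {x. P x \<in> S n}" by (simp only: P_eq)
    moreover have "{x. P x \<in> S n} = S (Suc n)" by (simp only: S_def mem_Collect_eq funpow_Suc_right o_apply)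
    ultimately show ?case by simp
  qed
  have "KP = \<Inter> (range S)" by (auto simp: KP_iff S_def)
  thus ?thesis using connected_nest[OF comp conn nest'] by simp
qed

text \<open>On a bounded component the maximum principle would bound all iterates by 2, so there is
  none; and a set with bounded complement has only one unbounded component.\<close>

lemma connected_complement_KP: "connected (- KP)"
proof -
  have bK: "bounded KP" using KP_iff by (auto simp: bounded_iff intro!: exI[of _ 2]) (metis funpow_0)
  have unb: "\<not> bounded C" if C: "C \<in> components (- KP)" for C
  proof
    assume b: "bounded C"
    have fr: "frontier C \<subseteq> KP" by (rule frontier_of_components_closed_complement[OF closed_KP C])
    have "C \<subseteq> KP"
    proof
      fix x assume x: "x \<in> C"
      have "cmod ((P ^^ n) x) \<le> 2" for n
      proof (rule maximum_modulus_frontier[of "P ^^ n" C])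
        show "(P ^^ n) holomorphic_on interior C" by (rule quad_holomorphic_iterate)
        show "continuous_on (closure C) (P ^^ n)" by (rule quad_continuous_iterate)
        show "cmod ((P ^^ n) z) \<le> 2" if "z \<in> frontier C" for z using that fr KP_iff by blast
      qed (use b x in auto)
      thus "x \<in> KP" by (simp add: KP_iff)
    qed
    thus False using C in_components_nonempty in_components_subset by blast
  qed
  have "C = C'" if "C \<in> components (- KP)" "C' \<in> components (- KP)" for C C'
    by (rule cobounded_unique_unbounded_components[of "- KP"]) (use that unb bK in auto)
  thus ?thesis by (metis (no_types, lifting) connected_eq_components_subset_sing_exists subset_singleton_iff singletonI subsetI empty_subsetI ex_in_conv singleton_iff)
qed

lemma connected_JP: "connected JP"
  unfolding julia_poly_def by (rule connected_frontier_simple[OF connected_KP connected_complement_KP])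

lemma JP_away_from_0: "\<exists>m>0. \<forall>\<zeta>\<in>JP. m \<le> cmod \<zeta>"
proof -
  obtain m where "m > 0" "ball 0 m \<subseteq> interior KP" using zero_in_KP(2) open_contains_ball[of "interior KP"] by auto
  thus ?thesis by (intro exI[of _ m]) (force simp: JP_eq)
qed

end

subsection \<open>The solenoidal model\<close>

text \<open>\<open>m0\<close> keeps the Julia set away from 0, where the second component of
  \<open>psi\<close> has its pole. \<open>a1\<close> makes \<open>psi\<close> send fibre discs of
  radius \<open>r\<close> into the unit disc, \<open>a2\<close> makes fibres contract by
  \<open>1/2\<close>, and \<open>a3\<close> separates the images of the fibres over
  \<open>\<zeta>\<close> and \<open>- \<zeta>\<close>.\<close>

locale parab_model = parab_branch +
  fixes a :: complex and r m0 :: real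
  assumes a0: "a \<noteq> 0" and r1: "r > 1" and m0: "m0 > 0" "\<And>\<zeta>. \<zeta> \<in> julia_poly (quad (cc 0)) \<Longrightarrow> m0 \<le> cmod \<zeta>"
    and a1: "2 * cmod a + (cmod a)\<^sup>2 * r / (2 * m0) \<le> 1" and a2: "(cmod a)\<^sup>2 \<le> m0" and a3: "cmod a < 2 * m0\<^sup>2"
begin

abbreviation "psi \<equiv> model_map P a"

lemma psi_eq: "psi (\<zeta>, z) = (P \<zeta>, a * \<zeta> - a\<^sup>2 * z / (2 * \<zeta>))"
proof -
  have "(P has_field_derivative 2 * \<zeta>) (at \<zeta>)" unfolding quad_def by (auto intro!: derivative_eq_intros)
  thus ?thesis by (simp add: model_map_def DERIV_imp_deriv)
qed

lemma JP_nz: "\<zeta> \<in> JP \<Longrightarrow> \<zeta> \<noteq> 0" using m0 by force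

lemma psi_maps:
  assumes "\<zeta> \<in> JP" "cmod z \<le> r" shows "fst (psi (\<zeta>, z)) \<in> JP" "cmod (snd (psi (\<zeta>, z))) \<le> 1"
proof -
  show "fst (psi (\<zeta>, z)) \<in> JP" using assms(1) by (simp only: psi_eq fst_conv JP_step)
  have "cmod (a\<^sup>2 * z / (2 * \<zeta>)) \<le> (cmod a)\<^sup>2 * r / (2 * m0)"
    unfolding norm_divide norm_mult norm_power using m0(1) m0(2)[OF assms(1)] assms(2)
    by (intro frac_le mult_left_mono) (use r1 in auto)
  moreover have "cmod (a * \<zeta>) \<le> cmod a * 2" unfolding norm_mult by (rule mult_left_mono[OF JP_bound[OF assms(1)]]) simp
  ultimately show "cmod (snd (psi (\<zeta>, z))) \<le> 1"
    using norm_triangle_ineq4[of "a * \<zeta>" "a\<^sup>2 * z / (2 * \<zeta>)"] a1 by (simp add: psi_eq)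
qed

lemma psi_iterate:
  assumes "p \<in> JP \<times> cball 0 r"
  shows "fst ((psi ^^ n) p) \<in> JP" "cmod (snd ((psi ^^ n) p)) \<le> r" "n \<ge> 1 \<Longrightarrow> cmod (snd ((psi ^^ n) p)) \<le> 1"
proof -
  have "fst ((psi ^^ n) p) \<in> JP \<and> cmod (snd ((psi ^^ n) p)) \<le> r \<and> (n \<ge> 1 \<longrightarrow> cmod (snd ((psi ^^ n) p)) \<le> 1)"
  proof (induction n)
    case 0 thus ?case using assms by auto
  next
    case (Suc n)
    hence "fst (psi ((psi ^^ n) p)) \<in> JP" "cmod (snd (psi ((psi ^^ n) p))) \<le> 1"
      using psi_maps[of "fst ((psi ^^ n) p)" "snd ((psi ^^ n) p)"] by simp_all
    thus ?case using r1 by simp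
  qed
  thus "fst ((psi ^^ n) p) \<in> JP" "cmod (snd ((psi ^^ n) p)) \<le> r" "n \<ge> 1 \<Longrightarrow> cmod (snd ((psi ^^ n) p)) \<le> 1" by blast+
qed

text \<open>Bi-infinite orbits of \<open>psi\<close>; the denominator is cleared so that the
  condition is closed.\<close>

definition MM :: "((int \<Rightarrow> complex) \<times> (int \<Rightarrow> complex)) set" where
  "MM = {(z, w). z \<in> SS 0 \<and> (\<forall>k. cmod (w k) \<le> 1 \<and> 2 * z k * w (k + 1) = 2 * a * (z k)\<^sup>2 - a\<^sup>2 * w k)}"

lemma MM_step:
  assumes "(z, w) \<in> MM" shows "psi (z k, w k) = (z (k + 1), w (k + 1))"
proof -
  have z: "z (k + 1) = P (z k)" "z k \<in> JP" using assms SS0_iff by (auto simp: MM_def)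
  have "2 * z k * w (k + 1) = 2 * a * (z k)\<^sup>2 - a\<^sup>2 * w k" using assms by (auto simp: MM_def)
  hence "w (k + 1) = a * z k - a\<^sup>2 * w k / (2 * z k)" using JP_nz[OF z(2)] by (simp add: field_simps power2_eq_square)
  thus ?thesis by (simp only: psi_eq z(1))
qed

lemma MM_I:
  assumes "\<And>k. z k \<in> JP" "\<And>k. cmod (w k) \<le> 1" "\<And>k. psi (z k, w k) = (z (k + 1), w (k + 1))"
  shows "(z, w) \<in> MM"
proof -
  have e: "P (z k) = z (k + 1)" "a * z k - a\<^sup>2 * w k / (2 * z k) = w (k + 1)" for k using assms(3)[of k] by (simp_all only: psi_eq prod.inject)
  have "z \<in> SS 0" unfolding SS0_iff using e(1) assms(1) by metis
  moreover have "2 * z k * w (k + 1) = 2 * a * (z k)\<^sup>2 - a\<^sup>2 * w k" for k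
  proof -
    have "2 * z k * (a * z k - a\<^sup>2 * w k / (2 * z k)) = 2 * a * (z k)\<^sup>2 - a\<^sup>2 * w k"
      using JP_nz[OF assms(1)[of k]] by (simp add: right_diff_distrib power2_eq_square)
    thus ?thesis by (simp only: e(2))
  qed
  ultimately show ?thesis using assms(2) by (simp add: MM_def)
qed

lemma psi_limit:
  assumes "\<And>j. fst (f j) \<in> JP" "(\<lambda>j. fst (f j)) \<longlonglongrightarrow> z" "(\<lambda>j. snd (f j)) \<longlonglongrightarrow> w"
  shows "z \<in> JP" "(\<lambda>j. psi (f j)) \<longlonglongrightarrow> psi (z, w)"
proof -
  show z: "z \<in> JP" by (rule closed_sequentially[OF compact_imp_closed[OF compact_JP] assms(1,2)])
  have "(\<lambda>j. P (fst (f j))) \<longlonglongrightarrow> P z" unfolding P_eq by (intro tendsto_intros assms)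
  moreover have "(\<lambda>j. a * fst (f j) - a\<^sup>2 * snd (f j) / (2 * fst (f j))) \<longlonglongrightarrow> a * z - a\<^sup>2 * w / (2 * z)"
    using JP_nz[OF z] by (intro tendsto_intros assms) auto
  ultimately have "(\<lambda>j. (P (fst (f j)), a * fst (f j) - a\<^sup>2 * snd (f j) / (2 * fst (f j)))) \<longlonglongrightarrow> (P z, a * z - a\<^sup>2 * w / (2 * z))"
    by (rule tendsto_Pair)
  thus "(\<lambda>j. psi (f j)) \<longlonglongrightarrow> psi (z, w)" by (simp only: psi_eq prod.collapse flip: psi_eq)
qed

text \<open>Orbit segments started at time \<open>- n\<close> accumulate at bi-infinite orbits;
  before the start, \<open>nat\<close> repeats the initial point. It is used with segments started
  at fibre coordinate 0, and with the preimages supplied by membership in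
  \<open>model_set\<close>.\<close>

lemma MM_from_finite_orbits:
  assumes q: "\<And>n. Q n \<in> JP \<times> cball 0 r"
  shows "\<exists>z w \<tau>. strict_mono (\<tau> :: nat \<Rightarrow> nat) \<and> (z, w) \<in> MM \<and>
    (\<forall>k. (\<lambda>n. (psi ^^ nat (k + int (\<tau> n))) (Q (\<tau> n))) \<longlonglongrightarrow> (z k, w k))"
proof -
  define F where "F n k = (psi ^^ nat (k + int n)) (Q n)" for n k
  have F: "fst (F n k) \<in> JP" "cmod (snd (F n k)) \<le> r" for n k unfolding F_def by (rule psi_iterate[OF q])+
  have F1: "cmod (snd (F n k)) \<le> 1" if "k + int n \<ge> 1" for n k unfolding F_def by (rule psi_iterate(3)[OF q]) (use that in linarith)
  have Fs: "psi (F n k) = F n (k + 1)" if "k + int n \<ge> 0" for n k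
  proof -
    have "nat (k + 1 + int n) = Suc (nat (k + int n))" using that by linarith
    thus ?thesis by (simp add: F_def)
  qed
  obtain \<tau>1 z where 1: "strict_mono (\<tau>1 :: nat \<Rightarrow> nat)" "\<And>k. (\<lambda>j. fst (F (\<tau>1 j) k)) \<longlonglongrightarrow> z k"
    using pointwise_subsequence[of "\<lambda>j k. fst (F j k)" 2] JP_bound[OF F(1)] by blast
  obtain \<tau>2 w where 2: "strict_mono (\<tau>2 :: nat \<Rightarrow> nat)" "\<And>k. (\<lambda>j. snd (F (\<tau>1 (\<tau>2 j)) k)) \<longlonglongrightarrow> w k"
    using pointwise_subsequence[of "\<lambda>j k. snd (F (\<tau>1 j) k)" r] F(2) by blast
  define \<tau> where "\<tau> = \<tau>1 \<circ> \<tau>2"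
  have \<tau>: "strict_mono \<tau>" unfolding \<tau>_def by (rule strict_mono_o[OF 1(1) 2(1)])
  have lz: "(\<lambda>j. fst (F (\<tau> j) k)) \<longlonglongrightarrow> z k" for k using LIMSEQ_subseq_LIMSEQ[OF 1(2) 2(1)] by (simp add: \<tau>_def o_def)
  have lw: "(\<lambda>j. snd (F (\<tau> j) k)) \<longlonglongrightarrow> w k" for k using 2(2) by (simp add: \<tau>_def)
  have lF: "(\<lambda>j. F (\<tau> j) k) \<longlonglongrightarrow> (z k, w k)" for k using tendsto_Pair[OF lz[of k] lw[of k]] by simp
  have ev: "\<forall>\<^sub>F j in sequentially. k + int (\<tau> j) \<ge> 1" for k
    using eventually_ge_at_top[of "nat (1 - k)"] by eventually_elim (use seq_suble[OF \<tau>] in \<open>smt (verit) nat_le_iff of_nat_le_iff\<close>)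
  have "(z, w) \<in> MM"
  proof (rule MM_I)
    fix k
    show "z k \<in> JP" by (rule psi_limit(1)[OF F(1) lz lw])
    show "cmod (w k) \<le> 1"
      by (rule tendsto_upperbound[OF tendsto_norm[OF lw]]) (use ev[of k] F1 in \<open>auto elim: eventually_mono\<close>)
    have "(\<lambda>j. psi (F (\<tau> j) k)) \<longlonglongrightarrow> psi (z k, w k)" by (rule psi_limit(2)[OF F(1) lz lw])
    moreover have "\<forall>\<^sub>F j in sequentially. psi (F (\<tau> j) k) = F (\<tau> j) (k + 1)" using ev[of k] by eventually_elim (simp add: Fs)
    ultimately have "(\<lambda>j. F (\<tau> j) (k + 1)) \<longlonglongrightarrow> psi (z k, w k)" by (rule Lim_transform_eventually)
    thus "psi (z k, w k) = (z (k + 1), w (k + 1))" using lF LIMSEQ_unique by blast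
  qed
  thus ?thesis using \<tau> lF unfolding F_def by blast
qed

text \<open>Over one base orbit the fibre maps contract by \<open>1/2\<close>, and both sequences
  are bounded on the whole past.\<close>

lemma MM_w_unique:
  assumes "(z, w) \<in> MM" "(z, w') \<in> MM" shows "w = w'"
proof -
  have step: "cmod (w (k + 1) - w' (k + 1)) \<le> 1/2 * cmod (w k - w' k)" for k
  proof -
    have z: "z k \<in> JP" using assms(1) SS0_iff by (auto simp: MM_def)
    have "w (k + 1) - w' (k + 1) = - (a\<^sup>2 / (2 * z k)) * (w k - w' k)"
    proof -
      have "w (k + 1) = a * z k - a\<^sup>2 * w k / (2 * z k)" "w' (k + 1) = a * z k - a\<^sup>2 * w' k / (2 * z k)"
        using MM_step[OF assms(1), of k] MM_step[OF assms(2), of k] by (simp_all add: psi_eq)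
      thus ?thesis by (simp only:) (simp add: right_diff_distrib diff_divide_distrib)
    qed
    hence "cmod (w (k + 1) - w' (k + 1)) = cmod (a\<^sup>2 / (2 * z k)) * cmod (w k - w' k)" by (metis norm_minus_cancel norm_mult)
    also have "... \<le> 1/2 * cmod (w k - w' k)"
    proof (rule mult_right_mono)
      have "cmod (a\<^sup>2 / (2 * z k)) = (cmod a)\<^sup>2 / (2 * cmod (z k))" by (simp add: norm_divide norm_mult norm_power)
      also have "... \<le> 1/2" using a2 m0(1) m0(2)[OF z] by (subst pos_divide_le_eq) linarith+
      finally show "cmod (a\<^sup>2 / (2 * z k)) \<le> 1/2" .
    qed simp
    finally show ?thesis .
  qed
  have b: "cmod (w k - w' k) \<le> 2" for k
  proof -
    have "cmod (w k) \<le> 1" "cmod (w' k) \<le> 1" using assms by (auto simp: MM_def)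
    thus ?thesis using norm_triangle_ineq4[of "w k" "w' k"] by linarith
  qed
  have "cmod (w k - w' k) \<le> 2 * (1/2) ^ n" for k n
  proof (induction n arbitrary: k)
    case (Suc n)
    show ?case using step[of "k - 1"] Suc[of "k - 1"] by simp
  qed (use b in simp)
  hence "cmod (w k - w' k) \<le> 0" for k
    by (intro LIMSEQ_le_const[of "\<lambda>n. 2 * (1/2) ^ n"]) (auto intro!: tendsto_eq_intros LIMSEQ_power_zero)
  thus ?thesis by (auto simp: fun_eq_iff)
qed

lemma compact_MM: "compact MM"
proof -
  define D where "D = {w :: int \<Rightarrow> complex. \<forall>k. cmod (w k) \<le> 1}"
  have "compact D" unfolding compact_eq_seq_compact_metric seq_compact_def
  proof (intro allI impI)
    fix f :: "nat \<Rightarrow> int \<Rightarrow> complex" assume f: "\<forall>n. f n \<in> D"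
    obtain r g where r: "strict_mono (r :: nat \<Rightarrow> nat)" "\<And>k. (\<lambda>j. f (r j) k) \<longlonglongrightarrow> g k"
      using pointwise_subsequence[of f 1] f unfolding D_def by blast
    have "cmod (g k) \<le> 1" for k
      by (rule LIMSEQ_le_const2[OF tendsto_norm[OF r(2)[of k]]]) (use f in \<open>auto simp: D_def\<close>)
    thus "\<exists>l\<in>D. \<exists>r. strict_mono r \<and> (f \<circ> r) \<longlonglongrightarrow> l"
      using r by (auto simp: tendsto_fun_iff o_def D_def)
  qed
  define E where "E k = {p :: (int \<Rightarrow> complex) \<times> (int \<Rightarrow> complex). 2 * fst p k * snd p (k + 1) = 2 * a * (fst p k)\<^sup>2 - a\<^sup>2 * snd p k}" for k
  have "closed (E k)" for k unfolding E_def
    by (intro closed_Collect_eq continuous_intros continuous_on_product_then_coordinatewise)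
  hence "closed (\<Inter>k. E k)" by (simp add: closed_INT)
  from compact_Int_closed[OF compact_Times[OF compact_SS[OF zero_lt_d(1)] \<open>compact D\<close>] this]
  have "compact (SS 0 \<times> D \<inter> (\<Inter>k. E k))" .
  moreover have "SS 0 \<times> D \<inter> (\<Inter>k. E k) = MM" by (auto simp: MM_def D_def E_def)
  ultimately show ?thesis by simp
qed

lemma MM_homeomorphic_SS: "MM homeomorphic SS 0"
proof (rule homeomorphic_compact[OF compact_MM continuous_on_fst[OF continuous_on_id]])
  show "inj_on fst MM" using MM_w_unique by (auto intro!: inj_onI)
  show "fst ` MM = SS 0"
  proof
    show "fst ` MM \<subseteq> SS 0" by (auto simp: MM_def)
    show "SS 0 \<subseteq> fst ` MM"
    proof
      fix z assume z: "z \<in> SS 0"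
      hence zJ: "z k \<in> JP" for k by (simp add: SS0_iff)
      define Q where "Q n = (z (- int n), 0 :: complex)" for n
      have q: "Q n \<in> JP \<times> cball 0 r" for n using zJ r1 by (simp add: Q_def)
      obtain z' w \<tau> where \<tau>: "strict_mono (\<tau> :: nat \<Rightarrow> nat)" "(z', w) \<in> MM"
        "\<And>k. (\<lambda>n. (psi ^^ nat (k + int (\<tau> n))) (Q (\<tau> n))) \<longlonglongrightarrow> (z' k, w k)" using MM_from_finite_orbits[of Q, OF q] by blast
      have fz: "fst ((psi ^^ j) (Q n)) = z (- int n + int j)" for j n
      proof (induction j)
        case (Suc j)
        have "fst (psi ((psi ^^ j) (Q n))) = P (fst ((psi ^^ j) (Q n)))" by (metis psi_eq fst_conv prod.collapse)
        also have "... = z (- int n + int j + 1)" using Suc z SS0_iff by metis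
        finally show ?case by (simp add: algebra_simps)
      qed (simp add: Q_def)
      have "z' k = z k" for k
      proof -
        have "\<forall>\<^sub>F n in sequentially. fst ((psi ^^ nat (k + int (\<tau> n))) (Q (\<tau> n))) = z k"
          using eventually_ge_at_top[of "nat (- k)"]
        proof eventually_elim
          case (elim n)
          hence "k + int (\<tau> n) \<ge> 0" using seq_suble[OF \<tau>(1), of n] by linarith
          thus ?case by (simp add: fz)
        qed
        hence "(\<lambda>n. fst ((psi ^^ nat (k + int (\<tau> n))) (Q (\<tau> n)))) \<longlonglongrightarrow> z k" by (rule tendsto_eventually)
        thus ?thesis using tendsto_fst[OF \<tau>(3)[of k]] LIMSEQ_unique by fastforce
      qed
      hence "z' = z" by auto
      thus "z \<in> fst ` MM" using \<tau>(2) by force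
    qed
  qed
qed

text \<open>A point of the model determines its past: base points with the same image are
  \<open>z k\<close> and \<open>- z k\<close>, and equal second components of the images would force
  \<open>4 * a * (z k)^2 = a^2 * (w k + w' k)\<close>, against \<open>a3\<close>. The preceding
  fibre coordinate is then determined as \<open>a\<close> is nonzero.\<close>

lemma MM_homeomorphic_model: "MM homeomorphic model_set P a r"
proof (rule homeomorphic_compact[OF compact_MM, of "\<lambda>(z, w). (z 0, w 0)"])
  show "continuous_on MM (\<lambda>(z, w). (z 0, w 0))" unfolding case_prod_unfold
    by (intro continuous_intros continuous_on_product_then_coordinatewise)
  show "inj_on (\<lambda>(z, w). (z 0, w 0)) MM"
  proof (rule inj_onI, clarify)
    fix z w z' w' assume m: "(z, w) \<in> MM" "(z', w') \<in> MM" and e: "z 0 = z' 0" "w 0 = w' 0"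
    have neg: "z (- int n) = z' (- int n) \<and> w (- int n) = w' (- int n)" for n
    proof (induction n)
      case (Suc n)
      define k where "k = - int (Suc n)"
      have k: "k + 1 = - int n" by (simp add: k_def)
      have eq: "2 * z k * w (k + 1) = 2 * a * (z k)\<^sup>2 - a\<^sup>2 * w k" "2 * z' k * w' (k + 1) = 2 * a * (z' k)\<^sup>2 - a\<^sup>2 * w' k"
        using m by (auto simp: MM_def)
      have zJ: "z k \<in> JP" using m SS0_iff by (auto simp: MM_def)
      have "P (z k) = P (z' k)" using m Suc SS0_iff by (metis (no_types, lifting) MM_step Pair_inject k psi_eq)
      hence "(z k)\<^sup>2 = (z' k)\<^sup>2" by (simp add: P_eq)
      then consider "z k = z' k" | "z' k = - z k" by (metis power2_eq_iff)
      thus ?case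
      proof cases
        case 1
        have "2 * z k * w (k + 1) = 2 * z' k * w' (k + 1)" using Suc 1 unfolding k by simp
        hence "a\<^sup>2 * w k = a\<^sup>2 * w' k" using eq 1 by (simp del: mult_cancel_left) (metis add_diff_cancel_left' diff_diff_eq2 add.commute diff_add_cancel)
        thus ?thesis using 1 a0 by (simp add: k_def)
      next
        case 2
        have "4 * a * (z k)\<^sup>2 = a\<^sup>2 * (w k + w' k)"
        proof -
          have "2 * z k * w (k + 1) + 2 * z' k * w' (k + 1) = 0" using Suc 2 unfolding k by simp
          hence "(2 * a * (z k)\<^sup>2 - a\<^sup>2 * w k) + (2 * a * (z' k)\<^sup>2 - a\<^sup>2 * w' k) = 0" unfolding eq .
          thus ?thesis unfolding 2 by (simp add: algebra_simps)
        qed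
        hence "4 * (z k)\<^sup>2 = a * (w k + w' k)" using a0 by (simp add: power2_eq_square)
        hence "4 * (cmod (z k))\<^sup>2 = cmod a * cmod (w k + w' k)" by (metis norm_mult norm_numeral norm_power)
        also have "... \<le> cmod a * 2"
        proof (rule mult_left_mono)
          have "cmod (w k) \<le> 1" "cmod (w' k) \<le> 1" using m by (auto simp: MM_def)
          thus "cmod (w k + w' k) \<le> 2" using norm_triangle_ineq[of "w k" "w' k"] by linarith
        qed simp
        finally have "4 * (cmod (z k))\<^sup>2 \<le> 2 * cmod a" by simp
        moreover have "m0\<^sup>2 \<le> (cmod (z k))\<^sup>2" using m0(1) m0(2)[OF zJ] by (intro power_mono) auto
        ultimately show ?thesis using a3 by linarith
      qed
    qed (use e in simp)
    have "z k = z' k" for k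
    proof (cases "k \<ge> 0")
      case True
      have o: "orbit 0 z" "orbit 0 z'" using m SS_D(1) by (auto simp: MM_def)
      show ?thesis using orbit0_iterate[OF o(1), of 0 "nat k"] orbit0_iterate[OF o(2), of 0 "nat k"] True e by simp
    next
      case False
      thus ?thesis using neg[of "nat (- k)"] by simp
    qed
    hence "z = z'" by auto
    thus "z = z' \<and> w = w'" using MM_w_unique m by blast
  qed
  show "(\<lambda>(z, w). (z 0, w 0)) ` MM = model_set P a r"
  proof
    show "(\<lambda>(z, w). (z 0, w 0)) ` MM \<subseteq> model_set P a r"
    proof clarify
      fix z w assume m: "(z, w) \<in> MM"
      have it: "(psi ^^ n) (z k, w k) = (z (k + int n), w (k + int n))" for n k
        by (induction n) (simp_all add: MM_step[OF m] algebra_simps)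
      show "(z 0, w 0) \<in> model_set P a r" unfolding model_set_def
      proof
        fix n
        have "z (- int n) \<in> JP" "cmod (w (- int n)) \<le> 1" using m SS0_iff by (auto simp: MM_def)
        hence "(z (- int n), w (- int n)) \<in> JP \<times> ball 0 r" using r1 by simp
        moreover have "(psi ^^ n) (z (- int n), w (- int n)) = (z 0, w 0)" using it[of n "- int n"] by simp
        ultimately show "(z 0, w 0) \<in> (psi ^^ n) ` (JP \<times> ball 0 r)" by (metis image_eqI)
      qed
    qed
    show "model_set P a r \<subseteq> (\<lambda>(z, w). (z 0, w 0)) ` MM"
    proof
      fix p assume "p \<in> model_set P a r"
      hence "p \<in> (psi ^^ n) ` (JP \<times> ball 0 r)" for n unfolding model_set_def by (rule INT_D) simp
      hence "\<exists>x. x \<in> JP \<times> ball 0 r \<and> (psi ^^ n) x = p" for n unfolding image_iff Bex_def by (simp only: eq_commute[of p])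
      then obtain Q where "\<forall>n. Q n \<in> JP \<times> ball 0 r \<and> (psi ^^ n) (Q n) = p" using choice[of "\<lambda>n x. x \<in> JP \<times> ball 0 r \<and> (psi ^^ n) x = p"] by blast
      hence q: "\<And>n. Q n \<in> JP \<times> ball 0 r" "\<And>n. (psi ^^ n) (Q n) = p" by simp_all
      have q': "Q n \<in> JP \<times> cball 0 r" for n using q(1)[of n] by (simp add: mem_Times_iff)
      obtain z w \<tau> where \<tau>: "strict_mono (\<tau> :: nat \<Rightarrow> nat)" "(z, w) \<in> MM"
        "\<And>k. (\<lambda>n. (psi ^^ nat (k + int (\<tau> n))) (Q (\<tau> n))) \<longlonglongrightarrow> (z k, w k)" using MM_from_finite_orbits[of Q, OF q'] by blast
      have "(\<lambda>n. p) \<longlonglongrightarrow> (z 0, w 0)" using \<tau>(3)[of 0] by (simp add: q(2))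
      hence "p = (z 0, w 0)" using LIMSEQ_const_iff by blast
      thus "p \<in> (\<lambda>(z, w). (z 0, w 0)) ` MM" using \<tau>(2) by force
    qed
  qed
qed

text \<open>Open discs of radius \<open>r\<close> are traded for closed unit discs: one step of
  \<open>psi\<close> maps the larger product into the smaller, so the intersections agree, and the
  second one is of nested compact connected sets.\<close>

lemma connected_model: "connected (model_set P a r)"
proof -
  define C where "C n = (psi ^^ n) ` (JP \<times> cball 0 1)" for n
  have sub: "psi ` (JP \<times> cball 0 r) \<subseteq> JP \<times> cball 0 1"
  proof (rule image_subsetI)
    fix x :: "complex \<times> complex" assume "x \<in> JP \<times> cball 0 r"
    thus "psi x \<in> JP \<times> cball 0 1" using psi_maps[of "fst x" "snd x"] by (simp add: mem_Times_iff)
  qed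
  have cont: "continuous_on (JP \<times> cball 0 1) psi"
  proof -
    have "continuous_on (JP \<times> cball 0 1) (\<lambda>p. (P (fst p), a * fst p - a\<^sup>2 * snd p / (2 * fst p)))"
      by (intro continuous_intros continuous_on_compose2[OF P_continuous[of UNIV]]) (auto dest: JP_nz)
    thus ?thesis by (simp only: prod.collapse flip: psi_eq)
  qed
  have cont_n: "continuous_on (JP \<times> cball 0 1) (psi ^^ n) \<and> C n \<subseteq> JP \<times> cball 0 1" for n
  proof (induction n)
    case 0 show ?case by (simp add: C_def id_def)
  next
    case (Suc n)
    have "continuous_on (JP \<times> cball 0 1) (psi \<circ> (psi ^^ n))"
      by (rule continuous_on_compose) (use Suc cont in \<open>auto simp: C_def intro: continuous_on_subset\<close>)
    moreover have "C (Suc n) = psi ` C n" by (simp only: C_def image_comp funpow.simps)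
    hence "C (Suc n) \<subseteq> JP \<times> cball 0 1" using Suc sub r1 by fastforce
    ultimately show ?case by simp
  qed
  have cK: "compact (JP \<times> cball (0::complex) 1)" "connected (JP \<times> cball (0::complex) 1)"
    by (intro compact_Times compact_JP compact_cball, intro connected_Times connected_JP connected_cball)
  have C: "compact (C n)" "connected (C n)" for n
    unfolding C_def using cont_n cK compact_continuous_image connected_continuous_image by blast+
  have nest1: "C (Suc n) \<subseteq> C n" for n
  proof -
    have "C (Suc n) = (psi ^^ n) ` (psi ` (JP \<times> cball 0 1))" by (simp only: C_def image_comp funpow_Suc_right)
    moreover have "psi ` (JP \<times> cball 0 1) \<subseteq> JP \<times> cball 0 1" using cont_n[of 1] by (simp add: C_def)
    ultimately show ?thesis unfolding C_def by blast
  qed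
  have nest: "m \<le> n \<Longrightarrow> C n \<subseteq> C m" for m n by (rule lift_Suc_antimono_le[of C]) (use nest1 in auto)
  have "model_set P a r = \<Inter> (range C)"
  proof
    show "model_set P a r \<subseteq> \<Inter> (range C)"
    proof clarify
      fix z w n assume "(z, w) \<in> model_set P a r"
      hence "(z, w) \<in> (psi ^^ Suc n) ` (JP \<times> ball 0 r)" unfolding model_set_def by (rule INT_D) simp
      then obtain x where q: "x \<in> JP \<times> ball 0 r" "(z, w) = (psi ^^ Suc n) x" by (rule imageE)
      have "x \<in> JP \<times> cball 0 r" using q(1) by (simp add: mem_Times_iff)
      hence x: "psi x \<in> JP \<times> cball 0 1" by (rule subsetD[OF sub imageI])
      have "(z, w) = (psi ^^ n) (psi x)" using q(2) by (simp only: funpow_Suc_right o_apply)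
      thus "(z, w) \<in> C n" unfolding C_def by (rule image_eqI[OF _ x])
    qed
    have "JP \<times> cball 0 1 \<subseteq> JP \<times> ball 0 r" using r1 by auto
    thus "\<Inter> (range C) \<subseteq> model_set P a r" unfolding model_set_def C_def by blast
  qed
  thus ?thesis using connected_nest[OF C nest] by simp
qed

end

section \<open>Choice of the constants and conclusion\<close>

lemma (in parab_glob) parab_branch_exists: "\<exists>\<sigma> \<rho> \<delta>1. parab_branch l q s0 s \<delta>0 Pet \<sigma> \<rho> \<delta>1"
proof -
  obtain \<sigma> where \<sigma>: "\<sigma> > 0" "\<sigma> \<le> s / 32" "\<And>\<xi> p. \<xi> \<in> EE \<Longrightarrow> p \<in> PC \<Longrightarrow> 4 * \<sigma> \<le> dist \<xi> p"
    using EE_separated by blast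
  obtain d where d: "d > 0" "\<And>b x k. cmod b < d \<Longrightarrow> x \<in> SS b \<Longrightarrow> 3 * s / 4 \<le> cmod (x k - beta) \<Longrightarrow> \<exists>\<xi>\<in>EE. cmod (x k - \<xi>) < \<sigma>"
    using SS_near_EE[OF \<sigma>(1)] by blast
  obtain t where t: "t > 0" "\<And>b u n \<xi>. cmod b < t \<Longrightarrow> recur b u \<Longrightarrow> cmod (u 0) \<le> 4 \<Longrightarrow> cmod (u 1 - cc 0) < t \<Longrightarrow>
     \<xi> \<in> EE \<Longrightarrow> 2 * \<sigma> \<le> cmod (u (Suc n) - \<xi>)"
    using critical_value_trapped[OF \<sigma>] by blast
  define \<rho> where "\<rho> = min (1/8) t"
  have \<rho>: "\<rho> > 0" "\<rho> \<le> 1/8" "\<rho> \<le> t" using t(1) by (auto simp: \<rho>_def)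
  have \<rho>2: "2 * \<rho>\<^sup>2 \<le> t"
  proof -
    have "\<rho> * \<rho> \<le> (1/8) * t" using \<rho> by (intro mult_mono) auto
    thus ?thesis using t(1) by (simp add: power2_eq_square)
  qed
  define \<delta>1 where "\<delta>1 = min (min \<delta>0 (\<rho> ^ 3 / 48)) (min d t)"
  have "parab_branch l q s0 s \<delta>0 Pet \<sigma> \<rho> \<delta>1"
  proof
    show "0 < \<delta>1" "\<delta>1 \<le> \<delta>0" "\<delta>1 \<le> \<rho> ^ 3 / 48" using d0_pos \<rho>(1) d(1) t(1) by (auto simp: \<delta>1_def)
    show "\<exists>\<xi>\<in>EE. cmod (x k - \<xi>) < \<sigma>" if "cmod b < \<delta>1" "x \<in> SS b" "3 * s / 4 \<le> cmod (x k - beta)" for b x k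
      using d(2)[OF _ that(2,3)] that(1) by (simp add: \<delta>1_def)
    show "2 * \<rho>\<^sup>2 \<le> cmod (u 1 - cc 0)" if "cmod b < \<delta>1" "recur b u" "cmod (u 0) \<le> 4" "\<xi> \<in> EE" "cmod (u (Suc n) - \<xi>) < 2 * \<sigma>" for b u n \<xi>
    proof (rule ccontr)
      assume "\<not> ?thesis"
      hence "cmod (u 1 - cc 0) < t" using \<rho>2 by linarith
      hence "2 * \<sigma> \<le> cmod (u (Suc n) - \<xi>)" using t(2)[OF _ that(2,3) _ that(4)] that(1) by (simp add: \<delta>1_def)
      thus False using that(5) by linarith
    qed
  qed (use \<sigma> \<rho> in auto)
  thus ?thesis by blast
qed

lemma (in parab) parab_branch_exists: "\<exists>s0 s \<delta>0 Pet \<sigma> \<rho> \<delta>1. parab_branch l q s0 s \<delta>0 Pet \<sigma> \<rho> \<delta>1"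
proof -
  obtain s0 where s0: "s0 > 0" "s0 \<le> 1/40" "\<And>s. 0 < s \<Longrightarrow> s \<le> s0 \<Longrightarrow> \<exists>\<delta>>0. \<delta> \<le> 1/48 \<and> (\<exists>Pet. good_pet s0 s \<delta> Pet)"
    using local_theory by blast
  obtain \<delta>0 Pet where "\<delta>0 > 0" "\<delta>0 \<le> 1/48" "good_pet s0 (s0 / 2) \<delta>0 Pet" using s0(3)[of "s0 / 2"] s0(1) by auto
  hence "parab_glob l q s0 (s0 / 2) \<delta>0 Pet" using s0(1,2) by unfold_locales auto
  thus ?thesis using parab_glob.parab_branch_exists by blast
qed

lemma multiplier_primitive:
  assumes "q \<ge> 1" "coprime p (int q)"
  shows "parab (multiplier p q) q"
proof
  have pw: "multiplier p q ^ k = exp (2 * of_real pi * \<i> * (of_int (int k * p) / of_nat q))" for k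
    by (simp add: multiplier_def algebra_simps flip: exp_of_nat_mult)
  show "multiplier p q ^ q = 1"
  proof -
    have "of_int (int q * p) / of_nat q = (of_int p :: complex)" using assms(1) by simp
    hence "multiplier p q ^ q = exp (2 * of_int p * of_real pi * \<i>)" unfolding pw by (simp add: mult_ac)
    thus ?thesis by (simp add: exp_eq_1)
  qed
  show "multiplier p q ^ k \<noteq> 1" if k: "1 \<le> k" "k < q" for k
  proof
    assume "multiplier p q ^ k = 1"
    then obtain n :: int where n: "2 * pi * (of_int (int k * p) / of_nat q) = of_int (2 * n) * pi"
      unfolding pw exp_eq_1 by (auto simp: Im_divide_of_nat)
    have "X = of_int n" if "2 * pi * X = of_int (2 * n) * pi" for X :: real
    proof -
      have "(2 * pi) * X = (2 * pi) * of_int n" using that by simp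
      thus ?thesis by (simp only: mult_cancel_left) simp
    qed
    from this[OF n] have "of_int (int k * p) / of_nat q = (of_int n :: real)" .
    hence "(of_int (int k * p) :: real) = of_int (n * int q)" using assms(1) by (simp add: field_simps)
    hence "int k * p = n * int q" by (simp only: of_int_eq_iff)
    hence "int q dvd int k * p" by simp
    hence "int q dvd int k" using assms(2) by (simp add: coprime_commute coprime_dvd_mult_left_iff)
    thus False using k by (auto dest: dvd_imp_le)
  qed
qed (use assms in auto)

theorem theorem1p2:
  fixes p :: int and q :: nat and r :: real and l :: complex
  assumes "q \<ge> 1" and "coprime p (int q)"
    and "l = multiplier p q"
    and "r > 3"
  shows "\<exists>\<delta>>0. \<forall>c a. (c, a) \<in> param_curve l \<and> 0 < cmod a \<and> cmod a < \<delta> \<longrightarrow>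
           henon_julia c a homeomorphic model_set (parabolic_poly l) a r \<and>
           connected (henon_julia c a) \<and>
           henon_julia c a = J_star c a"
proof -
  have "parab l q" unfolding assms(3) by (rule multiplier_primitive[OF assms(1,2)])
  then obtain s0 s \<delta>0 Pet \<sigma> \<rho> \<delta>1 where "parab_branch l q s0 s \<delta>0 Pet \<sigma> \<rho> \<delta>1"
    using parab.parab_branch_exists by blast
  then interpret parab_branch l q s0 s \<delta>0 Pet \<sigma> \<rho> \<delta>1 .
  obtain m where m: "m > 0" "\<And>\<zeta>. \<zeta> \<in> JP \<Longrightarrow> m \<le> cmod \<zeta>" using JP_away_from_0 by blast
  \<comment> \<open>Since \<open>cmod a < 1\<close>, bounds on \<open>cmod a\<close> also bound its
    square. In the premise \<open>a1\<close> of the model the entries \<open>1/4\<close> and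
    \<open>m / r\<close> account for \<open>1/2\<close> each.\<close>
  define \<delta> where "\<delta> = min (min (1/4) \<delta>4) (min (min m (2 * m\<^sup>2)) (m / r))"
  have "\<delta> > 0" using d4(1) m(1) assms(4) by (simp add: \<delta>_def)
  moreover have "henon_julia c a homeomorphic model_set (parabolic_poly l) a r \<and> connected (henon_julia c a) \<and> henon_julia c a = J_star c a"
    if h: "(c, a) \<in> param_curve l" "0 < cmod a" "cmod a < \<delta>" for c a
  proof -
    have d: "cmod a < 1/4" "cmod a < \<delta>4" "cmod a < m" "cmod a < 2 * m\<^sup>2" "cmod a < m / r" using h(3) by (auto simp: \<delta>_def)
    have sq: "(cmod a)\<^sup>2 \<le> cmod a" using d(1) by (simp add: power2_eq_square mult_left_le)
    interpret parab_henon l q s0 s \<delta>0 Pet \<sigma> \<rho> \<delta>1 a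
      by unfold_locales (use h(2) d(2) sq in \<open>auto simp: norm_power\<close>)
    have i: "(cmod a)\<^sup>2 * r / (2 * m) \<le> 1/2"
    proof -
      have "(cmod a)\<^sup>2 * r \<le> cmod a * r" using sq assms(4) by (intro mult_right_mono) auto
      also have "... \<le> m" using d(5) assms(4) by (simp add: pos_less_divide_eq)
      finally show ?thesis using m(1) by (simp add: pos_divide_le_eq)
    qed
    have "2 * cmod a + (cmod a)\<^sup>2 * r / (2 * m) \<le> 1" using i d(1) by linarith
    then interpret parab_model l q s0 s \<delta>0 Pet \<sigma> \<rho> \<delta>1 a r m
      by unfold_locales (use h(2) d sq assms(4) m in \<open>simp_all\<close>)
    have c: "c = cc (a\<^sup>2)" using h(1) l_nz by (simp add: param_curve_explicit cc_def bet_def)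
    have hom: "henon_julia c a homeomorphic model_set P a r"
      unfolding c using SS_homeomorphic_J SS_homeomorphic[OF a_small] MM_homeomorphic_SS MM_homeomorphic_model
      by (meson homeomorphic_sym homeomorphic_trans)
    hence "connected (henon_julia c a)" using connected_model homeomorphic_connectedness by blast
    thus ?thesis using hom J_eq(2) by (simp add: parabolic_poly_eq c)
  qed
  ultimately show ?thesis by blast
qed

end
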